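(* Let $\Bbbk$ be a unital commutative ring, $(A,\Delta)$ a $\Bbbk$-free cocommutative $\Bbbk$-algebra and $V$ a $\Bbbk$-free $A$-module. Fix $\Bbbk$-linear maps $\lambda:A\otimes V\to A$ and $\kappa=\kappa_A\oplus\kappa_V:V\wedge V\to A\oplus V$. Consider the condition ($\ast$) for all $v,v'\in V$ and $a\in A$: $\ \Delta(\lambda(a,v))=\sum\lambda(a_{(1)},v)\otimes a_{(2)}+\sum a_{(1)}\otimes\lambda(a_{(2)},v)$, and $\kappa_A(v,v')$ is primitive. (1) $\mathscr{H}_{\lambda,\kappa}$ is a cocommutative algebra (with coproduct extending that of $A$) with the image of $V$ primitive, if ($\ast$) holds. The converse is true if $\mathscr{H}_{\lambda,\kappa}$ has the PBW property. (2) Suppose $A$ is a cocommutative bialgebra with counit $\varepsilon$. Then $\mathscr{H}_{\lambda,\kappa}$ is a cocommutative bialgebra (with structure extending that of $A$) with $V$ primitive, if ($\ast$) holds and $\operatorname{im}\lambda\subset\ker\varepsilon$. The converse is true if $\mathscr{H}_{\lambda,\kappa}$ has the PBW property. (3) Suppose $A$ is a cocommutative Hopf algebra with counit $\varepsilon$ and antipode $S$. Then $\mathscr{H}_{\lambda,\kappa}$ is a cocommutative Hopf algebra (with structure extending that of $A$) with $V$ primitive, if ($\ast$) holds and moreover $\operatorname{im}\lambda\subset\ker\varepsilon$ and $S(\lambda(a,v))=\sum\lambda(S(a_{(1)}),a_{(2)}(v))$ for all $a\in A$, $v\in V$. The converse is true if $\mathscr{H}_{\lambda,\kappa}$ has the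 PBW property. In particular, in all three cases, the structure on $A$ extends to $\mathscr{H}_{0,0}=\mathrm{Sym}(V)\rtimes A$, and more generally to every $\mathscr{H}_{0,\kappa}$ for which all elements of $\operatorname{im}\kappa_A$ are primitive.
   Context: A cocommutative $\Bbbk$-algebra $(A,\Delta)$ is a unital associative $\Bbbk$-algebra $A$ with a $\Bbbk$-algebra map $\Delta:A\to A\otimes A$ satisfying $\Delta(1)=1\otimes1$, coassociativity, and $\Delta=\Delta^{op}$ (no counit or antipode is assumed). Sweedler notation: $\Delta(a)=\sum a_{(1)}\otimes a_{(2)}$. An element $a$ of a cocommutative algebra is primitive if $\Delta(a)=1\otimes a+a\otimes1$. The action of $a\in A$ on $v\in V$ is written $a(v)$. $V\wedge V\subset V\otimes V$ is the span of the $v\wedge v'=v\otimes v'-v'\otimes v$; $\kappa(v,v')=\kappa(v\wedge v')$. $\mathscr{H}_{\lambda,\kappa}$ is the quotient of the tensor algebra $T(V\oplus A)$ by the multiplication in $A$ (with $1_A$ the unit) and by the relations $av-\sum a_{(1)}(v)a_{(2)}=\lambda(a,v)$ and $vv'-v'v=\kappa(v,v')$ for $a\in A$, $v,v'\in V$. It is filtered by $\deg A=0$, $\deg V=1$. $\mathscr{H}_{0,0}=\mathrm{Sym}(V)\rtimes A$ is the smash product: $\mathrm{Sym}(V)\otimes A$ with $(f'\otimes a')(f\otimes a)=\sum f'a'_{(1)}(f)\otimes a'_{(2)}a$ for $f\in\mathrm{Sym}^{\ge1}(V)$ ($A$ acting on $\mathrm{Sym}^n(V)$, $n\ge1$, via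 iterated coproducts) and $(f'\otimes a')(1\otimes a)=f'\otimes a'a$. $\mathscr{H}_{\lambda,\kappa}$ has the PBW property if the natural surjection from $\mathscr{H}_{0,0}$ onto its associated graded algebra is an isomorphism. *)

theory Defs
  imports "HOL-Algebra.Module" "HOL-Algebra.Chinese_Remainder"
begin


section \<open>Linear algebra over a commutative ring\<close>

text \<open>
  Modules and algebras are records of type \<open>module\<close>. For a mere module the fields \<open>mult\<close> and
  \<open>one\<close> carry no information. The constructions below fill them in a way that is meaningful
  whenever their arguments are algebras.
\<close>

definition linear_maps ::
  "('k, 'r) ring_scheme \<Rightarrow> ('k, 'm, 'x) module_scheme \<Rightarrow> ('k, 'n, 'y) module_scheme \<Rightarrow> ('m \<Rightarrow> 'n) set"
  where "linear_maps R M N = {f \<in> carrier M \<rightarrow> carrier N.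
    (\<forall>x\<in>carrier M. \<forall>y\<in>carrier M. f (x \<oplus>\<^bsub>M\<^esub> y) = f x \<oplus>\<^bsub>N\<^esub> f y) \<and>
    (\<forall>r\<in>carrier R. \<forall>x\<in>carrier M. f (r \<odot>\<^bsub>M\<^esub> x) = r \<odot>\<^bsub>N\<^esub> f x)}"

definition mod_span ::
  "('k, 'r) ring_scheme \<Rightarrow> ('k, 'm, 'x) module_scheme \<Rightarrow> 'm set \<Rightarrow> 'm set"
  where "mod_span R M S = \<Inter>{N. submodule N R M \<and> S \<subseteq> N}"

definition fin_supp :: "('k, 'r) ring_scheme \<Rightarrow> 'g set \<Rightarrow> ('g \<Rightarrow> 'k) set"
  where "fin_supp R S = {f. (\<forall>x. f x \<in> carrier R) \<and> finite {x. f x \<noteq> \<zero>\<^bsub>R\<^esub>} \<and> (\<forall>x. x \<notin> S \<longrightarrow> f x = \<zero>\<^bsub>R\<^esub>)}"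

definition lin_ext ::
  "('k, 'r) ring_scheme \<Rightarrow> ('k, 'p, 'x) module_scheme \<Rightarrow> ('g \<Rightarrow> 'p) \<Rightarrow> ('g \<Rightarrow> 'k) \<Rightarrow> 'p"
  where "lin_ext R P b f = (\<Oplus>\<^bsub>P\<^esub>x\<in>{x. f x \<noteq> \<zero>\<^bsub>R\<^esub>}. f x \<odot>\<^bsub>P\<^esub> b x)"

definition free_module :: "('k, 'r) ring_scheme \<Rightarrow> ('k, 'm, 'x) module_scheme \<Rightarrow> bool"
  where "free_module R M \<longleftrightarrow> (\<exists>B\<subseteq>carrier M. \<forall>x\<in>carrier M.
    \<exists>!f. f \<in> fin_supp R B \<and> lin_ext R M (\<lambda>b. b) f = x)"

definition dsum ::
  "('k, 'm, 'x) module_scheme \<Rightarrow> ('k, 'n, 'y) module_scheme \<Rightarrow> ('k, 'm \<times> 'n) module"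
  where "dsum M N = ring.extend (RDirProd M N) (module.fields (\<lambda>r (x, y). (r \<odot>\<^bsub>M\<^esub> x, r \<odot>\<^bsub>N\<^esub> y)))"

text \<open>\<open>I\<close> is a submodule, and a two-sided ideal whenever the product of the quotient is used.\<close>

definition quot_alg :: "('k, 'm, 'x) module_scheme \<Rightarrow> 'm set \<Rightarrow> ('k, 'm set) module"
  where "quot_alg M I =
    ring.extend (M Quot I) (module.fields (\<lambda>r U. \<Union>x\<in>U. I +>\<^bsub>M\<^esub> (r \<odot>\<^bsub>M\<^esub> x)))"

locale assoc_algebra = module R M + ring M for R and M (structure) +
  assumes smult_mult_left:
      "\<lbrakk>r \<in> carrier R; x \<in> carrier M; y \<in> carrier M\<rbrakk> \<Longrightarrow> (r \<odot> x) \<otimes> y = r \<odot> (x \<otimes> y)"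
    and smult_mult_right:
      "\<lbrakk>r \<in> carrier R; x \<in> carrier M; y \<in> carrier M\<rbrakk> \<Longrightarrow> x \<otimes> (r \<odot> y) = r \<odot> (x \<otimes> y)"

definition alg_hom ::
  "('k, 'r) ring_scheme \<Rightarrow> ('k, 'm, 'x) module_scheme \<Rightarrow> ('k, 'n, 'y) module_scheme \<Rightarrow> ('m \<Rightarrow> 'n) set"
  where "alg_hom R A B = ring_hom A B \<inter> linear_maps R A B"


section \<open>Tensor products, tensor algebras, symmetric algebras\<close>

definition monoid_algebra ::
  "('k, 'r) ring_scheme \<Rightarrow> ('g, 'x) monoid_scheme \<Rightarrow> ('k, 'g \<Rightarrow> 'k) module"
  where "monoid_algebra R G = \<lparr>
    carrier = fin_supp R (carrier G),
    mult = (\<lambda>f g z. \<Oplus>\<^bsub>R\<^esub>x\<in>{x. f x \<noteq> \<zero>\<^bsub>R\<^esub>}. \<Oplus>\<^bsub>R\<^esub>y\<in>{y. g y \<noteq> \<zero>\<^bsub>R\<^esub>}.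
              if x \<otimes>\<^bsub>G\<^esub> y = z then f x \<otimes>\<^bsub>R\<^esub> g y else \<zero>\<^bsub>R\<^esub>),
    one = (\<lambda>z. if z = \<one>\<^bsub>G\<^esub> then \<one>\<^bsub>R\<^esub> else \<zero>\<^bsub>R\<^esub>),
    zero = (\<lambda>_. \<zero>\<^bsub>R\<^esub>),
    add = (\<lambda>f g z. f z \<oplus>\<^bsub>R\<^esub> g z),
    smult = (\<lambda>r f z. r \<otimes>\<^bsub>R\<^esub> f z)\<rparr>"

definition delta :: "('k, 'r) ring_scheme \<Rightarrow> 'g \<Rightarrow> 'g \<Rightarrow> 'k"
  where "delta R x = (\<lambda>z. if z = x then \<one>\<^bsub>R\<^esub> else \<zero>\<^bsub>R\<^esub>)"

text \<open>
  \<open>M \<otimes> N\<close> is the free module on pairs modulo bilinearity. The product inherited from the monoid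
  algebra of \<open>M \<times>\<times> N\<close> is \<open>(m \<otimes> n)(m' \<otimes> n') = m m' \<otimes> n n'\<close>.
\<close>

definition bilin_rels ::
  "('k, 'r) ring_scheme \<Rightarrow> ('k, 'm, 'x) module_scheme \<Rightarrow> ('k, 'n, 'y) module_scheme \<Rightarrow> ('m \<times> 'n \<Rightarrow> 'k) set"
  where "bilin_rels R M N = (let F = monoid_algebra R (M \<times>\<times> N) in
      {delta R (m \<oplus>\<^bsub>M\<^esub> m', n) \<ominus>\<^bsub>F\<^esub> (delta R (m, n) \<oplus>\<^bsub>F\<^esub> delta R (m', n)) | m m' n.
         m \<in> carrier M \<and> m' \<in> carrier M \<and> n \<in> carrier N}
    \<union> {delta R (m, n \<oplus>\<^bsub>N\<^esub> n') \<ominus>\<^bsub>F\<^esub> (delta R (m, n) \<oplus>\<^bsub>F\<^esub> delta R (m, n')) | m n n'.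
         m \<in> carrier M \<and> n \<in> carrier N \<and> n' \<in> carrier N}
    \<union> {delta R (r \<odot>\<^bsub>M\<^esub> m, n) \<ominus>\<^bsub>F\<^esub> r \<odot>\<^bsub>F\<^esub> delta R (m, n) | r m n.
         r \<in> carrier R \<and> m \<in> carrier M \<and> n \<in> carrier N}
    \<union> {delta R (m, r \<odot>\<^bsub>N\<^esub> n) \<ominus>\<^bsub>F\<^esub> r \<odot>\<^bsub>F\<^esub> delta R (m, n) | r m n.
         r \<in> carrier R \<and> m \<in> carrier M \<and> n \<in> carrier N})"

definition bilin_ker ::
  "('k, 'r) ring_scheme \<Rightarrow> ('k, 'm, 'x) module_scheme \<Rightarrow> ('k, 'n, 'y) module_scheme \<Rightarrow> ('m \<times> 'n \<Rightarrow> 'k) set"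
  where "bilin_ker R M N = mod_span R (monoid_algebra R (M \<times>\<times> N)) (bilin_rels R M N)"

definition tensor ::
  "('k, 'r) ring_scheme \<Rightarrow> ('k, 'm, 'x) module_scheme \<Rightarrow> ('k, 'n, 'y) module_scheme
    \<Rightarrow> ('k, ('m \<times> 'n \<Rightarrow> 'k) set) module"
  where "tensor R M N = quot_alg (monoid_algebra R (M \<times>\<times> N)) (bilin_ker R M N)"

definition tens ::
  "('k, 'r) ring_scheme \<Rightarrow> ('k, 'm, 'x) module_scheme \<Rightarrow> ('k, 'n, 'y) module_scheme
    \<Rightarrow> 'm \<Rightarrow> 'n \<Rightarrow> ('m \<times> 'n \<Rightarrow> 'k) set"
  where "tens R M N m n = bilin_ker R M N +>\<^bsub>monoid_algebra R (M \<times>\<times> N)\<^esub> delta R (m, n)"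

text \<open>
  For bilinear \<open>b\<close>, the value on a tensor of the linear map \<open>M \<otimes> N \<rightarrow> P\<close> induced by \<open>b\<close>,
  computed from an arbitrary representative. In particular \<open>tlift R P b (\<Delta> a)\<close> is the Sweedler
  sum of \<open>b a\<^sub>(\<^sub>1\<^sub>) a\<^sub>(\<^sub>2\<^sub>)\<close>.
\<close>

definition tlift ::
  "('k, 'r) ring_scheme \<Rightarrow> ('k, 'p, 'x) module_scheme \<Rightarrow> ('m \<Rightarrow> 'n \<Rightarrow> 'p) \<Rightarrow> ('m \<times> 'n \<Rightarrow> 'k) set \<Rightarrow> 'p"
  where "tlift R P b U = lin_ext R P (\<lambda>(m, n). b m n) (SOME f. f \<in> U)"

definition wdg ::
  "('k, 'r) ring_scheme \<Rightarrow> ('k, 'v, 'y) module_scheme \<Rightarrow> 'v \<Rightarrow> 'v \<Rightarrow> ('v \<times> 'v \<Rightarrow> 'k) set"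
  where "wdg R V v w = tens R V V v w \<ominus>\<^bsub>tensor R V V\<^esub> tens R V V w v"

definition wedge ::
  "('k, 'r) ring_scheme \<Rightarrow> ('k, 'v, 'y) module_scheme \<Rightarrow> ('k, ('v \<times> 'v \<Rightarrow> 'k) set) module"
  where "wedge R V = (tensor R V V)\<lparr>carrier := mod_span R (tensor R V V)
    {wdg R V v w | v w. v \<in> carrier V \<and> w \<in> carrier V}\<rparr>"

text \<open>
  \<open>T(M)\<close> is the free module on words in \<open>M\<close> modulo linearity in every letter. Words of length \<open>n\<close>
  span the \<open>n\<close>-th tensor power, and the product is concatenation.
\<close>

definition words :: "('k, 'm, 'x) module_scheme \<Rightarrow> 'm list monoid"
  where "words M = \<lparr>carrier = lists (carrier M), mult = (@), one = []\<rparr>"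

definition letter_ideal ::
  "('k, 'r) ring_scheme \<Rightarrow> ('k, 'm, 'x) module_scheme \<Rightarrow> ('m list \<Rightarrow> 'k) set"
  where "letter_ideal R M = (let F = monoid_algebra R (words M) in genideal F (
      {delta R [m \<oplus>\<^bsub>M\<^esub> m'] \<ominus>\<^bsub>F\<^esub> (delta R [m] \<oplus>\<^bsub>F\<^esub> delta R [m']) | m m'.
         m \<in> carrier M \<and> m' \<in> carrier M}
    \<union> {delta R [r \<odot>\<^bsub>M\<^esub> m] \<ominus>\<^bsub>F\<^esub> r \<odot>\<^bsub>F\<^esub> delta R [m] | r m. r \<in> carrier R \<and> m \<in> carrier M}))"

definition tensor_alg ::
  "('k, 'r) ring_scheme \<Rightarrow> ('k, 'm, 'x) module_scheme \<Rightarrow> ('k, ('m list \<Rightarrow> 'k) set) module"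
  where "tensor_alg R M = quot_alg (monoid_algebra R (words M)) (letter_ideal R M)"

definition tgen ::
  "('k, 'r) ring_scheme \<Rightarrow> ('k, 'm, 'x) module_scheme \<Rightarrow> 'm \<Rightarrow> ('m list \<Rightarrow> 'k) set"
  where "tgen R M m = letter_ideal R M +>\<^bsub>monoid_algebra R (words M)\<^esub> delta R [m]"

definition sym_ideal ::
  "('k, 'r) ring_scheme \<Rightarrow> ('k, 'v, 'y) module_scheme \<Rightarrow> ('v list \<Rightarrow> 'k) set set"
  where "sym_ideal R V = (let T = tensor_alg R V in genideal T
    {tgen R V v \<otimes>\<^bsub>T\<^esub> tgen R V w \<ominus>\<^bsub>T\<^esub> tgen R V w \<otimes>\<^bsub>T\<^esub> tgen R V v | v w. v \<in> carrier V \<and> w \<in> carrier V})"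

definition sym_alg ::
  "('k, 'r) ring_scheme \<Rightarrow> ('k, 'v, 'y) module_scheme \<Rightarrow> ('k, ('v list \<Rightarrow> 'k) set set) module"
  where "sym_alg R V = quot_alg (tensor_alg R V) (sym_ideal R V)"

definition sgen ::
  "('k, 'r) ring_scheme \<Rightarrow> ('k, 'v, 'y) module_scheme \<Rightarrow> 'v \<Rightarrow> ('v list \<Rightarrow> 'k) set set"
  where "sgen R V v = sym_ideal R V +>\<^bsub>tensor_alg R V\<^esub> tgen R V v"

text \<open>
  The linear map out of \<open>Sym(V)\<close> whose value on \<open>v\<^sub>1 \<cdots> v\<^sub>n\<close> is \<open>b [v\<^sub>1, \<dots>, v\<^sub>n]\<close>, provided there is
  one. An element of \<open>Sym(V)\<close> is a set of elements of \<open>T(V)\<close>, which are themselves cosets.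
\<close>

definition slift ::
  "('k, 'r) ring_scheme \<Rightarrow> ('k, 'p, 'x) module_scheme \<Rightarrow> ('v list \<Rightarrow> 'p) \<Rightarrow> ('v list \<Rightarrow> 'k) set set \<Rightarrow> 'p"
  where "slift R P b U = lin_ext R P b (SOME f. f \<in> \<Union>U)"


section \<open>Cocommutative algebras, bialgebras and Hopf algebras\<close>

text \<open>There is no counit in the first locale.\<close>

locale cocomm_algebra = assoc_algebra R A for R and A (structure) +
  fixes \<Delta>
  assumes comult_hom: "\<Delta> \<in> alg_hom R A (tensor R A A)"
    and coassoc: "a \<in> carrier A \<Longrightarrow>
      tlift R (tensor R (tensor R A A) A) (\<lambda>x y. tens R (tensor R A A) A (\<Delta> x) y) (\<Delta> a) =
      tlift R (tensor R (tensor R A A) A)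
        (\<lambda>x y. tlift R (tensor R (tensor R A A) A)
          (\<lambda>y' z. tens R (tensor R A A) A (tens R A A x y') z) (\<Delta> y)) (\<Delta> a)"
    and cocomm: "a \<in> carrier A \<Longrightarrow> tlift R (tensor R A A) (\<lambda>x y. tens R A A y x) (\<Delta> a) = \<Delta> a"

locale cocomm_bialgebra = cocomm_algebra R A \<Delta> for R and A (structure) and \<Delta> +
  fixes \<epsilon>
  assumes counit_hom: "\<epsilon> \<in> ring_hom A R"
    and counit_smult: "\<lbrakk>r \<in> carrier R; a \<in> carrier A\<rbrakk> \<Longrightarrow> \<epsilon> (r \<odot> a) = r \<otimes>\<^bsub>R\<^esub> \<epsilon> a"
    and counit_left: "a \<in> carrier A \<Longrightarrow> tlift R A (\<lambda>x y. \<epsilon> x \<odot> y) (\<Delta> a) = a"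
    and counit_right: "a \<in> carrier A \<Longrightarrow> tlift R A (\<lambda>x y. \<epsilon> y \<odot> x) (\<Delta> a) = a"

locale cocomm_hopf_algebra = cocomm_bialgebra R A \<Delta> \<epsilon> for R and A (structure) and \<Delta> and \<epsilon> +
  fixes S
  assumes antipode_linear: "S \<in> linear_maps R A A"
    and antipode_left: "a \<in> carrier A \<Longrightarrow> tlift R A (\<lambda>x y. S x \<otimes> y) (\<Delta> a) = \<epsilon> a \<odot> \<one>"
    and antipode_right: "a \<in> carrier A \<Longrightarrow> tlift R A (\<lambda>x y. x \<otimes> S y) (\<Delta> a) = \<epsilon> a \<odot> \<one>"

definition primitive ::
  "('k, 'r) ring_scheme \<Rightarrow> ('k, 'a, 'x) module_scheme \<Rightarrow> ('a \<Rightarrow> ('a \<times> 'a \<Rightarrow> 'k) set) \<Rightarrow> 'a \<Rightarrow> bool"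
  where "primitive R A \<Delta> a \<longleftrightarrow>
    \<Delta> a = tens R A A \<one>\<^bsub>A\<^esub> a \<oplus>\<^bsub>tensor R A A\<^esub> tens R A A a \<one>\<^bsub>A\<^esub>"

text \<open>A left module over an algebra whose underlying module over the ground ring is \<open>V\<close>.\<close>

locale algebra_module = A: assoc_algebra R A + V: module R V
  for R and A :: "('k, 'a, 'x) module_scheme" and V :: "('k, 'v, 'y) module_scheme" +
  fixes act :: "'a \<Rightarrow> 'v \<Rightarrow> 'v"
  assumes act_closed: "\<lbrakk>a \<in> carrier A; v \<in> carrier V\<rbrakk> \<Longrightarrow> act a v \<in> carrier V"
    and act_add_left: "\<lbrakk>a \<in> carrier A; b \<in> carrier A; v \<in> carrier V\<rbrakk>
      \<Longrightarrow> act (a \<oplus>\<^bsub>A\<^esub> b) v = act a v \<oplus>\<^bsub>V\<^esub> act b v"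
    and act_add_right: "\<lbrakk>a \<in> carrier A; v \<in> carrier V; w \<in> carrier V\<rbrakk>
      \<Longrightarrow> act a (v \<oplus>\<^bsub>V\<^esub> w) = act a v \<oplus>\<^bsub>V\<^esub> act a w"
    and act_smult_left: "\<lbrakk>r \<in> carrier R; a \<in> carrier A; v \<in> carrier V\<rbrakk>
      \<Longrightarrow> act (r \<odot>\<^bsub>A\<^esub> a) v = r \<odot>\<^bsub>V\<^esub> act a v"
    and act_smult_right: "\<lbrakk>r \<in> carrier R; a \<in> carrier A; v \<in> carrier V\<rbrakk>
      \<Longrightarrow> act a (r \<odot>\<^bsub>V\<^esub> v) = r \<odot>\<^bsub>V\<^esub> act a v"
    and act_mult: "\<lbrakk>a \<in> carrier A; b \<in> carrier A; v \<in> carrier V\<rbrakk>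
      \<Longrightarrow> act (a \<otimes>\<^bsub>A\<^esub> b) v = act a (act b v)"
    and act_one: "v \<in> carrier V \<Longrightarrow> act \<one>\<^bsub>A\<^esub> v = v"


section \<open>The algebras \<open>\<H>\<^sub>\<lambda>\<^sub>,\<^sub>\<kappa>\<close>\<close>

definition TV ::
  "('k, 'r) ring_scheme \<Rightarrow> ('k, 'a, 'x) module_scheme \<Rightarrow> ('k, 'v, 'y) module_scheme
    \<Rightarrow> 'v \<Rightarrow> (('v \<times> 'a) list \<Rightarrow> 'k) set"
  where "TV R A V v = tgen R (dsum V A) (v, \<zero>\<^bsub>A\<^esub>)"

definition TA ::
  "('k, 'r) ring_scheme \<Rightarrow> ('k, 'a, 'x) module_scheme \<Rightarrow> ('k, 'v, 'y) module_scheme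
    \<Rightarrow> 'a \<Rightarrow> (('v \<times> 'a) list \<Rightarrow> 'k) set"
  where "TA R A V a = tgen R (dsum V A) (\<zero>\<^bsub>V\<^esub>, a)"

text \<open>
  \<open>lam\<close> is a map on \<open>A \<otimes> V\<close> and \<open>kap\<close> a map from \<open>V \<and> V\<close> to \<open>A \<oplus> V\<close>, so that
  \<open>\<kappa>\<^sub>A = fst \<circ> kap\<close> and \<open>\<kappa>\<^sub>V = snd \<circ> kap\<close>.
\<close>

definition H_ideal ::
  "('k, 'r) ring_scheme \<Rightarrow> ('k, 'a, 'x) module_scheme \<Rightarrow> ('a \<Rightarrow> ('a \<times> 'a \<Rightarrow> 'k) set)
    \<Rightarrow> ('k, 'v, 'y) module_scheme \<Rightarrow> ('a \<Rightarrow> 'v \<Rightarrow> 'v)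
    \<Rightarrow> (('a \<times> 'v \<Rightarrow> 'k) set \<Rightarrow> 'a) \<Rightarrow> (('v \<times> 'v \<Rightarrow> 'k) set \<Rightarrow> 'a \<times> 'v)
    \<Rightarrow> (('v \<times> 'a) list \<Rightarrow> 'k) set set"
  where "H_ideal R A \<Delta> V act lam kap =
    (let T = tensor_alg R (dsum V A); iV = TV R A V; iA = TA R A V in genideal T (
      {iA a \<otimes>\<^bsub>T\<^esub> iA b \<ominus>\<^bsub>T\<^esub> iA (a \<otimes>\<^bsub>A\<^esub> b) | a b. a \<in> carrier A \<and> b \<in> carrier A}
    \<union> {iA \<one>\<^bsub>A\<^esub> \<ominus>\<^bsub>T\<^esub> \<one>\<^bsub>T\<^esub>}
    \<union> {(iA a \<otimes>\<^bsub>T\<^esub> iV v \<ominus>\<^bsub>T\<^esub> tlift R T (\<lambda>b c. iV (act b v) \<otimes>\<^bsub>T\<^esub> iA c) (\<Delta> a))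
        \<ominus>\<^bsub>T\<^esub> iA (lam (tens R A V a v)) | a v. a \<in> carrier A \<and> v \<in> carrier V}
    \<union> {(iV v \<otimes>\<^bsub>T\<^esub> iV w \<ominus>\<^bsub>T\<^esub> iV w \<otimes>\<^bsub>T\<^esub> iV v)
        \<ominus>\<^bsub>T\<^esub> (iA (fst (kap (wdg R V v w))) \<oplus>\<^bsub>T\<^esub> iV (snd (kap (wdg R V v w)))) | v w.
        v \<in> carrier V \<and> w \<in> carrier V}))"

definition H_alg ::
  "('k, 'r) ring_scheme \<Rightarrow> ('k, 'a, 'x) module_scheme \<Rightarrow> ('a \<Rightarrow> ('a \<times> 'a \<Rightarrow> 'k) set)
    \<Rightarrow> ('k, 'v, 'y) module_scheme \<Rightarrow> ('a \<Rightarrow> 'v \<Rightarrow> 'v)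
    \<Rightarrow> (('a \<times> 'v \<Rightarrow> 'k) set \<Rightarrow> 'a) \<Rightarrow> (('v \<times> 'v \<Rightarrow> 'k) set \<Rightarrow> 'a \<times> 'v)
    \<Rightarrow> ('k, (('v \<times> 'a) list \<Rightarrow> 'k) set set) module"
  where "H_alg R A \<Delta> V act lam kap =
    quot_alg (tensor_alg R (dsum V A)) (H_ideal R A \<Delta> V act lam kap)"

definition HV ::
  "('k, 'r) ring_scheme \<Rightarrow> ('k, 'a, 'x) module_scheme \<Rightarrow> ('a \<Rightarrow> ('a \<times> 'a \<Rightarrow> 'k) set)
    \<Rightarrow> ('k, 'v, 'y) module_scheme \<Rightarrow> ('a \<Rightarrow> 'v \<Rightarrow> 'v)
    \<Rightarrow> (('a \<times> 'v \<Rightarrow> 'k) set \<Rightarrow> 'a) \<Rightarrow> (('v \<times> 'v \<Rightarrow> 'k) set \<Rightarrow> 'a \<times> 'v)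
    \<Rightarrow> 'v \<Rightarrow> (('v \<times> 'a) list \<Rightarrow> 'k) set set"
  where "HV R A \<Delta> V act lam kap v =
    H_ideal R A \<Delta> V act lam kap +>\<^bsub>tensor_alg R (dsum V A)\<^esub> TV R A V v"

definition HA ::
  "('k, 'r) ring_scheme \<Rightarrow> ('k, 'a, 'x) module_scheme \<Rightarrow> ('a \<Rightarrow> ('a \<times> 'a \<Rightarrow> 'k) set)
    \<Rightarrow> ('k, 'v, 'y) module_scheme \<Rightarrow> ('a \<Rightarrow> 'v \<Rightarrow> 'v)
    \<Rightarrow> (('a \<times> 'v \<Rightarrow> 'k) set \<Rightarrow> 'a) \<Rightarrow> (('v \<times> 'v \<Rightarrow> 'k) set \<Rightarrow> 'a \<times> 'v)
    \<Rightarrow> 'a \<Rightarrow> (('v \<times> 'a) list \<Rightarrow> 'k) set set"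
  where "HA R A \<Delta> V act lam kap a =
    H_ideal R A \<Delta> V act lam kap +>\<^bsub>tensor_alg R (dsum V A)\<^esub> TA R A V a"


section \<open>The smash product\<close>

text \<open>
  The action of \<open>a\<close> on \<open>v\<^sub>1 \<cdots> v\<^sub>n\<close> in \<open>Sym(V)\<close> via the iterated coproduct, for \<open>n \<ge> 1\<close> only:
  without a counit there is no action on \<open>Sym\<^sup>0(V)\<close>.
\<close>

primrec sym_act ::
  "('k, 'r) ring_scheme \<Rightarrow> ('a \<Rightarrow> ('a \<times> 'a \<Rightarrow> 'k) set) \<Rightarrow> ('k, 'v, 'y) module_scheme
    \<Rightarrow> ('a \<Rightarrow> 'v \<Rightarrow> 'v) \<Rightarrow> 'v list \<Rightarrow> 'a \<Rightarrow> ('v list \<Rightarrow> 'k) set set"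
  where
    "sym_act R \<Delta> V act [] = undefined"
  | "sym_act R \<Delta> V act (v # vs) = (\<lambda>a. if vs = [] then sgen R V (act a v)
      else tlift R (sym_alg R V)
        (\<lambda>b c. sgen R V (act b v) \<otimes>\<^bsub>sym_alg R V\<^esub> sym_act R \<Delta> V act vs c) (\<Delta> a))"

definition smash ::
  "('k, 'r) ring_scheme \<Rightarrow> ('k, 'a, 'x) module_scheme \<Rightarrow> ('a \<Rightarrow> ('a \<times> 'a \<Rightarrow> 'k) set)
    \<Rightarrow> ('k, 'v, 'y) module_scheme \<Rightarrow> ('a \<Rightarrow> 'v \<Rightarrow> 'v)
    \<Rightarrow> ('k, (('v list \<Rightarrow> 'k) set set \<times> 'a \<Rightarrow> 'k) set) module"
  where "smash R A \<Delta> V act =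
    (let Sy = sym_alg R V; P = tensor R Sy A; t = tens R Sy A in
      P\<lparr>mult := (\<lambda>U W. tlift R P (\<lambda>f' a'. tlift R P (\<lambda>f a. slift R P (\<lambda>w.
          if w = [] then t f' (a' \<otimes>\<^bsub>A\<^esub> a)
          else tlift R P (\<lambda>b c. t (f' \<otimes>\<^bsub>Sy\<^esub> sym_act R \<Delta> V act w b) (c \<otimes>\<^bsub>A\<^esub> a)) (\<Delta> a')) f) W) U)\<rparr>)"


section \<open>Filtration, associated graded algebra and the PBW property\<close>

definition H_filt ::
  "('k, 'r) ring_scheme \<Rightarrow> ('k, 'a, 'x) module_scheme \<Rightarrow> ('a \<Rightarrow> ('a \<times> 'a \<Rightarrow> 'k) set)
    \<Rightarrow> ('k, 'v, 'y) module_scheme \<Rightarrow> ('a \<Rightarrow> 'v \<Rightarrow> 'v)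
    \<Rightarrow> (('a \<times> 'v \<Rightarrow> 'k) set \<Rightarrow> 'a) \<Rightarrow> (('v \<times> 'v \<Rightarrow> 'k) set \<Rightarrow> 'a \<times> 'v)
    \<Rightarrow> nat \<Rightarrow> (('v \<times> 'a) list \<Rightarrow> 'k) set set set"
  where "H_filt R A \<Delta> V act lam kap n =
    (let H = H_alg R A \<Delta> V act lam kap in mod_span R H
      {foldr (\<lambda>l h. case_sum (HV R A \<Delta> V act lam kap) (HA R A \<Delta> V act lam kap) l \<otimes>\<^bsub>H\<^esub> h) ls \<one>\<^bsub>H\<^esub> | ls.
         ls \<in> lists (carrier V <+> carrier A) \<and> length (filter isl ls) \<le> n})"

definition prev_filt :: "('k, 'h, 'x) module_scheme \<Rightarrow> (nat \<Rightarrow> 'h set) \<Rightarrow> nat \<Rightarrow> 'h set"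
  where "prev_filt H F n = (if n = 0 then {\<zero>\<^bsub>H\<^esub>} else F (n - 1))"

text \<open>
  Elements of the associated graded algebra are families \<open>x\<close> with \<open>x n \<in> F n / F (n - 1)\<close>, almost
  all of them zero. As a coset, the zero of \<open>F n / F (n - 1)\<close> is \<open>prev_filt H F n\<close>.
\<close>

definition assoc_graded ::
  "('k, 'h, 'x) module_scheme \<Rightarrow> (nat \<Rightarrow> 'h set) \<Rightarrow> ('k, nat \<Rightarrow> 'h set) module"
  where "assoc_graded H F = (let P = prev_filt H F in \<lparr>
    carrier = {x. (\<forall>n. \<exists>h\<in>F n. x n = P n +>\<^bsub>H\<^esub> h) \<and> finite {n. x n \<noteq> P n}},
    mult = (\<lambda>x y n. \<Oplus>\<^bsub>quot_alg H (P n)\<^esub>i\<in>{..n}. \<Union>g\<in>x i. \<Union>h\<in>y (n - i). P n +>\<^bsub>H\<^esub> (g \<otimes>\<^bsub>H\<^esub> h)),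
    one = (\<lambda>n. if n = 0 then P 0 +>\<^bsub>H\<^esub> \<one>\<^bsub>H\<^esub> else P n),
    zero = P,
    add = (\<lambda>x y n. x n <+>\<^bsub>H\<^esub> y n),
    smult = (\<lambda>r x n. \<Union>h\<in>x n. P n +>\<^bsub>H\<^esub> (r \<odot>\<^bsub>H\<^esub> h))\<rparr>)"

definition symbol :: "('k, 'h, 'x) module_scheme \<Rightarrow> (nat \<Rightarrow> 'h set) \<Rightarrow> nat \<Rightarrow> 'h \<Rightarrow> nat \<Rightarrow> 'h set"
  where "symbol H F n h = (\<lambda>m. if m = n then prev_filt H F n +>\<^bsub>H\<^esub> h else prev_filt H F m)"

definition zero_lam :: "('k, 'a, 'x) module_scheme \<Rightarrow> ('a \<times> 'v \<Rightarrow> 'k) set \<Rightarrow> 'a"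
  where "zero_lam A = (\<lambda>_. \<zero>\<^bsub>A\<^esub>)"

definition zero_kap ::
  "('k, 'a, 'x) module_scheme \<Rightarrow> ('k, 'v, 'y) module_scheme \<Rightarrow> ('v \<times> 'v \<Rightarrow> 'k) set \<Rightarrow> 'a \<times> 'v"
  where "zero_kap A V = (\<lambda>_. (\<zero>\<^bsub>A\<^esub>, \<zero>\<^bsub>V\<^esub>))"

text \<open>
  These conditions determine \<open>\<phi>\<close> on the carrier, since the images of \<open>V\<close> and \<open>A\<close> generate
  \<open>\<H>\<^sub>0\<^sub>,\<^sub>0\<close>.
\<close>

definition natural_gr_map ::
  "('k, 'r) ring_scheme \<Rightarrow> ('k, 'a, 'x) module_scheme \<Rightarrow> ('a \<Rightarrow> ('a \<times> 'a \<Rightarrow> 'k) set)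
    \<Rightarrow> ('k, 'v, 'y) module_scheme \<Rightarrow> ('a \<Rightarrow> 'v \<Rightarrow> 'v)
    \<Rightarrow> (('a \<times> 'v \<Rightarrow> 'k) set \<Rightarrow> 'a) \<Rightarrow> (('v \<times> 'v \<Rightarrow> 'k) set \<Rightarrow> 'a \<times> 'v)
    \<Rightarrow> ((('v \<times> 'a) list \<Rightarrow> 'k) set set \<Rightarrow> nat \<Rightarrow> (('v \<times> 'a) list \<Rightarrow> 'k) set set set) \<Rightarrow> bool"
  where "natural_gr_map R A \<Delta> V act lam kap \<phi> \<longleftrightarrow>
    (let H = H_alg R A \<Delta> V act lam kap; F = H_filt R A \<Delta> V act lam kap in
      \<phi> \<in> alg_hom R (H_alg R A \<Delta> V act (zero_lam A) (zero_kap A V)) (assoc_graded H F) \<and>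
      (\<forall>v\<in>carrier V. \<phi> (HV R A \<Delta> V act (zero_lam A) (zero_kap A V) v) =
        symbol H F 1 (HV R A \<Delta> V act lam kap v)) \<and>
      (\<forall>a\<in>carrier A. \<phi> (HA R A \<Delta> V act (zero_lam A) (zero_kap A V) a) =
        symbol H F 0 (HA R A \<Delta> V act lam kap a)))"

definition PBW_property ::
  "('k, 'r) ring_scheme \<Rightarrow> ('k, 'a, 'x) module_scheme \<Rightarrow> ('a \<Rightarrow> ('a \<times> 'a \<Rightarrow> 'k) set)
    \<Rightarrow> ('k, 'v, 'y) module_scheme \<Rightarrow> ('a \<Rightarrow> 'v \<Rightarrow> 'v)
    \<Rightarrow> (('a \<times> 'v \<Rightarrow> 'k) set \<Rightarrow> 'a) \<Rightarrow> (('v \<times> 'v \<Rightarrow> 'k) set \<Rightarrow> 'a \<times> 'v) \<Rightarrow> bool"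
  where "PBW_property R A \<Delta> V act lam kap \<longleftrightarrow>
    (\<exists>\<phi>. natural_gr_map R A \<Delta> V act lam kap \<phi> \<and>
      bij_betw \<phi> (carrier (H_alg R A \<Delta> V act (zero_lam A) (zero_kap A V)))
        (carrier (assoc_graded (H_alg R A \<Delta> V act lam kap) (H_filt R A \<Delta> V act lam kap))))"


section \<open>Extension of structure\<close>

definition star_condition ::
  "('k, 'r) ring_scheme \<Rightarrow> ('k, 'a, 'x) module_scheme \<Rightarrow> ('a \<Rightarrow> ('a \<times> 'a \<Rightarrow> 'k) set)
    \<Rightarrow> ('k, 'v, 'y) module_scheme
    \<Rightarrow> (('a \<times> 'v \<Rightarrow> 'k) set \<Rightarrow> 'a) \<Rightarrow> (('v \<times> 'v \<Rightarrow> 'k) set \<Rightarrow> 'a \<times> 'v) \<Rightarrow> bool"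
  where "star_condition R A \<Delta> V lam kap \<longleftrightarrow>
    (\<forall>a\<in>carrier A. \<forall>v\<in>carrier V.
      \<Delta> (lam (tens R A V a v)) =
        tlift R (tensor R A A) (\<lambda>b c. tens R A A (lam (tens R A V b v)) c) (\<Delta> a) \<oplus>\<^bsub>tensor R A A\<^esub>
        tlift R (tensor R A A) (\<lambda>b c. tens R A A b (lam (tens R A V c v))) (\<Delta> a)) \<and>
    (\<forall>v\<in>carrier V. \<forall>w\<in>carrier V. primitive R A \<Delta> (fst (kap (wdg R V v w))))"

text \<open>
  \<open>iA\<close> and \<open>iV\<close> stand for the canonical maps of \<open>A\<close> and \<open>V\<close> into \<open>H\<close>, which need not be
  injective.
\<close>

definition extends_comult ::
  "('k, 'r) ring_scheme \<Rightarrow> ('k, 'a, 'x) module_scheme \<Rightarrow> ('a \<Rightarrow> ('a \<times> 'a \<Rightarrow> 'k) set)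
    \<Rightarrow> ('k, 'v, 'y) module_scheme \<Rightarrow> ('k, 'h, 'z) module_scheme \<Rightarrow> ('a \<Rightarrow> 'h) \<Rightarrow> ('v \<Rightarrow> 'h)
    \<Rightarrow> ('h \<Rightarrow> ('h \<times> 'h \<Rightarrow> 'k) set) \<Rightarrow> bool"
  where "extends_comult R A \<Delta> V H iA iV \<Delta>H \<longleftrightarrow>
    (\<forall>a\<in>carrier A. \<Delta>H (iA a) = tlift R (tensor R H H) (\<lambda>b c. tens R H H (iA b) (iA c)) (\<Delta> a)) \<and>
    (\<forall>v\<in>carrier V. primitive R H \<Delta>H (iV v))"

definition H_cocomm_algebra ::
  "('k, 'r) ring_scheme \<Rightarrow> ('k, 'a, 'x) module_scheme \<Rightarrow> ('a \<Rightarrow> ('a \<times> 'a \<Rightarrow> 'k) set)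
    \<Rightarrow> ('k, 'v, 'y) module_scheme \<Rightarrow> ('a \<Rightarrow> 'v \<Rightarrow> 'v)
    \<Rightarrow> (('a \<times> 'v \<Rightarrow> 'k) set \<Rightarrow> 'a) \<Rightarrow> (('v \<times> 'v \<Rightarrow> 'k) set \<Rightarrow> 'a \<times> 'v) \<Rightarrow> bool"
  where "H_cocomm_algebra R A \<Delta> V act lam kap \<longleftrightarrow>
    (let H = H_alg R A \<Delta> V act lam kap; iA = HA R A \<Delta> V act lam kap; iV = HV R A \<Delta> V act lam kap in
      \<exists>\<Delta>H. cocomm_algebra R H \<Delta>H \<and> extends_comult R A \<Delta> V H iA iV \<Delta>H)"

definition H_cocomm_bialgebra ::
  "('k, 'r) ring_scheme \<Rightarrow> ('k, 'a, 'x) module_scheme \<Rightarrow> ('a \<Rightarrow> ('a \<times> 'a \<Rightarrow> 'k) set) \<Rightarrow> ('a \<Rightarrow> 'k)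
    \<Rightarrow> ('k, 'v, 'y) module_scheme \<Rightarrow> ('a \<Rightarrow> 'v \<Rightarrow> 'v)
    \<Rightarrow> (('a \<times> 'v \<Rightarrow> 'k) set \<Rightarrow> 'a) \<Rightarrow> (('v \<times> 'v \<Rightarrow> 'k) set \<Rightarrow> 'a \<times> 'v) \<Rightarrow> bool"
  where "H_cocomm_bialgebra R A \<Delta> \<epsilon> V act lam kap \<longleftrightarrow>
    (let H = H_alg R A \<Delta> V act lam kap; iA = HA R A \<Delta> V act lam kap; iV = HV R A \<Delta> V act lam kap in
      \<exists>\<Delta>H \<epsilon>H. cocomm_bialgebra R H \<Delta>H \<epsilon>H \<and> extends_comult R A \<Delta> V H iA iV \<Delta>H \<and>
        (\<forall>a\<in>carrier A. \<epsilon>H (iA a) = \<epsilon> a))"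

definition H_cocomm_hopf_algebra ::
  "('k, 'r) ring_scheme \<Rightarrow> ('k, 'a, 'x) module_scheme \<Rightarrow> ('a \<Rightarrow> ('a \<times> 'a \<Rightarrow> 'k) set) \<Rightarrow> ('a \<Rightarrow> 'k) \<Rightarrow> ('a \<Rightarrow> 'a)
    \<Rightarrow> ('k, 'v, 'y) module_scheme \<Rightarrow> ('a \<Rightarrow> 'v \<Rightarrow> 'v)
    \<Rightarrow> (('a \<times> 'v \<Rightarrow> 'k) set \<Rightarrow> 'a) \<Rightarrow> (('v \<times> 'v \<Rightarrow> 'k) set \<Rightarrow> 'a \<times> 'v) \<Rightarrow> bool"
  where "H_cocomm_hopf_algebra R A \<Delta> \<epsilon> S V act lam kap \<longleftrightarrow>
    (let H = H_alg R A \<Delta> V act lam kap; iA = HA R A \<Delta> V act lam kap; iV = HV R A \<Delta> V act lam kap in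
      \<exists>\<Delta>H \<epsilon>H SH. cocomm_hopf_algebra R H \<Delta>H \<epsilon>H SH \<and> extends_comult R A \<Delta> V H iA iV \<Delta>H \<and>
        (\<forall>a\<in>carrier A. \<epsilon>H (iA a) = \<epsilon> a) \<and> (\<forall>a\<in>carrier A. SH (iA a) = iA (S a)))"

definition smash_iso ::
  "('k, 'r) ring_scheme \<Rightarrow> ('k, 'a, 'x) module_scheme \<Rightarrow> ('a \<Rightarrow> ('a \<times> 'a \<Rightarrow> 'k) set)
    \<Rightarrow> ('k, 'v, 'y) module_scheme \<Rightarrow> ('a \<Rightarrow> 'v \<Rightarrow> 'v)
    \<Rightarrow> ((('v \<times> 'a) list \<Rightarrow> 'k) set set \<Rightarrow> (('v list \<Rightarrow> 'k) set set \<times> 'a \<Rightarrow> 'k) set) \<Rightarrow> bool"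
  where "smash_iso R A \<Delta> V act \<phi> \<longleftrightarrow>
    (let H0 = H_alg R A \<Delta> V act (zero_lam A) (zero_kap A V); Sm = smash R A \<Delta> V act in
      \<phi> \<in> alg_hom R H0 Sm \<and> bij_betw \<phi> (carrier H0) (carrier Sm) \<and>
      (\<forall>v\<in>carrier V. \<phi> (HV R A \<Delta> V act (zero_lam A) (zero_kap A V) v) =
        tens R (sym_alg R V) A (sgen R V v) \<one>\<^bsub>A\<^esub>) \<and>
      (\<forall>a\<in>carrier A. \<phi> (HA R A \<Delta> V act (zero_lam A) (zero_kap A V) a) =
        tens R (sym_alg R V) A \<one>\<^bsub>sym_alg R V\<^esub> a))"

end

theory Submission
  imports "HOL-Library.Multiset" Defs
begin

text \<open>
  Write \<open>H\<close> for \<open>\<H>\<^sub>\<lambda>\<^sub>,\<^sub>\<kappa>\<close>. Every structure map on \<open>H\<close> comes from its universal property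
  (\<open>H_lift\<close>): an algebra map out of \<open>H\<close> is a linear map on \<open>V\<close> and an algebra map on \<open>A\<close> that respect
  the two families of relations. Every identity between such maps is checked on the images of \<open>V\<close> and
  \<open>A\<close>, which generate \<open>H\<close> (\<open>generates_H\<close>).

  \<^emph>\<open>Coproduct.\<close> Let \<open>J\<close> be the algebra map \<open>A \<otimes> A \<rightarrow> H \<otimes> H\<close> induced by \<open>A \<rightarrow> H\<close>. The
  wanted coproduct is \<open>J \<circ> \<Delta>\<close> on \<open>A\<close> and makes \<open>V\<close> primitive. By coassociativity and cocommutativity,
  moving \<open>v \<otimes> 1 + 1 \<otimes> v\<close> to the left past \<open>J (\<Delta> a)\<close> leaves exactly the image under \<open>J\<close> of the right
  side of the first equation of the condition (\<open>comult_av\<close>), while a commutator of primitive elements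
  is primitive (\<open>prim_bracket\<close>). Hence the relations are respected if and only if the two equations of
  the condition hold after applying \<open>J\<close>. One direction of the first claim follows at once, and the
  converse follows when \<open>J\<close> is injective.

  \<^emph>\<open>Counit and antipode.\<close> Primitive elements are killed by a counit and negated by an antipode, so the
  counit has to vanish on \<open>V\<close>, and the antipode, an algebra map into the opposite algebra, has to be
  \<open>v \<mapsto> - v\<close> there. Applying either map to the relation between \<open>a\<close> and \<open>v\<close> gives the conditions on
  \<open>\<epsilon> \<circ> \<lambda>\<close> and \<open>S \<circ> \<lambda>\<close>. Conversely, the relation holds in the opposite algebra because convolving
  the formula for \<open>\<Delta> (\<lambda>(a, v))\<close> with \<open>S\<close> on both sides expresses \<open>S (\<lambda>(a, v))\<close> through \<open>\<lambda>\<close> and \<open>S\<close>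
  (\<open>S_lm\<close>), in the form in which the same element turns up when \<open>v S(a)\<close> is rewritten in \<open>H\<close>
  (\<open>antipode_av\<close>).

  \<^emph>\<open>Injectivity from the PBW property.\<close> Over a ring an injective map \<open>A \<rightarrow> H\<close> need not stay injective
  after tensoring with itself, so a linear retraction \<open>H \<rightarrow> A\<close> is constructed. Fix a basis \<open>B\<close> of \<open>V\<close>. The
  algebra \<open>\<H>\<^sub>0\<^sub>,\<^sub>0\<close> is \<open>Sym(V) \<otimes> A\<close> as a module, and \<open>Sym(V)\<close> is free on the multisets over \<open>B\<close>.
  Choosing for each multiset one word gives a linear map \<open>QA_to_H\<close> from the free module on multisets,
  tensored with \<open>A\<close>, to \<open>H\<close>. Its leading terms are the given isomorphism onto the associated graded
  algebra, so the map is bijective (\<open>bij_QA_to_H\<close>), and the coefficient at the empty multiset is the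
  retraction.

  \<^emph>\<open>The smash product.\<close> \<open>\<H>\<^sub>0\<^sub>,\<^sub>0\<close> acts on \<open>Sym(V) \<otimes> A\<close>, with \<open>V\<close> acting by multiplication and \<open>A\<close> by
  the multiplication rule of the smash product. Applying an element to \<open>1 \<otimes> 1\<close> gives the isomorphism,
  with inverse \<open>f \<otimes> a \<mapsto> f a\<close>.
\<close>

section \<open>Linear maps, spans and quotients\<close>

lemma (in abelian_group) diff_eq_zero_iff: "\<lbrakk>x \<in> carrier G; y \<in> carrier G\<rbrakk> \<Longrightarrow> x \<ominus> y = \<zero> \<longleftrightarrow> x = y"
  by (metis a_minus_def add.inv_closed add.inv_inv add.inv_equality r_neg)

context cring
begin

abbreviation lin where "lin M N f \<equiv> f \<in> linear_maps R M N"

lemma linI: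
  assumes "\<And>x. x \<in> carrier M \<Longrightarrow> f x \<in> carrier N"
    and "\<And>x y. \<lbrakk>x \<in> carrier M; y \<in> carrier M\<rbrakk> \<Longrightarrow> f (x \<oplus>\<^bsub>M\<^esub> y) = f x \<oplus>\<^bsub>N\<^esub> f y"
    and "\<And>r x. \<lbrakk>r \<in> carrier R; x \<in> carrier M\<rbrakk> \<Longrightarrow> f (r \<odot>\<^bsub>M\<^esub> x) = r \<odot>\<^bsub>N\<^esub> f x"
  shows "lin M N f"
  using assms by (auto simp: linear_maps_def)

lemma lin_closed: "\<lbrakk>lin M N f; x \<in> carrier M\<rbrakk> \<Longrightarrow> f x \<in> carrier N"
  and lin_add: "\<lbrakk>lin M N f; x \<in> carrier M; y \<in> carrier M\<rbrakk> \<Longrightarrow> f (x \<oplus>\<^bsub>M\<^esub> y) = f x \<oplus>\<^bsub>N\<^esub> f y"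
  and lin_smult: "\<lbrakk>lin M N f; r \<in> carrier R; x \<in> carrier M\<rbrakk> \<Longrightarrow> f (r \<odot>\<^bsub>M\<^esub> x) = r \<odot>\<^bsub>N\<^esub> f x"
  by (auto simp: linear_maps_def)

lemma lin_cong:
  assumes "lin M N f" "module R M" "\<And>x. x \<in> carrier M \<Longrightarrow> f x = g x"
  shows "lin M N g"
proof -
  interpret M: module R M by fact
  show ?thesis
    by (rule linI) (metis assms(1,3) lin_closed lin_add lin_smult M.M.a_closed M.smult_closed)+
qed

lemma lin_zero: assumes "module R M" "module R N" "lin M N f" shows "f \<zero>\<^bsub>M\<^esub> = \<zero>\<^bsub>N\<^esub>"
proof -
  interpret M: module R M by fact
  interpret N: module R N by fact
  have "f (\<zero> \<odot>\<^bsub>M\<^esub> \<zero>\<^bsub>M\<^esub>) = \<zero> \<odot>\<^bsub>N\<^esub> f \<zero>\<^bsub>M\<^esub>" by (rule lin_smult[OF assms(3)]) auto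
  then show ?thesis using lin_closed[OF assms(3), of "\<zero>\<^bsub>M\<^esub>"] by simp
qed

lemma lin_uminus:
  assumes "module R M" "module R N" "lin M N f" "x \<in> carrier M"
  shows "f (\<ominus>\<^bsub>M\<^esub> x) = \<ominus>\<^bsub>N\<^esub> f x"
proof -
  interpret M: module R M by fact
  interpret N: module R N by fact
  have c: "f (\<ominus>\<^bsub>M\<^esub> x) \<in> carrier N" "f x \<in> carrier N" using assms by (auto intro: lin_closed[OF assms(3)])
  have "f (\<ominus>\<^bsub>M\<^esub> x) \<oplus>\<^bsub>N\<^esub> f x = \<zero>\<^bsub>N\<^esub>"
    using lin_add[OF assms(3), of "\<ominus>\<^bsub>M\<^esub> x" x] assms lin_zero[OF assms(1-3)] by (simp add: M.M.l_neg)
  then show ?thesis using c N.M.minus_equality by metis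
qed

lemma lin_minus:
  assumes "module R M" "module R N" "lin M N f" "x \<in> carrier M" "y \<in> carrier M"
  shows "f (x \<ominus>\<^bsub>M\<^esub> y) = f x \<ominus>\<^bsub>N\<^esub> f y"
proof -
  interpret M: module R M by fact
  show ?thesis using assms by (simp add: a_minus_def lin_add[OF assms(3)] lin_uminus)
qed

lemma lin_id: "lin M M (\<lambda>x. x)" by (rule linI) auto

lemma lin_comp: "\<lbrakk>lin M N f; lin N P g\<rbrakk> \<Longrightarrow> lin M P (\<lambda>x. g (f x))"
  by (rule linI) (simp_all add: lin_closed[of f M N] lin_add[of f M N] lin_smult[of f M N]
    lin_closed[of g N P] lin_add[of g N P] lin_smult[of g N P])

lemma lin_const_zero: assumes "module R N" shows "lin M N (\<lambda>x. \<zero>\<^bsub>N\<^esub>)"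
proof -
  interpret N: module R N by fact
  show ?thesis by (rule linI) auto
qed

lemma lin_plus: assumes "module R N" "lin M N f" "lin M N g" shows "lin M N (\<lambda>x. f x \<oplus>\<^bsub>N\<^esub> g x)"
proof -
  interpret N: module R N by fact
  note c = lin_closed[OF assms(2)] lin_closed[OF assms(3)]
  show ?thesis
    by (rule linI)
      (simp_all add: c N.M.a_ac lin_add[OF assms(2)] lin_add[OF assms(3)] lin_smult[OF assms(2)] lin_smult[OF assms(3)] N.smult_r_distr)
qed

lemma lin_scale: assumes "module R N" "lin M N f" "r \<in> carrier R" shows "lin M N (\<lambda>x. r \<odot>\<^bsub>N\<^esub> f x)"
proof -
  interpret N: module R N by fact
  note c = lin_closed[OF assms(2)]
  show ?thesis
    by (rule linI)
      (simp_all add: c assms lin_add[OF assms(2)] lin_smult[OF assms(2)] N.smult_r_distr N.smult_assoc1[symmetric] m_comm)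
qed

lemma lin_neg: assumes "module R N" "lin M N f" shows "lin M N (\<lambda>x. \<ominus>\<^bsub>N\<^esub> f x)"
proof -
  interpret N: module R N by fact
  note c = lin_closed[OF assms(2)]
  show ?thesis
    by (rule linI)
      (simp_all add: c assms lin_add[OF assms(2)] lin_smult[OF assms(2)] N.M.minus_add N.smult_r_minus)
qed

lemma lin_diff: assumes "module R N" "lin M N f" "lin M N g" shows "lin M N (\<lambda>x. f x \<ominus>\<^bsub>N\<^esub> g x)"
  unfolding a_minus_def by (rule lin_plus[OF assms(1,2) lin_neg[OF assms(1,3)]])

lemma submodule_kernel:
  assumes "module R M" "module R N" "lin M N f"
  shows "submodule {x \<in> carrier M. f x = \<zero>\<^bsub>N\<^esub>} R M"
proof -
  interpret M: module R M by fact
  interpret N: module R N by fact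
  show ?thesis
    by (rule M.submoduleI)
      (auto simp: lin_zero[OF assms] lin_uminus[OF assms] lin_add[OF assms(3)] lin_smult[OF assms(3)])
qed

lemma mod_span_minimal: "\<lbrakk>submodule N R M; S \<subseteq> N\<rbrakk> \<Longrightarrow> mod_span R M S \<subseteq> N"
  by (auto simp: mod_span_def)

lemma mod_span_superset: "S \<subseteq> mod_span R M S"
  by (auto simp: mod_span_def)

lemma submodule_mod_span:
  assumes "module R M" "S \<subseteq> carrier M" shows "submodule (mod_span R M S) R M"
proof -
  interpret M: module R M by fact
  have c: "submodule (carrier M) R M" by (rule M.carrier_is_submodule)
  note E = M.submoduleE
  show ?thesis
  proof (rule M.submoduleI)
    show "mod_span R M S \<subseteq> carrier M" using c assms(2) by (auto simp: mod_span_def)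
    show "\<zero>\<^bsub>M\<^esub> \<in> mod_span R M S"
      unfolding mod_span_def
      by (metis (mono_tags, lifting) InterI mem_Collect_eq submodule.axioms(1) subgroup.one_closed monoid.simps(2))
  qed (auto simp: mod_span_def E)
qed

lemma mod_span_mono: "S \<subseteq> S' \<Longrightarrow> mod_span R M S \<subseteq> mod_span R M S'"
  by (auto simp: mod_span_def)

lemma abelian_subgroup_submodule:
  assumes "module R M" "submodule I R M" shows "abelian_subgroup I M"
proof -
  interpret M: module R M by fact
  show ?thesis
    by (rule abelian_subgroupI3)
      (auto simp: additive_subgroup_def submodule.axioms(1)[OF assms(2)] M.M.abelian_group_axioms)
qed

end

text \<open>
  A linear map vanishing on \<open>I\<close> is constant on each coset of \<open>I\<close>, so that any representative will do.
\<close>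

definition qlift :: "('m \<Rightarrow> 'n) \<Rightarrow> 'm set \<Rightarrow> 'n" where "qlift f U = f (SOME x. x \<in> U)"

lemma quot_alg_simps:
  "carrier (quot_alg M I) = a_rcosets\<^bsub>M\<^esub> I"
  "x \<oplus>\<^bsub>quot_alg M I\<^esub> y = x <+>\<^bsub>M\<^esub> y"
  "\<zero>\<^bsub>quot_alg M I\<^esub> = I"
  "x \<otimes>\<^bsub>quot_alg M I\<^esub> y = rcoset_mult M I x y"
  "\<one>\<^bsub>quot_alg M I\<^esub> = I +>\<^bsub>M\<^esub> \<one>\<^bsub>M\<^esub>"
  "r \<odot>\<^bsub>quot_alg M I\<^esub> U = (\<Union>x\<in>U. I +>\<^bsub>M\<^esub> (r \<odot>\<^bsub>M\<^esub> x))"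
  by (simp_all add: quot_alg_def FactRing_def ring.defs module.defs)

locale quotient_module = module R M for R and M (structure) +
  fixes I
  assumes submod: "submodule I R M"
begin

sublocale I: abelian_subgroup I M
  using cring.abelian_subgroup_submodule[OF R.is_cring module_axioms submod] .

lemma coset_eq_iff: "\<lbrakk>x \<in> carrier M; y \<in> carrier M\<rbrakk> \<Longrightarrow> I +> x = I +> y \<longleftrightarrow> x \<ominus> y \<in> I"
  by (metis I.a_rcos_module I.a_rcos_self I.a_repr_independence' a_minus_def)

lemma coset_mem: "\<lbrakk>x \<in> carrier M; y \<in> I +> x\<rbrakk> \<Longrightarrow> y \<in> carrier M \<and> I +> y = I +> x"
  by (metis I.a_elemrcos_carrier I.a_repr_independence')

lemma coset_zero: "x \<in> I \<Longrightarrow> I +> x = I"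
  by (metis I.a_rcos_const)

lemma coset_closed: "x \<in> carrier M \<Longrightarrow> I +> x \<in> carrier (quot_alg M I)"
  by (simp add: quot_alg_simps I.a_subset M.a_rcosetsI)

lemma coset_add: "\<lbrakk>x \<in> carrier M; y \<in> carrier M\<rbrakk> \<Longrightarrow> (I +> x) \<oplus>\<^bsub>quot_alg M I\<^esub> (I +> y) = I +> (x \<oplus> y)"
  by (simp add: quot_alg_simps I.a_rcos_sum)

lemma coset_smult:
  assumes "r \<in> carrier R" "x \<in> carrier M"
  shows "r \<odot>\<^bsub>quot_alg M I\<^esub> (I +> x) = I +> (r \<odot> x)"
proof -
  have "I +> (r \<odot> y) = I +> (r \<odot> x)" if "y \<in> I +> x" for y
  proof -
    from coset_mem[OF assms(2) that] coset_eq_iff[OF _ assms(2), of y] assms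
    have y: "y \<in> carrier M" "y \<ominus> x \<in> I" by auto
    have "r \<odot> y \<ominus> r \<odot> x = r \<odot> (y \<ominus> x)"
      using assms y(1) by (simp add: a_minus_def smult_r_distr smult_r_minus)
    also have "\<dots> \<in> I" using y assms submodule.smult_closed[OF submod] by simp
    finally show ?thesis using assms y coset_eq_iff by simp
  qed
  moreover have "x \<in> I +> x" using assms I.a_rcos_self M.abelian_group_axioms by blast
  ultimately show ?thesis unfolding quot_alg_simps by blast
qed

lemma coset_cases:
  assumes "U \<in> carrier (quot_alg M I)" obtains x where "x \<in> carrier M" "U = I +> x"
  using assms by (auto simp: quot_alg_simps A_RCOSETS_def')

lemma coset_0: "\<zero>\<^bsub>quot_alg M I\<^esub> = I +> \<zero>"
  by (simp add: quot_alg_simps coset_zero)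

lemma module_quot: "module R (quot_alg M I)"
proof (rule moduleI)
  show "cring R" by (rule R.is_cring)
  show "abelian_group (quot_alg M I)"
  proof (rule abelian_groupI)
    show "\<exists>y\<in>carrier (quot_alg M I). y \<oplus>\<^bsub>quot_alg M I\<^esub> x = \<zero>\<^bsub>quot_alg M I\<^esub>"
      if "x \<in> carrier (quot_alg M I)" for x
    proof -
      from coset_cases[OF that] obtain u where u: "u \<in> carrier M" "x = I +> u" .
      show ?thesis
        by (rule bexI[of _ "I +> (\<ominus> u)"]) (auto simp: u coset_add coset_closed coset_0 M.l_neg)
    qed
  qed (auto elim!: coset_cases simp: coset_add coset_closed coset_0 M.a_ac)
qed (auto elim!: coset_cases simp: coset_add coset_closed coset_0 coset_smult smult_l_distr smult_r_distr smult_assoc1)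

lemma lin_coset: "(\<lambda>x. I +> x) \<in> linear_maps R M (quot_alg M I)"
  by (rule cring.linI[OF R.is_cring]) (auto simp: coset_add coset_closed coset_smult)

lemma qlift_coset:
  assumes "module R N" "f \<in> linear_maps R M N" "\<And>x. x \<in> I \<Longrightarrow> f x = \<zero>\<^bsub>N\<^esub>" "x \<in> carrier M"
  shows "qlift f (I +> x) = f x"
proof -
  let ?y = "SOME y. y \<in> I +> x"
  have "?y \<in> I +> x" using I.a_rcos_self[of x] assms(4) M.abelian_group_axioms by (intro someI) blast
  with coset_mem[OF assms(4) this] coset_eq_iff[of ?y x] assms(4)
  have y: "?y \<in> carrier M" "?y \<ominus> x \<in> I" by auto
  interpret N: module R N by fact
  have "f ?y \<ominus>\<^bsub>N\<^esub> f x = \<zero>\<^bsub>N\<^esub>"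
    using R.lin_minus[OF module_axioms assms(1,2) y(1) assms(4)] assms(3)[OF y(2)] by simp
  then have "f ?y = f x"
    using R.lin_closed[OF assms(2)] y(1) assms(4) by (metis N.M.diff_eq_zero_iff)
  then show ?thesis by (simp add: qlift_def)
qed

lemma lin_qlift:
  assumes "module R N" "f \<in> linear_maps R M N" "\<And>x. x \<in> I \<Longrightarrow> f x = \<zero>\<^bsub>N\<^esub>"
  shows "qlift f \<in> linear_maps R (quot_alg M I) N"
proof -
  note q = qlift_coset[OF assms]
  show ?thesis
    by (rule R.linI)
      (auto elim!: coset_cases simp: coset_add coset_smult q R.lin_closed[OF assms(2)] R.lin_add[OF assms(2)] R.lin_smult[OF assms(2)])
qed

end

section \<open>Spanning sets and algebras\<close>

text \<open>
  Spanning is phrased through submodules and not through linear combinations: the induction rule and the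
  uniqueness of linear maps on spanning sets then need no manipulation of finite sums.
\<close>

definition spanned :: "('k, 'r) ring_scheme \<Rightarrow> ('k, 'm, 'x) module_scheme \<Rightarrow> 'm set \<Rightarrow> bool"
  where "spanned R M S \<longleftrightarrow> S \<subseteq> carrier M \<and> (\<forall>N. submodule N R M \<longrightarrow> S \<subseteq> N \<longrightarrow> carrier M \<subseteq> N)"

text \<open>
  Closure under left multiplication by generators, starting from the unit: this suffices for \<open>G\<close> to generate
  \<open>B\<close> as an algebra, and it gives an induction rule in which products have the form generator times element.
\<close>

definition generates :: "('k, 'r) ring_scheme \<Rightarrow> ('k, 'm, 'x) module_scheme \<Rightarrow> 'm set \<Rightarrow> bool"
  where "generates R B G \<longleftrightarrow> G \<subseteq> carrier B \<and>
    (\<forall>N. submodule N R B \<longrightarrow> \<one>\<^bsub>B\<^esub> \<in> N \<longrightarrow> (\<forall>g\<in>G. \<forall>x\<in>N. g \<otimes>\<^bsub>B\<^esub> x \<in> N) \<longrightarrow> carrier B \<subseteq> N)"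

text \<open>An antipode is an algebra map into this algebra.\<close>

definition op_alg :: "('k, 'm, 'x) module_scheme \<Rightarrow> ('k, 'm, 'x) module_scheme"
  where "op_alg B = B\<lparr>mult := \<lambda>x y. y \<otimes>\<^bsub>B\<^esub> x\<rparr>"

text \<open>The ground ring as an algebra over itself, the codomain of a counit.\<close>

definition reg_alg :: "('k, 'r) ring_scheme \<Rightarrow> ('k, 'k) module"
  where "reg_alg R = \<lparr>carrier = carrier R, mult = mult R, one = one R, zero = zero R, add = add R, smult = mult R\<rparr>"

context cring
begin

lemma submodule_Collect:
  assumes "module R M" "P \<zero>\<^bsub>M\<^esub>"
    and "\<And>x y. \<lbrakk>x \<in> carrier M; y \<in> carrier M; P x; P y\<rbrakk> \<Longrightarrow> P (x \<oplus>\<^bsub>M\<^esub> y)"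
    and "\<And>r x. \<lbrakk>r \<in> carrier R; x \<in> carrier M; P x\<rbrakk> \<Longrightarrow> P (r \<odot>\<^bsub>M\<^esub> x)"
  shows "submodule {x \<in> carrier M. P x} R M"
proof -
  interpret M: module R M by fact
  have neg: "\<ominus>\<^bsub>M\<^esub> x = (\<ominus> \<one>) \<odot>\<^bsub>M\<^esub> x" if "x \<in> carrier M" for x
    using that M.smult_l_minus[of \<one> x] by simp
  show ?thesis
    by (rule M.submoduleI) (auto simp: assms neg)
qed

lemma span_induct [consumes 3, case_names gen zero add smult]:
  assumes "spanned R M S" "module R M" "x \<in> carrier M"
    and "\<And>x. x \<in> S \<Longrightarrow> P x" and "P \<zero>\<^bsub>M\<^esub>"
    and "\<And>x y. \<lbrakk>x \<in> carrier M; y \<in> carrier M; P x; P y\<rbrakk> \<Longrightarrow> P (x \<oplus>\<^bsub>M\<^esub> y)"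
    and "\<And>r x. \<lbrakk>r \<in> carrier R; x \<in> carrier M; P x\<rbrakk> \<Longrightarrow> P (r \<odot>\<^bsub>M\<^esub> x)"
  shows "P x"
proof -
  have "submodule {x \<in> carrier M. P x} R M"
    by (rule submodule_Collect[where P=P]) (use assms in auto)
  then show ?thesis using assms(1,3,4) unfolding spanned_def by blast
qed

lemma lin_eq_on_span:
  assumes "spanned R M S" "module R M" "module R N" "lin M N f" "lin M N g"
    and "\<And>x. x \<in> S \<Longrightarrow> f x = g x" "x \<in> carrier M"
  shows "f x = g x"
  using assms(1,2,7)
proof (induction rule: span_induct)
  case zero then show ?case using lin_zero[OF assms(2,3)] assms(4,5) by metis
next
  case (add x y) then show ?case using lin_add[OF assms(4)] lin_add[OF assms(5)] by simp
next
  case (smult r x) then show ?case using lin_smult[OF assms(4)] lin_smult[OF assms(5)] by simp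
qed (use assms in auto)

lemma spanned_image:
  assumes "spanned R M S" "module R M" "module R N" "lin M N f" "carrier N \<subseteq> f ` carrier M"
  shows "spanned R N (f ` S)"
  unfolding spanned_def
proof (intro conjI allI impI)
  show "f ` S \<subseteq> carrier N" using assms(1) lin_closed[OF assms(4)] by (auto simp: spanned_def)
  fix N' assume N': "submodule N' R N" "f ` S \<subseteq> N'"
  interpret N: module R N by fact
  have z: "\<zero>\<^bsub>N\<^esub> \<in> N'"
    using subgroup.one_closed[OF submodule.axioms(1)[OF N'(1)]] by simp
  have "f x \<in> N'" if "x \<in> carrier M" for x
    using assms(1,2) that
  proof (induction rule: span_induct)
    case (gen x) then show ?case using N' by auto
  next
    case zero then show ?case using lin_zero[OF assms(2,3,4)] z by simp
  next
    case (add x y) then show ?case using lin_add[OF assms(4)] N.submoduleE(5)[OF N'(1)] by simp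
  next
    case (smult r x) then show ?case using lin_smult[OF assms(4)] N.submoduleE(4)[OF N'(1)] by simp
  qed
  then show "carrier N \<subseteq> N'" using assms(5) by auto
qed

lemma mod_span_induct [consumes 3, case_names gen zero add smult]:
  assumes "module R M" "S \<subseteq> carrier M" "x \<in> mod_span R M S"
    and "\<And>x. x \<in> S \<Longrightarrow> P x" and "P \<zero>\<^bsub>M\<^esub>"
    and "\<And>x y. \<lbrakk>x \<in> carrier M; y \<in> carrier M; P x; P y\<rbrakk> \<Longrightarrow> P (x \<oplus>\<^bsub>M\<^esub> y)"
    and "\<And>r x. \<lbrakk>r \<in> carrier R; x \<in> carrier M; P x\<rbrakk> \<Longrightarrow> P (r \<odot>\<^bsub>M\<^esub> x)"
  shows "P x"
proof -
  have "submodule {x \<in> carrier M. P x} R M"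
    by (rule submodule_Collect[where P=P]) (use assms in auto)
  then show ?thesis using mod_span_minimal[of "{x \<in> carrier M. P x}" M S] assms(2,3,4) by blast
qed

lemma assoc_algebraI:
  assumes "module R M" "\<one>\<^bsub>M\<^esub> \<in> carrier M"
    and "\<And>x y. \<lbrakk>x \<in> carrier M; y \<in> carrier M\<rbrakk> \<Longrightarrow> x \<otimes>\<^bsub>M\<^esub> y \<in> carrier M"
    and "\<And>x y z. \<lbrakk>x \<in> carrier M; y \<in> carrier M; z \<in> carrier M\<rbrakk> \<Longrightarrow>
      (x \<otimes>\<^bsub>M\<^esub> y) \<otimes>\<^bsub>M\<^esub> z = x \<otimes>\<^bsub>M\<^esub> (y \<otimes>\<^bsub>M\<^esub> z)"
    and "\<And>x. x \<in> carrier M \<Longrightarrow> \<one>\<^bsub>M\<^esub> \<otimes>\<^bsub>M\<^esub> x = x" "\<And>x. x \<in> carrier M \<Longrightarrow> x \<otimes>\<^bsub>M\<^esub> \<one>\<^bsub>M\<^esub> = x"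
    and "\<And>x. x \<in> carrier M \<Longrightarrow> lin M M (\<lambda>y. x \<otimes>\<^bsub>M\<^esub> y)"
    and "\<And>y. y \<in> carrier M \<Longrightarrow> lin M M (\<lambda>x. x \<otimes>\<^bsub>M\<^esub> y)"
  shows "assoc_algebra R M"
proof -
  interpret M: module R M by fact
  show ?thesis
    by (intro assoc_algebra.intro assms(1) ringI monoidI assoc_algebra_axioms.intro M.M.abelian_group_axioms)
      (simp_all add: assms(2-6) lin_add[OF assms(7)] lin_add[OF assms(8)] lin_smult[OF assms(7)] lin_smult[OF assms(8)])
qed

lemma alg_homI:
  assumes "lin A B f" "f \<one>\<^bsub>A\<^esub> = \<one>\<^bsub>B\<^esub>"
    and "\<And>x y. \<lbrakk>x \<in> carrier A; y \<in> carrier A\<rbrakk> \<Longrightarrow> f (x \<otimes>\<^bsub>A\<^esub> y) = f x \<otimes>\<^bsub>B\<^esub> f y"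
  shows "f \<in> alg_hom R A B"
  using assms by (auto simp: alg_hom_def ring_hom_def linear_maps_def)

lemma alg_hom_lin: "f \<in> alg_hom R A B \<Longrightarrow> lin A B f"
  and alg_hom_one: "f \<in> alg_hom R A B \<Longrightarrow> f \<one>\<^bsub>A\<^esub> = \<one>\<^bsub>B\<^esub>"
  and alg_hom_mult: "\<lbrakk>f \<in> alg_hom R A B; x \<in> carrier A; y \<in> carrier A\<rbrakk> \<Longrightarrow> f (x \<otimes>\<^bsub>A\<^esub> y) = f x \<otimes>\<^bsub>B\<^esub> f y"
  by (auto simp: alg_hom_def ring_hom_def)

lemma alg_hom_closed: "\<lbrakk>f \<in> alg_hom R A B; x \<in> carrier A\<rbrakk> \<Longrightarrow> f x \<in> carrier B"
  by (rule lin_closed[OF alg_hom_lin])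

lemma alg_hom_comp: "\<lbrakk>f \<in> alg_hom R A B; g \<in> alg_hom R B C\<rbrakk> \<Longrightarrow> (\<lambda>x. g (f x)) \<in> alg_hom R A C"
  by (rule alg_homI, rule lin_comp[OF alg_hom_lin alg_hom_lin], assumption+)
    (simp_all add: alg_hom_one[of f A B] alg_hom_one[of g B C] alg_hom_mult[of f A B] alg_hom_mult[of g B C] alg_hom_closed[of f A B])

lemma alg_hom_id: "(\<lambda>x. x) \<in> alg_hom R A A"
  by (rule alg_homI[OF lin_id]) auto

lemma lin_mult_left: "\<lbrakk>assoc_algebra R B; b \<in> carrier B\<rbrakk> \<Longrightarrow> lin B B (\<lambda>x. b \<otimes>\<^bsub>B\<^esub> x)"
proof -
  assume B: "assoc_algebra R B" "b \<in> carrier B"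
  interpret B: assoc_algebra R B by fact
  show ?thesis by (rule linI) (simp_all add: B B.r_distr B.smult_mult_right)
qed

lemma lin_mult_right: "\<lbrakk>assoc_algebra R B; b \<in> carrier B\<rbrakk> \<Longrightarrow> lin B B (\<lambda>x. x \<otimes>\<^bsub>B\<^esub> b)"
proof -
  assume B: "assoc_algebra R B" "b \<in> carrier B"
  interpret B: assoc_algebra R B by fact
  show ?thesis by (rule linI) (simp_all add: B B.l_distr B.smult_mult_left)
qed

lemma assoc_algebra_module: "assoc_algebra R B \<Longrightarrow> module R B"
  by (simp add: assoc_algebra_def)

lemma ideal_submodule:
  assumes "assoc_algebra R M" "ideal I M" shows "submodule I R M"
proof -
  interpret M: assoc_algebra R M by fact
  interpret I: ideal I M by fact
  show ?thesis
  proof (rule M.submoduleI)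
    show "a \<odot>\<^bsub>M\<^esub> x \<in> I" if "a \<in> carrier R" "x \<in> I" for a x
    proof -
      have "a \<odot>\<^bsub>M\<^esub> x = (a \<odot>\<^bsub>M\<^esub> \<one>\<^bsub>M\<^esub>) \<otimes>\<^bsub>M\<^esub> x"
        using that M.smult_mult_left[of a "\<one>\<^bsub>M\<^esub>" x] I.a_Hcarr by simp
      then show ?thesis using that I.I_l_closed by simp
    qed
  qed (use I.a_subset in auto)
qed

lemma assoc_algebra_quot:
  assumes "assoc_algebra R M" "ideal I M"
  shows "assoc_algebra R (quot_alg M I)" and "(\<lambda>x. I +>\<^bsub>M\<^esub> x) \<in> alg_hom R M (quot_alg M I)"
proof -
  interpret M: assoc_algebra R M by fact
  interpret I: ideal I M by fact
  interpret Q: quotient_module R M I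
    by (intro quotient_module.intro quotient_module_axioms.intro ideal_submodule assms M.module_axioms)
  have m: "(I +>\<^bsub>M\<^esub> x) \<otimes>\<^bsub>quot_alg M I\<^esub> (I +>\<^bsub>M\<^esub> y) = I +>\<^bsub>M\<^esub> (x \<otimes>\<^bsub>M\<^esub> y)"
    if "x \<in> carrier M" "y \<in> carrier M" for x y
    using that by (simp add: quot_alg_simps I.rcoset_mult_add)
  have o: "\<one>\<^bsub>quot_alg M I\<^esub> = I +>\<^bsub>M\<^esub> \<one>\<^bsub>M\<^esub>" by (simp add: quot_alg_simps)
  show "assoc_algebra R (quot_alg M I)"
  proof (rule assoc_algebraI)
    show "lin (quot_alg M I) (quot_alg M I) (\<lambda>y. x \<otimes>\<^bsub>quot_alg M I\<^esub> y)" if "x \<in> carrier (quot_alg M I)" for x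
      using that by (intro linI) (auto elim!: Q.coset_cases simp: m Q.coset_add Q.coset_closed Q.coset_smult M.r_distr M.smult_mult_right)
    show "lin (quot_alg M I) (quot_alg M I) (\<lambda>x. x \<otimes>\<^bsub>quot_alg M I\<^esub> y)" if "y \<in> carrier (quot_alg M I)" for y
      using that by (intro linI) (auto elim!: Q.coset_cases simp: m Q.coset_add Q.coset_closed Q.coset_smult M.l_distr M.smult_mult_left)
  qed (auto intro: Q.module_quot elim!: Q.coset_cases simp: m o Q.coset_closed M.m_assoc)
  show "(\<lambda>x. I +>\<^bsub>M\<^esub> x) \<in> alg_hom R M (quot_alg M I)"
    by (rule alg_homI[OF Q.lin_coset]) (auto simp: m o)
qed

lemma coset_surj: "carrier (quot_alg M I) = (\<lambda>x. I +>\<^bsub>M\<^esub> x) ` carrier M"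
  unfolding quot_alg_simps A_RCOSETS_def' by blast

lemma ideal_kernel:
  assumes "assoc_algebra R M" "assoc_algebra R N" "f \<in> alg_hom R M N"
  shows "ideal {x \<in> carrier M. f x = \<zero>\<^bsub>N\<^esub>} M"
proof -
  interpret M: assoc_algebra R M by fact
  interpret N: assoc_algebra R N by fact
  have "f \<in> ring_hom M N" using assms(3) by (simp add: alg_hom_def)
  from ring_hom_ringI2[OF M.ring_axioms N.ring_axioms this]
  have "ideal (a_kernel M N f) M" by (rule ring_hom_ring.kernel_is_ideal)
  then show ?thesis unfolding a_kernel_def' .
qed

lemma alg_hom_genideal:
  assumes "assoc_algebra R M" "assoc_algebra R N" "f \<in> alg_hom R M N" "S \<subseteq> carrier M"
    and "\<And>s. s \<in> S \<Longrightarrow> f s = \<zero>\<^bsub>N\<^esub>" "x \<in> genideal M S"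
  shows "f x = \<zero>\<^bsub>N\<^esub>"
proof -
  interpret M: assoc_algebra R M by fact
  have "genideal M S \<subseteq> {x \<in> carrier M. f x = \<zero>\<^bsub>N\<^esub>}"
    by (rule M.genideal_minimal[OF ideal_kernel[OF assms(1-3)]]) (use assms in auto)
  then show ?thesis using assms by auto
qed

lemma alg_hom_qlift:
  assumes "assoc_algebra R M" "ideal I M" "assoc_algebra R N" "f \<in> alg_hom R M N" "\<And>x. x \<in> I \<Longrightarrow> f x = \<zero>\<^bsub>N\<^esub>"
  shows "qlift f \<in> alg_hom R (quot_alg M I) N" and "x \<in> carrier M \<Longrightarrow> qlift f (I +>\<^bsub>M\<^esub> x) = f x"
proof -
  interpret M: assoc_algebra R M by fact
  interpret N: assoc_algebra R N by fact
  interpret I: ideal I M by fact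
  interpret Q: quotient_module R M I
    by (intro quotient_module.intro quotient_module_axioms.intro ideal_submodule assms M.module_axioms)
  note q = Q.qlift_coset[OF N.module_axioms alg_hom_lin[OF assms(4)] assms(5)]
  have m: "(I +>\<^bsub>M\<^esub> x) \<otimes>\<^bsub>quot_alg M I\<^esub> (I +>\<^bsub>M\<^esub> y) = I +>\<^bsub>M\<^esub> (x \<otimes>\<^bsub>M\<^esub> y)"
    if "x \<in> carrier M" "y \<in> carrier M" for x y
    using that by (simp add: quot_alg_simps I.rcoset_mult_add)
  show "qlift f \<in> alg_hom R (quot_alg M I) N"
  proof (rule alg_homI)
    show "lin (quot_alg M I) N (qlift f)"
      by (rule Q.lin_qlift[OF N.module_axioms alg_hom_lin[OF assms(4)] assms(5)])
    show "qlift f \<one>\<^bsub>quot_alg M I\<^esub> = \<one>\<^bsub>N\<^esub>"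
      by (simp add: quot_alg_simps(5) q alg_hom_one[OF assms(4)])
    fix x y assume "x \<in> carrier (quot_alg M I)" "y \<in> carrier (quot_alg M I)"
    then show "qlift f (x \<otimes>\<^bsub>quot_alg M I\<^esub> y) = qlift f x \<otimes>\<^bsub>N\<^esub> qlift f y"
      by (elim Q.coset_cases) (simp add: m q alg_hom_mult[OF assms(4)])
  qed
  show "x \<in> carrier M \<Longrightarrow> qlift f (I +>\<^bsub>M\<^esub> x) = f x" by (rule q)
qed

lemma generates_induct [consumes 3, case_names one add smult mult]:
  assumes "generates R B G" "assoc_algebra R B" "x \<in> carrier B"
    and "P \<one>\<^bsub>B\<^esub>"
    and "\<And>x y. \<lbrakk>x \<in> carrier B; y \<in> carrier B; P x; P y\<rbrakk> \<Longrightarrow> P (x \<oplus>\<^bsub>B\<^esub> y)"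
    and "\<And>r x. \<lbrakk>r \<in> carrier R; x \<in> carrier B; P x\<rbrakk> \<Longrightarrow> P (r \<odot>\<^bsub>B\<^esub> x)"
    and "\<And>g x. \<lbrakk>g \<in> G; x \<in> carrier B; P x\<rbrakk> \<Longrightarrow> P (g \<otimes>\<^bsub>B\<^esub> x)"
  shows "P x"
proof -
  interpret B: assoc_algebra R B by fact
  have "P (\<zero> \<odot>\<^bsub>B\<^esub> \<one>\<^bsub>B\<^esub>)" by (rule assms(6)) (auto simp: assms)
  then have "P \<zero>\<^bsub>B\<^esub>" by simp
  have N: "submodule {x \<in> carrier B. P x} R B"
    by (rule submodule_Collect[where P=P]) (use assms \<open>P \<zero>\<^bsub>B\<^esub>\<close> B.module_axioms in auto)
  have G: "G \<subseteq> carrier B" using assms(1) by (simp add: generates_def)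
  have "carrier B \<subseteq> {x \<in> carrier B. P x}"
    using assms(1) unfolding generates_def
  proof (elim conjE allE impE)
    show "\<forall>g\<in>G. \<forall>x\<in>{x \<in> carrier B. P x}. g \<otimes>\<^bsub>B\<^esub> x \<in> {x \<in> carrier B. P x}"
      using assms(7) G by auto
  qed (use N assms(4) in auto)
  then show ?thesis using assms(3) by auto
qed

lemma generates_subset: "generates R B G \<Longrightarrow> G \<subseteq> carrier B" by (simp add: generates_def)

text \<open>
  The elements on which two algebra maps agree form a submodule that contains the unit and is closed under
  multiplication by the generators.
\<close>

lemma alg_hom_eq_on_gens:
  assumes "generates R B G" "assoc_algebra R B" "assoc_algebra R C" "f \<in> alg_hom R B C" "g \<in> alg_hom R B C"
    and "\<And>x. x \<in> G \<Longrightarrow> f x = g x" "x \<in> carrier B"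
  shows "f x = g x"
  using assms(1,2,7)
proof (induction rule: generates_induct)
  case one then show ?case using alg_hom_one[OF assms(4)] alg_hom_one[OF assms(5)] by simp
next
  case (add x y) then show ?case using lin_add[OF alg_hom_lin[OF assms(4)]] lin_add[OF alg_hom_lin[OF assms(5)]] by simp
next
  case (smult r x) then show ?case using lin_smult[OF alg_hom_lin[OF assms(4)]] lin_smult[OF alg_hom_lin[OF assms(5)]] by simp
next
  case (mult h x) then show ?case
    using alg_hom_mult[OF assms(4), of h x] alg_hom_mult[OF assms(5), of h x] generates_subset[OF assms(1)] assms(6)
    by auto
qed

lemma generates_image:
  assumes "generates R B G" "assoc_algebra R B" "assoc_algebra R C" "f \<in> alg_hom R B C" "carrier C \<subseteq> f ` carrier B"
  shows "generates R C (f ` G)"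
  unfolding generates_def
proof (intro conjI allI impI)
  show "f ` G \<subseteq> carrier C" using generates_subset[OF assms(1)] alg_hom_closed[OF assms(4)] by auto
  fix N assume N: "submodule N R C" "\<one>\<^bsub>C\<^esub> \<in> N" "\<forall>g\<in>f ` G. \<forall>x\<in>N. g \<otimes>\<^bsub>C\<^esub> x \<in> N"
  interpret C: assoc_algebra R C by fact
  have "f x \<in> N" if "x \<in> carrier B" for x
    using assms(1,2) that
  proof (induction rule: generates_induct)
    case one then show ?case using N alg_hom_one[OF assms(4)] by simp
  next
    case (add x y) then show ?case using lin_add[OF alg_hom_lin[OF assms(4)]] C.submoduleE(5)[OF N(1)] by simp
  next
    case (smult r x) then show ?case using lin_smult[OF alg_hom_lin[OF assms(4)]] C.submoduleE(4)[OF N(1)] by simp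
  next
    case (mult h x) then show ?case
      using alg_hom_mult[OF assms(4), of h x] generates_subset[OF assms(1)] N(3) by auto
  qed
  then show "carrier C \<subseteq> N" using assms(5) by auto
qed

lemma op_alg_simps [simp]:
  "carrier (op_alg B) = carrier B" "x \<otimes>\<^bsub>op_alg B\<^esub> y = y \<otimes>\<^bsub>B\<^esub> x" "\<one>\<^bsub>op_alg B\<^esub> = \<one>\<^bsub>B\<^esub>"
  "\<zero>\<^bsub>op_alg B\<^esub> = \<zero>\<^bsub>B\<^esub>" "x \<oplus>\<^bsub>op_alg B\<^esub> y = x \<oplus>\<^bsub>B\<^esub> y" "r \<odot>\<^bsub>op_alg B\<^esub> x = r \<odot>\<^bsub>B\<^esub> x"
  by (simp_all add: op_alg_def)

lemma add_monoid_op_alg: "add_monoid (op_alg B) = add_monoid B"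
  by (simp add: op_alg_def)

lemma op_alg_ops [simp]:
  "\<ominus>\<^bsub>op_alg B\<^esub> x = \<ominus>\<^bsub>B\<^esub> x" "x \<ominus>\<^bsub>op_alg B\<^esub> y = x \<ominus>\<^bsub>B\<^esub> y" "finsum (op_alg B) f I = finsum B f I"
  unfolding a_inv_def a_minus_def finsum_def add_monoid_op_alg by simp_all

lemma linear_maps_op_alg [simp]: "linear_maps R M (op_alg B) = linear_maps R M B"
  by (simp add: linear_maps_def)

lemma lin_ext_op_alg [simp]: "lin_ext R (op_alg B) b f = lin_ext R B b f"
  by (simp add: lin_ext_def)

lemma tlift_op_alg [simp]: "tlift R (op_alg B) b U = tlift R B b U"
  by (simp add: tlift_def)

lemma assoc_algebra_op: assumes "assoc_algebra R B" shows "assoc_algebra R (op_alg B)"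
proof -
  interpret B: assoc_algebra R B by fact
  show ?thesis
  proof (rule assoc_algebraI)
    show "module R (op_alg B)"
    proof (rule moduleI)
      show "abelian_group (op_alg B)"
        using B.M.abelian_group_axioms
        unfolding abelian_group_def abelian_monoid_def abelian_group_axioms_def add_monoid_op_alg .
    qed (auto simp: is_cring B.smult_l_distr B.smult_r_distr B.smult_assoc1)
  next
    fix x assume x: "x \<in> carrier (op_alg B)"
    show "lin (op_alg B) (op_alg B) (\<lambda>y. x \<otimes>\<^bsub>op_alg B\<^esub> y)"
      using lin_mult_right[OF assms, of x] x by (simp add: linear_maps_def)
    show "lin (op_alg B) (op_alg B) (\<lambda>y. y \<otimes>\<^bsub>op_alg B\<^esub> x)"
      using lin_mult_left[OF assms, of x] x by (simp add: linear_maps_def)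
  qed (auto simp: B.m_assoc)
qed

lemma reg_alg_simps [simp]:
  "carrier (reg_alg R) = carrier R" "x \<otimes>\<^bsub>reg_alg R\<^esub> y = x \<otimes> y" "\<one>\<^bsub>reg_alg R\<^esub> = \<one>"
  "\<zero>\<^bsub>reg_alg R\<^esub> = \<zero>" "x \<oplus>\<^bsub>reg_alg R\<^esub> y = x \<oplus> y" "r \<odot>\<^bsub>reg_alg R\<^esub> x = r \<otimes> x"
  by (simp_all add: reg_alg_def)

lemma assoc_algebra_reg: "assoc_algebra R (reg_alg R)"
proof (rule assoc_algebraI)
  show "module R (reg_alg R)"
  proof (rule moduleI)
    show "abelian_group (reg_alg R)"
    proof (rule abelian_groupI)
      show "\<exists>y\<in>carrier (reg_alg R). y \<oplus>\<^bsub>reg_alg R\<^esub> x = \<zero>\<^bsub>reg_alg R\<^esub>"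
        if "x \<in> carrier (reg_alg R)" for x
        using that by (intro bexI[of _ "\<ominus> x"]) (auto simp: l_neg)
    qed (auto simp: a_ac)
  qed (auto simp: is_cring l_distr r_distr m_assoc)
qed (auto simp: m_ac l_distr r_distr intro!: linI)

end

section \<open>Free modules and monoid algebras\<close>

lemma monoid_algebra_simps:
  "carrier (monoid_algebra R G) = fin_supp R (carrier G)"
  "\<one>\<^bsub>monoid_algebra R G\<^esub> = delta R \<one>\<^bsub>G\<^esub>"
  "\<zero>\<^bsub>monoid_algebra R G\<^esub> = (\<lambda>_. \<zero>\<^bsub>R\<^esub>)"
  "f \<oplus>\<^bsub>monoid_algebra R G\<^esub> g = (\<lambda>z. f z \<oplus>\<^bsub>R\<^esub> g z)"
  "r \<odot>\<^bsub>monoid_algebra R G\<^esub> f = (\<lambda>z. r \<otimes>\<^bsub>R\<^esub> f z)"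
  by (simp_all add: monoid_algebra_def delta_def)

context cring
begin

lemma fin_supp_closed: "f \<in> fin_supp R S \<Longrightarrow> f x \<in> carrier R"
  and fin_supp_finite: "f \<in> fin_supp R S \<Longrightarrow> finite {x. f x \<noteq> \<zero>}"
  and fin_supp_subset: "f \<in> fin_supp R S \<Longrightarrow> {x. f x \<noteq> \<zero>} \<subseteq> S"
  by (auto simp: fin_supp_def)

lemma fin_suppI:
  assumes "\<And>x. f x \<in> carrier R" "finite T" "\<And>x. x \<notin> T \<Longrightarrow> f x = \<zero>" "\<And>x. x \<notin> S \<Longrightarrow> f x = \<zero>"
  shows "f \<in> fin_supp R S"
proof -
  have "finite {x. f x \<noteq> \<zero>}" by (rule finite_subset[OF _ assms(2)]) (use assms(3) in auto)
  then show ?thesis using assms by (auto simp: fin_supp_def)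
qed

lemma module_monoid_algebra: "module R (monoid_algebra R G)"
proof -
  have add: "(\<lambda>z. f z \<oplus> g z) \<in> fin_supp R S" if "f \<in> fin_supp R S" "g \<in> fin_supp R S" for f g and S :: "'g set"
    by (rule fin_suppI[where T="{x. f x \<noteq> \<zero>} \<union> {x. g x \<noteq> \<zero>}"]) (use that in \<open>auto simp: fin_supp_def\<close>)
  have sm: "(\<lambda>z. r \<otimes> f z) \<in> fin_supp R S" if "f \<in> fin_supp R S" "r \<in> carrier R" for f r and S :: "'g set"
    by (rule fin_suppI[where T="{x. f x \<noteq> \<zero>}"]) (use that in \<open>auto simp: fin_supp_def\<close>)
  have z: "(\<lambda>z. \<zero>) \<in> fin_supp R S" for S :: "'g set" by (auto simp: fin_supp_def)
  note c = fin_supp_closed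
  show ?thesis
  proof (rule moduleI)
    show "abelian_group (monoid_algebra R G)"
    proof (rule abelian_groupI)
      fix f assume f: "f \<in> carrier (monoid_algebra R G)"
      show "\<exists>g\<in>carrier (monoid_algebra R G). g \<oplus>\<^bsub>monoid_algebra R G\<^esub> f = \<zero>\<^bsub>monoid_algebra R G\<^esub>"
      proof (rule bexI)
        show "(\<lambda>z. (\<ominus> \<one>) \<otimes> f z) \<in> carrier (monoid_algebra R G)"
          using f sm[of f] by (simp add: monoid_algebra_simps)
        show "(\<lambda>z. (\<ominus> \<one>) \<otimes> f z) \<oplus>\<^bsub>monoid_algebra R G\<^esub> f = \<zero>\<^bsub>monoid_algebra R G\<^esub>"
          using f c[of f] by (simp add: monoid_algebra_simps l_minus l_neg)
      qed
    qed (auto simp: monoid_algebra_simps add z c a_ac)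
  qed (auto simp: monoid_algebra_simps is_cring sm c l_distr r_distr m_assoc)
qed

lemma finsum_monoid_algebra:
  assumes "finite I" "h \<in> I \<rightarrow> carrier (monoid_algebra R G)"
  shows "(\<Oplus>\<^bsub>monoid_algebra R G\<^esub>i\<in>I. h i) z = (\<Oplus>i\<in>I. h i z)"
  using assms
proof (induction I rule: finite_induct)
  interpret F: module R "monoid_algebra R G" by (rule module_monoid_algebra)
  case empty then show ?case by (simp add: monoid_algebra_simps)
next
  interpret F: module R "monoid_algebra R G" by (rule module_monoid_algebra)
  case (insert i I)
  then have "h \<in> I \<rightarrow> carrier (monoid_algebra R G)" "h i \<in> carrier (monoid_algebra R G)" by auto
  moreover from this have "(\<lambda>i. h i z) \<in> I \<rightarrow> carrier R" "h i z \<in> carrier R"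
    by (auto simp: monoid_algebra_simps fin_supp_def)
  ultimately show ?case using insert by (simp add: monoid_algebra_simps)
qed

lemma delta_closed: "x \<in> carrier G \<Longrightarrow> delta R x \<in> carrier (monoid_algebra R G)"
  unfolding monoid_algebra_simps by (rule fin_suppI[where T="{x}"]) (auto simp: delta_def)

text \<open>
  Supports differ between summands; a common finite superset makes \<open>lin_ext\<close> additive.
\<close>

lemma lin_ext_superset:
  assumes "module R P" "f \<in> carrier (monoid_algebra R G)" "b \<in> carrier G \<rightarrow> carrier P"
    and "finite S" "{x. f x \<noteq> \<zero>} \<subseteq> S" "S \<subseteq> carrier G"
  shows "lin_ext R P b f = (\<Oplus>\<^bsub>P\<^esub>x\<in>S. f x \<odot>\<^bsub>P\<^esub> b x)"
proof -
  interpret P: module R P by fact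
  show ?thesis unfolding lin_ext_def
  proof (rule P.M.add.finprod_mono_neutral_cong_left)
    show "f i \<odot>\<^bsub>P\<^esub> b i = \<zero>\<^bsub>P\<^esub>" if "i \<in> S - {x. f x \<noteq> \<zero>}" for i
      using that assms by (auto simp: Pi_def subset_iff)
    show "(\<lambda>x. f x \<odot>\<^bsub>P\<^esub> b x) \<in> S \<rightarrow> carrier P"
      using assms by (auto simp: Pi_def subset_iff monoid_algebra_simps fin_supp_closed)
  qed (use assms in auto)
qed

lemma lin_lin_ext:
  assumes "module R P" "b \<in> carrier G \<rightarrow> carrier P"
  shows "lin (monoid_algebra R G) P (lin_ext R P b)"
proof -
  interpret P: module R P by fact
  interpret F: module R "monoid_algebra R G" by (rule module_monoid_algebra)
  have cl: "(\<lambda>x. f x \<odot>\<^bsub>P\<^esub> b x) \<in> S \<rightarrow> carrier P"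
    if "f \<in> carrier (monoid_algebra R G)" "S \<subseteq> carrier G" for f S
    using assms(2) that by (auto simp: Pi_def monoid_algebra_simps subset_iff fin_supp_closed)
  show ?thesis
  proof (rule linI)
    fix f assume f: "f \<in> carrier (monoid_algebra R G)"
    have s: "{x. f x \<noteq> \<zero>} \<subseteq> carrier G" "finite {x. f x \<noteq> \<zero>}" using f by (auto simp: monoid_algebra_simps fin_supp_def)
    show "lin_ext R P b f \<in> carrier P"
      unfolding lin_ext_def by (rule P.M.finsum_closed) (rule cl[OF f s(1)])
    fix r assume r: "r \<in> carrier R"
    have "lin_ext R P b (r \<odot>\<^bsub>monoid_algebra R G\<^esub> f) = (\<Oplus>\<^bsub>P\<^esub>x\<in>{x. f x \<noteq> \<zero>}. (r \<otimes> f x) \<odot>\<^bsub>P\<^esub> b x)"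
    proof -
      have "{x. (r \<odot>\<^bsub>monoid_algebra R G\<^esub> f) x \<noteq> \<zero>} \<subseteq> {x. f x \<noteq> \<zero>}"
        using r by (auto simp: monoid_algebra_simps)
      from lin_ext_superset[OF assms(1) F.smult_closed[OF r f] assms(2) s(2) this s(1)]
      show ?thesis by (simp add: monoid_algebra_simps)
    qed
    also have "\<dots> = (\<Oplus>\<^bsub>P\<^esub>x\<in>{x. f x \<noteq> \<zero>}. r \<odot>\<^bsub>P\<^esub> (f x \<odot>\<^bsub>P\<^esub> b x))"
      using assms(2) s f r by (intro P.M.finsum_cong') (auto simp: Pi_def subset_iff monoid_algebra_simps fin_supp_closed P.smult_assoc1)
    also have "\<dots> = r \<odot>\<^bsub>P\<^esub> lin_ext R P b f"
      unfolding lin_ext_def by (rule P.finsum_smult_ldistr[symmetric, OF s(2) r cl[OF f s(1)]])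
    finally show "lin_ext R P b (r \<odot>\<^bsub>monoid_algebra R G\<^esub> f) = r \<odot>\<^bsub>P\<^esub> lin_ext R P b f" .
  next
    fix f g assume fg: "f \<in> carrier (monoid_algebra R G)" "g \<in> carrier (monoid_algebra R G)"
    let ?S = "{x. f x \<noteq> \<zero>} \<union> {x. g x \<noteq> \<zero>}"
    have S: "finite ?S" "?S \<subseteq> carrier G" using fg by (auto simp: monoid_algebra_simps fin_supp_def)
    note e = lin_ext_superset[OF assms(1) _ assms(2) S(1) _ S(2)]
    have "lin_ext R P b (f \<oplus>\<^bsub>monoid_algebra R G\<^esub> g) = (\<Oplus>\<^bsub>P\<^esub>x\<in>?S. (f x \<oplus> g x) \<odot>\<^bsub>P\<^esub> b x)"
    proof -
      have "{x. (f \<oplus>\<^bsub>monoid_algebra R G\<^esub> g) x \<noteq> \<zero>} \<subseteq> ?S"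
        by (auto simp: monoid_algebra_simps)
      from e[OF F.M.a_closed[OF fg] this] show ?thesis by (simp add: monoid_algebra_simps)
    qed
    also have "\<dots> = (\<Oplus>\<^bsub>P\<^esub>x\<in>?S. f x \<odot>\<^bsub>P\<^esub> b x \<oplus>\<^bsub>P\<^esub> g x \<odot>\<^bsub>P\<^esub> b x)"
      using assms(2) S(2) fg by (intro P.M.finsum_cong') (auto simp: Pi_def subset_iff monoid_algebra_simps fin_supp_closed P.smult_l_distr)
    also have "\<dots> = (\<Oplus>\<^bsub>P\<^esub>x\<in>?S. f x \<odot>\<^bsub>P\<^esub> b x) \<oplus>\<^bsub>P\<^esub> (\<Oplus>\<^bsub>P\<^esub>x\<in>?S. g x \<odot>\<^bsub>P\<^esub> b x)"
      by (rule P.M.finsum_addf) (rule cl[OF fg(1) S(2)], rule cl[OF fg(2) S(2)])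
    also have "\<dots> = lin_ext R P b f \<oplus>\<^bsub>P\<^esub> lin_ext R P b g"
      by (simp add: e[OF fg(1) Un_upper1] e[OF fg(2) Un_upper2])
    finally show "lin_ext R P b (f \<oplus>\<^bsub>monoid_algebra R G\<^esub> g) = lin_ext R P b f \<oplus>\<^bsub>P\<^esub> lin_ext R P b g" .
  qed
qed

lemma lin_ext_delta:
  fixes G :: "('g, 'z) monoid_scheme"
  assumes "module R P" "b \<in> carrier G \<rightarrow> carrier P" "x \<in> carrier G"
  shows "lin_ext R P b (delta R x) = b x"
proof -
  interpret P: module R P by fact
  have "lin_ext R P b (delta R x) = (\<Oplus>\<^bsub>P\<^esub>y\<in>{x}. delta R x y \<odot>\<^bsub>P\<^esub> b y)"
    by (rule lin_ext_superset[OF assms(1) delta_closed[OF assms(3)] assms(2)]) (auto simp: delta_def assms)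
  moreover have "b x \<in> carrier P" using assms by auto
  ultimately show ?thesis by (simp add: delta_def)
qed

lemma submodule_finsum:
  assumes "module R M" "submodule N R M" "finite I" "h \<in> I \<rightarrow> N"
  shows "(\<Oplus>\<^bsub>M\<^esub>i\<in>I. h i) \<in> N"
proof -
  interpret M: module R M by fact
  note E = M.submoduleE[OF assms(2)]
  have z: "\<zero>\<^bsub>M\<^esub> \<in> N" using subgroup.one_closed[OF submodule.axioms(1)[OF assms(2)]] by simp
  show ?thesis using assms(3,4)
  proof (induction I rule: finite_induct)
    case (insert i I)
    then have "h \<in> I \<rightarrow> carrier M" "h i \<in> carrier M" using E(1) by auto
    then show ?case using insert E(5) by auto
  qed (simp add: z)
qed

lemma lin_ext_delta_expand:
  assumes "f \<in> carrier (monoid_algebra R G)"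
  shows "f = (\<Oplus>\<^bsub>monoid_algebra R G\<^esub>x\<in>{x. f x \<noteq> \<zero>}. f x \<odot>\<^bsub>monoid_algebra R G\<^esub> delta R x)"
proof
  fix z
  interpret F: module R "monoid_algebra R G" by (rule module_monoid_algebra)
  have s: "{x. f x \<noteq> \<zero>} \<subseteq> carrier G" "finite {x. f x \<noteq> \<zero>}" "\<And>x. f x \<in> carrier R"
    using assms by (auto simp: monoid_algebra_simps fin_supp_def)
  have "(\<Oplus>\<^bsub>monoid_algebra R G\<^esub>x\<in>{x. f x \<noteq> \<zero>}. f x \<odot>\<^bsub>monoid_algebra R G\<^esub> delta R x) z =
    (\<Oplus>x\<in>{x. f x \<noteq> \<zero>}. (f x \<odot>\<^bsub>monoid_algebra R G\<^esub> delta R x) z)"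
    by (rule finsum_monoid_algebra[OF s(2)]) (use s in \<open>auto intro!: F.smult_closed delta_closed\<close>)
  also have "\<dots> = (\<Oplus>x\<in>{x. f x \<noteq> \<zero>}. if z = x then f x else \<zero>)"
    by (rule finsum_cong') (auto simp: monoid_algebra_simps delta_def s)
  also have "\<dots> = f z"
  proof (cases "f z = \<zero>")
    case False
    then show ?thesis using finsum_singleton[of z "{x. f x \<noteq> \<zero>}" f] s by auto
  next
    case True
    have "(\<Oplus>x\<in>{x. f x \<noteq> \<zero>}. if z = x then f x else \<zero>) = (\<Oplus>x\<in>{x. f x \<noteq> \<zero>}. \<zero>)"
      by (rule finsum_cong') (use True in auto)
    then show ?thesis using True by simp
  qed
  finally show "f z = (\<Oplus>\<^bsub>monoid_algebra R G\<^esub>x\<in>{x. f x \<noteq> \<zero>}. f x \<odot>\<^bsub>monoid_algebra R G\<^esub> delta R x) z" by simp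
qed

lemma spanned_monoid_algebra: "spanned R (monoid_algebra R G) (delta R ` carrier G)"
proof -
  interpret F: module R "monoid_algebra R G" by (rule module_monoid_algebra)
  have "f \<in> N" if N: "submodule N R (monoid_algebra R G)" "delta R ` carrier G \<subseteq> N"
    and f: "f \<in> carrier (monoid_algebra R G)" for N f
  proof -
    have s: "{x. f x \<noteq> \<zero>} \<subseteq> carrier G" "finite {x. f x \<noteq> \<zero>}" "\<And>x. f x \<in> carrier R"
      using f by (auto simp: monoid_algebra_simps fin_supp_def)
    have "(\<lambda>x. f x \<odot>\<^bsub>monoid_algebra R G\<^esub> delta R x) \<in> {x. f x \<noteq> \<zero>} \<rightarrow> N"
    proof (rule Pi_I)
      fix x assume "x \<in> {x. f x \<noteq> \<zero>}"
      then have "delta R x \<in> N" using s(1) N(2) by blast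
      then show "f x \<odot>\<^bsub>monoid_algebra R G\<^esub> delta R x \<in> N" by (rule F.submoduleE(4)[OF N(1) s(3)])
    qed
    from submodule_finsum[OF F.module_axioms N(1) s(2) this]
    show "f \<in> N" by (rule ssubst[where P="\<lambda>x. x \<in> N", OF lin_ext_delta_expand[OF f]])
  qed
  moreover have "delta R ` carrier G \<subseteq> carrier (monoid_algebra R G)" using delta_closed by (rule image_subsetI)
  ultimately show ?thesis unfolding spanned_def by blast
qed

lemma lin_finsum_fun:
  assumes "module R M" "module R N" "finite I" "\<And>i. i \<in> I \<Longrightarrow> lin M N (h i)"
  shows "lin M N (\<lambda>m. \<Oplus>\<^bsub>N\<^esub>i\<in>I. h i m)"
  using assms(3,4)
proof (induction I rule: finite_induct)
  case empty
  interpret N: module R N by fact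
  show ?case by (simp add: lin_const_zero[OF assms(2)])
next
  case (insert i I)
  interpret N: module R N by fact
  have "lin M N (\<lambda>m. h i m \<oplus>\<^bsub>N\<^esub> (\<Oplus>\<^bsub>N\<^esub>i\<in>I. h i m))"
    by (rule lin_plus[OF assms(2)]) (use insert in auto)
  then show ?case
    by (rule lin_cong[OF _ assms(1)])
      (subst N.M.finsum_insert, use insert lin_closed[OF insert.prems] in auto)
qed

lemma lin_lin_ext_fun:
  assumes "module R M" "module R P" "f \<in> carrier (monoid_algebra R G)" "\<And>x. x \<in> carrier G \<Longrightarrow> lin M P (\<lambda>m. b m x)"
  shows "lin M P (\<lambda>m. lin_ext R P (b m) f)"
  unfolding lin_ext_def
proof (rule lin_finsum_fun[OF assms(1,2)])
  show "lin M P (\<lambda>m. f x \<odot>\<^bsub>P\<^esub> b m x)" if "x \<in> {x. f x \<noteq> \<zero>}" for x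
    by (rule lin_scale[OF assms(2) assms(4)]) (use assms(3) that in \<open>auto simp: monoid_algebra_simps fin_supp_def\<close>)
qed (use assms(3) in \<open>auto simp: monoid_algebra_simps fin_supp_def\<close>)

text \<open>
  Convolution is the bilinear extension of the product of \<open>G\<close>. Every algebra law is thereby checked on basis
  elements.
\<close>

lemma monoid_algebra_mult:
  assumes G: "\<And>x y. \<lbrakk>x \<in> carrier G; y \<in> carrier G\<rbrakk> \<Longrightarrow> x \<otimes>\<^bsub>G\<^esub> y \<in> carrier G"
    and f: "f \<in> carrier (monoid_algebra R G)" and g: "g \<in> carrier (monoid_algebra R G)"
  shows "f \<otimes>\<^bsub>monoid_algebra R G\<^esub> g =
    lin_ext R (monoid_algebra R G) (\<lambda>x. lin_ext R (monoid_algebra R G) (\<lambda>y. delta R (x \<otimes>\<^bsub>G\<^esub> y)) g) f"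
proof
  fix z
  let ?F = "monoid_algebra R G"
  interpret F: module R ?F by (rule module_monoid_algebra)
  have s: "{x. f x \<noteq> \<zero>} \<subseteq> carrier G" "finite {x. f x \<noteq> \<zero>}" "\<And>x. f x \<in> carrier R"
    using f by (auto simp: monoid_algebra_simps fin_supp_def)
  have t: "{x. g x \<noteq> \<zero>} \<subseteq> carrier G" "finite {x. g x \<noteq> \<zero>}" "\<And>x. g x \<in> carrier R"
    using g by (auto simp: monoid_algebra_simps fin_supp_def)
  have l: "lin_ext R ?F (\<lambda>y. delta R (x \<otimes>\<^bsub>G\<^esub> y)) g \<in> carrier ?F" if "x \<in> carrier G" for x
    by (rule lin_closed[OF lin_lin_ext[OF F.module_axioms] g]) (auto intro!: delta_closed G that)
  have "lin_ext R ?F (\<lambda>x. lin_ext R ?F (\<lambda>y. delta R (x \<otimes>\<^bsub>G\<^esub> y)) g) f z =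
    (\<Oplus>x\<in>{x. f x \<noteq> \<zero>}. (f x \<odot>\<^bsub>?F\<^esub> lin_ext R ?F (\<lambda>y. delta R (x \<otimes>\<^bsub>G\<^esub> y)) g) z)"
    unfolding lin_ext_def[of _ _ _ f]
    by (rule finsum_monoid_algebra) (use s l in \<open>auto simp: subset_iff\<close>)
  also have "\<dots> = (\<Oplus>x\<in>{x. f x \<noteq> \<zero>}. \<Oplus>y\<in>{y. g y \<noteq> \<zero>}. if x \<otimes>\<^bsub>G\<^esub> y = z then f x \<otimes> g y else \<zero>)"
  proof (rule finsum_cong')
    fix x assume x: "x \<in> {x. f x \<noteq> \<zero>}"
    have "(f x \<odot>\<^bsub>?F\<^esub> lin_ext R ?F (\<lambda>y. delta R (x \<otimes>\<^bsub>G\<^esub> y)) g) z = f x \<otimes> (lin_ext R ?F (\<lambda>y. delta R (x \<otimes>\<^bsub>G\<^esub> y)) g z)"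
      by (simp add: monoid_algebra_simps)
    also have "lin_ext R ?F (\<lambda>y. delta R (x \<otimes>\<^bsub>G\<^esub> y)) g z = (\<Oplus>y\<in>{y. g y \<noteq> \<zero>}. (g y \<odot>\<^bsub>?F\<^esub> delta R (x \<otimes>\<^bsub>G\<^esub> y)) z)"
      unfolding lin_ext_def
      by (rule finsum_monoid_algebra) (use s t x in \<open>auto simp: subset_iff intro!: F.smult_closed delta_closed G\<close>)
    also have "f x \<otimes> \<dots> = (\<Oplus>y\<in>{y. g y \<noteq> \<zero>}. f x \<otimes> (g y \<odot>\<^bsub>?F\<^esub> delta R (x \<otimes>\<^bsub>G\<^esub> y)) z)"
      by (rule finsum_rdistr) (use s t x in \<open>auto simp: monoid_algebra_simps delta_def\<close>)
    also have "\<dots> = (\<Oplus>y\<in>{y. g y \<noteq> \<zero>}. if x \<otimes>\<^bsub>G\<^esub> y = z then f x \<otimes> g y else \<zero>)"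
      by (rule finsum_cong') (use s t in \<open>auto simp: monoid_algebra_simps delta_def\<close>)
    finally show "(f x \<odot>\<^bsub>?F\<^esub> lin_ext R ?F (\<lambda>y. delta R (x \<otimes>\<^bsub>G\<^esub> y)) g) z =
      (\<Oplus>y\<in>{y. g y \<noteq> \<zero>}. if x \<otimes>\<^bsub>G\<^esub> y = z then f x \<otimes> g y else \<zero>)" .
  qed (use s t in \<open>auto intro!: finsum_closed\<close>)
  finally show "(f \<otimes>\<^bsub>?F\<^esub> g) z = lin_ext R ?F (\<lambda>x. lin_ext R ?F (\<lambda>y. delta R (x \<otimes>\<^bsub>G\<^esub> y)) g) f z"
    by (simp add: monoid_algebra_def)
qed

lemma assoc_algebra_monoid_algebra:
  assumes "monoid G"
  shows "assoc_algebra R (monoid_algebra R G)"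
    and "\<And>x y. \<lbrakk>x \<in> carrier G; y \<in> carrier G\<rbrakk> \<Longrightarrow> delta R x \<otimes>\<^bsub>monoid_algebra R G\<^esub> delta R y = delta R (x \<otimes>\<^bsub>G\<^esub> y)"
proof -
  interpret G: monoid G by fact
  let ?F = "monoid_algebra R G"
  interpret F: module R ?F by (rule module_monoid_algebra)
  note m = monoid_algebra_mult[OF G.m_closed]
  have d1: "(\<lambda>y. delta R (x \<otimes>\<^bsub>G\<^esub> y)) \<in> carrier G \<rightarrow> carrier ?F" if "x \<in> carrier G" for x
    using that by (auto intro!: delta_closed)
  have d2: "(\<lambda>x. lin_ext R ?F (\<lambda>y. delta R (x \<otimes>\<^bsub>G\<^esub> y)) g) \<in> carrier G \<rightarrow> carrier ?F" if "g \<in> carrier ?F" for g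
    using lin_closed[OF lin_lin_ext[OF F.module_axioms d1] that] by auto
  show dm: "delta R x \<otimes>\<^bsub>?F\<^esub> delta R y = delta R (x \<otimes>\<^bsub>G\<^esub> y)" if "x \<in> carrier G" "y \<in> carrier G" for x y
    using that by (simp add: m delta_closed lin_ext_delta[OF F.module_axioms d2] lin_ext_delta[OF F.module_axioms d1])
  have l1: "lin ?F ?F (\<lambda>x. x \<otimes>\<^bsub>?F\<^esub> y)" if "y \<in> carrier ?F" for y
    by (rule lin_cong[OF lin_lin_ext[OF F.module_axioms d2[OF that]] F.module_axioms]) (simp add: m that)
  have l2: "lin ?F ?F (\<lambda>y. x \<otimes>\<^bsub>?F\<^esub> y)" if "x \<in> carrier ?F" for x
  proof (rule lin_cong[OF _ F.module_axioms])
    show "lin ?F ?F (\<lambda>g. lin_ext R ?F (\<lambda>x. lin_ext R ?F (\<lambda>y. delta R (x \<otimes>\<^bsub>G\<^esub> y)) g) x)"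
      by (rule lin_lin_ext_fun[OF F.module_axioms F.module_axioms that]) (rule lin_lin_ext[OF F.module_axioms d1])
  qed (simp add: m that)
  note eq = lin_eq_on_span[OF spanned_monoid_algebra F.module_axioms F.module_axioms]
  note c1 = lin_closed[OF l1]
  show "assoc_algebra R ?F"
  proof (rule assoc_algebraI[OF F.module_axioms])
    show "\<one>\<^bsub>?F\<^esub> \<in> carrier ?F" by (simp add: monoid_algebra_simps(2) delta_closed)
    show "\<one>\<^bsub>?F\<^esub> \<otimes>\<^bsub>?F\<^esub> x = x" if "x \<in> carrier ?F" for x
      by (rule eq[OF l2 lin_id]) (auto simp: monoid_algebra_simps(2) delta_closed dm that)
    show "x \<otimes>\<^bsub>?F\<^esub> \<one>\<^bsub>?F\<^esub> = x" if "x \<in> carrier ?F" for x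
      by (rule eq[OF l1 lin_id]) (auto simp: monoid_algebra_simps(2) delta_closed dm that)
    fix x y z assume xyz: "x \<in> carrier ?F" "y \<in> carrier ?F" "z \<in> carrier ?F"
    have dc: "u \<in> delta R ` carrier G \<Longrightarrow> u \<in> carrier ?F" for u by (auto intro: delta_closed)
    have 1: "(u \<otimes>\<^bsub>?F\<^esub> v) \<otimes>\<^bsub>?F\<^esub> w = u \<otimes>\<^bsub>?F\<^esub> (v \<otimes>\<^bsub>?F\<^esub> w)"
      if "u \<in> delta R ` carrier G" "v \<in> delta R ` carrier G" "w \<in> carrier ?F" for u v w
    proof (rule eq[where f="\<lambda>w. (u \<otimes>\<^bsub>?F\<^esub> v) \<otimes>\<^bsub>?F\<^esub> w" and g="\<lambda>w. u \<otimes>\<^bsub>?F\<^esub> (v \<otimes>\<^bsub>?F\<^esub> w)"])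
      show "lin ?F ?F (\<lambda>w. (u \<otimes>\<^bsub>?F\<^esub> v) \<otimes>\<^bsub>?F\<^esub> w)" by (rule l2[OF c1[OF dc dc]]) (rule that)+
      show "lin ?F ?F (\<lambda>w. u \<otimes>\<^bsub>?F\<^esub> (v \<otimes>\<^bsub>?F\<^esub> w))" by (rule lin_comp[OF l2[OF dc] l2[OF dc]]) (rule that)+
    qed (use that in \<open>auto simp: dm G.m_assoc\<close>)
    have 2: "(u \<otimes>\<^bsub>?F\<^esub> v) \<otimes>\<^bsub>?F\<^esub> w = u \<otimes>\<^bsub>?F\<^esub> (v \<otimes>\<^bsub>?F\<^esub> w)"
      if "u \<in> delta R ` carrier G" "v \<in> carrier ?F" "w \<in> carrier ?F" for u v w
    proof (rule eq[where f="\<lambda>v. (u \<otimes>\<^bsub>?F\<^esub> v) \<otimes>\<^bsub>?F\<^esub> w" and g="\<lambda>v. u \<otimes>\<^bsub>?F\<^esub> (v \<otimes>\<^bsub>?F\<^esub> w)"])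
      show "lin ?F ?F (\<lambda>v. (u \<otimes>\<^bsub>?F\<^esub> v) \<otimes>\<^bsub>?F\<^esub> w)" by (rule lin_comp[OF l2[OF dc] l1]) (rule that)+
      show "lin ?F ?F (\<lambda>v. u \<otimes>\<^bsub>?F\<^esub> (v \<otimes>\<^bsub>?F\<^esub> w))" by (rule lin_comp[OF l1 l2[OF dc]]) (rule that)+
    qed (use that 1 in auto)
    show "(x \<otimes>\<^bsub>?F\<^esub> y) \<otimes>\<^bsub>?F\<^esub> z = x \<otimes>\<^bsub>?F\<^esub> (y \<otimes>\<^bsub>?F\<^esub> z)"
    proof (rule eq[where f="\<lambda>x. (x \<otimes>\<^bsub>?F\<^esub> y) \<otimes>\<^bsub>?F\<^esub> z" and g="\<lambda>x. x \<otimes>\<^bsub>?F\<^esub> (y \<otimes>\<^bsub>?F\<^esub> z)"])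
      show "lin ?F ?F (\<lambda>x. (x \<otimes>\<^bsub>?F\<^esub> y) \<otimes>\<^bsub>?F\<^esub> z)" by (rule lin_comp[OF l1 l1]) (rule xyz)+
      show "lin ?F ?F (\<lambda>x. x \<otimes>\<^bsub>?F\<^esub> (y \<otimes>\<^bsub>?F\<^esub> z))" by (rule l1[OF c1]) (rule xyz)+
    qed (use xyz 2 in auto)
  qed (auto intro: l1 l2 c1)
qed

lemma alg_hom_lin_ext:
  assumes "monoid G" "assoc_algebra R B" "b \<in> carrier G \<rightarrow> carrier B" "b \<one>\<^bsub>G\<^esub> = \<one>\<^bsub>B\<^esub>"
    and "\<And>x y. \<lbrakk>x \<in> carrier G; y \<in> carrier G\<rbrakk> \<Longrightarrow> b (x \<otimes>\<^bsub>G\<^esub> y) = b x \<otimes>\<^bsub>B\<^esub> b y"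
  shows "lin_ext R B b \<in> alg_hom R (monoid_algebra R G) B"
proof -
  interpret G: monoid G by fact
  interpret B: assoc_algebra R B by fact
  let ?F = "monoid_algebra R G"
  interpret F: assoc_algebra R ?F by (rule assoc_algebra_monoid_algebra[OF assms(1)])
  note d = lin_ext_delta[OF B.module_axioms assms(3)] and l = lin_lin_ext[OF B.module_axioms assms(3)]
  note ml = lin_mult_left[OF F.assoc_algebra_axioms] lin_mult_right[OF F.assoc_algebra_axioms]
    lin_mult_left[OF assms(2)] lin_mult_right[OF assms(2)]
  note eq = lin_eq_on_span[OF spanned_monoid_algebra F.module_axioms B.module_axioms]
  show ?thesis
  proof (rule alg_homI[OF l])
    show "lin_ext R B b \<one>\<^bsub>?F\<^esub> = \<one>\<^bsub>B\<^esub>" by (simp add: monoid_algebra_simps d assms)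
    fix x y assume xy: "x \<in> carrier ?F" "y \<in> carrier ?F"
    have 1: "lin_ext R B b (u \<otimes>\<^bsub>?F\<^esub> v) = lin_ext R B b u \<otimes>\<^bsub>B\<^esub> lin_ext R B b v"
      if "u \<in> delta R ` carrier G" "v \<in> carrier ?F" for u v
    proof (rule eq[where f="\<lambda>v. lin_ext R B b (u \<otimes>\<^bsub>?F\<^esub> v)" and g="\<lambda>v. lin_ext R B b u \<otimes>\<^bsub>B\<^esub> lin_ext R B b v"])
      have u: "u \<in> carrier ?F" using that delta_closed by auto
      show "lin ?F B (\<lambda>v. lin_ext R B b (u \<otimes>\<^bsub>?F\<^esub> v))"
        by (rule lin_comp[OF ml(1)[OF u] l])
      show "lin ?F B (\<lambda>v. lin_ext R B b u \<otimes>\<^bsub>B\<^esub> lin_ext R B b v)"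
        by (rule lin_comp[OF l ml(3)[OF lin_closed[OF l u]]])
    qed (use that in \<open>auto simp: assoc_algebra_monoid_algebra[OF assms(1)] delta_closed d assms(5)\<close>)
    show "lin_ext R B b (x \<otimes>\<^bsub>?F\<^esub> y) = lin_ext R B b x \<otimes>\<^bsub>B\<^esub> lin_ext R B b y"
    proof (rule eq[where f="\<lambda>x. lin_ext R B b (x \<otimes>\<^bsub>?F\<^esub> y)" and g="\<lambda>x. lin_ext R B b x \<otimes>\<^bsub>B\<^esub> lin_ext R B b y"])
      show "lin ?F B (\<lambda>x. lin_ext R B b (x \<otimes>\<^bsub>?F\<^esub> y))"
        by (rule lin_comp[OF ml(2)[OF xy(2)] l])
      show "lin ?F B (\<lambda>x. lin_ext R B b x \<otimes>\<^bsub>B\<^esub> lin_ext R B b y)"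
        by (rule lin_comp[OF l ml(4)[OF lin_closed[OF l xy(2)]]])
    qed (use xy 1 in auto)
  qed
qed

end

section \<open>Tensor products\<close>

definition bil :: "('k, 'r) ring_scheme \<Rightarrow> ('k, 'm, 'x) module_scheme \<Rightarrow> ('k, 'n, 'y) module_scheme
    \<Rightarrow> ('k, 'p, 'z) module_scheme \<Rightarrow> ('m \<Rightarrow> 'n \<Rightarrow> 'p) \<Rightarrow> bool"
  where "bil R M N P b \<longleftrightarrow> (\<forall>m\<in>carrier M. (\<lambda>n. b m n) \<in> linear_maps R N P) \<and>
    (\<forall>n\<in>carrier N. (\<lambda>m. b m n) \<in> linear_maps R M P)"

lemma bilI:
  assumes "\<And>m. m \<in> carrier M \<Longrightarrow> (\<lambda>n. b m n) \<in> linear_maps R N P"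
    and "\<And>n. n \<in> carrier N \<Longrightarrow> (\<lambda>m. b m n) \<in> linear_maps R M P"
  shows "bil R M N P b"
  using assms by (auto simp: bil_def)

lemma bil_right: "bil R M N P b \<Longrightarrow> m \<in> carrier M \<Longrightarrow> (\<lambda>n. b m n) \<in> linear_maps R N P"
  and bil_left: "bil R M N P b \<Longrightarrow> n \<in> carrier N \<Longrightarrow> (\<lambda>m. b m n) \<in> linear_maps R M P"
  by (auto simp: bil_def)

context cring
begin

lemma bil_closed: "\<lbrakk>bil R M N P b; m \<in> carrier M; n \<in> carrier N\<rbrakk> \<Longrightarrow> b m n \<in> carrier P"
  by (rule lin_closed[OF bil_right])

lemma bil_cong:
  assumes "bil R M N P b" "module R M" "module R N"
    and "\<And>m n. \<lbrakk>m \<in> carrier M; n \<in> carrier N\<rbrakk> \<Longrightarrow> b m n = b' m n"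
  shows "bil R M N P b'"
  by (rule bilI; rule lin_cong[OF bil_right[OF assms(1)] assms(3)] lin_cong[OF bil_left[OF assms(1)] assms(2)])
    (auto simp: assms(4))

lemma delta_pair_closed: "\<lbrakk>m \<in> carrier M; n \<in> carrier N\<rbrakk> \<Longrightarrow> delta R (m, n) \<in> carrier (monoid_algebra R (M \<times>\<times> N))"
  by (rule delta_closed) (simp add: DirProd_def)

lemma bilin_rels_closed:
  assumes "module R M" "module R N"
  shows "bilin_rels R M N \<subseteq> carrier (monoid_algebra R (M \<times>\<times> N))"
proof -
  interpret M: module R M by fact
  interpret N: module R N by fact
  interpret F: module R "monoid_algebra R (M \<times>\<times> N)" by (rule module_monoid_algebra)
  show ?thesis
    unfolding bilin_rels_def Let_def
    by (auto intro!: F.M.minus_closed F.M.a_closed F.smult_closed delta_pair_closed)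
qed

lemma submodule_bilin_ker:
  assumes "module R M" "module R N"
  shows "submodule (bilin_ker R M N) R (monoid_algebra R (M \<times>\<times> N))"
  unfolding bilin_ker_def by (rule submodule_mod_span[OF module_monoid_algebra bilin_rels_closed[OF assms]])

lemma quotient_module_tensor:
  assumes "module R M" "module R N"
  shows "quotient_module R (monoid_algebra R (M \<times>\<times> N)) (bilin_ker R M N)"
  by (intro quotient_module.intro quotient_module_axioms.intro module_monoid_algebra submodule_bilin_ker assms)

lemma module_tensor:
  assumes "module R M" "module R N"
  shows "module R (tensor R M N)"
  unfolding tensor_def by (rule quotient_module.module_quot[OF quotient_module_tensor[OF assms]])

lemma tens_closed:
  assumes "module R M" "module R N" "m \<in> carrier M" "n \<in> carrier N"
  shows "tens R M N m n \<in> carrier (tensor R M N)"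
  unfolding tensor_def tens_def
  by (rule quotient_module.coset_closed[OF quotient_module_tensor[OF assms(1,2)] delta_pair_closed[OF assms(3,4)]])

lemma bil_tens:
  assumes "module R M" "module R N"
  shows "bil R M N (tensor R M N) (tens R M N)"
proof -
  interpret M: module R M by fact
  interpret N: module R N by fact
  let ?F = "monoid_algebra R (M \<times>\<times> N)"
  interpret F: module R ?F by (rule module_monoid_algebra)
  interpret Q: quotient_module R ?F "bilin_ker R M N" by (rule quotient_module_tensor[OF assms])
  have r: "bilin_rels R M N \<subseteq> bilin_ker R M N" unfolding bilin_ker_def by (rule mod_span_superset)
  note c = delta_pair_closed[of _ M _ N]
  have 1: "delta R (m \<oplus>\<^bsub>M\<^esub> m', n) \<ominus>\<^bsub>?F\<^esub> (delta R (m, n) \<oplus>\<^bsub>?F\<^esub> delta R (m', n)) \<in> bilin_ker R M N"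
    if "m \<in> carrier M" "m' \<in> carrier M" "n \<in> carrier N" for m m' n
    by (rule subsetD[OF r]) (use that in \<open>auto simp: bilin_rels_def Let_def\<close>)
  have 2: "delta R (m, n \<oplus>\<^bsub>N\<^esub> n') \<ominus>\<^bsub>?F\<^esub> (delta R (m, n) \<oplus>\<^bsub>?F\<^esub> delta R (m, n')) \<in> bilin_ker R M N"
    if "m \<in> carrier M" "n \<in> carrier N" "n' \<in> carrier N" for m n n'
    by (rule subsetD[OF r]) (use that in \<open>auto simp: bilin_rels_def Let_def\<close>)
  have 3: "delta R (r \<odot>\<^bsub>M\<^esub> m, n) \<ominus>\<^bsub>?F\<^esub> r \<odot>\<^bsub>?F\<^esub> delta R (m, n) \<in> bilin_ker R M N"
    if "r \<in> carrier R" "m \<in> carrier M" "n \<in> carrier N" for r m n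
    by (rule subsetD[OF r]) (use that in \<open>auto simp: bilin_rels_def Let_def\<close>)
  have 4: "delta R (m, r \<odot>\<^bsub>N\<^esub> n) \<ominus>\<^bsub>?F\<^esub> r \<odot>\<^bsub>?F\<^esub> delta R (m, n) \<in> bilin_ker R M N"
    if "r \<in> carrier R" "m \<in> carrier M" "n \<in> carrier N" for r m n
    by (rule subsetD[OF r]) (use that in \<open>auto simp: bilin_rels_def Let_def\<close>)
  note e = Q.coset_eq_iff[THEN iffD2]
  show ?thesis
    unfolding tens_def tensor_def
  proof (intro bilI linI)
    fix m n n' assume a: "m \<in> carrier M" "n \<in> carrier N" "n' \<in> carrier N"
    show "bilin_ker R M N +>\<^bsub>?F\<^esub> delta R (m, n) \<in> carrier (quot_alg ?F (bilin_ker R M N))"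
      by (rule Q.coset_closed[OF c[OF a(1,2)]])
    show "bilin_ker R M N +>\<^bsub>?F\<^esub> delta R (m, n \<oplus>\<^bsub>N\<^esub> n') =
      (bilin_ker R M N +>\<^bsub>?F\<^esub> delta R (m, n)) \<oplus>\<^bsub>quot_alg ?F (bilin_ker R M N)\<^esub> (bilin_ker R M N +>\<^bsub>?F\<^esub> delta R (m, n'))"
      unfolding Q.coset_add[OF c[OF a(1,2)] c[OF a(1,3)]]
      by (rule e[OF _ _ 2[OF a]]) (auto simp: a intro!: c F.M.a_closed)
    fix r assume r: "r \<in> carrier R"
    show "bilin_ker R M N +>\<^bsub>?F\<^esub> delta R (m, r \<odot>\<^bsub>N\<^esub> n) =
      r \<odot>\<^bsub>quot_alg ?F (bilin_ker R M N)\<^esub> (bilin_ker R M N +>\<^bsub>?F\<^esub> delta R (m, n))"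
      unfolding Q.coset_smult[OF r c[OF a(1,2)]]
      by (rule e[OF _ _ 4[OF r a(1,2)]]) (auto simp: a r intro!: c F.smult_closed)
  next
    fix m m' n assume a: "n \<in> carrier N" "m \<in> carrier M" "m' \<in> carrier M"
    show "bilin_ker R M N +>\<^bsub>?F\<^esub> delta R (m, n) \<in> carrier (quot_alg ?F (bilin_ker R M N))"
      by (rule Q.coset_closed[OF c[OF a(2,1)]])
    show "bilin_ker R M N +>\<^bsub>?F\<^esub> delta R (m \<oplus>\<^bsub>M\<^esub> m', n) =
      (bilin_ker R M N +>\<^bsub>?F\<^esub> delta R (m, n)) \<oplus>\<^bsub>quot_alg ?F (bilin_ker R M N)\<^esub> (bilin_ker R M N +>\<^bsub>?F\<^esub> delta R (m', n))"
      unfolding Q.coset_add[OF c[OF a(2,1)] c[OF a(3,1)]]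
      by (rule e[OF _ _ 1[OF a(2,3,1)]]) (auto simp: a intro!: c F.M.a_closed)
    fix r assume r: "r \<in> carrier R"
    show "bilin_ker R M N +>\<^bsub>?F\<^esub> delta R (r \<odot>\<^bsub>M\<^esub> m, n) =
      r \<odot>\<^bsub>quot_alg ?F (bilin_ker R M N)\<^esub> (bilin_ker R M N +>\<^bsub>?F\<^esub> delta R (m, n))"
      unfolding Q.coset_smult[OF r c[OF a(2,1)]]
      by (rule e[OF _ _ 3[OF r a(2,1)]]) (auto simp: a r intro!: c F.smult_closed)
  qed
qed

lemma lin_ext_bilin_ker:
  assumes "module R M" "module R N" "module R P" "bil R M N P b" "x \<in> bilin_ker R M N"
  shows "lin_ext R P (\<lambda>(m, n). b m n) x = \<zero>\<^bsub>P\<^esub>"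
proof -
  interpret M: module R M by fact
  interpret N: module R N by fact
  interpret P: module R P by fact
  let ?F = "monoid_algebra R (M \<times>\<times> N)"
  interpret F: module R ?F by (rule module_monoid_algebra)
  let ?L = "lin_ext R P (\<lambda>(m, n). b m n)"
  have b: "(\<lambda>(m, n). b m n) \<in> carrier (M \<times>\<times> N) \<rightarrow> carrier P"
    using bil_closed[OF assms(4)] by (auto simp: DirProd_def)
  note L = lin_lin_ext[OF P.module_axioms b]
  note d = lin_ext_delta[OF P.module_axioms b]
  have dd: "?L (delta R (m, n)) = b m n" if "m \<in> carrier M" "n \<in> carrier N" for m n
    using d[of "(m, n)"] that by (simp add: DirProd_def)
  note c = delta_pair_closed[of _ M _ N] bil_closed[OF assms(4)]
  note ll = lin_minus[OF F.module_axioms P.module_axioms L] lin_add[OF L] lin_smult[OF L]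
    lin_add[OF bil_right[OF assms(4)]] lin_add[OF bil_left[OF assms(4)]]
    lin_smult[OF bil_right[OF assms(4)]] lin_smult[OF bil_left[OF assms(4)]]
  have "bilin_rels R M N \<subseteq> {x \<in> carrier ?F. ?L x = \<zero>\<^bsub>P\<^esub>}"
    unfolding bilin_rels_def Let_def
    by (auto simp: ll dd c P.M.diff_eq_zero_iff)
  from mod_span_minimal[OF submodule_kernel[OF F.module_axioms P.module_axioms L] this]
  show ?thesis using assms(5) by (auto simp: bilin_ker_def)
qed

text \<open>The maps out of a tensor product are a special case of maps out of a quotient module.\<close>

lemma tlift_qlift: "tlift R P b = qlift (lin_ext R P (\<lambda>(m, n). b m n))"
  by (simp add: tlift_def qlift_def fun_eq_iff)

lemma lin_tlift:
  assumes "module R M" "module R N" "module R P" "bil R M N P b"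
  shows "lin (tensor R M N) P (tlift R P b)"
proof -
  interpret Q: quotient_module R "monoid_algebra R (M \<times>\<times> N)" "bilin_ker R M N" by (rule quotient_module_tensor[OF assms(1,2)])
  show ?thesis unfolding tlift_qlift tensor_def
  proof (rule Q.lin_qlift[OF assms(3) lin_lin_ext[OF assms(3)]])
    show "(\<lambda>(m, n). b m n) \<in> carrier (M \<times>\<times> N) \<rightarrow> carrier P"
      using bil_closed[OF assms(4)] by (auto simp: DirProd_def)
  qed (rule lin_ext_bilin_ker[OF assms])
qed

lemma tlift_tens:
  assumes "module R M" "module R N" "module R P" "bil R M N P b" "m \<in> carrier M" "n \<in> carrier N"
  shows "tlift R P b (tens R M N m n) = b m n"
proof -
  interpret Q: quotient_module R "monoid_algebra R (M \<times>\<times> N)" "bilin_ker R M N" by (rule quotient_module_tensor[OF assms(1,2)])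
  have b: "(\<lambda>(m, n). b m n) \<in> carrier (M \<times>\<times> N) \<rightarrow> carrier P"
    using bil_closed[OF assms(4)] by (auto simp: DirProd_def)
  show ?thesis unfolding tlift_qlift tens_def
    using Q.qlift_coset[OF assms(3) lin_lin_ext[OF assms(3) b] lin_ext_bilin_ker[OF assms(1-4)] delta_pair_closed[OF assms(5,6)]]
      lin_ext_delta[OF assms(3) b, of "(m, n)"] assms(5,6)
    by (simp add: DirProd_def)
qed

lemma spanned_tensor:
  assumes "module R M" "module R N"
  shows "spanned R (tensor R M N) {tens R M N m n | m n. m \<in> carrier M \<and> n \<in> carrier N}"
proof -
  interpret Q: quotient_module R "monoid_algebra R (M \<times>\<times> N)" "bilin_ker R M N" by (rule quotient_module_tensor[OF assms])
  have "spanned R (tensor R M N) ((\<lambda>x. bilin_ker R M N +>\<^bsub>monoid_algebra R (M \<times>\<times> N)\<^esub> x) ` delta R ` carrier (M \<times>\<times> N))"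
    unfolding tensor_def
    by (rule spanned_image[OF spanned_monoid_algebra Q.module_axioms Q.module_quot Q.lin_coset]) (simp add: coset_surj)
  moreover have "((\<lambda>x. bilin_ker R M N +>\<^bsub>monoid_algebra R (M \<times>\<times> N)\<^esub> x) ` delta R ` carrier (M \<times>\<times> N)) =
    {tens R M N m n | m n. m \<in> carrier M \<and> n \<in> carrier N}"
    by (auto simp: tens_def DirProd_def)
  ultimately show ?thesis by simp
qed

lemma tensor_lin_eq:
  assumes "module R M" "module R N" "module R P" "lin (tensor R M N) P f" "lin (tensor R M N) P g"
    and "\<And>m n. \<lbrakk>m \<in> carrier M; n \<in> carrier N\<rbrakk> \<Longrightarrow> f (tens R M N m n) = g (tens R M N m n)"
    and "U \<in> carrier (tensor R M N)"
  shows "f U = g U"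
  by (rule lin_eq_on_span[OF spanned_tensor[OF assms(1,2)] module_tensor[OF assms(1,2)] assms(3-5) _ assms(7)])
    (use assms(6) in auto)

lemma tlift_cong:
  assumes "module R M" "module R N" "module R P" "bil R M N P b" "U \<in> carrier (tensor R M N)"
    and "\<And>m n. \<lbrakk>m \<in> carrier M; n \<in> carrier N\<rbrakk> \<Longrightarrow> b m n = b' m n"
  shows "tlift R P b U = tlift R P b' U"
proof -
  note b' = bil_cong[OF assms(4,1,2,6)]
  show ?thesis
    by (rule tensor_lin_eq[OF assms(1-3) lin_tlift[OF assms(1-4)] lin_tlift[OF assms(1-3) b'] _ assms(5)])
      (simp_all add: tlift_tens[OF assms(1-4)] tlift_tens[OF assms(1-3) b'] assms(6))
qed

lemma bil_lin_comp:
  assumes "bil R M N P b" "lin P Q g"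
  shows "bil R M N Q (\<lambda>m n. g (b m n))"
  by (rule bilI) (rule lin_comp[OF bil_right[OF assms(1)] assms(2)] lin_comp[OF bil_left[OF assms(1)] assms(2)], assumption)+

lemma lin_of_tlift:
  assumes "module R M" "module R N" "module R P" "module R Q" "bil R M N P b" "U \<in> carrier (tensor R M N)" "lin P Q g"
  shows "g (tlift R P b U) = tlift R Q (\<lambda>m n. g (b m n)) U"
  by (rule tensor_lin_eq[OF assms(1,2,4) lin_comp[OF lin_tlift[OF assms(1-3,5)] assms(7)]
      lin_tlift[OF assms(1,2,4) bil_lin_comp[OF assms(5,7)]] _ assms(6)])
    (simp_all add: tlift_tens[OF assms(1-3,5)] tlift_tens[OF assms(1,2,4) bil_lin_comp[OF assms(5,7)]])

lemma tlift_id: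
  assumes "module R M" "module R N" "U \<in> carrier (tensor R M N)"
  shows "tlift R (tensor R M N) (tens R M N) U = U"
  by (rule tensor_lin_eq[OF assms(1,2) module_tensor[OF assms(1,2)] lin_tlift[OF assms(1,2) module_tensor[OF assms(1,2)] bil_tens[OF assms(1,2)]] lin_id _ assms(3)])
    (simp add: tlift_tens[OF assms(1,2) module_tensor[OF assms(1,2)] bil_tens[OF assms(1,2)]])

text \<open>
  Each linearity law in \<open>x\<close> compares two linear functions of \<open>U\<close> that agree on pure tensors.
\<close>

lemma lin_tlift_fun:
  assumes "module R X" "module R M" "module R N" "module R P" "U \<in> carrier (tensor R M N)"
    and "\<And>x. x \<in> carrier X \<Longrightarrow> bil R M N P (b x)"
    and "\<And>m n. \<lbrakk>m \<in> carrier M; n \<in> carrier N\<rbrakk> \<Longrightarrow> lin X P (\<lambda>x. b x m n)"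
  shows "lin X P (\<lambda>x. tlift R P (b x) U)"
proof -
  interpret X: module R X by fact
  note t = tlift_tens[OF assms(2-4) assms(6)] and l = lin_tlift[OF assms(2-4) assms(6)]
  note eq = tensor_lin_eq[OF assms(2-4) _ _ _ assms(5)]
  show ?thesis
  proof (rule linI)
    show "tlift R P (b x) U \<in> carrier P" if "x \<in> carrier X" for x
      by (rule lin_closed[OF l[OF that] assms(5)])
    show "tlift R P (b (x \<oplus>\<^bsub>X\<^esub> y)) U = tlift R P (b x) U \<oplus>\<^bsub>P\<^esub> tlift R P (b y) U"
      if xy: "x \<in> carrier X" "y \<in> carrier X" for x y
      by (rule eq[OF l[OF X.M.a_closed[OF xy]] lin_plus[OF assms(4) l[OF xy(1)] l[OF xy(2)]]])
        (simp add: t xy lin_add[OF assms(7)])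
    show "tlift R P (b (r \<odot>\<^bsub>X\<^esub> x)) U = r \<odot>\<^bsub>P\<^esub> tlift R P (b x) U"
      if x: "r \<in> carrier R" "x \<in> carrier X" for r x
      by (rule eq[OF l[OF X.smult_closed[OF x]] lin_scale[OF assms(4) l[OF x(2)] x(1)]])
        (simp add: t x lin_smult[OF assms(7)])
  qed
qed

lemma tlift_plus:
  assumes "module R M" "module R N" "module R P" "bil R M N P b" "bil R M N P c" "U \<in> carrier (tensor R M N)"
  shows "tlift R P (\<lambda>m n. b m n \<oplus>\<^bsub>P\<^esub> c m n) U = tlift R P b U \<oplus>\<^bsub>P\<^esub> tlift R P c U"
proof -
  have bc: "bil R M N P (\<lambda>m n. b m n \<oplus>\<^bsub>P\<^esub> c m n)"
    by (rule bilI; rule lin_plus[OF assms(3)])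
      (rule bil_right[OF assms(4)] bil_right[OF assms(5)] bil_left[OF assms(4)] bil_left[OF assms(5)], assumption)+
  show ?thesis
    by (rule tensor_lin_eq[OF assms(1-3) lin_tlift[OF assms(1-3) bc] lin_plus[OF assms(3) lin_tlift[OF assms(1-4)] lin_tlift[OF assms(1-3,5)]] _ assms(6)])
      (simp add: tlift_tens[OF assms(1-3) bc] tlift_tens[OF assms(1-4)] tlift_tens[OF assms(1-3,5)])
qed

subsection \<open>Tensor products of algebras\<close>

text \<open>
  The multiple of a bilinearity relation by a pair \<open>(x, y)\<close> is again a bilinearity relation.
\<close>

lemma ideal_bilin_ker:
  assumes "assoc_algebra R M" "assoc_algebra R N"
  shows "ideal (bilin_ker R M N) (monoid_algebra R (M \<times>\<times> N))"
proof -
  interpret M: assoc_algebra R M by fact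
  interpret N: assoc_algebra R N by fact
  let ?F = "monoid_algebra R (M \<times>\<times> N)" and ?K = "bilin_ker R M N"
  have mon: "monoid (M \<times>\<times> N)" by (rule DirProd_monoid[OF M.monoid_axioms N.monoid_axioms])
  interpret F: assoc_algebra R ?F by (rule assoc_algebra_monoid_algebra[OF mon])
  have dm: "delta R (x, y) \<otimes>\<^bsub>?F\<^esub> delta R (x', y') = delta R (x \<otimes>\<^bsub>M\<^esub> x', y \<otimes>\<^bsub>N\<^esub> y')"
    if "x \<in> carrier M" "y \<in> carrier N" "x' \<in> carrier M" "y' \<in> carrier N" for x y x' y'
    using assoc_algebra_monoid_algebra(2)[OF mon, of "(x, y)" "(x', y')"] that by (simp add: DirProd_def)
  note c = delta_pair_closed[of _ M _ N]
  have K: "submodule ?K R ?F" by (rule submodule_bilin_ker) (rule M.module_axioms N.module_axioms)+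
  note KE = F.submoduleE[OF K]
  have rK: "bilin_rels R M N \<subseteq> ?K" unfolding bilin_ker_def by (rule mod_span_superset)
  have lm: "d \<otimes>\<^bsub>?F\<^esub> (p \<ominus>\<^bsub>?F\<^esub> q) = d \<otimes>\<^bsub>?F\<^esub> p \<ominus>\<^bsub>?F\<^esub> d \<otimes>\<^bsub>?F\<^esub> q"
    and rm: "(p \<ominus>\<^bsub>?F\<^esub> q) \<otimes>\<^bsub>?F\<^esub> d = p \<otimes>\<^bsub>?F\<^esub> d \<ominus>\<^bsub>?F\<^esub> q \<otimes>\<^bsub>?F\<^esub> d"
    if "d \<in> carrier ?F" "p \<in> carrier ?F" "q \<in> carrier ?F" for d p q
    using that by (simp_all add: a_minus_def F.r_distr F.l_distr F.r_minus F.l_minus)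
  have gen: "delta R (x, y) \<otimes>\<^bsub>?F\<^esub> k \<in> ?K \<and> k \<otimes>\<^bsub>?F\<^esub> delta R (x, y) \<in> ?K"
    if "x \<in> carrier M" "y \<in> carrier N" "k \<in> bilin_rels R M N" for x y k
    using that(3) unfolding bilin_rels_def Let_def
  proof (elim UnE CollectE exE conjE)
    fix m m' n assume "k = delta R (m \<oplus>\<^bsub>M\<^esub> m', n) \<ominus>\<^bsub>?F\<^esub> (delta R (m, n) \<oplus>\<^bsub>?F\<^esub> delta R (m', n))"
      and a: "m \<in> carrier M" "m' \<in> carrier M" "n \<in> carrier N"
    then have e: "delta R (x, y) \<otimes>\<^bsub>?F\<^esub> k = delta R (x \<otimes>\<^bsub>M\<^esub> m \<oplus>\<^bsub>M\<^esub> x \<otimes>\<^bsub>M\<^esub> m', y \<otimes>\<^bsub>N\<^esub> n)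
        \<ominus>\<^bsub>?F\<^esub> (delta R (x \<otimes>\<^bsub>M\<^esub> m, y \<otimes>\<^bsub>N\<^esub> n) \<oplus>\<^bsub>?F\<^esub> delta R (x \<otimes>\<^bsub>M\<^esub> m', y \<otimes>\<^bsub>N\<^esub> n))"
      "k \<otimes>\<^bsub>?F\<^esub> delta R (x, y) = delta R (m \<otimes>\<^bsub>M\<^esub> x \<oplus>\<^bsub>M\<^esub> m' \<otimes>\<^bsub>M\<^esub> x, n \<otimes>\<^bsub>N\<^esub> y)
        \<ominus>\<^bsub>?F\<^esub> (delta R (m \<otimes>\<^bsub>M\<^esub> x, n \<otimes>\<^bsub>N\<^esub> y) \<oplus>\<^bsub>?F\<^esub> delta R (m' \<otimes>\<^bsub>M\<^esub> x, n \<otimes>\<^bsub>N\<^esub> y))"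
      using that by (simp_all add: lm rm c dm F.r_distr F.l_distr M.r_distr M.l_distr)
    have "delta R (x, y) \<otimes>\<^bsub>?F\<^esub> k \<in> bilin_rels R M N" "k \<otimes>\<^bsub>?F\<^esub> delta R (x, y) \<in> bilin_rels R M N"
      unfolding e bilin_rels_def Let_def using that a M.m_closed N.m_closed by blast+
    then show ?thesis using rK by auto
  next
    fix m n n' assume "k = delta R (m, n \<oplus>\<^bsub>N\<^esub> n') \<ominus>\<^bsub>?F\<^esub> (delta R (m, n) \<oplus>\<^bsub>?F\<^esub> delta R (m, n'))"
      and a: "m \<in> carrier M" "n \<in> carrier N" "n' \<in> carrier N"
    then have e: "delta R (x, y) \<otimes>\<^bsub>?F\<^esub> k = delta R (x \<otimes>\<^bsub>M\<^esub> m, y \<otimes>\<^bsub>N\<^esub> n \<oplus>\<^bsub>N\<^esub> y \<otimes>\<^bsub>N\<^esub> n')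
        \<ominus>\<^bsub>?F\<^esub> (delta R (x \<otimes>\<^bsub>M\<^esub> m, y \<otimes>\<^bsub>N\<^esub> n) \<oplus>\<^bsub>?F\<^esub> delta R (x \<otimes>\<^bsub>M\<^esub> m, y \<otimes>\<^bsub>N\<^esub> n'))"
      "k \<otimes>\<^bsub>?F\<^esub> delta R (x, y) = delta R (m \<otimes>\<^bsub>M\<^esub> x, n \<otimes>\<^bsub>N\<^esub> y \<oplus>\<^bsub>N\<^esub> n' \<otimes>\<^bsub>N\<^esub> y)
        \<ominus>\<^bsub>?F\<^esub> (delta R (m \<otimes>\<^bsub>M\<^esub> x, n \<otimes>\<^bsub>N\<^esub> y) \<oplus>\<^bsub>?F\<^esub> delta R (m \<otimes>\<^bsub>M\<^esub> x, n' \<otimes>\<^bsub>N\<^esub> y))"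
      using that by (simp_all add: lm rm c dm F.r_distr F.l_distr N.r_distr N.l_distr)
    have "delta R (x, y) \<otimes>\<^bsub>?F\<^esub> k \<in> bilin_rels R M N" "k \<otimes>\<^bsub>?F\<^esub> delta R (x, y) \<in> bilin_rels R M N"
      unfolding e bilin_rels_def Let_def using that a M.m_closed N.m_closed by blast+
    then show ?thesis using rK by auto
  next
    fix r m n assume "k = delta R (r \<odot>\<^bsub>M\<^esub> m, n) \<ominus>\<^bsub>?F\<^esub> r \<odot>\<^bsub>?F\<^esub> delta R (m, n)"
      and a: "r \<in> carrier R" "m \<in> carrier M" "n \<in> carrier N"
    then have e: "delta R (x, y) \<otimes>\<^bsub>?F\<^esub> k = delta R (r \<odot>\<^bsub>M\<^esub> (x \<otimes>\<^bsub>M\<^esub> m), y \<otimes>\<^bsub>N\<^esub> n)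
        \<ominus>\<^bsub>?F\<^esub> r \<odot>\<^bsub>?F\<^esub> delta R (x \<otimes>\<^bsub>M\<^esub> m, y \<otimes>\<^bsub>N\<^esub> n)"
      "k \<otimes>\<^bsub>?F\<^esub> delta R (x, y) = delta R (r \<odot>\<^bsub>M\<^esub> (m \<otimes>\<^bsub>M\<^esub> x), n \<otimes>\<^bsub>N\<^esub> y)
        \<ominus>\<^bsub>?F\<^esub> r \<odot>\<^bsub>?F\<^esub> delta R (m \<otimes>\<^bsub>M\<^esub> x, n \<otimes>\<^bsub>N\<^esub> y)"
      using that by (simp_all add: lm rm c dm M.smult_mult_left M.smult_mult_right F.smult_mult_left F.smult_mult_right)
    have "delta R (x, y) \<otimes>\<^bsub>?F\<^esub> k \<in> bilin_rels R M N" "k \<otimes>\<^bsub>?F\<^esub> delta R (x, y) \<in> bilin_rels R M N"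
      unfolding e bilin_rels_def Let_def using that a M.m_closed N.m_closed by blast+
    then show ?thesis using rK by auto
  next
    fix r m n assume "k = delta R (m, r \<odot>\<^bsub>N\<^esub> n) \<ominus>\<^bsub>?F\<^esub> r \<odot>\<^bsub>?F\<^esub> delta R (m, n)"
      and a: "r \<in> carrier R" "m \<in> carrier M" "n \<in> carrier N"
    then have e: "delta R (x, y) \<otimes>\<^bsub>?F\<^esub> k = delta R (x \<otimes>\<^bsub>M\<^esub> m, r \<odot>\<^bsub>N\<^esub> (y \<otimes>\<^bsub>N\<^esub> n))
        \<ominus>\<^bsub>?F\<^esub> r \<odot>\<^bsub>?F\<^esub> delta R (x \<otimes>\<^bsub>M\<^esub> m, y \<otimes>\<^bsub>N\<^esub> n)"
      "k \<otimes>\<^bsub>?F\<^esub> delta R (x, y) = delta R (m \<otimes>\<^bsub>M\<^esub> x, r \<odot>\<^bsub>N\<^esub> (n \<otimes>\<^bsub>N\<^esub> y))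
        \<ominus>\<^bsub>?F\<^esub> r \<odot>\<^bsub>?F\<^esub> delta R (m \<otimes>\<^bsub>M\<^esub> x, n \<otimes>\<^bsub>N\<^esub> y)"
      using that by (simp_all add: lm rm c dm N.smult_mult_left N.smult_mult_right F.smult_mult_left F.smult_mult_right)
    have "delta R (x, y) \<otimes>\<^bsub>?F\<^esub> k \<in> bilin_rels R M N" "k \<otimes>\<^bsub>?F\<^esub> delta R (x, y) \<in> bilin_rels R M N"
      unfolding e bilin_rels_def Let_def using that a M.m_closed N.m_closed by blast+
    then show ?thesis using rK by auto
  qed
  have relc: "k \<in> carrier ?F" if "k \<in> bilin_rels R M N" for k using that rK KE(1) by blast
  have z: "\<zero>\<^bsub>?F\<^esub> \<in> ?K" using subgroup.one_closed[OF submodule.axioms(1)[OF K]] by simp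
  have cp: "carrier (M \<times>\<times> N) = carrier M \<times> carrier N" by (simp add: DirProd_def)
  note relmult = gen
  have step: "f \<otimes>\<^bsub>?F\<^esub> k \<in> ?K \<and> k \<otimes>\<^bsub>?F\<^esub> f \<in> ?K" if "f \<in> carrier ?F" "k \<in> bilin_rels R M N" for f k
    using spanned_monoid_algebra F.module_axioms that(1)
  proof (induction rule: span_induct)
    case (gen x)
    then obtain a b where "x = delta R (a, b)" "a \<in> carrier M" "b \<in> carrier N"
      using cp by auto
    then show ?case using relmult that(2) by simp
  next
    case zero then show ?case using relc[OF that(2)] z by simp
  next
    case (add x y) then show ?case using relc[OF that(2)] KE(5) by (simp add: F.l_distr F.r_distr)
  next
    case (smult r x) then show ?case using relc[OF that(2)] KE(4) by (simp add: F.smult_mult_left F.smult_mult_right)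
  qed
  have all: "\<forall>f\<in>carrier ?F. f \<otimes>\<^bsub>?F\<^esub> k \<in> ?K \<and> k \<otimes>\<^bsub>?F\<^esub> f \<in> ?K" if "k \<in> ?K" for k
    using F.module_axioms bilin_rels_closed[OF M.module_axioms N.module_axioms] that[unfolded bilin_ker_def]
  proof (induction rule: mod_span_induct)
    case (gen x) then show ?case using step by blast
  next
    case zero then show ?case using z by simp
  next
    case (add x y) then show ?case using KE(5) by (simp add: F.l_distr F.r_distr)
  next
    case (smult r x) then show ?case using KE(4) by (simp add: F.smult_mult_left F.smult_mult_right)
  qed
  show ?thesis
    by (rule idealI[OF F.ring_axioms submodule.axioms(1)[OF K]]) (use all in auto)
qed

text \<open>
  The product on pure tensors is inherited from the monoid algebra of the product monoid.
\<close>

lemma tensor_algebra: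
  assumes "assoc_algebra R M" "assoc_algebra R N"
  shows "assoc_algebra R (tensor R M N)"
    and "\<one>\<^bsub>tensor R M N\<^esub> = tens R M N \<one>\<^bsub>M\<^esub> \<one>\<^bsub>N\<^esub>"
    and "\<And>m n m' n'. \<lbrakk>m \<in> carrier M; n \<in> carrier N; m' \<in> carrier M; n' \<in> carrier N\<rbrakk> \<Longrightarrow>
      tens R M N m n \<otimes>\<^bsub>tensor R M N\<^esub> tens R M N m' n' = tens R M N (m \<otimes>\<^bsub>M\<^esub> m') (n \<otimes>\<^bsub>N\<^esub> n')"
proof -
  interpret M: assoc_algebra R M by fact
  interpret N: assoc_algebra R N by fact
  let ?F = "monoid_algebra R (M \<times>\<times> N)" and ?K = "bilin_ker R M N"
  have mon: "monoid (M \<times>\<times> N)" by (rule DirProd_monoid[OF M.monoid_axioms N.monoid_axioms])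
  interpret F: assoc_algebra R ?F by (rule assoc_algebra_monoid_algebra[OF mon])
  interpret I: ideal ?K ?F by (rule ideal_bilin_ker[OF assms])
  show "assoc_algebra R (tensor R M N)"
    unfolding tensor_def by (rule assoc_algebra_quot[OF F.assoc_algebra_axioms I.ideal_axioms])
  show "\<one>\<^bsub>tensor R M N\<^esub> = tens R M N \<one>\<^bsub>M\<^esub> \<one>\<^bsub>N\<^esub>"
    by (simp add: tensor_def tens_def quot_alg_simps monoid_algebra_simps DirProd_def)
  show "tens R M N m n \<otimes>\<^bsub>tensor R M N\<^esub> tens R M N m' n' = tens R M N (m \<otimes>\<^bsub>M\<^esub> m') (n \<otimes>\<^bsub>N\<^esub> n')"
    if "m \<in> carrier M" "n \<in> carrier N" "m' \<in> carrier M" "n' \<in> carrier N" for m n m' n'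
    using that assoc_algebra_monoid_algebra(2)[OF mon, of "(m, n)" "(m', n')"]
      I.rcoset_mult_add[OF delta_pair_closed[OF that(1,2)] delta_pair_closed[OF that(3,4)]]
    by (simp add: tensor_def tens_def quot_alg_simps DirProd_def)
qed

lemma tlift_alg_hom:
  assumes "assoc_algebra R M" "assoc_algebra R N" "assoc_algebra R P" "bil R M N P b" "b \<one>\<^bsub>M\<^esub> \<one>\<^bsub>N\<^esub> = \<one>\<^bsub>P\<^esub>"
    and "\<And>m n m' n'. \<lbrakk>m \<in> carrier M; n \<in> carrier N; m' \<in> carrier M; n' \<in> carrier N\<rbrakk> \<Longrightarrow>
      b (m \<otimes>\<^bsub>M\<^esub> m') (n \<otimes>\<^bsub>N\<^esub> n') = b m n \<otimes>\<^bsub>P\<^esub> b m' n'"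
  shows "tlift R P b \<in> alg_hom R (tensor R M N) P"
proof -
  interpret M: assoc_algebra R M by fact
  interpret N: assoc_algebra R N by fact
  interpret P: assoc_algebra R P by fact
  let ?T = "tensor R M N"
  interpret T: assoc_algebra R ?T by (rule tensor_algebra[OF assms(1,2)])
  note L = lin_tlift[OF M.module_axioms N.module_axioms P.module_axioms assms(4)]
  note t = tlift_tens[OF M.module_axioms N.module_axioms P.module_axioms assms(4)]
  note c = tens_closed[OF M.module_axioms N.module_axioms]
  note eq = tensor_lin_eq[OF M.module_axioms N.module_axioms P.module_axioms]
  show ?thesis
  proof (rule alg_homI[OF L])
    show "tlift R P b \<one>\<^bsub>?T\<^esub> = \<one>\<^bsub>P\<^esub>" by (simp add: tensor_algebra(2)[OF assms(1,2)] t assms(5))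
    fix U W assume UW: "U \<in> carrier ?T" "W \<in> carrier ?T"
    have 1: "tlift R P b (tens R M N m n \<otimes>\<^bsub>?T\<^esub> V) = b m n \<otimes>\<^bsub>P\<^esub> tlift R P b V"
      if "m \<in> carrier M" "n \<in> carrier N" "V \<in> carrier ?T" for m n V
      by (rule eq[OF lin_comp[OF lin_mult_left[OF T.assoc_algebra_axioms c[OF that(1,2)]] L]
          lin_comp[OF L lin_mult_left[OF assms(3) bil_closed[OF assms(4) that(1,2)]]] _ that(3)])
        (simp add: that tensor_algebra(3)[OF assms(1,2)] t assms(6))
    show "tlift R P b (U \<otimes>\<^bsub>?T\<^esub> W) = tlift R P b U \<otimes>\<^bsub>P\<^esub> tlift R P b W"
      by (rule eq[OF lin_comp[OF lin_mult_right[OF T.assoc_algebra_axioms UW(2)] L]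
          lin_comp[OF L lin_mult_right[OF assms(3) lin_closed[OF L UW(2)]]] _ UW(1)])
        (simp add: UW 1 t)
  qed
qed

lemma lin_tens1: "\<lbrakk>module R M; module R N; lin X M f; n \<in> carrier N\<rbrakk> \<Longrightarrow> lin X (tensor R M N) (\<lambda>x. tens R M N (f x) n)"
  by (rule lin_comp[OF _ bil_left[OF bil_tens]])

lemma lin_tens2: "\<lbrakk>module R M; module R N; lin X N f; m \<in> carrier M\<rbrakk> \<Longrightarrow> lin X (tensor R M N) (\<lambda>x. tens R M N m (f x))"
  by (rule lin_comp[OF _ bil_right[OF bil_tens]])

lemma lin_mult1: "\<lbrakk>assoc_algebra R B; lin X B f; b \<in> carrier B\<rbrakk> \<Longrightarrow> lin X B (\<lambda>x. f x \<otimes>\<^bsub>B\<^esub> b)"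
  by (rule lin_comp[OF _ lin_mult_right])

lemma lin_mult2: "\<lbrakk>assoc_algebra R B; lin X B f; b \<in> carrier B\<rbrakk> \<Longrightarrow> lin X B (\<lambda>x. b \<otimes>\<^bsub>B\<^esub> f x)"
  by (rule lin_comp[OF _ lin_mult_left])

lemma lin_tlift_arg:
  "\<lbrakk>module R M; module R N; module R P; bil R M N P b; lin X (tensor R M N) f\<rbrakk> \<Longrightarrow> lin X P (\<lambda>x. tlift R P b (f x))"
  by (rule lin_comp[OF _ lin_tlift])

lemma tlift_closed:
  "\<lbrakk>module R M; module R N; module R P; bil R M N P b; U \<in> carrier (tensor R M N)\<rbrakk> \<Longrightarrow> tlift R P b U \<in> carrier P"
  by (rule lin_closed[OF lin_tlift])

lemma mult_closed: "\<lbrakk>assoc_algebra R B; x \<in> carrier B; y \<in> carrier B\<rbrakk> \<Longrightarrow> x \<otimes>\<^bsub>B\<^esub> y \<in> carrier B"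
  by (rule lin_closed[OF lin_mult_left])

lemma plus_closed: "\<lbrakk>module R B; x \<in> carrier B; y \<in> carrier B\<rbrakk> \<Longrightarrow> x \<oplus>\<^bsub>B\<^esub> y \<in> carrier B"
  by (auto simp: module_def abelian_group_def intro: abelian_monoid.a_closed)

end

section \<open>Tensor algebras and symmetric algebras\<close>

definition letter_rels where
  "letter_rels R M = (let F = monoid_algebra R (words M) in
      {delta R [m \<oplus>\<^bsub>M\<^esub> m'] \<ominus>\<^bsub>F\<^esub> (delta R [m] \<oplus>\<^bsub>F\<^esub> delta R [m']) | m m'.
         m \<in> carrier M \<and> m' \<in> carrier M}
    \<union> {delta R [r \<odot>\<^bsub>M\<^esub> m] \<ominus>\<^bsub>F\<^esub> r \<odot>\<^bsub>F\<^esub> delta R [m] | r m. r \<in> carrier R \<and> m \<in> carrier M})"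

definition word_val where "word_val B f w = foldr (\<lambda>m y. f m \<otimes>\<^bsub>B\<^esub> y) w \<one>\<^bsub>B\<^esub>"

definition sym_rels where
  "sym_rels R V = (let T = tensor_alg R V in
    {tgen R V v \<otimes>\<^bsub>T\<^esub> tgen R V w \<ominus>\<^bsub>T\<^esub> tgen R V w \<otimes>\<^bsub>T\<^esub> tgen R V v | v w. v \<in> carrier V \<and> w \<in> carrier V})"

context cring
begin

lemma monoid_words: "monoid (words M)"
  by (rule monoidI) (auto simp: words_def)

lemma words_simps [simp]: "carrier (words M) = lists (carrier M)" "\<one>\<^bsub>words M\<^esub> = []" "x \<otimes>\<^bsub>words M\<^esub> y = x @ y"
  by (simp_all add: words_def)

lemmas word_algebra = assoc_algebra_monoid_algebra(1)[OF monoid_words]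

lemma delta_word_mult:
  "\<lbrakk>u \<in> lists (carrier M); w \<in> lists (carrier M)\<rbrakk> \<Longrightarrow>
    delta R u \<otimes>\<^bsub>monoid_algebra R (words M)\<^esub> delta R w = delta R (u @ w)"
  using assoc_algebra_monoid_algebra(2)[OF monoid_words, of u M w] by simp

lemma delta_word_closed: "u \<in> lists (carrier M) \<Longrightarrow> delta R u \<in> carrier (monoid_algebra R (words M))"
  by (rule delta_closed) simp

lemma letter_ideal_genideal: "letter_ideal R M = genideal (monoid_algebra R (words M)) (letter_rels R M)"
  by (simp add: letter_ideal_def letter_rels_def Let_def)

lemma letter_rels_closed:
  assumes "module R M" shows "letter_rels R M \<subseteq> carrier (monoid_algebra R (words M))"
proof -
  interpret M: module R M by fact
  interpret F: assoc_algebra R "monoid_algebra R (words M)" by (rule word_algebra)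
  show ?thesis unfolding letter_rels_def Let_def
    by (auto intro!: F.minus_closed F.a_closed F.smult_closed delta_word_closed)
qed

lemma ideal_letter_ideal:
  assumes "module R M" shows "ideal (letter_ideal R M) (monoid_algebra R (words M))"
proof -
  interpret F: assoc_algebra R "monoid_algebra R (words M)" by (rule word_algebra)
  show ?thesis unfolding letter_ideal_genideal by (rule F.genideal_ideal[OF letter_rels_closed[OF assms]])
qed

lemma assoc_algebra_tensor_alg: "module R M \<Longrightarrow> assoc_algebra R (tensor_alg R M)"
  unfolding tensor_alg_def by (rule assoc_algebra_quot(1)[OF word_algebra ideal_letter_ideal])

lemma alg_hom_tensor_alg_proj:
  "module R M \<Longrightarrow> (\<lambda>x. letter_ideal R M +>\<^bsub>monoid_algebra R (words M)\<^esub> x) \<in> alg_hom R (monoid_algebra R (words M)) (tensor_alg R M)"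
  unfolding tensor_alg_def by (rule assoc_algebra_quot(2)[OF word_algebra ideal_letter_ideal])

lemma lin_tgen:
  assumes "module R M" shows "lin M (tensor_alg R M) (tgen R M)"
proof -
  interpret M: module R M by fact
  let ?F = "monoid_algebra R (words M)" and ?I = "letter_ideal R M"
  interpret F: assoc_algebra R ?F by (rule word_algebra)
  interpret Q: quotient_module R ?F ?I
    by (intro quotient_module.intro quotient_module_axioms.intro F.module_axioms ideal_submodule F.assoc_algebra_axioms ideal_letter_ideal assms)
  have r: "letter_rels R M \<subseteq> ?I" unfolding letter_ideal_genideal by (rule F.genideal_self[OF letter_rels_closed[OF assms]])
  have c: "delta R [m] \<in> carrier ?F" if "m \<in> carrier M" for m using that by (auto intro!: delta_word_closed)
  note e = Q.coset_eq_iff[THEN iffD2]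
  show ?thesis unfolding tgen_def tensor_alg_def
  proof (rule linI)
    fix m m' assume a: "m \<in> carrier M" "m' \<in> carrier M"
    show "?I +>\<^bsub>?F\<^esub> delta R [m \<oplus>\<^bsub>M\<^esub> m'] = (?I +>\<^bsub>?F\<^esub> delta R [m]) \<oplus>\<^bsub>quot_alg ?F ?I\<^esub> (?I +>\<^bsub>?F\<^esub> delta R [m'])"
      unfolding Q.coset_add[OF c[OF a(1)] c[OF a(2)]]
    proof (rule e)
      show "delta R [m \<oplus>\<^bsub>M\<^esub> m'] \<ominus>\<^bsub>?F\<^esub> (delta R [m] \<oplus>\<^bsub>?F\<^esub> delta R [m']) \<in> ?I"
        by (rule subsetD[OF r]) (use a in \<open>auto simp: letter_rels_def Let_def\<close>)
    qed (auto simp: a c)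
  next
    fix q m assume a: "q \<in> carrier R" "m \<in> carrier M"
    show "?I +>\<^bsub>?F\<^esub> delta R [q \<odot>\<^bsub>M\<^esub> m] = q \<odot>\<^bsub>quot_alg ?F ?I\<^esub> (?I +>\<^bsub>?F\<^esub> delta R [m])"
      unfolding Q.coset_smult[OF a(1) c[OF a(2)]]
    proof (rule e)
      show "delta R [q \<odot>\<^bsub>M\<^esub> m] \<ominus>\<^bsub>?F\<^esub> q \<odot>\<^bsub>?F\<^esub> delta R [m] \<in> ?I"
        by (rule subsetD[OF r]) (use a in \<open>auto simp: letter_rels_def Let_def\<close>)
    qed (auto simp: a c)
  qed (auto intro: Q.coset_closed c)
qed

lemma generates_word_algebra: "generates R (monoid_algebra R (words M)) ((\<lambda>m. delta R [m]) ` carrier M)"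
proof -
  let ?F = "monoid_algebra R (words M)"
  interpret F: assoc_algebra R ?F by (rule word_algebra)
  have "carrier ?F \<subseteq> N"
    if N: "submodule N R ?F" "\<one>\<^bsub>?F\<^esub> \<in> N" "\<forall>g\<in>(\<lambda>m. delta R [m]) ` carrier M. \<forall>x\<in>N. g \<otimes>\<^bsub>?F\<^esub> x \<in> N" for N
  proof -
    have "delta R w \<in> N" if "w \<in> lists (carrier M)" for w
      using that
    proof (induction w)
      case Nil then show ?case using N(2) by (simp add: monoid_algebra_simps)
    next
      case (Cons m w)
      then have "delta R (m # w) = delta R [m] \<otimes>\<^bsub>?F\<^esub> delta R w" using delta_word_mult[of "[m]" M w] by simp
      then show ?case using N(3) Cons by auto
    qed
    then have "delta R ` carrier (words M) \<subseteq> N" by auto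
    then show ?thesis using spanned_monoid_algebra[of "words M"] N(1) unfolding spanned_def by blast
  qed
  then show ?thesis unfolding generates_def using delta_word_closed[of "[_]" M] by (auto simp del: words_simps)
qed

lemma generates_tensor_alg: "module R M \<Longrightarrow> generates R (tensor_alg R M) (tgen R M ` carrier M)"
  using generates_image[OF generates_word_algebra word_algebra assoc_algebra_tensor_alg alg_hom_tensor_alg_proj]
  by (simp add: image_image tgen_def[symmetric] tensor_alg_def coset_surj)

lemma word_val_simps [simp]: "word_val B f [] = \<one>\<^bsub>B\<^esub>" "word_val B f (m # w) = f m \<otimes>\<^bsub>B\<^esub> word_val B f w"
  by (simp_all add: word_val_def)

lemma word_val_closed:
  assumes "assoc_algebra R B" "f \<in> S \<rightarrow> carrier B" "w \<in> lists S" shows "word_val B f w \<in> carrier B"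
proof -
  interpret B: assoc_algebra R B by fact
  show ?thesis using assms(3) by (induction w) (use assms(2) in auto)
qed

lemma word_val_append:
  assumes "assoc_algebra R B" "f \<in> S \<rightarrow> carrier B" "u \<in> lists S" "w \<in> lists S"
  shows "word_val B f (u @ w) = word_val B f u \<otimes>\<^bsub>B\<^esub> word_val B f w"
proof -
  interpret B: assoc_algebra R B by fact
  note c = word_val_closed[OF assms(1,2)]
  show ?thesis using assms(3)
  proof (induction u)
    case (Cons m u)
    then have "f m \<in> carrier B" using assms(2) by auto
    then show ?case using Cons c[of u] c[OF assms(4)] by (simp add: B.m_assoc)
  qed (simp add: c[OF assms(4)])
qed

lemma word_val_hom:
  assumes "assoc_algebra R B" "h \<in> alg_hom R B C" "f \<in> S \<rightarrow> carrier B" "w \<in> lists S"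
  shows "h (word_val B f w) = word_val C (\<lambda>x. h (f x)) w"
  using assms(4)
proof (induction w)
  case (Cons m w)
  then have "f m \<in> carrier B" using assms(3) by auto
  then show ?case using Cons word_val_closed[OF assms(1,3), of w] by (simp add: alg_hom_mult[OF assms(2)])
qed (simp add: alg_hom_one[OF assms(2)])

text \<open>
  The extension to words is multiplicative, and linearity of \<open>f\<close> is what makes it vanish on the letter relations.
\<close>

lemma tensor_alg_lift:
  assumes "module R M" "assoc_algebra R B" "lin M B f"
  obtains h where "h \<in> alg_hom R (tensor_alg R M) B" "\<And>m. m \<in> carrier M \<Longrightarrow> h (tgen R M m) = f m"
proof -
  interpret M: module R M by fact
  interpret B: assoc_algebra R B by fact
  let ?F = "monoid_algebra R (words M)" and ?I = "letter_ideal R M"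
  interpret F: assoc_algebra R ?F by (rule word_algebra)
  let ?L = "lin_ext R B (word_val B f)"
  have f: "f \<in> carrier M \<rightarrow> carrier B" using lin_closed[OF assms(3)] by auto
  have wv: "word_val B f \<in> carrier (words M) \<rightarrow> carrier B" using word_val_closed[OF assms(2) f] by auto
  have L: "?L \<in> alg_hom R ?F B"
    by (rule alg_hom_lin_ext[OF monoid_words assms(2) wv]) (auto intro: word_val_append[OF assms(2) f])
  have c: "delta R [m] \<in> carrier ?F" if "m \<in> carrier M" for m using that by (auto intro!: delta_word_closed)
  have d: "?L (delta R [m]) = f m" if "m \<in> carrier M" for m
    using lin_ext_delta[OF B.module_axioms wv, of "[m]"] that lin_closed[OF assms(3) that] by simp
  note ll = lin_minus[OF F.module_axioms B.module_axioms alg_hom_lin[OF L]] lin_add[OF alg_hom_lin[OF L]]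
    lin_smult[OF alg_hom_lin[OF L]] lin_add[OF assms(3)] lin_smult[OF assms(3)]
  have k: "?L x = \<zero>\<^bsub>B\<^esub>" if "x \<in> ?I" for x
  proof (rule alg_hom_genideal[OF F.assoc_algebra_axioms assms(2) L letter_rels_closed[OF assms(1)] _ that[unfolded letter_ideal_genideal]])
    show "?L s = \<zero>\<^bsub>B\<^esub>" if "s \<in> letter_rels R M" for s
      using that unfolding letter_rels_def Let_def
      by (auto simp: ll c d lin_closed[OF assms(3)] B.diff_eq_zero_iff)
  qed
  note q = alg_hom_qlift[OF F.assoc_algebra_axioms ideal_letter_ideal[OF assms(1)] assms(2) L k]
  show thesis
    by (rule that[of "qlift ?L"]) (use q c d in \<open>auto simp: tensor_alg_def tgen_def\<close>)
qed

lemma sym_ideal_genideal: "sym_ideal R V = genideal (tensor_alg R V) (sym_rels R V)"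
  by (simp add: sym_ideal_def sym_rels_def Let_def)

lemma sym_rels_closed:
  assumes "module R V" shows "sym_rels R V \<subseteq> carrier (tensor_alg R V)"
proof -
  interpret T: assoc_algebra R "tensor_alg R V" by (rule assoc_algebra_tensor_alg[OF assms])
  show ?thesis unfolding sym_rels_def Let_def by (auto intro!: T.minus_closed T.m_closed lin_closed[OF lin_tgen[OF assms]])
qed

lemma ideal_sym_ideal:
  assumes "module R V" shows "ideal (sym_ideal R V) (tensor_alg R V)"
proof -
  interpret T: assoc_algebra R "tensor_alg R V" by (rule assoc_algebra_tensor_alg[OF assms])
  show ?thesis unfolding sym_ideal_genideal by (rule T.genideal_ideal[OF sym_rels_closed[OF assms]])
qed

lemma assoc_algebra_sym_alg: "module R V \<Longrightarrow> assoc_algebra R (sym_alg R V)"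
  unfolding sym_alg_def by (rule assoc_algebra_quot(1)[OF assoc_algebra_tensor_alg ideal_sym_ideal])

lemma alg_hom_sym_alg_proj:
  "module R V \<Longrightarrow> (\<lambda>x. sym_ideal R V +>\<^bsub>tensor_alg R V\<^esub> x) \<in> alg_hom R (tensor_alg R V) (sym_alg R V)"
  unfolding sym_alg_def by (rule assoc_algebra_quot(2)[OF assoc_algebra_tensor_alg ideal_sym_ideal])

lemma lin_sgen: "module R V \<Longrightarrow> lin V (sym_alg R V) (sgen R V)"
  using lin_comp[OF lin_tgen alg_hom_lin[OF alg_hom_sym_alg_proj]] by (simp add: sgen_def[abs_def])

lemma generates_sym_alg: "module R V \<Longrightarrow> generates R (sym_alg R V) (sgen R V ` carrier V)"
  using generates_image[OF generates_tensor_alg assoc_algebra_tensor_alg assoc_algebra_sym_alg alg_hom_sym_alg_proj]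
  by (simp add: image_image sgen_def[symmetric] sym_alg_def coset_surj)

lemma sgen_commute:
  assumes "module R V" "v \<in> carrier V" "w \<in> carrier V"
  shows "sgen R V v \<otimes>\<^bsub>sym_alg R V\<^esub> sgen R V w = sgen R V w \<otimes>\<^bsub>sym_alg R V\<^esub> sgen R V v"
proof -
  let ?T = "tensor_alg R V"
  interpret T: assoc_algebra R ?T by (rule assoc_algebra_tensor_alg[OF assms(1)])
  interpret Q: quotient_module R ?T "sym_ideal R V"
    by (intro quotient_module.intro quotient_module_axioms.intro T.module_axioms ideal_submodule T.assoc_algebra_axioms ideal_sym_ideal assms)
  note c = lin_closed[OF lin_tgen[OF assms(1)]]
  have "tgen R V v \<otimes>\<^bsub>?T\<^esub> tgen R V w \<ominus>\<^bsub>?T\<^esub> tgen R V w \<otimes>\<^bsub>?T\<^esub> tgen R V v \<in> sym_ideal R V"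
    unfolding sym_ideal_genideal
    by (rule subsetD[OF T.genideal_self[OF sym_rels_closed[OF assms(1)]]]) (use assms in \<open>auto simp: sym_rels_def Let_def\<close>)
  from Q.coset_eq_iff[THEN iffD2, OF _ _ this] show ?thesis
    using assms c by (simp add: sgen_def alg_hom_mult[OF alg_hom_sym_alg_proj[OF assms(1)], symmetric])
qed

lemma sym_alg_lift:
  assumes "module R V" "assoc_algebra R B" "lin V B f"
    and "\<And>v w. \<lbrakk>v \<in> carrier V; w \<in> carrier V\<rbrakk> \<Longrightarrow> f v \<otimes>\<^bsub>B\<^esub> f w = f w \<otimes>\<^bsub>B\<^esub> f v"
  obtains h where "h \<in> alg_hom R (sym_alg R V) B" "\<And>v. v \<in> carrier V \<Longrightarrow> h (sgen R V v) = f v"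
proof -
  obtain h where h: "h \<in> alg_hom R (tensor_alg R V) B" "\<And>m. m \<in> carrier V \<Longrightarrow> h (tgen R V m) = f m"
    by (rule tensor_alg_lift[OF assms(1-3)]) blast
  let ?T = "tensor_alg R V"
  interpret T: assoc_algebra R ?T by (rule assoc_algebra_tensor_alg[OF assms(1)])
  interpret B: assoc_algebra R B by fact
  note c = lin_closed[OF lin_tgen[OF assms(1)]]
  have k: "h x = \<zero>\<^bsub>B\<^esub>" if "x \<in> sym_ideal R V" for x
  proof (rule alg_hom_genideal[OF T.assoc_algebra_axioms assms(2) h(1) sym_rels_closed[OF assms(1)] _ that[unfolded sym_ideal_genideal]])
    show "h s = \<zero>\<^bsub>B\<^esub>" if "s \<in> sym_rels R V" for s
      using that unfolding sym_rels_def Let_def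
      by (auto simp: lin_minus[OF T.module_axioms B.module_axioms alg_hom_lin[OF h(1)]] alg_hom_mult[OF h(1)] c h(2)
          B.diff_eq_zero_iff lin_closed[OF assms(3)] assms(4))
  qed
  note q = alg_hom_qlift[OF T.assoc_algebra_axioms ideal_sym_ideal[OF assms(1)] assms(2) h(1) k]
  show thesis
    by (rule that[of "qlift h"]) (use q c h in \<open>auto simp: sym_alg_def sgen_def\<close>)
qed

text \<open>
  The operator \<open>slift\<close> evaluates the extension of \<open>b\<close> at an arbitrary representative in the monoid algebra on
  words. The value is independent of this choice as soon as \<open>b\<close> is the restriction to words of some
  linear map \<open>L\<close> on the symmetric algebra.
\<close>

lemma slift_eq:
  assumes "module R V" "module R P" "lin (sym_alg R V) P L"
    and "\<And>w. w \<in> lists (carrier V) \<Longrightarrow> L (word_val (sym_alg R V) (sgen R V) w) = b w"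
    and "U \<in> carrier (sym_alg R V)"
  shows "slift R P b U = L U"
proof -
  interpret P: module R P by fact
  let ?F = "monoid_algebra R (words V)" and ?T = "tensor_alg R V"
  interpret F: assoc_algebra R ?F by (rule word_algebra)
  interpret T: assoc_algebra R ?T by (rule assoc_algebra_tensor_alg[OF assms(1)])
  let ?p = "\<lambda>x. letter_ideal R V +>\<^bsub>?F\<^esub> x" and ?q = "\<lambda>x. sym_ideal R V +>\<^bsub>?T\<^esub> x"
  interpret Q1: quotient_module R ?F "letter_ideal R V"
    by (intro quotient_module.intro quotient_module_axioms.intro F.module_axioms ideal_submodule F.assoc_algebra_axioms ideal_letter_ideal assms)
  interpret Q2: quotient_module R ?T "sym_ideal R V"
    by (intro quotient_module.intro quotient_module_axioms.intro T.module_axioms ideal_submodule T.assoc_algebra_axioms ideal_sym_ideal assms)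
  \<comment> \<open>The representative at which \<open>slift\<close> evaluates.\<close>
  let ?f = "SOME f. f \<in> \<Union>U"
  obtain t where t: "t \<in> carrier ?T" "U = ?q t"
    using assms(5) Q2.coset_cases unfolding sym_alg_def by blast
  have tU: "t \<in> U" using t Q2.I.a_rcos_self by blast
  obtain g where g: "g \<in> carrier ?F" "t = ?p g" using t(1) Q1.coset_cases unfolding tensor_alg_def by blast
  have "g \<in> t" using g Q1.I.a_rcos_self by blast
  then have "?f \<in> \<Union>U" using tU by (metis UnionI someI)
  then obtain t' where t': "t' \<in> U" "?f \<in> t'" by blast
  have t'c: "t' \<in> carrier ?T" "U = ?q t'" using Q2.coset_mem[OF t(1)] t' t(2) by auto
  obtain g' where g': "g' \<in> carrier ?F" "t' = ?p g'" using t'c(1) Q1.coset_cases unfolding tensor_alg_def by blast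
  have f: "?f \<in> carrier ?F" "t' = ?p ?f" using Q1.coset_mem[OF g'(1)] t'(2) g'(2) by auto
  note pq = alg_hom_comp[OF alg_hom_tensor_alg_proj[OF assms(1)] alg_hom_sym_alg_proj[OF assms(1)]]
  have s: "sgen R V v = ?q (?p (delta R [v]))" for v by (simp add: sgen_def tgen_def)
  have w: "?q (?p (delta R w)) = word_val (sym_alg R V) (sgen R V) w" if "w \<in> lists (carrier V)" for w
    using that
  proof (induction w)
    case Nil then show ?case using alg_hom_one[OF pq] by (simp add: monoid_algebra_simps)
  next
    case (Cons v w)
    then have "delta R (v # w) = delta R [v] \<otimes>\<^bsub>?F\<^esub> delta R w" using delta_word_mult[of "[v]" V w] by simp
    then show ?case using Cons alg_hom_mult[OF pq, of "delta R [v]" "delta R w"] delta_word_closed[of _ V]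
      by (simp add: s)
  qed
  have Lc: "lin ?F P (\<lambda>x. L (?q (?p x)))" by (rule lin_comp[OF alg_hom_lin[OF pq] assms(3)])
  have b: "b \<in> carrier (words V) \<rightarrow> carrier P"
    using lin_closed[OF Lc] delta_word_closed[of _ V] w assms(4) by force
  have lf: "lin_ext R P b ?f = L (?q (?p ?f))"
  proof (rule lin_eq_on_span[OF spanned_monoid_algebra F.module_axioms P.module_axioms lin_lin_ext[OF P.module_axioms b] Lc _ f(1)])
    fix x assume "x \<in> delta R ` carrier (words V)"
    then obtain u where u: "x = delta R u" "u \<in> lists (carrier V)" by auto
    then show "lin_ext R P b x = L (?q (?p x))"
      using lin_ext_delta[OF P.module_axioms b, of u] w[OF u(2)] assms(4)[OF u(2)] by simp
  qed
  have "?q (?p ?f) = U" by (rule trans[OF arg_cong[where f="?q", OF f(2)[symmetric]] t'c(2)[symmetric]])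
  then have "L (?q (?p ?f)) = L U" by (rule arg_cong)
  with lf show ?thesis unfolding slift_def by (rule trans)
qed

subsection \<open>Direct sums\<close>

lemma dsum_simps:
  "carrier (dsum M N) = carrier M \<times> carrier N"
  "(m, n) \<oplus>\<^bsub>dsum M N\<^esub> (m', n') = (m \<oplus>\<^bsub>M\<^esub> m', n \<oplus>\<^bsub>N\<^esub> n')"
  "\<zero>\<^bsub>dsum M N\<^esub> = (\<zero>\<^bsub>M\<^esub>, \<zero>\<^bsub>N\<^esub>)"
  "r \<odot>\<^bsub>dsum M N\<^esub> (m, n) = (r \<odot>\<^bsub>M\<^esub> m, r \<odot>\<^bsub>N\<^esub> n)"
  by (simp_all add: dsum_def RDirProd_def DirProd_def monoid.defs ring.defs module.defs)

lemma module_dsum: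
  assumes "module R M" "module R N" shows "module R (dsum M N)"
proof -
  interpret M: module R M by fact
  interpret N: module R N by fact
  show ?thesis
  proof (rule moduleI)
    show "abelian_group (dsum M N)"
    proof (rule abelian_groupI)
      show "\<exists>y\<in>carrier (dsum M N). y \<oplus>\<^bsub>dsum M N\<^esub> x = \<zero>\<^bsub>dsum M N\<^esub>" if "x \<in> carrier (dsum M N)" for x
        using that by (intro bexI[of _ "(\<ominus>\<^bsub>M\<^esub> fst x, \<ominus>\<^bsub>N\<^esub> snd x)"]) (auto simp: dsum_simps M.M.l_neg N.M.l_neg)
    qed (auto simp: dsum_simps M.M.a_ac N.M.a_ac)
  qed (auto simp: dsum_simps is_cring M.smult_l_distr N.smult_l_distr M.smult_r_distr N.smult_r_distr M.smult_assoc1 N.smult_assoc1)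
qed

lemma lin_dsum_fst: "lin (dsum M N) M fst" and lin_dsum_snd: "lin (dsum M N) N snd"
  by (auto intro!: linI simp: dsum_simps)

lemma lin_dsum_inl: assumes "module R N" shows "lin M (dsum M N) (\<lambda>m. (m, \<zero>\<^bsub>N\<^esub>))"
proof -
  interpret N: module R N by fact
  show ?thesis by (rule linI) (auto simp: dsum_simps)
qed

lemma lin_dsum_inr: assumes "module R M" shows "lin N (dsum M N) (\<lambda>n. (\<zero>\<^bsub>M\<^esub>, n))"
proof -
  interpret M: module R M by fact
  show ?thesis by (rule linI) (auto simp: dsum_simps)
qed

lemma wdg_closed:
  assumes "module R V" "v \<in> carrier V" "w \<in> carrier V"
  shows "wdg R V v w \<in> carrier (wedge R V)"
  unfolding wedge_def using mod_span_superset assms(2,3) by fastforce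

end

section \<open>Sweedler calculus\<close>

lemma (in abelian_group) diff_diff_zeroD:
  assumes "x \<ominus> y \<ominus> z = \<zero>" "x \<in> carrier G" "y \<in> carrier G" "z \<in> carrier G" shows "x = y \<oplus> z"
proof -
  have "x \<ominus> y = z" using assms diff_eq_zero_iff[of "x \<ominus> y" z] by simp
  then have "y \<oplus> z = y \<oplus> (x \<ominus> y)" by simp
  also have "\<dots> = x" using assms(2,3) by (simp add: a_minus_def a_lcomm[of y x] r_neg)
  finally show ?thesis by simp
qed

text \<open>Trilinear expressions are the terms to which coassociativity is applied.\<close>

definition tril :: "('k, 'r) ring_scheme \<Rightarrow> ('k, 'm, 'x) module_scheme \<Rightarrow> ('k, 'p, 'z) module_scheme \<Rightarrow> ('m \<Rightarrow> 'm \<Rightarrow> 'm \<Rightarrow> 'p) \<Rightarrow> bool"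
  where "tril R M P t \<longleftrightarrow>
    (\<forall>y\<in>carrier M. \<forall>z\<in>carrier M. (\<lambda>x. t x y z) \<in> linear_maps R M P \<and>
      (\<lambda>x. t y x z) \<in> linear_maps R M P \<and> (\<lambda>x. t y z x) \<in> linear_maps R M P)"

lemma trilI:
  assumes "\<And>y z. \<lbrakk>y \<in> carrier M; z \<in> carrier M\<rbrakk> \<Longrightarrow> (\<lambda>x. t x y z) \<in> linear_maps R M P"
    and "\<And>y z. \<lbrakk>y \<in> carrier M; z \<in> carrier M\<rbrakk> \<Longrightarrow> (\<lambda>x. t y x z) \<in> linear_maps R M P"
    and "\<And>y z. \<lbrakk>y \<in> carrier M; z \<in> carrier M\<rbrakk> \<Longrightarrow> (\<lambda>x. t y z x) \<in> linear_maps R M P"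
  shows "tril R M P t"
  using assms by (auto simp: tril_def)

lemma trilD:
  assumes "tril R M P t" "y \<in> carrier M" "z \<in> carrier M"
  shows "(\<lambda>x. t x y z) \<in> linear_maps R M P" "(\<lambda>x. t y x z) \<in> linear_maps R M P" "(\<lambda>x. t y z x) \<in> linear_maps R M P"
  using assms by (auto simp: tril_def)

context cring
begin

text \<open>
  Two independent Sweedler sums may be interchanged: both sides are bilinear in \<open>U\<close> and \<open>W\<close> and agree on
  pure tensors.
\<close>

lemma tlift_swap:
  assumes "module R M" "module R N" "module R M'" "module R N'" "module R P"
    and "\<And>x y. \<lbrakk>x \<in> carrier M; y \<in> carrier N\<rbrakk> \<Longrightarrow> bil R M' N' P (\<lambda>u v. c x y u v)"
    and "\<And>u v. \<lbrakk>u \<in> carrier M'; v \<in> carrier N'\<rbrakk> \<Longrightarrow> bil R M N P (\<lambda>x y. c x y u v)"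
    and "U \<in> carrier (tensor R M N)" "W \<in> carrier (tensor R M' N')"
  shows "tlift R P (\<lambda>x y. tlift R P (\<lambda>u v. c x y u v) W) U = tlift R P (\<lambda>u v. tlift R P (\<lambda>x y. c x y u v) U) W"
proof -
  have b1: "bil R M N P (\<lambda>x y. tlift R P (\<lambda>u v. c x y u v) W)"
  proof (rule bilI)
    show "lin N P (\<lambda>y. tlift R P (\<lambda>u v. c x y u v) W)" if "x \<in> carrier M" for x
      by (rule lin_tlift_fun[OF assms(2-5,9) assms(6)[OF that]], assumption) (rule bil_right[OF assms(7) that])
    show "lin M P (\<lambda>x. tlift R P (\<lambda>u v. c x y u v) W)" if "y \<in> carrier N" for y
      by (rule lin_tlift_fun[OF assms(1,3-5,9) assms(6)[OF _ that]], assumption) (rule bil_left[OF assms(7) that])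
  qed
  have b2: "bil R M' N' P (\<lambda>u v. tlift R P (\<lambda>x y. c x y u v) U)" if U: "U \<in> carrier (tensor R M N)" for U
  proof (rule bilI)
    show "lin N' P (\<lambda>v. tlift R P (\<lambda>x y. c x y u v) U)" if "u \<in> carrier M'" for u
      by (rule lin_tlift_fun[OF assms(4,1,2,5) U assms(7)[OF that]], assumption) (rule bil_right[OF assms(6) that])
    show "lin M' P (\<lambda>u. tlift R P (\<lambda>x y. c x y u v) U)" if "v \<in> carrier N'" for v
      by (rule lin_tlift_fun[OF assms(3,1,2,5) U assms(7)[OF _ that]], assumption) (rule bil_left[OF assms(6) that])
  qed
  show ?thesis
  proof (rule tensor_lin_eq[OF assms(1,2,5) lin_tlift[OF assms(1,2,5) b1] _ _ assms(8)])
    show "lin (tensor R M N) P (\<lambda>U. tlift R P (\<lambda>u v. tlift R P (\<lambda>x y. c x y u v) U) W)"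
    proof (rule lin_tlift_fun[OF module_tensor[OF assms(1,2)] assms(3-5,9)])
      fix U assume U: "U \<in> carrier (tensor R M N)"
      show "bil R M' N' P (\<lambda>u v. tlift R P (\<lambda>x y. c x y u v) U)"
        by (rule b2[OF U])
    next
      show "lin (tensor R M N) P (\<lambda>U. tlift R P (\<lambda>x y. c x y m n) U)" if "m \<in> carrier M'" "n \<in> carrier N'" for m n
        by (rule lin_tlift[OF assms(1,2,5) assms(7)[OF that]])
    qed
    fix m n assume mn: "m \<in> carrier M" "n \<in> carrier N"
    have "tlift R P (\<lambda>u v. tlift R P (\<lambda>x y. c x y u v) (tens R M N m n)) W = tlift R P (\<lambda>u v. c m n u v) W"
    proof (rule tlift_cong[OF assms(3-5) _ assms(9), symmetric])
      show "c m n u v = tlift R P (\<lambda>x y. c x y u v) (tens R M N m n)" if "u \<in> carrier M'" "v \<in> carrier N'" for u v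
        by (rule tlift_tens[OF assms(1,2,5) assms(7)[OF that] mn, symmetric])
    qed (rule assms(6)[OF mn])
    then show "tlift R P (\<lambda>x y. tlift R P (\<lambda>u v. c x y u v) W) (tens R M N m n) =
      tlift R P (\<lambda>u v. tlift R P (\<lambda>x y. c x y u v) (tens R M N m n)) W"
      by (simp add: tlift_tens[OF assms(1,2,5) b1 mn])
  qed
qed

text \<open>
  The Sweedler sum of a product: both sides are bilinear in \<open>U\<close> and \<open>W\<close>.
\<close>

lemma tlift_mult:
  assumes "assoc_algebra R M" "assoc_algebra R N" "module R P" "bil R M N P b"
    and "U \<in> carrier (tensor R M N)" "W \<in> carrier (tensor R M N)"
  shows "tlift R P b (U \<otimes>\<^bsub>tensor R M N\<^esub> W) =
    tlift R P (\<lambda>x y. tlift R P (\<lambda>u v. b (x \<otimes>\<^bsub>M\<^esub> u) (y \<otimes>\<^bsub>N\<^esub> v)) W) U"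
proof -
  note mM = assoc_algebra_module[OF assms(1)] and mN = assoc_algebra_module[OF assms(2)]
  note T = tensor_algebra[OF assms(1,2)]
  note L = lin_tlift[OF mM mN assms(3,4)]
  note c = mult_closed[OF assms(1)] mult_closed[OF assms(2)] tens_closed[OF mM mN]
  have b1: "bil R M N P (\<lambda>u v. b (x \<otimes>\<^bsub>M\<^esub> u) (y \<otimes>\<^bsub>N\<^esub> v))" if "x \<in> carrier M" "y \<in> carrier N" for x y
    by (rule bilI; rule lin_comp[OF lin_mult_left[OF assms(2)] bil_right[OF assms(4)]] lin_comp[OF lin_mult_left[OF assms(1)] bil_left[OF assms(4)]])
      (simp_all add: that c)
  have b2: "bil R M N P (\<lambda>x y. tlift R P (\<lambda>u v. b (x \<otimes>\<^bsub>M\<^esub> u) (y \<otimes>\<^bsub>N\<^esub> v)) W)" 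
  proof (rule bilI)
    show "lin N P (\<lambda>n. tlift R P (\<lambda>u v. b (m \<otimes>\<^bsub>M\<^esub> u) (n \<otimes>\<^bsub>N\<^esub> v)) W)" if "m \<in> carrier M" for m
      by (rule lin_tlift_fun[OF mN mM mN assms(3,6) b1[OF that]], assumption)
        (rule lin_comp[OF lin_mult_right[OF assms(2)] bil_right[OF assms(4)]], simp_all add: that c)
    show "lin M P (\<lambda>m. tlift R P (\<lambda>u v. b (m \<otimes>\<^bsub>M\<^esub> u) (n \<otimes>\<^bsub>N\<^esub> v)) W)" if "n \<in> carrier N" for n
      by (rule lin_tlift_fun[OF mM mM mN assms(3,6) b1[OF _ that]], assumption)
        (rule lin_comp[OF lin_mult_right[OF assms(1)] bil_left[OF assms(4)]], simp_all add: that c)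
  qed
  show ?thesis
  proof (rule tensor_lin_eq[OF mM mN assms(3) _ lin_tlift[OF mM mN assms(3) b2] _ assms(5)])
    show "lin (tensor R M N) P (\<lambda>U. tlift R P b (U \<otimes>\<^bsub>tensor R M N\<^esub> W))"
      by (rule lin_comp[OF lin_mult_right[OF T(1) assms(6)] L])
    fix m n assume mn: "m \<in> carrier M" "n \<in> carrier N"
    have "tlift R P b (tens R M N m n \<otimes>\<^bsub>tensor R M N\<^esub> W) = tlift R P (\<lambda>u v. b (m \<otimes>\<^bsub>M\<^esub> u) (n \<otimes>\<^bsub>N\<^esub> v)) W"
      by (rule tensor_lin_eq[OF mM mN assms(3) lin_comp[OF lin_mult_left[OF T(1) c(3)[OF mn]] L] lin_tlift[OF mM mN assms(3) b1[OF mn]] _ assms(6)])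
        (simp add: T(3) mn tlift_tens[OF mM mN assms(3,4)] tlift_tens[OF mM mN assms(3) b1[OF mn]] c)
    then show "tlift R P b (tens R M N m n \<otimes>\<^bsub>tensor R M N\<^esub> W) =
      tlift R P (\<lambda>x y. tlift R P (\<lambda>u v. b (x \<otimes>\<^bsub>M\<^esub> u) (y \<otimes>\<^bsub>N\<^esub> v)) W) (tens R M N m n)"
      by (simp add: tlift_tens[OF mM mN assms(3) b2 mn])
  qed
qed

end

context cocomm_algebra
begin

abbreviation sw where "sw P b a \<equiv> tlift R P b (\<Delta> a)"

lemma alg_A: "assoc_algebra R A" ..
lemma mod_A: "module R A" ..

lemma lin_Delta: "lin A (tensor R A A) \<Delta>" by (rule alg_hom_lin[OF comult_hom])
lemma Delta_closed [simp]: "a \<in> carrier A \<Longrightarrow> \<Delta> a \<in> carrier (tensor R A A)" by (rule lin_closed[OF lin_Delta])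
lemma lin_Delta_comp: "lin X A f \<Longrightarrow> lin X (tensor R A A) (\<lambda>x. \<Delta> (f x))" by (rule lin_comp[OF _ lin_Delta])
lemma Delta_one: "\<Delta> \<one>\<^bsub>A\<^esub> = tens R A A \<one>\<^bsub>A\<^esub> \<one>\<^bsub>A\<^esub>"
  by (simp add: alg_hom_one[OF comult_hom] tensor_algebra(2)[OF alg_A alg_A])
lemmas Delta_mult = alg_hom_mult[OF comult_hom]

lemma sw_closed: "\<lbrakk>module R P; bil R A A P b; a \<in> carrier A\<rbrakk> \<Longrightarrow> sw P b a \<in> carrier P"
  by (rule tlift_closed[OF mod_A mod_A]) auto

lemma sw_cong:
  "\<lbrakk>module R P; bil R A A P b; a \<in> carrier A; \<And>x y. \<lbrakk>x \<in> carrier A; y \<in> carrier A\<rbrakk> \<Longrightarrow> b x y = b' x y\<rbrakk> \<Longrightarrow> sw P b a = sw P b' a"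
  by (rule tlift_cong[OF mod_A mod_A]) auto

lemma sw_lin: "\<lbrakk>module R P; module R Q; bil R A A P b; a \<in> carrier A; lin P Q g\<rbrakk> \<Longrightarrow> g (sw P b a) = sw Q (\<lambda>x y. g (b x y)) a"
  by (rule lin_of_tlift[OF mod_A mod_A]) auto

lemma sw_one: "\<lbrakk>module R P; bil R A A P b\<rbrakk> \<Longrightarrow> sw P b \<one>\<^bsub>A\<^esub> = b \<one>\<^bsub>A\<^esub> \<one>\<^bsub>A\<^esub>"
  by (simp add: Delta_one tlift_tens[OF mod_A mod_A])

lemma lin_sw: "\<lbrakk>module R P; bil R A A P b; lin X A f\<rbrakk> \<Longrightarrow> lin X P (\<lambda>x. sw P b (f x))"
  by (rule lin_tlift_arg[OF mod_A mod_A]) (auto intro: lin_Delta_comp)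

lemma sw_mult:
  assumes "module R P" "bil R A A P b" "a \<in> carrier A" "a' \<in> carrier A"
  shows "sw P b (a \<otimes>\<^bsub>A\<^esub> a') = sw P (\<lambda>x y. sw P (\<lambda>u v. b (x \<otimes>\<^bsub>A\<^esub> u) (y \<otimes>\<^bsub>A\<^esub> v)) a') a"
  using tlift_mult[OF alg_A alg_A assms(1,2), of "\<Delta> a" "\<Delta> a'"] assms(3,4) by (simp add: Delta_mult)

lemma sw_cocomm:
  assumes "module R P" "bil R A A P b" "a \<in> carrier A"
  shows "sw P b a = sw P (\<lambda>x y. b y x) a"
proof -
  note mT = module_tensor[OF mod_A mod_A]
  have s: "bil R A A (tensor R A A) (\<lambda>x y. tens R A A y x)"
    using bil_tens[OF mod_A mod_A] by (auto simp: bil_def)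
  have "sw P b a = tlift R P b (tlift R (tensor R A A) (\<lambda>x y. tens R A A y x) (\<Delta> a))"
    by (simp add: cocomm assms(3))
  also have "\<dots> = sw P (\<lambda>x y. tlift R P b (tens R A A y x)) a"
    by (rule sw_lin[OF mT assms(1) s assms(3) lin_tlift[OF mod_A mod_A assms(1,2)]])
  also have "\<dots> = sw P (\<lambda>x y. b y x) a"
    by (rule sw_cong[OF assms(1) bil_lin_comp[OF s lin_tlift[OF mod_A mod_A assms(1,2)]] assms(3)])
      (simp add: tlift_tens[OF mod_A mod_A assms(1,2)])
  finally show ?thesis .
qed

lemma tril_bil:
  assumes "tril R A P t" "x \<in> carrier A"
  shows "bil R A A P (\<lambda>u v. t x u v)" "bil R A A P (\<lambda>u v. t u x v)" "bil R A A P (\<lambda>u v. t u v x)"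
  by (rule bilI; rule trilD[OF assms(1)]; use assms(2) in simp)+

lemma tril_sw_bil:
  assumes "module R P" "tril R A P t"
  shows "bil R A A P (\<lambda>x y. sw P (\<lambda>u v. t u v y) x)" "bil R A A P (\<lambda>x y. sw P (\<lambda>u v. t x u v) y)"
proof -
  note m = mod_A mod_A mod_A assms(1)
  show "bil R A A P (\<lambda>x y. sw P (\<lambda>u v. t u v y) x)"
  proof (rule bilI)
    show "lin A P (\<lambda>y. sw P (\<lambda>u v. t u v y) x)" if "x \<in> carrier A" for x
      by (rule lin_tlift_fun[OF m Delta_closed[OF that] tril_bil(3)[OF assms(2)]], assumption) (rule trilD(3)[OF assms(2)])
    show "lin A P (\<lambda>x. sw P (\<lambda>u v. t u v y) x)" if "y \<in> carrier A" for y
      by (rule lin_sw[OF assms(1) tril_bil(3)[OF assms(2) that] lin_id])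
  qed
  show "bil R A A P (\<lambda>x y. sw P (\<lambda>u v. t x u v) y)"
  proof (rule bilI)
    show "lin A P (\<lambda>x. sw P (\<lambda>u v. t x u v) y)" if "y \<in> carrier A" for y
      by (rule lin_tlift_fun[OF m Delta_closed[OF that] tril_bil(1)[OF assms(2)]], assumption) (rule trilD(1)[OF assms(2)])
    show "lin A P (\<lambda>y. sw P (\<lambda>u v. t x u v) y)" if "x \<in> carrier A" for x
      by (rule lin_sw[OF assms(1) tril_bil(1)[OF assms(2) that] lin_id])
  qed
qed

text \<open>
  Coassociativity in Sweedler form: it lets \<open>a\<^sub>(\<^sub>1\<^sub>) \<otimes> a\<^sub>(\<^sub>2\<^sub>) \<otimes> a\<^sub>(\<^sub>3\<^sub>)\<close> be split from either side inside a
  trilinear expression.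
\<close>

lemma sw_coassoc:
  assumes "module R P" "tril R A P t" "a \<in> carrier A"
  shows "sw P (\<lambda>x y. sw P (\<lambda>u v. t u v y) x) a = sw P (\<lambda>x y. sw P (\<lambda>u v. t x u v) y) a"
proof -
  note m = mod_A mod_A assms(1)
  let ?T = "tensor R A A" and ?T3 = "tensor R (tensor R A A) A"
  note mT = module_tensor[OF mod_A mod_A] and mT3 = module_tensor[OF module_tensor[OF mod_A mod_A] mod_A]
  note tb = tril_bil[OF assms(2)]
  have b: "bil R ?T A P (\<lambda>U y. tlift R P (\<lambda>u v. t u v y) U)"
  proof (rule bilI)
    show "lin A P (\<lambda>y. tlift R P (\<lambda>u v. t u v y) U)" if "U \<in> carrier ?T" for U
      by (rule lin_tlift_fun[OF mod_A m that tb(3)], assumption) (rule trilD(3)[OF assms(2)])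
    show "lin ?T P (\<lambda>U. tlift R P (\<lambda>u v. t u v y) U)" if "y \<in> carrier A" for y
      by (rule lin_tlift[OF m tb(3)[OF that]])
  qed
  let ?L = "tlift R P (\<lambda>U y. tlift R P (\<lambda>u v. t u v y) U)"
  note L = lin_tlift[OF mT mod_A assms(1) b] and Lt = tlift_tens[OF mT mod_A assms(1) b]
  have b1: "bil R A A ?T3 (\<lambda>x y. tens R ?T A (\<Delta> x) y)"
    by (intro bilI lin_tens1 lin_tens2 mT mod_A lin_Delta lin_id) auto
  have tt: "bil R A A ?T3 (\<lambda>y' z. tens R ?T A (tens R A A x y') z)" if "x \<in> carrier A" for x
    by (intro bilI lin_tens1 lin_tens2 mT mod_A lin_Delta lin_id tens_closed that)
  have b2: "bil R A A ?T3 (\<lambda>x y. tlift R ?T3 (\<lambda>y' z. tens R ?T A (tens R A A x y') z) (\<Delta> y))"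
  proof (rule bilI)
    show "lin A ?T3 (\<lambda>x. sw ?T3 (\<lambda>y' z. tens R ?T A (tens R A A x y') z) y)" if "y \<in> carrier A" for y
      by (rule lin_tlift_fun[OF mod_A mod_A mod_A mT3 Delta_closed[OF that] tt], assumption)
        (intro lin_tens1 lin_tens2 mT mod_A lin_id)
    show "lin A ?T3 (\<lambda>y. sw ?T3 (\<lambda>y' z. tens R ?T A (tens R A A x y') z) y)" if "x \<in> carrier A" for x
      by (rule lin_sw[OF mT3 tt[OF that] lin_id])
  qed
  have "sw P (\<lambda>x y. sw P (\<lambda>u v. t u v y) x) a = sw P (\<lambda>x y. ?L (tens R ?T A (\<Delta> x) y)) a"
    by (rule sw_cong[OF assms(1) tril_sw_bil(1)[OF assms(1,2)] assms(3)]) (simp add: Lt)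
  also have "\<dots> = ?L (sw ?T3 (\<lambda>x y. tens R ?T A (\<Delta> x) y) a)"
    by (rule sw_lin[OF mT3 assms(1) b1 assms(3) L, symmetric])
  also have "\<dots> = ?L (sw ?T3 (\<lambda>x y. sw ?T3 (\<lambda>y' z. tens R ?T A (tens R A A x y') z) y) a)"
    by (simp only: coassoc[OF assms(3)])
  also have "\<dots> = sw P (\<lambda>x y. ?L (sw ?T3 (\<lambda>y' z. tens R ?T A (tens R A A x y') z) y)) a"
    by (rule sw_lin[OF mT3 assms(1) b2 assms(3) L])
  also have "\<dots> = sw P (\<lambda>x y. sw P (\<lambda>u v. t x u v) y) a"
  proof (rule sw_cong[OF assms(1) bil_lin_comp[OF b2 L] assms(3)])
    fix x y assume xy: "x \<in> carrier A" "y \<in> carrier A"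
    have "?L (sw ?T3 (\<lambda>y' z. tens R ?T A (tens R A A x y') z) y) = sw P (\<lambda>y' z. ?L (tens R ?T A (tens R A A x y') z)) y"
      by (rule sw_lin[OF mT3 assms(1) tt[OF xy(1)] xy(2) L])
    also have "\<dots> = sw P (\<lambda>u v. t x u v) y"
      by (rule sw_cong[OF assms(1) bil_lin_comp[OF tt[OF xy(1)] L] xy(2)])
        (simp add: Lt tens_closed[OF mod_A mod_A] xy tlift_tens[OF m tb(3)])
    finally show "?L (sw ?T3 (\<lambda>y' z. tens R ?T A (tens R A A x y') z) y) = sw P (\<lambda>u v. t x u v) y" .
  qed
  finally show ?thesis .
qed

lemma tril_swap: "tril R A P t \<Longrightarrow> tril R A P (\<lambda>x y z. t y x z)"
  by (auto simp: tril_def)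

text \<open>
  The first two of three Sweedler components may be exchanged, by coassociativity and cocommutativity.
\<close>

lemma sw_left_comm:
  assumes "module R P" "tril R A P t" "a \<in> carrier A"
  shows "sw P (\<lambda>x y. sw P (\<lambda>u v. t x u v) y) a = sw P (\<lambda>x y. sw P (\<lambda>u v. t u x v) y) a"
proof -
  have "sw P (\<lambda>x y. sw P (\<lambda>u v. t x u v) y) a = sw P (\<lambda>x y. sw P (\<lambda>u v. t u v y) x) a"
    by (rule sw_coassoc[OF assms, symmetric])
  also have "\<dots> = sw P (\<lambda>x y. sw P (\<lambda>u v. t v u y) x) a"
    by (rule sw_cong[OF assms(1) tril_sw_bil(1)[OF assms(1,2)] assms(3)]) (rule sw_cocomm[OF assms(1) tril_bil(3)[OF assms(2)]])
  also have "\<dots> = sw P (\<lambda>x y. sw P (\<lambda>u v. t u x v) y) a"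
    by (rule sw_coassoc[OF assms(1) tril_swap[OF assms(2)] assms(3)])
  finally show ?thesis .
qed

end

section \<open>Presentation of the algebra by generators and relations\<close>

locale H_data = cring R + C: cocomm_algebra R A \<Delta> + VM: algebra_module R A V act
  for R :: "('k, 'r) ring_scheme" and A :: "('k, 'a, 'x) module_scheme" and \<Delta>
    and V :: "('k, 'v, 'y) module_scheme" and act +
  fixes lam :: "('a \<times> 'v \<Rightarrow> 'k) set \<Rightarrow> 'a" and kap :: "('v \<times> 'v \<Rightarrow> 'k) set \<Rightarrow> 'a \<times> 'v"
  assumes lam_linear: "lam \<in> linear_maps R (tensor R A V) A"
    and kap_linear: "kap \<in> linear_maps R (wedge R V) (dsum A V)"
begin

abbreviation T where "T \<equiv> tensor_alg R (dsum V A)"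
abbreviation H where "H \<equiv> H_alg R A \<Delta> V act lam kap"
abbreviation iA where "iA \<equiv> HA R A \<Delta> V act lam kap"
abbreviation iV where "iV \<equiv> HV R A \<Delta> V act lam kap"
abbreviation HI where "HI \<equiv> H_ideal R A \<Delta> V act lam kap"
abbreviation lm where "lm a v \<equiv> lam (tens R A V a v)"
abbreviation kA where "kA v w \<equiv> fst (kap (wdg R V v w))"
abbreviation kV where "kV v w \<equiv> snd (kap (wdg R V v w))"

lemma alg_A [simp]: "assoc_algebra R A" by (rule C.alg_A)
lemma mod_A [simp]: "module R A" by (rule C.mod_A)
lemma mod_V [simp]: "module R V" ..
lemma mod_VA: "module R (dsum V A)" by (rule module_dsum) simp_all
lemma alg_T: "assoc_algebra R T" by (rule assoc_algebra_tensor_alg[OF mod_VA])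
lemma mod_T: "module R T" by (rule assoc_algebra_module[OF alg_T])

lemma lin_TV: "lin V T (TV R A V)"
  using lin_comp[OF lin_dsum_inl[OF mod_A] lin_tgen[OF mod_VA]] by (simp add: TV_def[abs_def])
lemma lin_TA: "lin A T (TA R A V)"
  using lin_comp[OF lin_dsum_inr[OF mod_V] lin_tgen[OF mod_VA]] by (simp add: TA_def[abs_def])

lemma bil_act: "bil R A V V act"
  by (intro bilI linI) (auto simp: VM.act_closed VM.act_add_left VM.act_add_right VM.act_smult_left VM.act_smult_right)
lemma act_closed [simp]: "\<lbrakk>a \<in> carrier A; v \<in> carrier V\<rbrakk> \<Longrightarrow> act a v \<in> carrier V" by (rule VM.act_closed)
lemma lin_act: "\<lbrakk>lin X A f; v \<in> carrier V\<rbrakk> \<Longrightarrow> lin X V (\<lambda>x. act (f x) v)"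
  by (rule lin_comp[OF _ bil_left[OF bil_act]])
lemma bil_lm: "bil R A V A lm"
  by (rule bil_lin_comp[OF bil_tens[OF mod_A mod_V] lam_linear])
lemma lm_closed [simp]: "\<lbrakk>a \<in> carrier A; v \<in> carrier V\<rbrakk> \<Longrightarrow> lm a v \<in> carrier A" by (rule bil_closed[OF bil_lm])
lemma lin_lm: "\<lbrakk>lin X A f; v \<in> carrier V\<rbrakk> \<Longrightarrow> lin X A (\<lambda>x. lm (f x) v)"
  by (rule lin_comp[OF _ bil_left[OF bil_lm]])
lemma kap_closed [simp]:
  assumes "v \<in> carrier V" "w \<in> carrier V" shows "kA v w \<in> carrier A" "kV v w \<in> carrier V"
  using lin_closed[OF kap_linear wdg_closed[OF mod_V assms]] by (auto simp: dsum_simps)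

text \<open>
  The generators of \<open>H_ideal\<close>, named so that properties of the ideal can be checked on them.
\<close>

definition "H_rels =
      {TA R A V a \<otimes>\<^bsub>T\<^esub> TA R A V b \<ominus>\<^bsub>T\<^esub> TA R A V (a \<otimes>\<^bsub>A\<^esub> b) | a b. a \<in> carrier A \<and> b \<in> carrier A}
    \<union> {TA R A V \<one>\<^bsub>A\<^esub> \<ominus>\<^bsub>T\<^esub> \<one>\<^bsub>T\<^esub>}
    \<union> {(TA R A V a \<otimes>\<^bsub>T\<^esub> TV R A V v \<ominus>\<^bsub>T\<^esub> tlift R T (\<lambda>b c. TV R A V (act b v) \<otimes>\<^bsub>T\<^esub> TA R A V c) (\<Delta> a))
        \<ominus>\<^bsub>T\<^esub> TA R A V (lm a v) | a v. a \<in> carrier A \<and> v \<in> carrier V}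
    \<union> {(TV R A V v \<otimes>\<^bsub>T\<^esub> TV R A V w \<ominus>\<^bsub>T\<^esub> TV R A V w \<otimes>\<^bsub>T\<^esub> TV R A V v)
        \<ominus>\<^bsub>T\<^esub> (TA R A V (kA v w) \<oplus>\<^bsub>T\<^esub> TV R A V (kV v w)) | v w.
        v \<in> carrier V \<and> w \<in> carrier V}"

lemma HI_genideal: "HI = genideal T H_rels"
  by (simp add: H_ideal_def H_rels_def Let_def)

lemma bil_T: "v \<in> carrier V \<Longrightarrow> bil R A A T (\<lambda>b c. TV R A V (act b v) \<otimes>\<^bsub>T\<^esub> TA R A V c)"
  by (intro bilI lin_mult1 lin_mult2 alg_T lin_TA lin_comp[OF _ lin_TV] lin_act lin_id)
    (simp_all add: lin_closed[OF lin_TA] lin_closed[OF lin_TV])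

lemma H_rels_closed: "H_rels \<subseteq> carrier T"
proof -
  interpret T: assoc_algebra R T by (rule alg_T)
  interpret A: assoc_algebra R A by (rule alg_A)
  show ?thesis unfolding H_rels_def
    by (auto intro!: T.minus_closed T.m_closed T.a_closed lin_closed[OF lin_TV] lin_closed[OF lin_TA]
        C.sw_closed[OF mod_T bil_T])
qed

lemma ideal_HI: "ideal HI T"
proof -
  interpret T: assoc_algebra R T by (rule alg_T)
  show ?thesis unfolding HI_genideal by (rule T.genideal_ideal[OF H_rels_closed])
qed

lemma alg_H [simp]: "assoc_algebra R H"
  unfolding H_alg_def by (rule assoc_algebra_quot(1)[OF alg_T ideal_HI])
lemma mod_H [simp]: "module R H" by (rule assoc_algebra_module[OF alg_H])
lemma H_proj: "(\<lambda>x. HI +>\<^bsub>T\<^esub> x) \<in> alg_hom R T H"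
  unfolding H_alg_def by (rule assoc_algebra_quot(2)[OF alg_T ideal_HI])

lemma lin_iV: "lin V H iV"
  using lin_comp[OF lin_TV alg_hom_lin[OF H_proj]] by (simp add: HV_def[abs_def])
lemma lin_iA: "lin A H iA"
  using lin_comp[OF lin_TA alg_hom_lin[OF H_proj]] by (simp add: HA_def[abs_def])
lemma iV_closed [simp]: "v \<in> carrier V \<Longrightarrow> iV v \<in> carrier H" by (rule lin_closed[OF lin_iV])
lemma iA_closed [simp]: "a \<in> carrier A \<Longrightarrow> iA a \<in> carrier H" by (rule lin_closed[OF lin_iA])
lemma lin_iV_comp: "lin X V f \<Longrightarrow> lin X H (\<lambda>x. iV (f x))" by (rule lin_comp[OF _ lin_iV])
lemma lin_iA_comp: "lin X A f \<Longrightarrow> lin X H (\<lambda>x. iA (f x))" by (rule lin_comp[OF _ lin_iA])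

lemma H_proj_rel: "x \<in> H_rels \<Longrightarrow> HI +>\<^bsub>T\<^esub> x = \<zero>\<^bsub>H\<^esub>"
proof -
  assume x: "x \<in> H_rels"
  interpret T: assoc_algebra R T by (rule alg_T)
  interpret Q: quotient_module R T HI
    by (intro quotient_module.intro quotient_module_axioms.intro T.module_axioms ideal_submodule alg_T ideal_HI)
  have "x \<in> HI" using x T.genideal_self[OF H_rels_closed] by (auto simp: HI_genideal)
  then show ?thesis by (simp add: Q.coset_zero H_alg_def quot_alg_simps)
qed

lemma bil_H: "v \<in> carrier V \<Longrightarrow> bil R A A H (\<lambda>b c. iV (act b v) \<otimes>\<^bsub>H\<^esub> iA c)"
  by (intro bilI lin_mult1 lin_mult2 alg_H lin_iV_comp lin_iA_comp lin_act lin_id) simp_all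

lemma iA_mult:
  assumes "a \<in> carrier A" "b \<in> carrier A" shows "iA (a \<otimes>\<^bsub>A\<^esub> b) = iA a \<otimes>\<^bsub>H\<^esub> iA b"
proof -
  interpret H: assoc_algebra R H by (rule alg_H)
  interpret A: assoc_algebra R A by (rule alg_A)
  note c = lin_closed[OF lin_TA] lin_closed[OF lin_TV] mult_closed[OF alg_T]
  have "HI +>\<^bsub>T\<^esub> (TA R A V a \<otimes>\<^bsub>T\<^esub> TA R A V b \<ominus>\<^bsub>T\<^esub> TA R A V (a \<otimes>\<^bsub>A\<^esub> b)) = \<zero>\<^bsub>H\<^esub>"
    by (rule H_proj_rel) (use assms in \<open>auto simp: H_rels_def\<close>)
  then have "iA a \<otimes>\<^bsub>H\<^esub> iA b \<ominus>\<^bsub>H\<^esub> iA (a \<otimes>\<^bsub>A\<^esub> b) = \<zero>\<^bsub>H\<^esub>"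
    using assms by (simp add: lin_minus[OF mod_T mod_H alg_hom_lin[OF H_proj]] alg_hom_mult[OF H_proj] c HA_def)
  then show ?thesis using assms by (simp add: H.diff_eq_zero_iff)
qed

lemma iA_one: "iA \<one>\<^bsub>A\<^esub> = \<one>\<^bsub>H\<^esub>"
proof -
  interpret H: assoc_algebra R H by (rule alg_H)
  interpret T: assoc_algebra R T by (rule alg_T)
  interpret A: assoc_algebra R A by (rule alg_A)
  note c = lin_closed[OF lin_TA]
  have "HI +>\<^bsub>T\<^esub> (TA R A V \<one>\<^bsub>A\<^esub> \<ominus>\<^bsub>T\<^esub> \<one>\<^bsub>T\<^esub>) = \<zero>\<^bsub>H\<^esub>"
    by (rule H_proj_rel) (auto simp: H_rels_def)
  then have "iA \<one>\<^bsub>A\<^esub> \<ominus>\<^bsub>H\<^esub> \<one>\<^bsub>H\<^esub> = \<zero>\<^bsub>H\<^esub>"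
    by (simp add: lin_minus[OF mod_T mod_H alg_hom_lin[OF H_proj]] alg_hom_one[OF H_proj] c HA_def)
  then show ?thesis by (simp add: H.diff_eq_zero_iff)
qed

lemma rel_av:
  assumes "a \<in> carrier A" "v \<in> carrier V"
  shows "iA a \<otimes>\<^bsub>H\<^esub> iV v = tlift R H (\<lambda>b c. iV (act b v) \<otimes>\<^bsub>H\<^esub> iA c) (\<Delta> a) \<oplus>\<^bsub>H\<^esub> iA (lm a v)"
proof -
  interpret H: assoc_algebra R H by (rule alg_H)
  interpret T: assoc_algebra R T by (rule alg_T)
  note c = lin_closed[OF lin_TA] lin_closed[OF lin_TV] mult_closed[OF alg_T] C.sw_closed[OF mod_T bil_T]
  have e: "HI +>\<^bsub>T\<^esub> (tlift R T (\<lambda>b c. TV R A V (act b v) \<otimes>\<^bsub>T\<^esub> TA R A V c) (\<Delta> a)) = tlift R H (\<lambda>b c. iV (act b v) \<otimes>\<^bsub>H\<^esub> iA c) (\<Delta> a)"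
    unfolding C.sw_lin[OF mod_T mod_H bil_T[OF assms(2)] assms(1) alg_hom_lin[OF H_proj]]
    by (rule C.sw_cong[OF mod_H bil_lin_comp[OF bil_T[OF assms(2)] alg_hom_lin[OF H_proj]] assms(1)])
      (simp add: alg_hom_mult[OF H_proj] c assms HA_def HV_def)
  have "HI +>\<^bsub>T\<^esub> ((TA R A V a \<otimes>\<^bsub>T\<^esub> TV R A V v \<ominus>\<^bsub>T\<^esub> tlift R T (\<lambda>b c. TV R A V (act b v) \<otimes>\<^bsub>T\<^esub> TA R A V c) (\<Delta> a))
        \<ominus>\<^bsub>T\<^esub> TA R A V (lm a v)) = \<zero>\<^bsub>H\<^esub>"
    by (rule H_proj_rel) (use assms in \<open>auto simp: H_rels_def\<close>)
  then have "(iA a \<otimes>\<^bsub>H\<^esub> iV v \<ominus>\<^bsub>H\<^esub> tlift R H (\<lambda>b c. iV (act b v) \<otimes>\<^bsub>H\<^esub> iA c) (\<Delta> a)) \<ominus>\<^bsub>H\<^esub> iA (lm a v) = \<zero>\<^bsub>H\<^esub>"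
    using assms by (simp add: lin_minus[OF mod_T mod_H alg_hom_lin[OF H_proj]] alg_hom_mult[OF H_proj] c HA_def[symmetric] HV_def[symmetric] e)
  then show ?thesis using assms by (intro H.diff_diff_zeroD) (simp_all add: C.sw_closed[OF mod_H bil_H])
qed

lemma rel_vv:
  assumes "v \<in> carrier V" "w \<in> carrier V"
  shows "iV v \<otimes>\<^bsub>H\<^esub> iV w \<ominus>\<^bsub>H\<^esub> iV w \<otimes>\<^bsub>H\<^esub> iV v = iA (kA v w) \<oplus>\<^bsub>H\<^esub> iV (kV v w)"
proof -
  interpret H: assoc_algebra R H by (rule alg_H)
  interpret T: assoc_algebra R T by (rule alg_T)
  note c = lin_closed[OF lin_TA] lin_closed[OF lin_TV] mult_closed[OF alg_T]
  have "HI +>\<^bsub>T\<^esub> ((TV R A V v \<otimes>\<^bsub>T\<^esub> TV R A V w \<ominus>\<^bsub>T\<^esub> TV R A V w \<otimes>\<^bsub>T\<^esub> TV R A V v)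
        \<ominus>\<^bsub>T\<^esub> (TA R A V (kA v w) \<oplus>\<^bsub>T\<^esub> TV R A V (kV v w))) = \<zero>\<^bsub>H\<^esub>"
    by (rule H_proj_rel) (use assms in \<open>auto simp: H_rels_def\<close>)
  then have "(iV v \<otimes>\<^bsub>H\<^esub> iV w \<ominus>\<^bsub>H\<^esub> iV w \<otimes>\<^bsub>H\<^esub> iV v) \<ominus>\<^bsub>H\<^esub> (iA (kA v w) \<oplus>\<^bsub>H\<^esub> iV (kV v w)) = \<zero>\<^bsub>H\<^esub>"
    using assms by (simp add: lin_minus[OF mod_T mod_H alg_hom_lin[OF H_proj]] lin_add[OF alg_hom_lin[OF H_proj]] alg_hom_mult[OF H_proj] c HA_def[symmetric] HV_def[symmetric])
  then show ?thesis using assms by (simp add: H.diff_eq_zero_iff)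
qed

text \<open>
  \<open>V\<close> and \<open>A\<close> together generate the tensor algebra on \<open>V \<oplus> A\<close>, which maps onto \<open>H\<close>.
\<close>

lemma generates_H: "generates R H (iV ` carrier V \<union> iA ` carrier A)"
proof -
  interpret H: assoc_algebra R H by (rule alg_H)
  interpret T: assoc_algebra R T by (rule alg_T)
  have g: "generates R H ((\<lambda>m. HI +>\<^bsub>T\<^esub> tgen R (dsum V A) m) ` carrier (dsum V A))"
    using generates_image[OF generates_tensor_alg[OF mod_VA] alg_T alg_H H_proj]
    by (simp add: image_image H_alg_def coset_surj)
  have e: "HI +>\<^bsub>T\<^esub> tgen R (dsum V A) (v, a) = iV v \<oplus>\<^bsub>H\<^esub> iA a" if "v \<in> carrier V" "a \<in> carrier A" for v a
  proof -
    interpret V: module R V by simp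
    interpret A: module R A by simp
    have "(v, a) = (v, \<zero>\<^bsub>A\<^esub>) \<oplus>\<^bsub>dsum V A\<^esub> (\<zero>\<^bsub>V\<^esub>, a)" using that by (simp add: dsum_simps)
    then show ?thesis
      using that lin_add[OF lin_comp[OF lin_tgen[OF mod_VA] alg_hom_lin[OF H_proj]], of "(v, \<zero>\<^bsub>A\<^esub>)" "(\<zero>\<^bsub>V\<^esub>, a)"]
      by (simp add: dsum_simps HA_def HV_def TA_def TV_def)
  qed
  show ?thesis unfolding generates_def
  proof (intro conjI allI impI)
    fix N assume N: "submodule N R H" "\<one>\<^bsub>H\<^esub> \<in> N" "\<forall>g\<in>iV ` carrier V \<union> iA ` carrier A. \<forall>x\<in>N. g \<otimes>\<^bsub>H\<^esub> x \<in> N"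
    have "(iV v \<oplus>\<^bsub>H\<^esub> iA a) \<otimes>\<^bsub>H\<^esub> x \<in> N" if "v \<in> carrier V" "a \<in> carrier A" "x \<in> N" for v a x
    proof -
      have "x \<in> carrier H" using H.submoduleE(1)[OF N(1)] that by auto
      moreover have "iV v \<otimes>\<^bsub>H\<^esub> x \<in> N" "iA a \<otimes>\<^bsub>H\<^esub> x \<in> N" using N(3) that by auto
      ultimately show ?thesis using H.submoduleE(5)[OF N(1)] that by (simp add: H.l_distr)
    qed
    then have "\<forall>g\<in>(\<lambda>m. HI +>\<^bsub>T\<^esub> tgen R (dsum V A) m) ` carrier (dsum V A). \<forall>x\<in>N. g \<otimes>\<^bsub>H\<^esub> x \<in> N"
      by (auto simp: dsum_simps e)
    then show "carrier H \<subseteq> N" using g N(1,2) unfolding generates_def by blast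
  qed auto
qed

text \<open>The universal property of the presentation.\<close>

lemma H_lift:
  assumes B: "assoc_algebra R B" and f: "lin V B f" and g: "lin A B g"
    and gm: "\<And>a b. \<lbrakk>a \<in> carrier A; b \<in> carrier A\<rbrakk> \<Longrightarrow> g (a \<otimes>\<^bsub>A\<^esub> b) = g a \<otimes>\<^bsub>B\<^esub> g b"
    and g1: "g \<one>\<^bsub>A\<^esub> = \<one>\<^bsub>B\<^esub>"
    and av: "\<And>a v. \<lbrakk>a \<in> carrier A; v \<in> carrier V\<rbrakk> \<Longrightarrow>
      g a \<otimes>\<^bsub>B\<^esub> f v = tlift R B (\<lambda>b c. f (act b v) \<otimes>\<^bsub>B\<^esub> g c) (\<Delta> a) \<oplus>\<^bsub>B\<^esub> g (lm a v)"
    and vv: "\<And>v w. \<lbrakk>v \<in> carrier V; w \<in> carrier V\<rbrakk> \<Longrightarrow>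
      f v \<otimes>\<^bsub>B\<^esub> f w \<ominus>\<^bsub>B\<^esub> f w \<otimes>\<^bsub>B\<^esub> f v = g (kA v w) \<oplus>\<^bsub>B\<^esub> f (kV v w)"
  obtains h where "h \<in> alg_hom R H B" "\<And>v. v \<in> carrier V \<Longrightarrow> h (iV v) = f v" "\<And>a. a \<in> carrier A \<Longrightarrow> h (iA a) = g a"
proof -
  interpret B: assoc_algebra R B by fact
  interpret T: assoc_algebra R T by (rule alg_T)
  interpret A: assoc_algebra R A by simp
  interpret V: module R V by simp
  have l: "lin (dsum V A) B (\<lambda>x. f (fst x) \<oplus>\<^bsub>B\<^esub> g (snd x))"
    by (intro lin_plus B.module_axioms lin_comp[OF lin_dsum_fst f] lin_comp[OF lin_dsum_snd g])
  obtain h where h: "h \<in> alg_hom R T B" "\<And>m. m \<in> carrier (dsum V A) \<Longrightarrow> h (tgen R (dsum V A) m) = f (fst m) \<oplus>\<^bsub>B\<^esub> g (snd m)"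
    by (rule tensor_alg_lift[OF mod_VA B l]) blast
  have fg0: "f \<zero>\<^bsub>V\<^esub> = \<zero>\<^bsub>B\<^esub>" "g \<zero>\<^bsub>A\<^esub> = \<zero>\<^bsub>B\<^esub>"
    by (rule lin_zero[OF _ B.module_axioms f] lin_zero[OF _ B.module_axioms g], simp)+
  have hV: "h (TV R A V v) = f v" if "v \<in> carrier V" for v
    using that by (simp add: TV_def h(2) dsum_simps fg0 lin_closed[OF f])
  have hA: "h (TA R A V a) = g a" if "a \<in> carrier A" for a
    using that by (simp add: TA_def h(2) dsum_simps fg0 lin_closed[OF g])
  note c = lin_closed[OF lin_TA] lin_closed[OF lin_TV] mult_closed[OF alg_T] C.sw_closed[OF mod_T bil_T] lin_closed[OF f] lin_closed[OF g]
  note hl = lin_minus[OF mod_T B.module_axioms alg_hom_lin[OF h(1)]] lin_add[OF alg_hom_lin[OF h(1)]] alg_hom_mult[OF h(1)] alg_hom_one[OF h(1)]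
  have e: "h (tlift R T (\<lambda>b c. TV R A V (act b v) \<otimes>\<^bsub>T\<^esub> TA R A V c) (\<Delta> a)) = tlift R B (\<lambda>b c. f (act b v) \<otimes>\<^bsub>B\<^esub> g c) (\<Delta> a)"
    if "a \<in> carrier A" "v \<in> carrier V" for a v
    unfolding C.sw_lin[OF mod_T B.module_axioms bil_T[OF that(2)] that(1) alg_hom_lin[OF h(1)]]
    by (rule C.sw_cong[OF B.module_axioms bil_lin_comp[OF bil_T[OF that(2)] alg_hom_lin[OF h(1)]] that(1)])
      (simp add: hl c that hV hA)
  have bc: "tlift R B (\<lambda>b c. f (act b v) \<otimes>\<^bsub>B\<^esub> g c) (\<Delta> a) \<in> carrier B" if "a \<in> carrier A" "v \<in> carrier V" for a v
    using lin_closed[OF alg_hom_lin[OF h(1)] c(4)[OF that(2,1)]] by (simp add: e that)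
  have k: "h x = \<zero>\<^bsub>B\<^esub>" if "x \<in> HI" for x
  proof (rule alg_hom_genideal[OF alg_T B h(1) H_rels_closed _ that[unfolded HI_genideal]])
    fix s assume "s \<in> H_rels"
    then show "h s = \<zero>\<^bsub>B\<^esub>" unfolding H_rels_def
    proof (elim UnE CollectE exE conjE singletonE)
      fix a b assume "s = TA R A V a \<otimes>\<^bsub>T\<^esub> TA R A V b \<ominus>\<^bsub>T\<^esub> TA R A V (a \<otimes>\<^bsub>A\<^esub> b)" "a \<in> carrier A" "b \<in> carrier A"
      then show ?thesis by (simp add: hl c hA gm B.diff_eq_zero_iff)
    next
      assume "s = TA R A V \<one>\<^bsub>A\<^esub> \<ominus>\<^bsub>T\<^esub> \<one>\<^bsub>T\<^esub>"
      then show ?thesis by (simp add: hl c hA g1 B.diff_eq_zero_iff)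
    next
      fix a v assume s: "s = TA R A V a \<otimes>\<^bsub>T\<^esub> TV R A V v \<ominus>\<^bsub>T\<^esub> tlift R T (\<lambda>b c. TV R A V (act b v) \<otimes>\<^bsub>T\<^esub> TA R A V c) (\<Delta> a)
        \<ominus>\<^bsub>T\<^esub> TA R A V (lm a v)" and a: "a \<in> carrier A" "v \<in> carrier V"
      have "h s = (tlift R B (\<lambda>b c. f (act b v) \<otimes>\<^bsub>B\<^esub> g c) (\<Delta> a) \<oplus>\<^bsub>B\<^esub> g (lm a v)) \<ominus>\<^bsub>B\<^esub> tlift R B (\<lambda>b c. f (act b v) \<otimes>\<^bsub>B\<^esub> g c) (\<Delta> a) \<ominus>\<^bsub>B\<^esub> g (lm a v)"
        using a by (simp add: s hl c hA hV av e)
      also have "\<dots> = \<zero>\<^bsub>B\<^esub>"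
      proof -
        have "(p \<oplus>\<^bsub>B\<^esub> q) \<ominus>\<^bsub>B\<^esub> p \<ominus>\<^bsub>B\<^esub> q = \<zero>\<^bsub>B\<^esub>" if "p \<in> carrier B" "q \<in> carrier B" for p q
          using that by (simp add: B.a_comm[of p q] a_minus_def B.a_assoc B.r_neg)
        then show ?thesis using bc[OF a] a c by simp
      qed
      finally show ?thesis .
    next
      fix v w assume "s = TV R A V v \<otimes>\<^bsub>T\<^esub> TV R A V w \<ominus>\<^bsub>T\<^esub> TV R A V w \<otimes>\<^bsub>T\<^esub> TV R A V v
        \<ominus>\<^bsub>T\<^esub> (TA R A V (kA v w) \<oplus>\<^bsub>T\<^esub> TV R A V (kV v w))" "v \<in> carrier V" "w \<in> carrier V"
      then show ?thesis by (simp add: hl c hA hV vv B.diff_eq_zero_iff)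
    qed
  qed
  note q = alg_hom_qlift[OF alg_T ideal_HI B h(1) k]
  show thesis
    by (rule that[of "qlift h"]) (use q c hV hA in \<open>auto simp: H_alg_def HV_def HA_def\<close>)
qed

end

section \<open>The coproduct\<close>

context cring
begin

text \<open>
  Both sides of the coassociativity axiom are algebra maps in the argument, so that coassociativity can be
  checked on generators. The second map is the identity tensored with \<open>D\<close>, followed by moving the brackets.
\<close>

lemma assoc_homs:
  assumes B: "assoc_algebra R B" and D: "D \<in> alg_hom R B (tensor R B B)"
  defines "T3 \<equiv> tensor R (tensor R B B) B"
  shows "tlift R T3 (\<lambda>x y. tens R (tensor R B B) B (D x) y) \<in> alg_hom R (tensor R B B) T3"
    and "bil R B B T3 (\<lambda>x y. tens R (tensor R B B) B (D x) y)"
    and "tlift R T3 (\<lambda>x y. tlift R T3 (\<lambda>y' z. tens R (tensor R B B) B (tens R B B x y') z) (D y)) \<in> alg_hom R (tensor R B B) T3"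
    and "bil R B B T3 (\<lambda>x y. tlift R T3 (\<lambda>y' z. tens R (tensor R B B) B (tens R B B x y') z) (D y))"
    and "\<And>x. x \<in> carrier B \<Longrightarrow> bil R B B T3 (\<lambda>y' z. tens R (tensor R B B) B (tens R B B x y') z)"
proof -
  let ?BB = "tensor R B B"
  note BB = tensor_algebra[OF B B]
  note mB = assoc_algebra_module[OF B] and mBB = assoc_algebra_module[OF BB(1)]
  note T3a = tensor_algebra[OF BB(1) B, folded T3_def]
  note mT3 = assoc_algebra_module[OF T3a(1)]
  interpret B: assoc_algebra R B by fact
  interpret T3: assoc_algebra R T3 by (rule T3a(1))
  note Dl = alg_hom_lin[OF D] and Dc = alg_hom_closed[OF D]
  note c = tens_closed[OF mBB mB, folded T3_def] tens_closed[OF mB mB]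
  note l3 = lin_tens1[OF mBB mB, folded T3_def] lin_tens2[OF mBB mB, folded T3_def]
  note l2 = lin_tens1[OF mB mB] lin_tens2[OF mB mB]
  show b1: "bil R B B T3 (\<lambda>x y. tens R ?BB B (D x) y)"
    by (intro bilI l3 Dl lin_id Dc)
  show "tlift R T3 (\<lambda>x y. tens R ?BB B (D x) y) \<in> alg_hom R ?BB T3"
    by (rule tlift_alg_hom[OF B B T3a(1) b1]) (simp_all add: alg_hom_one[OF D] T3a(2) alg_hom_mult[OF D] T3a(3) Dc)
  show tb: "bil R B B T3 (\<lambda>y' z. tens R ?BB B (tens R B B x y') z)" if "x \<in> carrier B" for x
    by (intro bilI l3 l2 lin_id c that)
  let ?p = "\<lambda>x U. tlift R T3 (\<lambda>y' z. tens R ?BB B (tens R B B x y') z) U"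
  let ?X = "\<lambda>x. tens R ?BB B (tens R B B x \<one>\<^bsub>B\<^esub>) \<one>\<^bsub>B\<^esub>"
  note pl = lin_tlift[OF mB mB mT3 tb] and pt = tlift_tens[OF mB mB mT3 tb]
  show b2: "bil R B B T3 (\<lambda>x y. ?p x (D y))"
  proof (rule bilI)
    show "lin B T3 (\<lambda>x. ?p x (D y))" if "y \<in> carrier B" for y
      by (rule lin_tlift_fun[OF mB mB mB mT3 Dc[OF that] tb], assumption) (intro l3 l2 lin_id)
    show "lin B T3 (\<lambda>y. ?p x (D y))" if "x \<in> carrier B" for x
      by (rule lin_comp[OF Dl pl[OF that]])
  qed
  have ph: "?p \<one>\<^bsub>B\<^esub> \<in> alg_hom R ?BB T3"
    by (rule tlift_alg_hom[OF B B T3a(1) tb[OF B.one_closed]]) (simp_all add: T3a(2,3) BB(2,3) c)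
  have Xc: "?X x \<in> carrier T3" if "x \<in> carrier B" for x using that by (simp add: c)
  have pX: "?p x U = ?X x \<otimes>\<^bsub>T3\<^esub> ?p \<one>\<^bsub>B\<^esub> U" if "x \<in> carrier B" "U \<in> carrier ?BB" for x U
    by (rule tensor_lin_eq[OF mB mB mT3 pl[OF that(1)] lin_mult2[OF T3a(1) pl[OF B.one_closed] Xc[OF that(1)]] _ that(2)])
      (simp add: pt that c T3a(3) BB(3))
  have comm: "?X x \<otimes>\<^bsub>T3\<^esub> ?p \<one>\<^bsub>B\<^esub> U = ?p \<one>\<^bsub>B\<^esub> U \<otimes>\<^bsub>T3\<^esub> ?X x" if "x \<in> carrier B" "U \<in> carrier ?BB" for x U
    by (rule tensor_lin_eq[OF mB mB mT3 lin_mult2[OF T3a(1) pl[OF B.one_closed] Xc[OF that(1)]] lin_mult1[OF T3a(1) pl[OF B.one_closed] Xc[OF that(1)]] _ that(2)])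
      (simp add: pt that c T3a(3) BB(3))
  note pc = lin_closed[OF pl]
  show "tlift R T3 (\<lambda>x y. ?p x (D y)) \<in> alg_hom R ?BB T3"
  proof (rule tlift_alg_hom[OF B B T3a(1) b2])
    show "?p \<one>\<^bsub>B\<^esub> (D \<one>\<^bsub>B\<^esub>) = \<one>\<^bsub>T3\<^esub>" by (simp add: alg_hom_one[OF D] alg_hom_one[OF ph])
    fix x y x' y' assume a: "x \<in> carrier B" "y \<in> carrier B" "x' \<in> carrier B" "y' \<in> carrier B"
    let ?i = "?p \<one>\<^bsub>B\<^esub>"
    have XX: "?X (x \<otimes>\<^bsub>B\<^esub> x') = ?X x \<otimes>\<^bsub>T3\<^esub> ?X x'" using a by (simp add: T3a(3) BB(3) c)
    have k: "?X x \<in> carrier T3" "?X x' \<in> carrier T3" "?i (D y) \<in> carrier T3" "?i (D y') \<in> carrier T3"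
      using a by (simp_all add: Xc pc Dc)
    have "?p (x \<otimes>\<^bsub>B\<^esub> x') (D (y \<otimes>\<^bsub>B\<^esub> y')) = (?X x \<otimes>\<^bsub>T3\<^esub> ?X x') \<otimes>\<^bsub>T3\<^esub> (?i (D y) \<otimes>\<^bsub>T3\<^esub> ?i (D y'))"
      using pX[of "x \<otimes>\<^bsub>B\<^esub> x'" "D (y \<otimes>\<^bsub>B\<^esub> y')"] a by (simp only: XX B.m_closed Dc alg_hom_mult[OF D] alg_hom_mult[OF ph] mult_closed[OF BB(1)])
    also have "\<dots> = ?X x \<otimes>\<^bsub>T3\<^esub> (?X x' \<otimes>\<^bsub>T3\<^esub> ?i (D y)) \<otimes>\<^bsub>T3\<^esub> ?i (D y')" using k by (simp add: T3.m_assoc)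
    also have "\<dots> = ?X x \<otimes>\<^bsub>T3\<^esub> (?i (D y) \<otimes>\<^bsub>T3\<^esub> ?X x') \<otimes>\<^bsub>T3\<^esub> ?i (D y')" using comm a by (simp only: Dc)
    also have "\<dots> = (?X x \<otimes>\<^bsub>T3\<^esub> ?i (D y)) \<otimes>\<^bsub>T3\<^esub> (?X x' \<otimes>\<^bsub>T3\<^esub> ?i (D y'))" using k by (simp add: T3.m_assoc)
    also have "\<dots> = ?p x (D y) \<otimes>\<^bsub>T3\<^esub> ?p x' (D y')" using pX a by (simp only: Dc)
    finally show "?p (x \<otimes>\<^bsub>B\<^esub> x') (D (y \<otimes>\<^bsub>B\<^esub> y')) = ?p x (D y) \<otimes>\<^bsub>T3\<^esub> ?p x' (D y')" .
  qed
qed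

text \<open>An element is primitive if and only if its coproduct is this expression.\<close>

definition prim where "prim B x = tens R B B \<one>\<^bsub>B\<^esub> x \<oplus>\<^bsub>tensor R B B\<^esub> tens R B B x \<one>\<^bsub>B\<^esub>"

lemma lin_prim: assumes "assoc_algebra R B" shows "lin B (tensor R B B) (prim B)"
proof -
  interpret B: assoc_algebra R B by fact
  note m = B.module_axioms
  have "lin B (tensor R B B) (\<lambda>x. tens R B B \<one>\<^bsub>B\<^esub> x \<oplus>\<^bsub>tensor R B B\<^esub> tens R B B x \<one>\<^bsub>B\<^esub>)"
    by (intro lin_plus lin_tens1 lin_tens2 m module_tensor lin_id) auto
  then show ?thesis by (simp add: prim_def[abs_def])
qed

text \<open>
  The mixed terms \<open>x \<otimes> y\<close> and \<open>y \<otimes> x\<close> occur in both products and cancel.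
\<close>

lemma prim_bracket:
  assumes B: "assoc_algebra R B" and xy: "x \<in> carrier B" "y \<in> carrier B"
  shows "prim B x \<otimes>\<^bsub>tensor R B B\<^esub> prim B y \<ominus>\<^bsub>tensor R B B\<^esub> prim B y \<otimes>\<^bsub>tensor R B B\<^esub> prim B x
    = prim B (x \<otimes>\<^bsub>B\<^esub> y \<ominus>\<^bsub>B\<^esub> y \<otimes>\<^bsub>B\<^esub> x)"
proof -
  interpret B: assoc_algebra R B by fact
  note BB = tensor_algebra[OF B B]
  interpret BB: assoc_algebra R "tensor R B B" by (rule BB(1))
  note c = tens_closed[OF B.module_axioms B.module_axioms]
  have e: "prim B u \<otimes>\<^bsub>tensor R B B\<^esub> prim B w = (tens R B B u w \<oplus>\<^bsub>tensor R B B\<^esub> tens R B B w u) \<oplus>\<^bsub>tensor R B B\<^esub> prim B (u \<otimes>\<^bsub>B\<^esub> w)"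
    if "u \<in> carrier B" "w \<in> carrier B" for u w
    using that by (simp add: prim_def BB.l_distr BB.r_distr BB(3) c BB.a_ac)
  have cancel: "(p \<oplus>\<^bsub>tensor R B B\<^esub> q) \<ominus>\<^bsub>tensor R B B\<^esub> (p \<oplus>\<^bsub>tensor R B B\<^esub> r) = q \<ominus>\<^bsub>tensor R B B\<^esub> r"
    if "p \<in> carrier (tensor R B B)" "q \<in> carrier (tensor R B B)" "r \<in> carrier (tensor R B B)" for p q r
    using that by (simp add: a_minus_def BB.minus_add BB.a_comm[of p q] BB.a_assoc BB.r_neg2 BB.r_neg1)
  have "tens R B B y x \<oplus>\<^bsub>tensor R B B\<^esub> tens R B B x y = tens R B B x y \<oplus>\<^bsub>tensor R B B\<^esub> tens R B B y x"
    using xy c by (simp add: BB.a_comm)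
  then show ?thesis
    using xy c lin_closed[OF lin_prim[OF B]]
    by (simp add: e cancel lin_minus[OF B.module_axioms BB.module_axioms lin_prim[OF B]])
qed

end

context H_data
begin

lemma alg_HH [simp]: "assoc_algebra R (tensor R H H)" by (simp add: tensor_algebra)
lemma mod_HH [simp]: "module R (tensor R H H)" by (simp add: module_tensor)
lemma alg_AA [simp]: "assoc_algebra R (tensor R A A)" by (simp add: tensor_algebra)
lemma mod_AA [simp]: "module R (tensor R A A)" by (simp add: module_tensor)

sublocale Ha: assoc_algebra R H by (rule alg_H)
sublocale H2: assoc_algebra R "tensor R H H" by (rule alg_HH)

lemma tt_closed [simp]: "\<lbrakk>x \<in> carrier H; y \<in> carrier H\<rbrakk> \<Longrightarrow> tens R H H x y \<in> carrier (tensor R H H)"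
  by (simp add: tens_closed)
lemma ta_closed [simp]: "\<lbrakk>x \<in> carrier A; y \<in> carrier A\<rbrakk> \<Longrightarrow> tens R A A x y \<in> carrier (tensor R A A)"
  by (simp add: tens_closed)
lemma prim_closed [simp]: "x \<in> carrier H \<Longrightarrow> prim H x \<in> carrier (tensor R H H)"
  by (rule lin_closed[OF lin_prim[OF alg_H]])
lemma lin_prim_comp: "lin X H f \<Longrightarrow> lin X (tensor R H H) (\<lambda>x. prim H (f x))"
  by (rule lin_comp[OF _ lin_prim[OF alg_H]])

lemmas tensor_H = tensor_algebra[OF alg_H alg_H]

text \<open>
  The coproduct on \<open>H\<close> is prescribed on \<open>A\<close> as \<open>J \<circ> \<Delta>\<close>, and the converse directions reduce to injectivity
  of this map.
\<close>

abbreviation J where "J \<equiv> tlift R (tensor R H H) (\<lambda>b c. tens R H H (iA b) (iA c))"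

lemmas li = lin_tens1 lin_tens2 lin_mult1 lin_mult2 lin_plus lin_iV_comp lin_iA_comp lin_act lin_lm lin_prim_comp lin_id

lemma bil_J: "bil R A A (tensor R H H) (\<lambda>b c. tens R H H (iA b) (iA c))"
  by (intro bilI li) simp_all

lemma J_hom: "J \<in> alg_hom R (tensor R A A) (tensor R H H)"
  by (rule tlift_alg_hom[OF alg_A alg_A alg_HH bil_J]) (simp_all add: iA_one iA_mult tensor_H)

lemma J_tens: "\<lbrakk>a \<in> carrier A; b \<in> carrier A\<rbrakk> \<Longrightarrow> J (tens R A A a b) = tens R H H (iA a) (iA b)"
  by (rule tlift_tens[OF mod_A mod_A mod_HH bil_J])

lemmas lin_J = alg_hom_lin[OF J_hom]

definition "star_rhs a v =
  C.sw (tensor R A A) (\<lambda>b c. tens R A A (lm b v) c) a \<oplus>\<^bsub>tensor R A A\<^esub>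
  C.sw (tensor R A A) (\<lambda>b c. tens R A A b (lm c v)) a"

lemma bil_star_rhs:
  assumes "v \<in> carrier V"
  shows "bil R A A (tensor R A A) (\<lambda>b c. tens R A A (lm b v) c)" "bil R A A (tensor R A A) (\<lambda>b c. tens R A A b (lm c v))"
  using assms by (intro bilI li; simp)+

lemma star_rhs_closed [simp]: "\<lbrakk>a \<in> carrier A; v \<in> carrier V\<rbrakk> \<Longrightarrow> star_rhs a v \<in> carrier (tensor R A A)"
  unfolding star_rhs_def by (intro plus_closed C.sw_closed bil_star_rhs) simp_all

lemma star_condition_iff:
  "star_condition R A \<Delta> V lam kap \<longleftrightarrow>
    (\<forall>a\<in>carrier A. \<forall>v\<in>carrier V. \<Delta> (lm a v) = star_rhs a v) \<and>
    (\<forall>v\<in>carrier V. \<forall>w\<in>carrier V. \<Delta> (kA v w) = prim A (kA v w))"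
  by (simp add: star_condition_def star_rhs_def primitive_def prim_def)

text \<open>
  The key identity: a coproduct given by \<open>J \<circ> \<Delta>\<close> on \<open>A\<close> and primitive on \<open>V\<close> sends the two sides of the
  relation between \<open>a\<close> and \<open>v\<close> to elements that differ by the gap between \<open>\<Delta> (\<lambda>(a, v))\<close> and \<open>star_rhs\<close>, seen
  under \<open>J\<close>. The relation is applied in each tensor factor; the two action terms
  \<open>a\<^sub>(\<^sub>1\<^sub>) \<otimes> a\<^sub>(\<^sub>2\<^sub>)(v) a\<^sub>(\<^sub>3\<^sub>)\<close> and \<open>a\<^sub>(\<^sub>1\<^sub>)(v) a\<^sub>(\<^sub>2\<^sub>) \<otimes> a\<^sub>(\<^sub>3\<^sub>)\<close> recombine once \<open>a\<^sub>(\<^sub>1\<^sub>)\<close> and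
  \<open>a\<^sub>(\<^sub>2\<^sub>)\<close> are exchanged in the first, which is where cocommutativity enters.
\<close>

lemma comult_av:
  assumes a: "a \<in> carrier A" and v: "v \<in> carrier V"
  shows "J (\<Delta> a) \<otimes>\<^bsub>tensor R H H\<^esub> prim H (iV v) =
    C.sw (tensor R H H) (\<lambda>b c. prim H (iV (act b v)) \<otimes>\<^bsub>tensor R H H\<^esub> J (\<Delta> c)) a \<oplus>\<^bsub>tensor R H H\<^esub> J (star_rhs a v)"
proof -
  let ?P = "tensor R H H" and ?s = "tens R H H"
  let ?t1 = "\<lambda>x b c. ?s (iA x) (iV (act b v) \<otimes>\<^bsub>H\<^esub> iA c)"
  let ?t2 = "\<lambda>b c y. ?s (iV (act b v) \<otimes>\<^bsub>H\<^esub> iA c) (iA y)"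
  let ?t3 = "\<lambda>x y. ?s (iA x) (iA (lm y v))" and ?t4 = "\<lambda>x y. ?s (iA (lm x v)) (iA y)"
  have t1: "tril R A ?P ?t1" and t2: "tril R A ?P ?t2"
    using v by (intro trilI li; simp)+
  have t3: "bil R A A ?P ?t3" and t4: "bil R A A ?P ?t4"
    using v by (intro bilI li; simp)+
  note S = C.sw_closed[OF mod_HH] and tb1 = C.tril_bil[OF t1] and tb2 = C.tril_bil[OF t2]
  note ts1 = C.tril_sw_bil[OF mod_HH t1] and ts2 = C.tril_sw_bil[OF mod_HH t2]
  have t1': "tril R A ?P (\<lambda>x b c. ?t1 b x c)" by (rule C.tril_swap[OF t1])
  note ts1' = C.tril_sw_bil[OF mod_HH t1'] and tb1' = C.tril_bil[OF t1']
  let ?S1 = "C.sw ?P (\<lambda>x y. C.sw ?P (\<lambda>b c. ?t1 x b c) y) a"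
  let ?S3 = "C.sw ?P (\<lambda>x y. C.sw ?P (\<lambda>b c. ?t2 b c y) x) a"
  have pb: "bil R A A ?P (\<lambda>b c. f b c \<oplus>\<^bsub>?P\<^esub> g b c)" if "bil R A A ?P f" "bil R A A ?P g" for f g
    by (rule bilI; rule lin_plus[OF mod_HH]; rule bil_right[OF that(1)] bil_right[OF that(2)] bil_left[OF that(1)] bil_left[OF that(2)])
  have plus: "C.sw ?P (\<lambda>b c. f b c \<oplus>\<^bsub>?P\<^esub> g b c) d = C.sw ?P f d \<oplus>\<^bsub>?P\<^esub> C.sw ?P g d"
    if "bil R A A ?P f" "bil R A A ?P g" "d \<in> carrier A" for f g d
    by (rule tlift_plus[OF mod_A mod_A mod_HH that(1,2)]) (use that in simp)
  \<comment> \<open>The left side: \<open>v \<otimes> 1 + 1 \<otimes> v\<close> is multiplied into each tensor factor and the defining relation applied there.\<close>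
  have lp: "lin ?P ?P (\<lambda>U. U \<otimes>\<^bsub>?P\<^esub> prim H (iV v))" by (rule lin_mult_right) (use v in simp_all)
  have "J (\<Delta> a) \<otimes>\<^bsub>?P\<^esub> prim H (iV v) = C.sw ?P (\<lambda>x y. ?s (iA x) (iA y) \<otimes>\<^bsub>?P\<^esub> prim H (iV v)) a"
    by (rule C.sw_lin[OF mod_HH mod_HH bil_J a lp])
  also have "\<dots> = C.sw ?P (\<lambda>x y. (C.sw ?P (\<lambda>b c. ?t1 x b c) y \<oplus>\<^bsub>?P\<^esub> ?t3 x y) \<oplus>\<^bsub>?P\<^esub> (C.sw ?P (\<lambda>b c. ?t2 b c y) x \<oplus>\<^bsub>?P\<^esub> ?t4 x y)) a"
  proof (rule C.sw_cong[OF mod_HH bil_lin_comp[OF bil_J lp] a])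
    fix x y assume xy: "x \<in> carrier A" "y \<in> carrier A"
    have bH: "C.sw H (\<lambda>b c. iV (act b v) \<otimes>\<^bsub>H\<^esub> iA c) z \<in> carrier H" if "z \<in> carrier A" for z
      by (rule C.sw_closed[OF mod_H bil_H[OF v] that])
    have 1: "?s (iA x) (iA y \<otimes>\<^bsub>H\<^esub> iV v) = C.sw ?P (\<lambda>b c. ?t1 x b c) y \<oplus>\<^bsub>?P\<^esub> ?t3 x y"
      using C.sw_lin[OF mod_H mod_HH bil_H[OF v] xy(2) lin_tens2[OF mod_H mod_H lin_id iA_closed[OF xy(1)]]]
        lin_add[OF lin_tens2[OF mod_H mod_H lin_id iA_closed[OF xy(1)]] bH[OF xy(2)] iA_closed[OF lm_closed[OF xy(2) v]]]
      by (simp add: rel_av[OF xy(2) v])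
    have 2: "?s (iA x \<otimes>\<^bsub>H\<^esub> iV v) (iA y) = C.sw ?P (\<lambda>b c. ?t2 b c y) x \<oplus>\<^bsub>?P\<^esub> ?t4 x y"
      using C.sw_lin[OF mod_H mod_HH bil_H[OF v] xy(1) lin_tens1[OF mod_H mod_H lin_id iA_closed[OF xy(2)]]]
        lin_add[OF lin_tens1[OF mod_H mod_H lin_id iA_closed[OF xy(2)]] bH[OF xy(1)] iA_closed[OF lm_closed[OF xy(1) v]]]
      by (simp add: rel_av[OF xy(1) v])
    have "?s (iA x) (iA y) \<otimes>\<^bsub>?P\<^esub> prim H (iV v) = ?s (iA x) (iA y \<otimes>\<^bsub>H\<^esub> iV v) \<oplus>\<^bsub>?P\<^esub> ?s (iA x \<otimes>\<^bsub>H\<^esub> iV v) (iA y)"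
      using xy v by (simp add: prim_def H2.r_distr tensor_H(3))
    then show "?s (iA x) (iA y) \<otimes>\<^bsub>?P\<^esub> prim H (iV v) = (C.sw ?P (\<lambda>b c. ?t1 x b c) y \<oplus>\<^bsub>?P\<^esub> ?t3 x y) \<oplus>\<^bsub>?P\<^esub> (C.sw ?P (\<lambda>b c. ?t2 b c y) x \<oplus>\<^bsub>?P\<^esub> ?t4 x y)"
      by (simp only: 1 2)
  qed
  also have "\<dots> = (?S1 \<oplus>\<^bsub>?P\<^esub> C.sw ?P ?t3 a) \<oplus>\<^bsub>?P\<^esub> (?S3 \<oplus>\<^bsub>?P\<^esub> C.sw ?P ?t4 a)"
    by (simp only: plus[OF pb[OF ts1(2) t3] pb[OF ts2(1) t4] a] plus[OF ts1(2) t3 a] plus[OF ts2(1) t4 a])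
  finally have lhs: "J (\<Delta> a) \<otimes>\<^bsub>?P\<^esub> prim H (iV v) = (?S1 \<oplus>\<^bsub>?P\<^esub> C.sw ?P ?t3 a) \<oplus>\<^bsub>?P\<^esub> (?S3 \<oplus>\<^bsub>?P\<^esub> C.sw ?P ?t4 a)" .
  \<comment> \<open>The first sum on the right side, with the Sweedler components in the order produced by the action.\<close>
  have "C.sw ?P (\<lambda>b c. C.sw ?P (\<lambda>x y. ?t1 x b y) c \<oplus>\<^bsub>?P\<^esub> C.sw ?P (\<lambda>x y. ?t2 b x y) c) a =
      C.sw ?P (\<lambda>b c. prim H (iV (act b v)) \<otimes>\<^bsub>?P\<^esub> J (\<Delta> c)) a"
  proof (rule C.sw_cong[OF mod_HH pb[OF ts1'(2) ts2(2)] a])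
    fix b c assume bc: "b \<in> carrier A" "c \<in> carrier A"
    have l: "lin ?P ?P (\<lambda>U. prim H (iV (act b v)) \<otimes>\<^bsub>?P\<^esub> U)" by (rule lin_mult_left) (use bc v in simp_all)
    have "prim H (iV (act b v)) \<otimes>\<^bsub>?P\<^esub> J (\<Delta> c) = C.sw ?P (\<lambda>x y. prim H (iV (act b v)) \<otimes>\<^bsub>?P\<^esub> ?s (iA x) (iA y)) c"
      by (rule C.sw_lin[OF mod_HH mod_HH bil_J bc(2) l])
    also have "\<dots> = C.sw ?P (\<lambda>x y. ?t1 x b y \<oplus>\<^bsub>?P\<^esub> ?t2 b x y) c"
      by (rule C.sw_cong[OF mod_HH bil_lin_comp[OF bil_J l] bc(2)]) (use bc v in \<open>simp add: prim_def H2.l_distr tensor_H(3)\<close>)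
    also have "\<dots> = C.sw ?P (\<lambda>x y. ?t1 x b y) c \<oplus>\<^bsub>?P\<^esub> C.sw ?P (\<lambda>x y. ?t2 b x y) c"
      by (rule plus[OF tb1(2)[OF bc(1)] tb2(1)[OF bc(1)] bc(2)])
    finally show "C.sw ?P (\<lambda>x y. ?t1 x b y) c \<oplus>\<^bsub>?P\<^esub> C.sw ?P (\<lambda>x y. ?t2 b x y) c = prim H (iV (act b v)) \<otimes>\<^bsub>?P\<^esub> J (\<Delta> c)" by simp
  qed
  then have e1: "C.sw ?P (\<lambda>b c. prim H (iV (act b v)) \<otimes>\<^bsub>?P\<^esub> J (\<Delta> c)) a =
      C.sw ?P (\<lambda>b c. C.sw ?P (\<lambda>x y. ?t1 x b y) c \<oplus>\<^bsub>?P\<^esub> C.sw ?P (\<lambda>x y. ?t2 b x y) c) a" by (rule sym)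
  have e2: "C.sw ?P (\<lambda>b c. C.sw ?P (\<lambda>x y. ?t1 x b y) c \<oplus>\<^bsub>?P\<^esub> C.sw ?P (\<lambda>x y. ?t2 b x y) c) a = ?S1 \<oplus>\<^bsub>?P\<^esub> ?S3"
    by (simp only: plus[OF ts1'(2) ts2(2) a] C.sw_left_comm[OF mod_HH t1' a] C.sw_coassoc[OF mod_HH t2 a])
  have e3: "J (star_rhs a v) = C.sw ?P ?t4 a \<oplus>\<^bsub>?P\<^esub> C.sw ?P ?t3 a"
  proof -
    note bs = bil_star_rhs[OF v]
    have "J (star_rhs a v) = C.sw ?P (\<lambda>b c. J (tens R A A (lm b v) c)) a \<oplus>\<^bsub>?P\<^esub> C.sw ?P (\<lambda>b c. J (tens R A A b (lm c v))) a"
      unfolding star_rhs_def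
      by (simp add: lin_add[OF lin_J] C.sw_closed[OF mod_AA] bs a C.sw_lin[OF mod_AA mod_HH bs(1) a lin_J] C.sw_lin[OF mod_AA mod_HH bs(2) a lin_J])
    also have "C.sw ?P (\<lambda>b c. J (tens R A A (lm b v) c)) a = C.sw ?P ?t4 a"
      by (rule C.sw_cong[OF mod_HH bil_lin_comp[OF bs(1) lin_J] a]) (use v in \<open>simp add: J_tens\<close>)
    also have "C.sw ?P (\<lambda>b c. J (tens R A A b (lm c v))) a = C.sw ?P ?t3 a"
      by (rule C.sw_cong[OF mod_HH bil_lin_comp[OF bs(2) lin_J] a]) (use v in \<open>simp add: J_tens\<close>)
    finally show ?thesis .
  qed
  have ac: "(p \<oplus>\<^bsub>?P\<^esub> q) \<oplus>\<^bsub>?P\<^esub> (r \<oplus>\<^bsub>?P\<^esub> s) = (p \<oplus>\<^bsub>?P\<^esub> r) \<oplus>\<^bsub>?P\<^esub> (s \<oplus>\<^bsub>?P\<^esub> q)"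
    if "p \<in> carrier ?P" "q \<in> carrier ?P" "r \<in> carrier ?P" "s \<in> carrier ?P" for p q r s
    using that by (simp add: H2.a_ac)
  show ?thesis unfolding lhs e1 e2 e3
    by (rule ac[OF S[OF ts1(2) a] S[OF t3 a] S[OF ts2(1) a] S[OF t4 a]])
qed

lemma lin_JDelta: "lin A (tensor R H H) (\<lambda>a. J (\<Delta> a))"
  by (rule lin_comp[OF C.lin_Delta lin_J])

lemma J_prim: "a \<in> carrier A \<Longrightarrow> J (prim A a) = prim H (iA a)"
proof -
  interpret A: assoc_algebra R A by simp
  assume "a \<in> carrier A"
  then show ?thesis by (simp add: prim_def lin_add[OF lin_J] J_tens iA_one)
qed

text \<open>
  The condition says that the prescription on \<open>V\<close> and \<open>A\<close> respects the defining relations.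
\<close>

lemma comult_exists:
  assumes "star_condition R A \<Delta> V lam kap"
  obtains D where "D \<in> alg_hom R H (tensor R H H)" "\<And>v. v \<in> carrier V \<Longrightarrow> D (iV v) = prim H (iV v)"
    "\<And>a. a \<in> carrier A \<Longrightarrow> D (iA a) = J (\<Delta> a)"
proof -
  have st: "\<And>a v. \<lbrakk>a \<in> carrier A; v \<in> carrier V\<rbrakk> \<Longrightarrow> \<Delta> (lm a v) = star_rhs a v"
    "\<And>v w. \<lbrakk>v \<in> carrier V; w \<in> carrier V\<rbrakk> \<Longrightarrow> \<Delta> (kA v w) = prim A (kA v w)"
    using assms by (auto simp: star_condition_iff)
  show thesis
  proof (rule H_lift[OF alg_HH, of "\<lambda>v. prim H (iV v)" "\<lambda>a. J (\<Delta> a)"])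
    show "lin V (tensor R H H) (\<lambda>v. prim H (iV v))" by (intro li)
    show "lin A (tensor R H H) (\<lambda>a. J (\<Delta> a))" by (rule lin_JDelta)
    show "J (\<Delta> (a \<otimes>\<^bsub>A\<^esub> b)) = J (\<Delta> a) \<otimes>\<^bsub>tensor R H H\<^esub> J (\<Delta> b)" if "a \<in> carrier A" "b \<in> carrier A" for a b
      using that by (simp add: C.Delta_mult alg_hom_mult[OF J_hom])
    show "J (\<Delta> \<one>\<^bsub>A\<^esub>) = \<one>\<^bsub>tensor R H H\<^esub>" by (simp add: alg_hom_one[OF C.comult_hom] alg_hom_one[OF J_hom])
    fix v w assume "v \<in> carrier V" "w \<in> carrier V"
    then show "prim H (iV v) \<otimes>\<^bsub>tensor R H H\<^esub> prim H (iV w) \<ominus>\<^bsub>tensor R H H\<^esub> prim H (iV w) \<otimes>\<^bsub>tensor R H H\<^esub> prim H (iV v) =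
      J (\<Delta> (kA v w)) \<oplus>\<^bsub>tensor R H H\<^esub> prim H (iV (kV v w))"
      by (simp add: prim_bracket[OF alg_H] rel_vv lin_add[OF lin_prim[OF alg_H]] st J_prim)
  next
    fix a v assume "a \<in> carrier A" "v \<in> carrier V"
    then show "J (\<Delta> a) \<otimes>\<^bsub>tensor R H H\<^esub> prim H (iV v) =
      C.sw (tensor R H H) (\<lambda>b c. prim H (iV (act b v)) \<otimes>\<^bsub>tensor R H H\<^esub> J (\<Delta> c)) a \<oplus>\<^bsub>tensor R H H\<^esub> J (\<Delta> (lm a v))"
      by (simp add: comult_av st)
  qed (rule that)
qed

text \<open>
  Coassociativity and cocommutativity are equalities of algebra maps, so they follow from the same laws on
  \<open>A\<close> and from their validity for primitive elements.
\<close>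

lemma H_cocomm:
  assumes D: "D \<in> alg_hom R H (tensor R H H)" and DV: "\<And>v. v \<in> carrier V \<Longrightarrow> D (iV v) = prim H (iV v)"
    and DA: "\<And>a. a \<in> carrier A \<Longrightarrow> D (iA a) = J (\<Delta> a)"
  shows "cocomm_algebra R H D"
proof (intro cocomm_algebra.intro cocomm_algebra_axioms.intro alg_H D)
  let ?P = "tensor R H H" and ?T3 = "tensor R (tensor R H H) H"
  note ah = assoc_homs[OF alg_H D]
  note T3 = tensor_algebra[OF alg_HH alg_H]
  interpret T3: assoc_algebra R ?T3 by (rule T3(1))
  have mT3: "module R ?T3" by (rule assoc_algebra_module[OF T3(1)])
  have c3: "tens R ?P H U x \<in> carrier ?T3" if "U \<in> carrier ?P" "x \<in> carrier H" for U x
    using that by (simp add: tens_closed)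
  note Dc = alg_hom_closed[OF D]
  let ?D1 = "tlift R ?T3 (\<lambda>x y. tens R ?P H (D x) y)"
  let ?D2 = "tlift R ?T3 (\<lambda>x y. tlift R ?T3 (\<lambda>y' z. tens R ?P H (tens R H H x y') z) (D y))"
  let ?p = "\<lambda>x U. tlift R ?T3 (\<lambda>y' z. tens R ?P H (tens R H H x y') z) U"
  note d1 = tlift_tens[OF mod_H mod_H mT3 ah(2)] and d2 = tlift_tens[OF mod_H mod_H mT3 ah(4)]
  note pt = tlift_tens[OF mod_H mod_H mT3 ah(5)] and pl = lin_tlift[OF mod_H mod_H mT3 ah(5)]
  fix h assume h: "h \<in> carrier H"
  show "?D1 (D h) = ?D2 (D h)"
  proof (rule alg_hom_eq_on_gens[OF generates_H alg_H T3(1) alg_hom_comp[OF D ah(1)] alg_hom_comp[OF D ah(3)] _ h])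
    fix x assume "x \<in> iV ` carrier V \<union> iA ` carrier A"
    then show "?D1 (D x) = ?D2 (D x)"
    proof (elim UnE imageE)
      fix v assume v: "v \<in> carrier V" and x: "x = iV v"
      have 1: "D \<one>\<^bsub>H\<^esub> = tens R H H \<one>\<^bsub>H\<^esub> \<one>\<^bsub>H\<^esub>" by (simp add: alg_hom_one[OF D] tensor_H(2))
      have "?D1 (D x) = tens R ?P H (D \<one>\<^bsub>H\<^esub>) (iV v) \<oplus>\<^bsub>?T3\<^esub> tens R ?P H (D (iV v)) \<one>\<^bsub>H\<^esub>"
        using v by (simp add: x DV) (simp add: prim_def lin_add[OF alg_hom_lin[OF ah(1)]] d1 DV)
      also have "\<dots> = tens R ?P H (tens R H H \<one>\<^bsub>H\<^esub> \<one>\<^bsub>H\<^esub>) (iV v) \<oplus>\<^bsub>?T3\<^esub>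
        (tens R ?P H (tens R H H \<one>\<^bsub>H\<^esub> (iV v)) \<one>\<^bsub>H\<^esub> \<oplus>\<^bsub>?T3\<^esub> tens R ?P H (tens R H H (iV v) \<one>\<^bsub>H\<^esub>) \<one>\<^bsub>H\<^esub>)"
        using v by (simp add: DV 1 prim_def lin_add[OF lin_tens1[OF mod_HH mod_H lin_id]])
      also have "\<dots> = ?p \<one>\<^bsub>H\<^esub> (D (iV v)) \<oplus>\<^bsub>?T3\<^esub> ?p (iV v) (D \<one>\<^bsub>H\<^esub>)"
        using v by (simp add: DV 1 pt) (simp add: prim_def lin_add[OF pl] pt c3 T3.a_assoc)
      also have "\<dots> = ?D2 (D x)"
        using v by (simp add: x DV) (simp add: prim_def[of H "iV v"] lin_add[OF alg_hom_lin[OF ah(3)]] d2 DV)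
      finally show ?thesis .
    next
      fix a assume a: "a \<in> carrier A" and x: "x = iA a"
      let ?t = "\<lambda>x y z. tens R ?P H (tens R H H (iA x) (iA y)) (iA z)"
      have t: "tril R A ?T3 ?t" by (intro trilI li) simp_all
      have "?D1 (D x) = C.sw ?T3 (\<lambda>b c. ?D1 (tens R H H (iA b) (iA c))) a"
        using C.sw_lin[OF mod_HH mT3 bil_J a alg_hom_lin[OF ah(1)]] by (simp add: x DA a)
      also have "\<dots> = C.sw ?T3 (\<lambda>b c. C.sw ?T3 (\<lambda>u w. ?t u w c) b) a"
      proof (rule C.sw_cong[OF mT3 bil_lin_comp[OF bil_J alg_hom_lin[OF ah(1)]] a])
        fix b c assume bc: "b \<in> carrier A" "c \<in> carrier A"
        show "?D1 (tens R H H (iA b) (iA c)) = C.sw ?T3 (\<lambda>u w. ?t u w c) b"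
          using C.sw_lin[OF mod_HH mT3 bil_J bc(1) lin_tens1[OF mod_HH mod_H lin_id iA_closed[OF bc(2)]]] bc
          by (simp add: d1 DA)
      qed
      also have "\<dots> = C.sw ?T3 (\<lambda>b c. C.sw ?T3 (\<lambda>u w. ?t b u w) c) a"
        by (rule C.sw_coassoc[OF mT3 t a])
      also have "\<dots> = C.sw ?T3 (\<lambda>b c. ?D2 (tens R H H (iA b) (iA c))) a"
      proof (rule C.sw_cong[OF mT3 C.tril_sw_bil(2)[OF mT3 t] a])
        fix b c assume bc: "b \<in> carrier A" "c \<in> carrier A"
        have "?D2 (tens R H H (iA b) (iA c)) = C.sw ?T3 (\<lambda>u w. ?p (iA b) (tens R H H (iA u) (iA w))) c"
          using C.sw_lin[OF mod_HH mT3 bil_J bc(2) pl[OF iA_closed[OF bc(1)]]] bc by (simp add: d2 DA)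
        also have "\<dots> = C.sw ?T3 (\<lambda>u w. ?t b u w) c"
          by (rule C.sw_cong[OF mT3 bil_lin_comp[OF bil_J pl[OF iA_closed[OF bc(1)]]] bc(2)]) (simp add: pt bc)
        finally show "C.sw ?T3 (\<lambda>u w. ?t b u w) c = ?D2 (tens R H H (iA b) (iA c))" by simp
      qed
      also have "\<dots> = ?D2 (D x)"
        using C.sw_lin[OF mod_HH mT3 bil_J a alg_hom_lin[OF ah(3)]] by (simp add: x DA a)
      finally show ?thesis .
    qed
  qed
  let ?sw = "tlift R ?P (\<lambda>x y. tens R H H y x)"
  have sb: "bil R H H ?P (\<lambda>x y. tens R H H y x)" by (intro bilI li) simp_all
  have sh: "?sw \<in> alg_hom R ?P ?P"
    by (rule tlift_alg_hom[OF alg_H alg_H alg_HH sb]) (simp_all add: tensor_H)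
  note st = tlift_tens[OF mod_H mod_H mod_HH sb]
  show "?sw (D h) = D h"
  proof (rule alg_hom_eq_on_gens[OF generates_H alg_H alg_HH alg_hom_comp[OF D sh] D _ h])
    fix x assume "x \<in> iV ` carrier V \<union> iA ` carrier A"
    then show "?sw (D x) = D x"
    proof (elim UnE imageE)
      fix v assume v: "v \<in> carrier V" and x: "x = iV v"
      then show ?thesis by (simp add: DV) (simp add: prim_def lin_add[OF alg_hom_lin[OF sh]] st H2.a_comm)
    next
      fix a assume a: "a \<in> carrier A" and x: "x = iA a"
      have "?sw (D x) = C.sw ?P (\<lambda>b c. ?sw (tens R H H (iA b) (iA c))) a"
        using C.sw_lin[OF mod_HH mod_HH bil_J a alg_hom_lin[OF sh]] by (simp add: x DA a)
      also have "\<dots> = C.sw ?P (\<lambda>b c. tens R H H (iA c) (iA b)) a"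
        by (rule C.sw_cong[OF mod_HH bil_lin_comp[OF bil_J alg_hom_lin[OF sh]] a]) (simp add: st)
      also have "\<dots> = D x" using C.sw_cocomm[OF mod_HH bil_J a] by (simp add: x DA a)
      finally show ?thesis .
    qed
  qed
qed

lemma extends_comult_iff:
  "extends_comult R A \<Delta> V H iA iV D \<longleftrightarrow>
    (\<forall>a\<in>carrier A. D (iA a) = J (\<Delta> a)) \<and> (\<forall>v\<in>carrier V. D (iV v) = prim H (iV v))"
  by (simp add: extends_comult_def primitive_def prim_def)

theorem star_imp_cocomm:
  "star_condition R A \<Delta> V lam kap \<Longrightarrow> H_cocomm_algebra R A \<Delta> V act lam kap"
  by (rule comult_exists, assumption)
    (unfold H_cocomm_algebra_def Let_def extends_comult_iff, use H_cocomm in blast)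

end

section \<open>Counits and antipodes\<close>

context cocomm_algebra
begin

lemma lin_sw_fun:
  "\<lbrakk>module R X; module R P; \<And>x. x \<in> carrier X \<Longrightarrow> bil R A A P (b x);
    \<And>m n. \<lbrakk>m \<in> carrier A; n \<in> carrier A\<rbrakk> \<Longrightarrow> lin X P (\<lambda>x. b x m n); a \<in> carrier A\<rbrakk> \<Longrightarrow> lin X P (\<lambda>x. sw P (b x) a)"
  by (rule lin_tlift_fun[OF _ mod_A mod_A]) auto

declare mod_A [simp] alg_A [simp]

lemma alg_AA' [simp]: "assoc_algebra R (tensor R A A)" by (simp add: tensor_algebra)
lemma mod_AA' [simp]: "module R (tensor R A A)" by (simp add: module_tensor)
lemma ta_closed' [simp]: "\<lbrakk>x \<in> carrier A; y \<in> carrier A\<rbrakk> \<Longrightarrow> tens R A A x y \<in> carrier (tensor R A A)"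
  by (simp add: tens_closed)
lemmas tensor_A = tensor_algebra[OF alg_A alg_A]

end

context cocomm_bialgebra
begin

lemma eps_closed [simp]: "a \<in> carrier A \<Longrightarrow> \<epsilon> a \<in> carrier R"
  using counit_hom by (auto simp: ring_hom_def)
lemma eps_one: "\<epsilon> \<one>\<^bsub>A\<^esub> = \<one>\<^bsub>R\<^esub>" and eps_mult: "\<lbrakk>a \<in> carrier A; b \<in> carrier A\<rbrakk> \<Longrightarrow> \<epsilon> (a \<otimes>\<^bsub>A\<^esub> b) = \<epsilon> a \<otimes>\<^bsub>R\<^esub> \<epsilon> b"
  using counit_hom by (auto simp: ring_hom_def)

lemma lin_eps: "lin A (reg_alg R) \<epsilon>"
  using counit_hom counit_smult by (intro linI) (auto simp: ring_hom_def)

lemma lin_eps_scale: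
  assumes "module R P" "p \<in> carrier P" "lin X A f" shows "lin X P (\<lambda>x. \<epsilon> (f x) \<odot>\<^bsub>P\<^esub> p)"
proof -
  interpret P: module R P by fact
  have "lin A P (\<lambda>x. \<epsilon> x \<odot>\<^bsub>P\<^esub> p)"
    by (rule linI) (simp_all add: lin_add[OF lin_eps, simplified] lin_smult[OF lin_eps, simplified] P.smult_l_distr P.smult_assoc1 assms)
  then show ?thesis by (rule lin_comp[OF assms(3)])
qed

lemma sw_counit_left:
  assumes P: "module R P" and f: "lin A P f" and a: "a \<in> carrier A"
  shows "sw P (\<lambda>x y. \<epsilon> x \<odot>\<^bsub>P\<^esub> f y) a = f a"
proof -
  have b: "bil R A A A (\<lambda>x y. \<epsilon> x \<odot>\<^bsub>A\<^esub> y)" by (intro bilI lin_scale lin_eps_scale lin_id) simp_all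
  have "f a = f (sw A (\<lambda>x y. \<epsilon> x \<odot>\<^bsub>A\<^esub> y) a)" by (simp add: counit_left a)
  also have "\<dots> = sw P (\<lambda>x y. f (\<epsilon> x \<odot>\<^bsub>A\<^esub> y)) a" by (rule sw_lin[OF mod_A P b a f])
  also have "\<dots> = sw P (\<lambda>x y. \<epsilon> x \<odot>\<^bsub>P\<^esub> f y) a"
    by (rule sw_cong[OF P bil_lin_comp[OF b f] a]) (simp add: lin_smult[OF f])
  finally show ?thesis by simp
qed

lemma sw_counit_right:
  assumes P: "module R P" and f: "lin A P f" and a: "a \<in> carrier A"
  shows "sw P (\<lambda>x y. \<epsilon> y \<odot>\<^bsub>P\<^esub> f x) a = f a"
proof -
  have b: "bil R A A A (\<lambda>x y. \<epsilon> y \<odot>\<^bsub>A\<^esub> x)" by (intro bilI lin_scale lin_eps_scale lin_id) simp_all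
  have "f a = f (sw A (\<lambda>x y. \<epsilon> y \<odot>\<^bsub>A\<^esub> x) a)" by (simp add: counit_right a)
  also have "\<dots> = sw P (\<lambda>x y. f (\<epsilon> y \<odot>\<^bsub>A\<^esub> x)) a" by (rule sw_lin[OF mod_A P b a f])
  also have "\<dots> = sw P (\<lambda>x y. \<epsilon> y \<odot>\<^bsub>P\<^esub> f x) a"
    by (rule sw_cong[OF P bil_lin_comp[OF b f] a]) (simp add: lin_smult[OF f])
  finally show ?thesis by simp
qed

text \<open>
  The counit law at a primitive element reads \<open>a + \<epsilon>(a) 1 = a\<close>, and \<open>\<epsilon>(1) = 1\<close>.
\<close>

lemma eps_primitive:
  assumes a: "a \<in> carrier A" "\<Delta> a = prim A a" shows "\<epsilon> a = \<zero>\<^bsub>R\<^esub>"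
proof -
  have b: "bil R A A A (\<lambda>x y. \<epsilon> x \<odot>\<^bsub>A\<^esub> y)" by (intro bilI lin_scale lin_eps_scale lin_id) simp_all
  note l = lin_tlift[OF mod_A mod_A mod_A b] and t = tlift_tens[OF mod_A mod_A mod_A b]
  have "tlift R A (\<lambda>x y. \<epsilon> x \<odot>\<^bsub>A\<^esub> y) (prim A a) = a \<oplus>\<^bsub>A\<^esub> \<epsilon> a \<odot>\<^bsub>A\<^esub> \<one>\<^bsub>A\<^esub>"
    using a(1) by (simp add: prim_def lin_add[OF l] t eps_one)
  then have e: "a \<oplus>\<^bsub>A\<^esub> \<epsilon> a \<odot>\<^bsub>A\<^esub> \<one>\<^bsub>A\<^esub> = a"
    using counit_left[OF a(1)] unfolding a(2) by (rule trans[OF sym])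
  have c: "\<epsilon> a \<odot>\<^bsub>A\<^esub> \<one>\<^bsub>A\<^esub> \<in> carrier A" using a(1) by simp
  have z: "\<epsilon> a \<odot>\<^bsub>A\<^esub> \<one>\<^bsub>A\<^esub> = \<zero>\<^bsub>A\<^esub>" using e add.l_cancel_one[OF a(1) c] by simp
  have "\<epsilon> a = \<epsilon> (\<epsilon> a \<odot>\<^bsub>A\<^esub> \<one>\<^bsub>A\<^esub>)" using a(1) by (simp add: counit_smult eps_one)
  also have "\<dots> = \<epsilon> \<zero>\<^bsub>A\<^esub>" by (simp only: z)
  also have "\<dots> = \<zero>\<^bsub>R\<^esub>"
    using lin_zero[OF mod_A assoc_algebra_module[OF assoc_algebra_reg] lin_eps] by simp
  finally show ?thesis .
qed

end

context cocomm_hopf_algebra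
begin

lemma S_closed [simp]: "a \<in> carrier A \<Longrightarrow> S a \<in> carrier A" by (rule lin_closed[OF antipode_linear])
lemma lin_S_comp: "lin X A f \<Longrightarrow> lin X A (\<lambda>x. S (f x))" by (rule lin_comp[OF _ antipode_linear])

lemmas la = lin_tens1 lin_tens2 lin_mult1 lin_mult2 lin_plus lin_S_comp lin_Delta_comp lin_id

lemma bil_S: "bil R A A A (\<lambda>x y. S x \<otimes>\<^bsub>A\<^esub> y)" "bil R A A A (\<lambda>x y. x \<otimes>\<^bsub>A\<^esub> S y)"
  by (intro bilI la; simp)+

lemma S_one: "S \<one>\<^bsub>A\<^esub> = \<one>\<^bsub>A\<^esub>"
  using antipode_left[of "\<one>\<^bsub>A\<^esub>"] sw_one[OF mod_A bil_S(1)] by (simp add: eps_one)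

text \<open>
  The antipode law at a primitive element reads \<open>S(a) + a = \<epsilon>(a) 1 = 0\<close>.
\<close>

lemma S_primitive:
  assumes a: "a \<in> carrier A" "\<Delta> a = prim A a" shows "S a = \<ominus>\<^bsub>A\<^esub> a"
proof -
  note l = lin_tlift[OF mod_A mod_A mod_A bil_S(1)] and t = tlift_tens[OF mod_A mod_A mod_A bil_S(1)]
  have "a \<oplus>\<^bsub>A\<^esub> S a = \<zero>\<^bsub>A\<^esub>"
    using antipode_left[OF a(1)] a by (simp add: prim_def lin_add[OF l] t S_one eps_primitive)
  then show ?thesis using a by (metis S_closed a_comm minus_equality)
qed

text \<open>
  A left and a right inverse in a monoid coincide; here the monoid is that of linear maps \<open>A \<rightarrow> B\<close> under
  convolution, with unit \<open>a \<mapsto> \<epsilon>(a) 1\<close>.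
\<close>

lemma convolution_inverse_unique:
  assumes B: "assoc_algebra R B" and f: "lin A B f" and g: "lin A B g" and h: "lin A B h"
    and fg: "\<And>a. a \<in> carrier A \<Longrightarrow> sw B (\<lambda>x y. f x \<otimes>\<^bsub>B\<^esub> g y) a = \<epsilon> a \<odot>\<^bsub>B\<^esub> \<one>\<^bsub>B\<^esub>"
    and gh: "\<And>a. a \<in> carrier A \<Longrightarrow> sw B (\<lambda>x y. g x \<otimes>\<^bsub>B\<^esub> h y) a = \<epsilon> a \<odot>\<^bsub>B\<^esub> \<one>\<^bsub>B\<^esub>"
    and a: "a \<in> carrier A"
  shows "f a = h a"
proof -
  interpret B: assoc_algebra R B by fact
  note mB = B.module_axioms
  note c = lin_closed[OF f] lin_closed[OF g] lin_closed[OF h]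
  have t: "tril R A B (\<lambda>x y z. f x \<otimes>\<^bsub>B\<^esub> (g y \<otimes>\<^bsub>B\<^esub> h z))"
    by (intro trilI lin_mult1 lin_mult2 B f g h) (simp_all add: c)
  have b1: "bil R A A B (\<lambda>x y. g x \<otimes>\<^bsub>B\<^esub> h y)" and b2: "bil R A A B (\<lambda>x y. f x \<otimes>\<^bsub>B\<^esub> g y)"
    by (intro bilI lin_mult1 lin_mult2 B f g h; simp add: c)+
  have "sw B (\<lambda>x y. sw B (\<lambda>u v. f x \<otimes>\<^bsub>B\<^esub> (g u \<otimes>\<^bsub>B\<^esub> h v)) y) a = sw B (\<lambda>x y. \<epsilon> y \<odot>\<^bsub>B\<^esub> f x) a"
  proof (rule sw_cong[OF mB tril_sw_bil(2)[OF mB t] a])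
    fix x y assume xy: "x \<in> carrier A" "y \<in> carrier A"
    show "sw B (\<lambda>u v. f x \<otimes>\<^bsub>B\<^esub> (g u \<otimes>\<^bsub>B\<^esub> h v)) y = \<epsilon> y \<odot>\<^bsub>B\<^esub> f x"
      using sw_lin[OF mB mB b1 xy(2) lin_mult_left[OF B c(1)[OF xy(1)]]] xy by (simp add: gh B.smult_mult_right c)
  qed
  moreover have "sw B (\<lambda>x y. sw B (\<lambda>u v. f u \<otimes>\<^bsub>B\<^esub> (g v \<otimes>\<^bsub>B\<^esub> h y)) x) a = sw B (\<lambda>x y. \<epsilon> x \<odot>\<^bsub>B\<^esub> h y) a"
  proof (rule sw_cong[OF mB tril_sw_bil(1)[OF mB t] a])
    fix x y assume xy: "x \<in> carrier A" "y \<in> carrier A"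
    have "sw B (\<lambda>u v. f u \<otimes>\<^bsub>B\<^esub> (g v \<otimes>\<^bsub>B\<^esub> h y)) x = sw B (\<lambda>u v. (f u \<otimes>\<^bsub>B\<^esub> g v) \<otimes>\<^bsub>B\<^esub> h y) x"
      by (rule sw_cong[OF mB tril_bil(3)[OF t xy(2)] xy(1)]) (simp add: c xy B.m_assoc)
    also have "\<dots> = \<epsilon> x \<odot>\<^bsub>B\<^esub> h y"
      using sw_lin[OF mB mB b2 xy(1) lin_mult_right[OF B c(3)[OF xy(2)]]] xy by (simp add: fg B.smult_mult_left c)
    finally show "sw B (\<lambda>u v. f u \<otimes>\<^bsub>B\<^esub> (g v \<otimes>\<^bsub>B\<^esub> h y)) x = \<epsilon> x \<odot>\<^bsub>B\<^esub> h y" .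
  qed
  ultimately show ?thesis
    using sw_coassoc[OF mB t a] by (simp add: sw_counit_left[OF mB h a] sw_counit_right[OF mB f a])
qed

text \<open>
  Both sides are convolution inverse to \<open>\<Delta>\<close> in the algebra of linear maps \<open>A \<rightarrow> A \<otimes> A\<close>, the left one from the
  left and the right one from the right.
\<close>

lemma S_comult:
  assumes a: "a \<in> carrier A" shows "\<Delta> (S a) = sw (tensor R A A) (\<lambda>x y. tens R A A (S y) (S x)) a"
proof -
  let ?P = "tensor R A A" and ?s = "tens R A A"
  let ?h = "\<lambda>a. sw ?P (\<lambda>x y. ?s (S y) (S x)) a"
  have bh: "bil R A A ?P (\<lambda>x y. ?s (S y) (S x))" by (intro bilI la) simp_all
  have h: "lin A ?P ?h" by (rule lin_sw[OF mod_AA' bh lin_id])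
  note hc = lin_closed[OF h]
  interpret P: assoc_algebra R ?P by simp
  show ?thesis
  proof (rule convolution_inverse_unique[OF alg_AA' lin_comp[OF antipode_linear lin_Delta] lin_Delta h _ _ a])
    fix a assume a: "a \<in> carrier A"
    have "\<Delta> (sw A (\<lambda>x y. S x \<otimes>\<^bsub>A\<^esub> y) a) = sw ?P (\<lambda>x y. \<Delta> (S x \<otimes>\<^bsub>A\<^esub> y)) a"
      by (rule sw_lin[OF mod_A mod_AA' bil_S(1) a lin_Delta])
    also have "\<dots> = sw ?P (\<lambda>x y. \<Delta> (S x) \<otimes>\<^bsub>?P\<^esub> \<Delta> y) a"
      by (rule sw_cong[OF mod_AA' bil_lin_comp[OF bil_S(1) lin_Delta] a]) (simp add: Delta_mult)
    finally show "sw ?P (\<lambda>x y. \<Delta> (S x) \<otimes>\<^bsub>?P\<^esub> \<Delta> y) a = \<epsilon> a \<odot>\<^bsub>?P\<^esub> \<one>\<^bsub>?P\<^esub>"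
      by (simp add: antipode_left a lin_smult[OF lin_Delta] Delta_one tensor_A(2))
    have t: "tril R A ?P (\<lambda>p q r. ?s p q \<otimes>\<^bsub>?P\<^esub> ?h r)"
      by (intro trilI lin_mult1 lin_mult2 lin_tens1 lin_tens2 lin_id h) (simp_all add: hc)
    have bt: "bil R A A ?P (\<lambda>p y. ?s (p \<otimes>\<^bsub>A\<^esub> S y) \<one>\<^bsub>A\<^esub>)" by (intro bilI la) simp_all
    have "sw ?P (\<lambda>x y. \<Delta> x \<otimes>\<^bsub>?P\<^esub> ?h y) a = sw ?P (\<lambda>x y. sw ?P (\<lambda>p q. ?s p q \<otimes>\<^bsub>?P\<^esub> ?h y) x) a"
    proof (rule sw_cong[OF mod_AA' tril_sw_bil(1)[OF mod_AA' t] a, symmetric])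
      fix x y assume xy: "x \<in> carrier A" "y \<in> carrier A"
      show "sw ?P (\<lambda>p q. ?s p q \<otimes>\<^bsub>?P\<^esub> ?h y) x = \<Delta> x \<otimes>\<^bsub>?P\<^esub> ?h y"
        using sw_lin[OF mod_AA' mod_AA' bil_tens[OF mod_A mod_A] xy(1) lin_mult_right[OF alg_AA' hc[OF xy(2)]]] xy
        by (simp add: tlift_id[OF mod_A mod_A])
    qed
    also have "\<dots> = sw ?P (\<lambda>p y. sw ?P (\<lambda>q r. ?s p q \<otimes>\<^bsub>?P\<^esub> ?h r) y) a"
      by (rule sw_coassoc[OF mod_AA' t a])
    also have "\<dots> = sw ?P (\<lambda>p y. ?s (p \<otimes>\<^bsub>A\<^esub> S y) \<one>\<^bsub>A\<^esub>) a"
    proof (rule sw_cong[OF mod_AA' tril_sw_bil(2)[OF mod_AA' t] a])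
      fix p y assume py: "p \<in> carrier A" "y \<in> carrier A"
      let ?t = "\<lambda>q u v. ?s (p \<otimes>\<^bsub>A\<^esub> S v) (q \<otimes>\<^bsub>A\<^esub> S u)"
      have t': "tril R A ?P ?t" by (intro trilI la) (simp_all add: py)
      have lf: "lin A ?P (\<lambda>v. ?s (p \<otimes>\<^bsub>A\<^esub> S v) \<one>\<^bsub>A\<^esub>)" by (intro la) (simp_all add: py)
      have "sw ?P (\<lambda>q r. ?s p q \<otimes>\<^bsub>?P\<^esub> ?h r) y = sw ?P (\<lambda>q r. sw ?P (\<lambda>u v. ?t q u v) r) y"
      proof (rule sw_cong[OF mod_AA' tril_bil(1)[OF t py(1)] py(2)])
        fix q r assume qr: "q \<in> carrier A" "r \<in> carrier A"
        have l: "lin ?P ?P (\<lambda>U. ?s p q \<otimes>\<^bsub>?P\<^esub> U)" by (rule lin_mult_left) (simp_all add: py qr)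
        have "?s p q \<otimes>\<^bsub>?P\<^esub> ?h r = sw ?P (\<lambda>u v. ?s p q \<otimes>\<^bsub>?P\<^esub> ?s (S v) (S u)) r"
          by (rule sw_lin[OF mod_AA' mod_AA' bh qr(2) l])
        also have "\<dots> = sw ?P (\<lambda>u v. ?t q u v) r"
          by (rule sw_cong[OF mod_AA' bil_lin_comp[OF bh l] qr(2)]) (simp add: py qr tensor_A(3))
        finally show "?s p q \<otimes>\<^bsub>?P\<^esub> ?h r = sw ?P (\<lambda>u v. ?t q u v) r" .
      qed
      also have "\<dots> = sw ?P (\<lambda>r v. sw ?P (\<lambda>q u. ?t q u v) r) y"
        by (rule sw_coassoc[OF mod_AA' t' py(2), symmetric])
      also have "\<dots> = sw ?P (\<lambda>r v. \<epsilon> r \<odot>\<^bsub>?P\<^esub> ?s (p \<otimes>\<^bsub>A\<^esub> S v) \<one>\<^bsub>A\<^esub>) y"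
      proof (rule sw_cong[OF mod_AA' tril_sw_bil(1)[OF mod_AA' t'] py(2)])
        fix r v assume rv: "r \<in> carrier A" "v \<in> carrier A"
        have "?s (p \<otimes>\<^bsub>A\<^esub> S v) (sw A (\<lambda>q u. q \<otimes>\<^bsub>A\<^esub> S u) r) = sw ?P (\<lambda>q u. ?t q u v) r"
          by (rule sw_lin[OF mod_A mod_AA' bil_S(2) rv(1)]) (intro la, simp_all add: py rv)
        then show "sw ?P (\<lambda>q u. ?t q u v) r = \<epsilon> r \<odot>\<^bsub>?P\<^esub> ?s (p \<otimes>\<^bsub>A\<^esub> S v) \<one>\<^bsub>A\<^esub>"
          using py rv by (simp add: antipode_right lin_smult[OF lin_tens2[OF mod_A mod_A lin_id]])
      qed
      also have "\<dots> = ?s (p \<otimes>\<^bsub>A\<^esub> S y) \<one>\<^bsub>A\<^esub>" by (rule sw_counit_left[OF mod_AA' lf py(2)])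
      finally show "sw ?P (\<lambda>q r. ?s p q \<otimes>\<^bsub>?P\<^esub> ?h r) y = ?s (p \<otimes>\<^bsub>A\<^esub> S y) \<one>\<^bsub>A\<^esub>" .
    qed
    also have "\<dots> = ?s (sw A (\<lambda>p y. p \<otimes>\<^bsub>A\<^esub> S y) a) \<one>\<^bsub>A\<^esub>"
      by (rule sw_lin[OF mod_A mod_AA' bil_S(2) a, symmetric]) (intro la, simp_all)
    also have "\<dots> = \<epsilon> a \<odot>\<^bsub>?P\<^esub> \<one>\<^bsub>?P\<^esub>"
      using a by (simp add: antipode_right lin_smult[OF lin_tens1[OF mod_A mod_A lin_id]] tensor_A(2))
    finally show "sw ?P (\<lambda>x y. \<Delta> x \<otimes>\<^bsub>?P\<^esub> ?h y) a = \<epsilon> a \<odot>\<^bsub>?P\<^esub> \<one>\<^bsub>?P\<^esub>" .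
  qed
qed

text \<open>
  The usual proof compares two convolution inverses of the multiplication on \<open>A \<otimes> A\<close>. Here the same
  computation is done with \<open>b\<close> as a parameter, which needs no coalgebra structure on \<open>A \<otimes> A\<close>.
\<close>

lemma S_antihom:
  assumes a: "a \<in> carrier A" and b: "b \<in> carrier A"
  shows "S (a \<otimes>\<^bsub>A\<^esub> b) = S b \<otimes>\<^bsub>A\<^esub> S a"
proof -
  let ?Z = "\<lambda>p q r. (S (p \<otimes>\<^bsub>A\<^esub> b) \<otimes>\<^bsub>A\<^esub> q) \<otimes>\<^bsub>A\<^esub> S r"
  let ?c = "\<lambda>p q u1 u2 w. (S (p \<otimes>\<^bsub>A\<^esub> u1) \<otimes>\<^bsub>A\<^esub> (q \<otimes>\<^bsub>A\<^esub> u2)) \<otimes>\<^bsub>A\<^esub> S w"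
  have tZ: "tril R A A ?Z" by (intro trilI la) (simp_all add: b)
  have tc: "tril R A A (?c p q)" if "p \<in> carrier A" "q \<in> carrier A" for p q
    by (intro trilI la) (simp_all add: that)
  have bc: "bil R A A A (\<lambda>p q. ?c p q u1 u2 w)" if "u1 \<in> carrier A" "u2 \<in> carrier A" "w \<in> carrier A" for u1 u2 w
    by (intro bilI la) (simp_all add: that)
  have bZ: "bil R A A A (\<lambda>x y. S (x \<otimes>\<^bsub>A\<^esub> b) \<otimes>\<^bsub>A\<^esub> (\<epsilon> y \<odot>\<^bsub>A\<^esub> \<one>\<^bsub>A\<^esub>))"
    by (intro bilI la lin_eps_scale) (simp_all add: b)
  have l1: "lin A A (\<lambda>x. S (x \<otimes>\<^bsub>A\<^esub> b))" by (intro la) (simp_all add: b)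
  \<comment> \<open>Inserting \<open>b\<^sub>(\<^sub>2\<^sub>) S(b\<^sub>(\<^sub>3\<^sub>))\<close> creates the pattern \<open>S(p b\<^sub>(\<^sub>1\<^sub>)) q b\<^sub>(\<^sub>2\<^sub>)\<close>, to which the antipode law of a product applies.\<close>
  have Z: "S (p \<otimes>\<^bsub>A\<^esub> b) \<otimes>\<^bsub>A\<^esub> q = sw A (\<lambda>u w. sw A (\<lambda>u1 u2. ?c p q u1 u2 w) u) b"
    if p: "p \<in> carrier A" and q: "q \<in> carrier A" for p q
  proof -
    have lp: "lin A A (\<lambda>u. S (p \<otimes>\<^bsub>A\<^esub> u) \<otimes>\<^bsub>A\<^esub> q)" by (intro la) (simp_all add: p q)
    have "sw A (\<lambda>u w. sw A (\<lambda>u1 u2. ?c p q u1 u2 w) u) b = sw A (\<lambda>u w. sw A (\<lambda>w1 w2. ?c p q u w1 w2) w) b"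
      by (rule sw_coassoc[OF mod_A tc[OF p q] b])
    also have "\<dots> = sw A (\<lambda>u w. \<epsilon> w \<odot>\<^bsub>A\<^esub> (S (p \<otimes>\<^bsub>A\<^esub> u) \<otimes>\<^bsub>A\<^esub> q)) b"
    proof (rule sw_cong[OF mod_A tril_sw_bil(2)[OF mod_A tc[OF p q]] b])
      fix u w assume uw: "u \<in> carrier A" "w \<in> carrier A"
      have k: "S (p \<otimes>\<^bsub>A\<^esub> u) \<otimes>\<^bsub>A\<^esub> q \<in> carrier A" using p q uw by simp
      have "sw A (\<lambda>w1 w2. ?c p q u w1 w2) w = sw A (\<lambda>w1 w2. (S (p \<otimes>\<^bsub>A\<^esub> u) \<otimes>\<^bsub>A\<^esub> q) \<otimes>\<^bsub>A\<^esub> (w1 \<otimes>\<^bsub>A\<^esub> S w2)) w"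
        by (rule sw_cong[OF mod_A tril_bil(1)[OF tc[OF p q] uw(1)] uw(2)]) (simp add: p q uw m_assoc)
      also have "\<dots> = (S (p \<otimes>\<^bsub>A\<^esub> u) \<otimes>\<^bsub>A\<^esub> q) \<otimes>\<^bsub>A\<^esub> sw A (\<lambda>w1 w2. w1 \<otimes>\<^bsub>A\<^esub> S w2) w"
        by (rule sw_lin[OF mod_A mod_A bil_S(2) uw(2) lin_mult_left[OF alg_A k], symmetric])
      finally show "sw A (\<lambda>w1 w2. ?c p q u w1 w2) w = \<epsilon> w \<odot>\<^bsub>A\<^esub> (S (p \<otimes>\<^bsub>A\<^esub> u) \<otimes>\<^bsub>A\<^esub> q)"
        using k uw by (simp add: antipode_right smult_mult_right)
    qed
    also have "\<dots> = S (p \<otimes>\<^bsub>A\<^esub> b) \<otimes>\<^bsub>A\<^esub> q" by (rule sw_counit_right[OF mod_A lp b])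
    finally show ?thesis by simp
  qed
  have bs: "bil R A A A (\<lambda>p q. S (p \<otimes>\<^bsub>A\<^esub> b) \<otimes>\<^bsub>A\<^esub> q)" by (intro bilI la) (simp_all add: b)
  have inner: "sw A (\<lambda>p q. S (p \<otimes>\<^bsub>A\<^esub> b) \<otimes>\<^bsub>A\<^esub> q) x = \<epsilon> x \<odot>\<^bsub>A\<^esub> S b" if x: "x \<in> carrier A" for x
  proof -
    have bu: "bil R A A A (\<lambda>u w. sw A (\<lambda>u1 u2. ?c p q u1 u2 w) u)" if "p \<in> carrier A" "q \<in> carrier A" for p q
      by (rule tril_sw_bil(1)[OF mod_A tc[OF that]])
    have bu': "bil R A A A (\<lambda>p q. sw A (\<lambda>u1 u2. ?c p q u1 u2 w) u)" if "u \<in> carrier A" "w \<in> carrier A" for u w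
    proof (rule bilI)
      show "lin A A (\<lambda>q. sw A (\<lambda>u1 u2. ?c p q u1 u2 w) u)" if "p \<in> carrier A" for p
        by (rule lin_sw_fun[OF mod_A mod_A tril_bil(3)[OF tc[OF that] \<open>w \<in> carrier A\<close>]], assumption)
          (rule bil_right[OF bc], use that \<open>u \<in> carrier A\<close> \<open>w \<in> carrier A\<close> in simp_all)
      show "lin A A (\<lambda>p. sw A (\<lambda>u1 u2. ?c p q u1 u2 w) u)" if "q \<in> carrier A" for q
        by (rule lin_sw_fun[OF mod_A mod_A tril_bil(3)[OF tc[OF _ that] \<open>w \<in> carrier A\<close>]], assumption)
          (rule bil_left[OF bc], use that \<open>u \<in> carrier A\<close> \<open>w \<in> carrier A\<close> in simp_all)
    qed
    have "sw A (\<lambda>p q. S (p \<otimes>\<^bsub>A\<^esub> b) \<otimes>\<^bsub>A\<^esub> q) x = sw A (\<lambda>p q. sw A (\<lambda>u w. sw A (\<lambda>u1 u2. ?c p q u1 u2 w) u) b) x"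
      by (rule sw_cong[OF mod_A bs x Z])
    also have "\<dots> = sw A (\<lambda>u w. sw A (\<lambda>p q. sw A (\<lambda>u1 u2. ?c p q u1 u2 w) u) x) b"
      by (rule tlift_swap[OF mod_A mod_A mod_A mod_A mod_A bu bu' Delta_closed[OF x] Delta_closed[OF b]])
    also have "\<dots> = sw A (\<lambda>u w. \<epsilon> u \<odot>\<^bsub>A\<^esub> (\<epsilon> x \<odot>\<^bsub>A\<^esub> S w)) b"
    proof (rule sw_cong[OF mod_A _ b])
      show "bil R A A A (\<lambda>u w. sw A (\<lambda>p q. sw A (\<lambda>u1 u2. ?c p q u1 u2 w) u) x)"
      proof (rule bilI)
        show "lin A A (\<lambda>w. sw A (\<lambda>p q. sw A (\<lambda>u1 u2. ?c p q u1 u2 w) u) x)" if "u \<in> carrier A" for u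
          by (rule lin_sw_fun[OF mod_A mod_A bu'[OF that]], assumption) (rule bil_right[OF bu], use that x in simp_all)
        show "lin A A (\<lambda>u. sw A (\<lambda>p q. sw A (\<lambda>u1 u2. ?c p q u1 u2 w) u) x)" if "w \<in> carrier A" for w
          by (rule lin_sw_fun[OF mod_A mod_A bu'[OF _ that]], assumption) (rule bil_left[OF bu], use that x in simp_all)
      qed
      fix u w assume uw: "u \<in> carrier A" "w \<in> carrier A"
      have lw: "lin A A (\<lambda>y. y \<otimes>\<^bsub>A\<^esub> S w)" by (rule lin_mult_right) (use uw in simp_all)
      have bm: "bil R A A A (\<lambda>p q. sw A (\<lambda>u1 u2. S (p \<otimes>\<^bsub>A\<^esub> u1) \<otimes>\<^bsub>A\<^esub> (q \<otimes>\<^bsub>A\<^esub> u2)) u)"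
      proof (rule bilI)
        show "lin A A (\<lambda>q. sw A (\<lambda>u1 u2. S (p \<otimes>\<^bsub>A\<^esub> u1) \<otimes>\<^bsub>A\<^esub> (q \<otimes>\<^bsub>A\<^esub> u2)) u)" if "p \<in> carrier A" for p
          by (rule lin_sw_fun[OF mod_A mod_A]; (intro bilI la)?) (use that uw in simp_all)
        show "lin A A (\<lambda>p. sw A (\<lambda>u1 u2. S (p \<otimes>\<^bsub>A\<^esub> u1) \<otimes>\<^bsub>A\<^esub> (q \<otimes>\<^bsub>A\<^esub> u2)) u)" if "q \<in> carrier A" for q
          by (rule lin_sw_fun[OF mod_A mod_A]; (intro bilI la)?) (use that uw in simp_all)
      qed
      have bb: "bil R A A A (\<lambda>u1 u2. S (p \<otimes>\<^bsub>A\<^esub> u1) \<otimes>\<^bsub>A\<^esub> (q \<otimes>\<^bsub>A\<^esub> u2))" if "p \<in> carrier A" "q \<in> carrier A" for p q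
        by (intro bilI la) (use that in simp_all)
      have "sw A (\<lambda>p q. sw A (\<lambda>u1 u2. ?c p q u1 u2 w) u) x =
          sw A (\<lambda>p q. sw A (\<lambda>u1 u2. S (p \<otimes>\<^bsub>A\<^esub> u1) \<otimes>\<^bsub>A\<^esub> (q \<otimes>\<^bsub>A\<^esub> u2)) u \<otimes>\<^bsub>A\<^esub> S w) x"
        by (rule sw_cong[OF mod_A bu'[OF uw] x]) (rule sw_lin[OF mod_A mod_A bb uw(1) lw, symmetric])
      also have "\<dots> = sw A (\<lambda>p q. sw A (\<lambda>u1 u2. S (p \<otimes>\<^bsub>A\<^esub> u1) \<otimes>\<^bsub>A\<^esub> (q \<otimes>\<^bsub>A\<^esub> u2)) u) x \<otimes>\<^bsub>A\<^esub> S w"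
        by (rule sw_lin[OF mod_A mod_A bm x lw, symmetric])
      also have "\<dots> = sw A (\<lambda>x y. S x \<otimes>\<^bsub>A\<^esub> y) (x \<otimes>\<^bsub>A\<^esub> u) \<otimes>\<^bsub>A\<^esub> S w"
        by (simp only: sw_mult[OF mod_A bil_S(1) x uw(1)])
      also have "\<dots> = \<epsilon> u \<odot>\<^bsub>A\<^esub> (\<epsilon> x \<odot>\<^bsub>A\<^esub> S w)"
        using x uw by (simp add: antipode_left smult_mult_left eps_mult R.m_comm smult_assoc1)
      finally show "sw A (\<lambda>p q. sw A (\<lambda>u1 u2. ?c p q u1 u2 w) u) x = \<epsilon> u \<odot>\<^bsub>A\<^esub> (\<epsilon> x \<odot>\<^bsub>A\<^esub> S w)" .
    qed
    also have "\<dots> = \<epsilon> x \<odot>\<^bsub>A\<^esub> S b"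
      by (rule sw_counit_left[OF mod_A lin_scale[OF mod_A antipode_linear eps_closed[OF x]] b])
    finally show ?thesis .
  qed
  have "S (a \<otimes>\<^bsub>A\<^esub> b) = sw A (\<lambda>x y. \<epsilon> y \<odot>\<^bsub>A\<^esub> S (x \<otimes>\<^bsub>A\<^esub> b)) a"
    by (rule sw_counit_right[OF mod_A l1 a, symmetric])
  also have "\<dots> = sw A (\<lambda>x y. sw A (\<lambda>u v. ?Z x u v) y) a"
  proof (rule sw_cong[OF mod_A tril_sw_bil(2)[OF mod_A tZ] a, symmetric])
    fix x y assume xy: "x \<in> carrier A" "y \<in> carrier A"
    have k: "S (x \<otimes>\<^bsub>A\<^esub> b) \<in> carrier A" using xy b by simp
    have "sw A (\<lambda>u v. ?Z x u v) y = sw A (\<lambda>u v. S (x \<otimes>\<^bsub>A\<^esub> b) \<otimes>\<^bsub>A\<^esub> (u \<otimes>\<^bsub>A\<^esub> S v)) y"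
      by (rule sw_cong[OF mod_A tril_bil(1)[OF tZ xy(1)] xy(2)]) (simp add: xy b m_assoc)
    also have "\<dots> = S (x \<otimes>\<^bsub>A\<^esub> b) \<otimes>\<^bsub>A\<^esub> sw A (\<lambda>u v. u \<otimes>\<^bsub>A\<^esub> S v) y"
      by (rule sw_lin[OF mod_A mod_A bil_S(2) xy(2) lin_mult_left[OF alg_A k], symmetric])
    finally show "sw A (\<lambda>u v. ?Z x u v) y = \<epsilon> y \<odot>\<^bsub>A\<^esub> S (x \<otimes>\<^bsub>A\<^esub> b)"
      using k xy by (simp add: antipode_right smult_mult_right)
  qed
  also have "\<dots> = sw A (\<lambda>x y. sw A (\<lambda>u v. ?Z u v y) x) a" by (rule sw_coassoc[OF mod_A tZ a, symmetric])
  also have "\<dots> = sw A (\<lambda>x y. \<epsilon> x \<odot>\<^bsub>A\<^esub> (S b \<otimes>\<^bsub>A\<^esub> S y)) a"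
  proof (rule sw_cong[OF mod_A tril_sw_bil(1)[OF mod_A tZ] a])
    fix x y assume xy: "x \<in> carrier A" "y \<in> carrier A"
    show "sw A (\<lambda>u v. ?Z u v y) x = \<epsilon> x \<odot>\<^bsub>A\<^esub> (S b \<otimes>\<^bsub>A\<^esub> S y)"
      using sw_lin[OF mod_A mod_A bs xy(1) lin_mult_right[OF alg_A S_closed[OF xy(2)]]] xy b
      by (simp add: inner smult_mult_left)
  qed
  also have "\<dots> = S b \<otimes>\<^bsub>A\<^esub> S a"
    by (rule sw_counit_left[OF mod_A lin_comp[OF antipode_linear lin_mult_left[OF alg_A S_closed[OF b]]] a])
  finally show ?thesis .
qed

end

section \<open>Extension of the counit and the antipode\<close>

context cring
begin

lemma bil_plus: "\<lbrakk>module R P; bil R M N P f; bil R M N P g\<rbrakk> \<Longrightarrow> bil R M N P (\<lambda>b c. f b c \<oplus>\<^bsub>P\<^esub> g b c)"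
  by (rule bilI; rule lin_plus) (simp_all add: bil_left bil_right)

lemma tlift_zero:
  assumes "module R M" "module R N" "module R P" "U \<in> carrier (tensor R M N)"
  shows "tlift R P (\<lambda>x y. \<zero>\<^bsub>P\<^esub>) U = \<zero>\<^bsub>P\<^esub>"
proof -
  have b: "bil R M N P (\<lambda>x y. \<zero>\<^bsub>P\<^esub>)" by (intro bilI lin_const_zero assms)
  show ?thesis
    by (rule tensor_lin_eq[OF assms(1-3) lin_tlift[OF assms(1-3) b] lin_const_zero[OF assms(3)] _ assms(4)])
      (simp add: tlift_tens[OF assms(1-3) b])
qed

end

context cocomm_algebra
begin

lemma sw_plus:
  "\<lbrakk>module R P; bil R A A P f; bil R A A P g; d \<in> carrier A\<rbrakk> \<Longrightarrow> sw P (\<lambda>b c. f b c \<oplus>\<^bsub>P\<^esub> g b c) d = sw P f d \<oplus>\<^bsub>P\<^esub> sw P g d"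
  by (rule tlift_plus[OF mod_A mod_A]) auto

end

context H_data
begin

text \<open>
  The condition on \<open>\<lambda>\<close> and the vanishing of \<open>\<epsilon>\<close> on the primitive elements \<open>\<kappa>\<^sub>A(v, w)\<close> are the two
  families of relations after applying the counit.
\<close>

lemma counit_exists:
  assumes "cocomm_bialgebra R A \<Delta> \<epsilon>" and st: "star_condition R A \<Delta> V lam kap"
    and el: "\<forall>x\<in>carrier (tensor R A V). \<epsilon> (lam x) = \<zero>\<^bsub>R\<^esub>"
  obtains e where "e \<in> alg_hom R H (reg_alg R)" "\<And>v. v \<in> carrier V \<Longrightarrow> e (iV v) = \<zero>\<^bsub>R\<^esub>" "\<And>a. a \<in> carrier A \<Longrightarrow> e (iA a) = \<epsilon> a"
proof -
  interpret E: cocomm_bialgebra R A \<Delta> \<epsilon> by fact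
  have mR: "module R (reg_alg R)" by (rule assoc_algebra_module[OF assoc_algebra_reg])
  have z: "lin X (reg_alg R) (\<lambda>_. \<zero>\<^bsub>R\<^esub>)" for X :: "('k, 'x1, 'x2) module_scheme"
    using lin_const_zero[OF mR, of X] by simp
  show thesis
  proof (rule H_lift[OF assoc_algebra_reg z E.lin_eps])
    fix a v assume a: "a \<in> carrier A" and v: "v \<in> carrier V"
    have "C.sw (reg_alg R) (\<lambda>b c. \<zero>\<^bsub>R\<^esub> \<otimes>\<^bsub>reg_alg R\<^esub> \<epsilon> c) a = C.sw (reg_alg R) (\<lambda>b c. \<zero>\<^bsub>reg_alg R\<^esub>) a"
    proof (rule C.sw_cong[OF mR _ a, symmetric])
      show "bil R A A (reg_alg R) (\<lambda>b c. \<zero>\<^bsub>reg_alg R\<^esub>)" by (intro bilI lin_const_zero mR)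
    qed simp
    then show "\<epsilon> a \<otimes>\<^bsub>reg_alg R\<^esub> \<zero>\<^bsub>R\<^esub> = C.sw (reg_alg R) (\<lambda>b c. \<zero>\<^bsub>R\<^esub> \<otimes>\<^bsub>reg_alg R\<^esub> \<epsilon> c) a \<oplus>\<^bsub>reg_alg R\<^esub> \<epsilon> (lm a v)"
      using el a v tlift_zero[OF mod_A mod_A mR C.Delta_closed[OF a]] by (simp add: tens_closed)
  next
    fix v w assume vw: "v \<in> carrier V" "w \<in> carrier V"
    have "\<epsilon> (kA v w) = \<zero>\<^bsub>R\<^esub>" by (rule E.eps_primitive) (use st vw in \<open>simp_all add: star_condition_iff\<close>)
    moreover have "\<zero>\<^bsub>R\<^esub> \<ominus>\<^bsub>reg_alg R\<^esub> \<zero>\<^bsub>R\<^esub> = \<zero>\<^bsub>R\<^esub>"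
    proof -
      interpret Q: module R "reg_alg R" by (rule mR)
      show ?thesis using Q.M.diff_eq_zero_iff[of "\<zero>\<^bsub>R\<^esub>" "\<zero>\<^bsub>R\<^esub>"] by simp
    qed
    ultimately show "\<zero>\<^bsub>R\<^esub> \<otimes>\<^bsub>reg_alg R\<^esub> \<zero>\<^bsub>R\<^esub> \<ominus>\<^bsub>reg_alg R\<^esub> \<zero>\<^bsub>R\<^esub> \<otimes>\<^bsub>reg_alg R\<^esub> \<zero>\<^bsub>R\<^esub> = \<epsilon> (kA v w) \<oplus>\<^bsub>reg_alg R\<^esub> \<zero>\<^bsub>R\<^esub>" by simp
  qed (use that in \<open>simp_all add: E.eps_mult E.eps_one\<close>)
qed

text \<open>The counit laws are equalities of algebra maps and hold on generators.\<close>

lemma H_bialgebra: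
  assumes EA: "cocomm_bialgebra R A \<Delta> \<epsilon>"
    and D: "D \<in> alg_hom R H (tensor R H H)" and DV: "\<And>v. v \<in> carrier V \<Longrightarrow> D (iV v) = prim H (iV v)"
    and DA: "\<And>a. a \<in> carrier A \<Longrightarrow> D (iA a) = J (\<Delta> a)"
    and e: "e \<in> alg_hom R H (reg_alg R)" "\<And>v. v \<in> carrier V \<Longrightarrow> e (iV v) = \<zero>\<^bsub>R\<^esub>" "\<And>a. a \<in> carrier A \<Longrightarrow> e (iA a) = \<epsilon> a"
  shows "cocomm_bialgebra R H D e"
proof -
  interpret E: cocomm_bialgebra R A \<Delta> \<epsilon> by fact
  have ec: "e x \<in> carrier R" if "x \<in> carrier H" for x using alg_hom_closed[OF e(1) that] by simp
  have em: "e (x \<otimes>\<^bsub>H\<^esub> y) = e x \<otimes>\<^bsub>R\<^esub> e y" if "x \<in> carrier H" "y \<in> carrier H" for x y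
    using alg_hom_mult[OF e(1) that] by simp
  have e1: "e \<one>\<^bsub>H\<^esub> = \<one>\<^bsub>R\<^esub>" using alg_hom_one[OF e(1)] by simp
  have les: "lin X H (\<lambda>x. e (f x) \<odot>\<^bsub>H\<^esub> p)" if "p \<in> carrier H" "lin X H f" for X :: "('k, 'x1, 'x2) module_scheme" and f p
  proof (rule lin_comp[OF that(2)])
    show "lin H H (\<lambda>x. e x \<odot>\<^bsub>H\<^esub> p)"
      by (rule linI) (simp_all add: that ec lin_add[OF alg_hom_lin[OF e(1)], simplified] lin_smult[OF alg_hom_lin[OF e(1)], simplified] Ha.smult_l_distr Ha.smult_assoc1)
  qed
  have ring: "e \<in> ring_hom H R" using ec em e1 lin_add[OF alg_hom_lin[OF e(1)]] by (auto simp: ring_hom_def)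
  have bl: "bil R H H H (\<lambda>x y. e x \<odot>\<^bsub>H\<^esub> y)" and br: "bil R H H H (\<lambda>x y. e y \<odot>\<^bsub>H\<^esub> x)"
    by (intro bilI lin_scale les lin_id; simp add: ec)+
  have sm: "(r \<odot>\<^bsub>H\<^esub> x) \<otimes>\<^bsub>H\<^esub> (s \<odot>\<^bsub>H\<^esub> y) = (r \<otimes>\<^bsub>R\<^esub> s) \<odot>\<^bsub>H\<^esub> (x \<otimes>\<^bsub>H\<^esub> y)"
    if "r \<in> carrier R" "s \<in> carrier R" "x \<in> carrier H" "y \<in> carrier H" for r s x y
    using that by (simp add: Ha.smult_mult_left Ha.smult_mult_right Ha.smult_assoc1[symmetric] m_comm)
  have hl: "tlift R H (\<lambda>x y. e x \<odot>\<^bsub>H\<^esub> y) \<in> alg_hom R (tensor R H H) H"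
    by (rule tlift_alg_hom[OF alg_H alg_H alg_H bl]) (simp_all add: e1 em sm ec)
  have hr: "tlift R H (\<lambda>x y. e y \<odot>\<^bsub>H\<^esub> x) \<in> alg_hom R (tensor R H H) H"
    by (rule tlift_alg_hom[OF alg_H alg_H alg_H br]) (simp_all add: e1 em sm ec)
  note tl = tlift_tens[OF mod_H mod_H mod_H bl] and tr = tlift_tens[OF mod_H mod_H mod_H br]
  show ?thesis
  proof (intro cocomm_bialgebra.intro cocomm_bialgebra_axioms.intro H_cocomm[OF D DV DA] ring)
    show "e (r \<odot>\<^bsub>H\<^esub> a) = r \<otimes>\<^bsub>R\<^esub> e a" if "r \<in> carrier R" "a \<in> carrier H" for r a
      using lin_smult[OF alg_hom_lin[OF e(1)] that] by simp
    fix h assume h: "h \<in> carrier H"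
    show "tlift R H (\<lambda>x y. e x \<odot>\<^bsub>H\<^esub> y) (D h) = h"
    proof (rule alg_hom_eq_on_gens[OF generates_H alg_H alg_H alg_hom_comp[OF D hl] alg_hom_id _ h])
      fix x assume "x \<in> iV ` carrier V \<union> iA ` carrier A"
      then show "tlift R H (\<lambda>x y. e x \<odot>\<^bsub>H\<^esub> y) (D x) = x"
      proof (elim UnE imageE)
        fix v assume "v \<in> carrier V" "x = iV v"
        then show ?thesis by (simp add: DV) (simp add: prim_def lin_add[OF alg_hom_lin[OF hl]] tl e1 e)
      next
        fix a assume a: "a \<in> carrier A" and x: "x = iA a"
        have "tlift R H (\<lambda>x y. e x \<odot>\<^bsub>H\<^esub> y) (D x) = C.sw H (\<lambda>b c. tlift R H (\<lambda>x y. e x \<odot>\<^bsub>H\<^esub> y) (tens R H H (iA b) (iA c))) a"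
          using C.sw_lin[OF mod_HH mod_H bil_J a alg_hom_lin[OF hl]] by (simp add: x DA a)
        also have "\<dots> = C.sw H (\<lambda>b c. \<epsilon> b \<odot>\<^bsub>H\<^esub> iA c) a"
          by (rule C.sw_cong[OF mod_H bil_lin_comp[OF bil_J alg_hom_lin[OF hl]] a]) (simp add: tl e)
        finally show ?thesis by (simp add: E.sw_counit_left[OF mod_H lin_iA a] x)
      qed
    qed
    show "tlift R H (\<lambda>x y. e y \<odot>\<^bsub>H\<^esub> x) (D h) = h"
    proof (rule alg_hom_eq_on_gens[OF generates_H alg_H alg_H alg_hom_comp[OF D hr] alg_hom_id _ h])
      fix x assume "x \<in> iV ` carrier V \<union> iA ` carrier A"
      then show "tlift R H (\<lambda>x y. e y \<odot>\<^bsub>H\<^esub> x) (D x) = x"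
      proof (elim UnE imageE)
        fix v assume "v \<in> carrier V" "x = iV v"
        then show ?thesis by (simp add: DV) (simp add: prim_def lin_add[OF alg_hom_lin[OF hr]] tr e1 e)
      next
        fix a assume a: "a \<in> carrier A" and x: "x = iA a"
        have "tlift R H (\<lambda>x y. e y \<odot>\<^bsub>H\<^esub> x) (D x) = C.sw H (\<lambda>b c. tlift R H (\<lambda>x y. e y \<odot>\<^bsub>H\<^esub> x) (tens R H H (iA b) (iA c))) a"
          using C.sw_lin[OF mod_HH mod_H bil_J a alg_hom_lin[OF hr]] by (simp add: x DA a)
        also have "\<dots> = C.sw H (\<lambda>b c. \<epsilon> c \<odot>\<^bsub>H\<^esub> iA b) a"
          by (rule C.sw_cong[OF mod_H bil_lin_comp[OF bil_J alg_hom_lin[OF hr]] a]) (simp add: tr e)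
        finally show ?thesis by (simp add: E.sw_counit_right[OF mod_H lin_iA a] x)
      qed
    qed
  qed
qed

theorem star_imp_bialgebra:
  assumes "cocomm_bialgebra R A \<Delta> \<epsilon>" "star_condition R A \<Delta> V lam kap"
    "\<forall>x\<in>carrier (tensor R A V). \<epsilon> (lam x) = \<zero>\<^bsub>R\<^esub>"
  shows "H_cocomm_bialgebra R A \<Delta> \<epsilon> V act lam kap"
proof -
  obtain D where D: "D \<in> alg_hom R H (tensor R H H)" "\<And>v. v \<in> carrier V \<Longrightarrow> D (iV v) = prim H (iV v)"
    "\<And>a. a \<in> carrier A \<Longrightarrow> D (iA a) = J (\<Delta> a)" by (rule comult_exists[OF assms(2)]) blast
  obtain e where e: "e \<in> alg_hom R H (reg_alg R)" "\<And>v. v \<in> carrier V \<Longrightarrow> e (iV v) = \<zero>\<^bsub>R\<^esub>" "\<And>a. a \<in> carrier A \<Longrightarrow> e (iA a) = \<epsilon> a"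
    by (rule counit_exists[OF assms]) blast
  show ?thesis
    unfolding H_cocomm_bialgebra_def Let_def extends_comult_iff
    by (intro exI[of _ D] exI[of _ e] conjI ballI H_bialgebra[OF assms(1) D e] D e)
qed

end

locale H_hopf = H_data R A \<Delta> V act lam kap + Sa: cocomm_hopf_algebra R A \<Delta> \<epsilon> S
  for R :: "('k, 'r) ring_scheme" and A :: "('k, 'a, 'x) module_scheme" and \<Delta>
    and V :: "('k, 'v, 'y) module_scheme" and act lam kap \<epsilon> S
begin

lemmas lh = li Sa.lin_S_comp

text \<open>
  Since \<open>\<epsilon>(\<lambda>(a, v)) = 0\<close>, the antipode law at \<open>\<lambda>(a, v)\<close>, with its coproduct expanded, says that
  \<open>S(\<lambda>(a\<^sub>(\<^sub>1\<^sub>), v)) a\<^sub>(\<^sub>2\<^sub>) + S(a\<^sub>(\<^sub>1\<^sub>)) \<lambda>(a\<^sub>(\<^sub>2\<^sub>), v)\<close> vanishes. Multiplying by \<open>S(a\<^sub>(\<^sub>3\<^sub>))\<close> on the right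
  isolates \<open>S(\<lambda>(a, v))\<close>.
\<close>

lemma S_lm:
  assumes st: "star_condition R A \<Delta> V lam kap" and el: "\<forall>x\<in>carrier (tensor R A V). \<epsilon> (lam x) = \<zero>\<^bsub>R\<^esub>"
    and a: "a \<in> carrier A" and v: "v \<in> carrier V"
  shows "S (lm a v) \<oplus>\<^bsub>A\<^esub> C.sw A (\<lambda>x y. S x \<otimes>\<^bsub>A\<^esub> C.sw A (\<lambda>p q. lm p v \<otimes>\<^bsub>A\<^esub> S q) y) a = \<zero>\<^bsub>A\<^esub>"
proof -
  let ?t1 = "\<lambda>x1 x2 y. (S (lm x1 v) \<otimes>\<^bsub>A\<^esub> x2) \<otimes>\<^bsub>A\<^esub> S y" and ?t2 = "\<lambda>x1 x2 y. (S x1 \<otimes>\<^bsub>A\<^esub> lm x2 v) \<otimes>\<^bsub>A\<^esub> S y"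
  have t1: "tril R A A ?t1" and t2: "tril R A A ?t2" using v by (intro trilI lh; simp)+
  have b1: "bil R A A A (\<lambda>x1 x2. S (lm x1 v) \<otimes>\<^bsub>A\<^esub> x2)" and b2: "bil R A A A (\<lambda>x1 x2. S x1 \<otimes>\<^bsub>A\<^esub> lm x2 v)"
    and b3: "bil R A A A (\<lambda>p q. lm p v \<otimes>\<^bsub>A\<^esub> S q)"
    using v by (intro bilI lh; simp)+
  note c1 = C.sw_closed[OF mod_A b1] and c2 = C.sw_closed[OF mod_A b2] and c3 = C.sw_closed[OF mod_A b3]
  note lS = lin_tlift[OF mod_A mod_A mod_A Sa.bil_S(1)] and tS = tlift_tens[OF mod_A mod_A mod_A Sa.bil_S(1)]
  note bs = bil_star_rhs[OF v]
  \<comment> \<open>The antipode law at \<open>\<lambda>(x, v)\<close>.\<close>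
  have W: "C.sw A (\<lambda>x1 x2. S (lm x1 v) \<otimes>\<^bsub>A\<^esub> x2) x \<oplus>\<^bsub>A\<^esub> C.sw A (\<lambda>x1 x2. S x1 \<otimes>\<^bsub>A\<^esub> lm x2 v) x = \<zero>\<^bsub>A\<^esub>" if x: "x \<in> carrier A" for x
  proof -
    have "tlift R A (\<lambda>x y. S x \<otimes>\<^bsub>A\<^esub> y) (\<Delta> (lm x v)) = \<zero>\<^bsub>A\<^esub>"
      using Sa.antipode_left[of "lm x v"] el x v by (simp add: tens_closed)
    moreover have "\<Delta> (lm x v) = star_rhs x v" using st x v by (simp add: star_condition_iff)
    moreover have "tlift R A (\<lambda>x y. S x \<otimes>\<^bsub>A\<^esub> y) (star_rhs x v) =
        C.sw A (\<lambda>b c. tlift R A (\<lambda>x y. S x \<otimes>\<^bsub>A\<^esub> y) (tens R A A (lm b v) c)) x \<oplus>\<^bsub>A\<^esub>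
        C.sw A (\<lambda>b c. tlift R A (\<lambda>x y. S x \<otimes>\<^bsub>A\<^esub> y) (tens R A A b (lm c v))) x"
      unfolding star_rhs_def
      by (simp add: lin_add[OF lS] C.sw_closed[OF mod_AA] bs x C.sw_lin[OF mod_AA mod_A bs(1) x lS] C.sw_lin[OF mod_AA mod_A bs(2) x lS])
    moreover have "C.sw A (\<lambda>b c. tlift R A (\<lambda>x y. S x \<otimes>\<^bsub>A\<^esub> y) (tens R A A (lm b v) c)) x = C.sw A (\<lambda>x1 x2. S (lm x1 v) \<otimes>\<^bsub>A\<^esub> x2) x"
      by (rule C.sw_cong[OF mod_A bil_lin_comp[OF bs(1) lS] x]) (simp add: tS v)
    moreover have "C.sw A (\<lambda>b c. tlift R A (\<lambda>x y. S x \<otimes>\<^bsub>A\<^esub> y) (tens R A A b (lm c v))) x = C.sw A (\<lambda>x1 x2. S x1 \<otimes>\<^bsub>A\<^esub> lm x2 v) x"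
      by (rule C.sw_cong[OF mod_A bil_lin_comp[OF bs(2) lS] x]) (simp add: tS v)
    ultimately show ?thesis by (simp only:)
  qed
  note ts1 = C.tril_sw_bil[OF mod_A t1] and ts2 = C.tril_sw_bil[OF mod_A t2]
  let ?X1 = "C.sw A (\<lambda>x y. C.sw A (\<lambda>x1 x2. ?t1 x1 x2 y) x) a" and ?X2 = "C.sw A (\<lambda>x y. C.sw A (\<lambda>x1 x2. ?t2 x1 x2 y) x) a"
  have "?X1 \<oplus>\<^bsub>A\<^esub> ?X2 = C.sw A (\<lambda>x y. C.sw A (\<lambda>x1 x2. ?t1 x1 x2 y) x \<oplus>\<^bsub>A\<^esub> C.sw A (\<lambda>x1 x2. ?t2 x1 x2 y) x) a"
    by (rule C.sw_plus[OF mod_A ts1(1) ts2(1) a, symmetric])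
  also have "\<dots> = C.sw A (\<lambda>x y. \<zero>\<^bsub>A\<^esub>) a"
  proof (rule C.sw_cong[OF mod_A bil_plus[OF mod_A ts1(1) ts2(1)] a])
    fix x y assume xy: "x \<in> carrier A" "y \<in> carrier A"
    note lr = lin_mult_right[OF alg_A Sa.S_closed[OF xy(2)]]
    have "C.sw A (\<lambda>x1 x2. ?t1 x1 x2 y) x \<oplus>\<^bsub>A\<^esub> C.sw A (\<lambda>x1 x2. ?t2 x1 x2 y) x =
      (C.sw A (\<lambda>x1 x2. S (lm x1 v) \<otimes>\<^bsub>A\<^esub> x2) x \<oplus>\<^bsub>A\<^esub> C.sw A (\<lambda>x1 x2. S x1 \<otimes>\<^bsub>A\<^esub> lm x2 v) x) \<otimes>\<^bsub>A\<^esub> S y"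
      using c1[OF xy(1)] c2[OF xy(1)] xy
      by (simp add: C.l_distr C.sw_lin[OF mod_A mod_A b1 xy(1) lr] C.sw_lin[OF mod_A mod_A b2 xy(1) lr])
    then show "C.sw A (\<lambda>x1 x2. ?t1 x1 x2 y) x \<oplus>\<^bsub>A\<^esub> C.sw A (\<lambda>x1 x2. ?t2 x1 x2 y) x = \<zero>\<^bsub>A\<^esub>"
      using xy by (simp add: W)
  qed
  also have "\<dots> = \<zero>\<^bsub>A\<^esub>" by (rule tlift_zero[OF mod_A mod_A mod_A C.Delta_closed[OF a]])
  finally have sum: "?X1 \<oplus>\<^bsub>A\<^esub> ?X2 = \<zero>\<^bsub>A\<^esub>" .
  \<comment> \<open>In the first sum the factor \<open>S(a\<^sub>(\<^sub>3\<^sub>))\<close> cancels against \<open>a\<^sub>(\<^sub>2\<^sub>)\<close>.\<close>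
  have "?X1 = C.sw A (\<lambda>x y. C.sw A (\<lambda>p q. ?t1 x p q) y) a" by (rule C.sw_coassoc[OF mod_A t1 a])
  also have "\<dots> = C.sw A (\<lambda>x y. \<epsilon> y \<odot>\<^bsub>A\<^esub> S (lm x v)) a"
  proof (rule C.sw_cong[OF mod_A ts1(2) a])
    fix x y assume xy: "x \<in> carrier A" "y \<in> carrier A"
    have k: "S (lm x v) \<in> carrier A" using xy v by simp
    have "C.sw A (\<lambda>p q. ?t1 x p q) y = C.sw A (\<lambda>p q. S (lm x v) \<otimes>\<^bsub>A\<^esub> (p \<otimes>\<^bsub>A\<^esub> S q)) y"
      by (rule C.sw_cong[OF mod_A C.tril_bil(1)[OF t1 xy(1)] xy(2)]) (simp add: k C.m_assoc)
    also have "\<dots> = S (lm x v) \<otimes>\<^bsub>A\<^esub> C.sw A (\<lambda>p q. p \<otimes>\<^bsub>A\<^esub> S q) y"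
      by (rule C.sw_lin[OF mod_A mod_A Sa.bil_S(2) xy(2) lin_mult_left[OF alg_A k], symmetric])
    finally show "C.sw A (\<lambda>p q. ?t1 x p q) y = \<epsilon> y \<odot>\<^bsub>A\<^esub> S (lm x v)"
      using k xy by (simp add: Sa.antipode_right C.smult_mult_right)
  qed
  also have "\<dots> = S (lm a v)"
    by (rule Sa.sw_counit_right[OF mod_A _ a]) (intro lh, simp_all add: v)
  finally have X1: "?X1 = S (lm a v)" .
  have "?X2 = C.sw A (\<lambda>x y. C.sw A (\<lambda>p q. ?t2 x p q) y) a" by (rule C.sw_coassoc[OF mod_A t2 a])
  also have "\<dots> = C.sw A (\<lambda>x y. S x \<otimes>\<^bsub>A\<^esub> C.sw A (\<lambda>p q. lm p v \<otimes>\<^bsub>A\<^esub> S q) y) a"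
  proof (rule C.sw_cong[OF mod_A ts2(2) a])
    fix x y assume xy: "x \<in> carrier A" "y \<in> carrier A"
    have "C.sw A (\<lambda>p q. ?t2 x p q) y = C.sw A (\<lambda>p q. S x \<otimes>\<^bsub>A\<^esub> (lm p v \<otimes>\<^bsub>A\<^esub> S q)) y"
      by (rule C.sw_cong[OF mod_A C.tril_bil(1)[OF t2 xy(1)] xy(2)]) (simp add: xy v C.m_assoc)
    then show "C.sw A (\<lambda>p q. ?t2 x p q) y = S x \<otimes>\<^bsub>A\<^esub> C.sw A (\<lambda>p q. lm p v \<otimes>\<^bsub>A\<^esub> S q) y"
      using C.sw_lin[OF mod_A mod_A b3 xy(2) lin_mult_left[OF alg_A Sa.S_closed[OF xy(1)]]] by simp
  qed
  finally show ?thesis using sum X1 by simp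
qed

text \<open>
  From \<open>v S(a) = S(a\<^sub>(\<^sub>1\<^sub>)) (a\<^sub>(\<^sub>2\<^sub>) v) S(a\<^sub>(\<^sub>3\<^sub>))\<close> by rewriting the inner product with the defining relation. The last
  summand is the element that also occurs in \<open>S_lm\<close>.
\<close>

lemma antipode_av:
  assumes a: "a \<in> carrier A" and v: "v \<in> carrier V"
  shows "iV v \<otimes>\<^bsub>H\<^esub> iA (S a) = C.sw H (\<lambda>b c. iA (S c) \<otimes>\<^bsub>H\<^esub> iV (act b v)) a
    \<oplus>\<^bsub>H\<^esub> iA (C.sw A (\<lambda>x y. S x \<otimes>\<^bsub>A\<^esub> C.sw A (\<lambda>p q. lm p v \<otimes>\<^bsub>A\<^esub> S q) y) a)"
proof -
  let ?n = "\<lambda>y. C.sw A (\<lambda>p q. lm p v \<otimes>\<^bsub>A\<^esub> S q) y"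
  let ?t = "\<lambda>x p y. (iA (S x) \<otimes>\<^bsub>H\<^esub> (iA p \<otimes>\<^bsub>H\<^esub> iV v)) \<otimes>\<^bsub>H\<^esub> iA (S y)"
  let ?u = "\<lambda>b c q. (iV (act b v) \<otimes>\<^bsub>H\<^esub> iA c) \<otimes>\<^bsub>H\<^esub> iA (S q)"
  have t: "tril R A H ?t" and u: "tril R A H ?u" using v by (intro trilI lh; simp)+
  have b3: "bil R A A A (\<lambda>p q. lm p v \<otimes>\<^bsub>A\<^esub> S q)" and b4: "bil R A A H (\<lambda>p q. (iA p \<otimes>\<^bsub>H\<^esub> iV v) \<otimes>\<^bsub>H\<^esub> iA (S q))"
    and b5: "bil R A A H (\<lambda>p q. iA (lm p v) \<otimes>\<^bsub>H\<^esub> iA (S q))" and b6: "bil R A A H (\<lambda>x y. iA (S x) \<otimes>\<^bsub>H\<^esub> iV (act y v))"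
    using v by (intro bilI lh; simp)+
  have nl: "lin A A ?n" by (rule C.lin_sw[OF mod_A b3 lin_id])
  note nc [simp] = lin_closed[OF nl]
  have b7: "bil R A A A (\<lambda>x y. S x \<otimes>\<^bsub>A\<^esub> ?n y)" by (intro bilI lin_mult1 lin_mult2 nl lh) simp_all
  note ts = C.tril_sw_bil[OF mod_H t] and us = C.tril_sw_bil[OF mod_H u]
  \<comment> \<open>The inner expression \<open>y\<^sub>(\<^sub>1\<^sub>) v S(y\<^sub>(\<^sub>2\<^sub>))\<close>: the defining relation leaves the action of \<open>y\<close> and a remainder in \<open>A\<close>.\<close>
  have K: "C.sw H (\<lambda>p q. (iA p \<otimes>\<^bsub>H\<^esub> iV v) \<otimes>\<^bsub>H\<^esub> iA (S q)) y = iV (act y v) \<oplus>\<^bsub>H\<^esub> iA (?n y)" if y: "y \<in> carrier A" for y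
  proof -
    have "C.sw H (\<lambda>p q. (iA p \<otimes>\<^bsub>H\<^esub> iV v) \<otimes>\<^bsub>H\<^esub> iA (S q)) y =
        C.sw H (\<lambda>p q. C.sw H (\<lambda>b c. ?u b c q) p \<oplus>\<^bsub>H\<^esub> iA (lm p v) \<otimes>\<^bsub>H\<^esub> iA (S q)) y"
    proof (rule C.sw_cong[OF mod_H b4 y])
      fix p q assume pq: "p \<in> carrier A" "q \<in> carrier A"
      show "(iA p \<otimes>\<^bsub>H\<^esub> iV v) \<otimes>\<^bsub>H\<^esub> iA (S q) = C.sw H (\<lambda>b c. ?u b c q) p \<oplus>\<^bsub>H\<^esub> iA (lm p v) \<otimes>\<^bsub>H\<^esub> iA (S q)"
        using C.sw_lin[OF mod_H mod_H bil_H[OF v] pq(1) lin_mult_right[OF alg_H, of "iA (S q)"]] C.sw_closed[OF mod_H bil_H[OF v] pq(1)] pq v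
        by (simp add: rel_av Ha.l_distr)
    qed
    also have "\<dots> = C.sw H (\<lambda>p q. C.sw H (\<lambda>b c. ?u b c q) p) y \<oplus>\<^bsub>H\<^esub> C.sw H (\<lambda>p q. iA (lm p v) \<otimes>\<^bsub>H\<^esub> iA (S q)) y"
      by (rule C.sw_plus[OF mod_H us(1) b5 y])
    also have "C.sw H (\<lambda>p q. iA (lm p v) \<otimes>\<^bsub>H\<^esub> iA (S q)) y = iA (?n y)"
      unfolding C.sw_lin[OF mod_A mod_H b3 y lin_iA]
      by (rule C.sw_cong[OF mod_H b5 y]) (simp add: v iA_mult)
    also have "C.sw H (\<lambda>p q. C.sw H (\<lambda>b c. ?u b c q) p) y = C.sw H (\<lambda>b r. C.sw H (\<lambda>c q. ?u b c q) r) y"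
      by (rule C.sw_coassoc[OF mod_H u y])
    also have "\<dots> = C.sw H (\<lambda>b r. \<epsilon> r \<odot>\<^bsub>H\<^esub> iV (act b v)) y"
    proof (rule C.sw_cong[OF mod_H us(2) y])
      fix b r assume br: "b \<in> carrier A" "r \<in> carrier A"
      have k: "iV (act b v) \<in> carrier H" using br v by simp
      have l: "lin A H (\<lambda>z. iV (act b v) \<otimes>\<^bsub>H\<^esub> iA z)" by (intro lh) (simp_all add: k)
      have "C.sw H (\<lambda>c q. ?u b c q) r = C.sw H (\<lambda>c q. iV (act b v) \<otimes>\<^bsub>H\<^esub> iA (c \<otimes>\<^bsub>A\<^esub> S q)) r"
        by (rule C.sw_cong[OF mod_H C.tril_bil(1)[OF u br(1)] br(2)]) (simp add: k iA_mult Ha.m_assoc)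
      also have "\<dots> = iV (act b v) \<otimes>\<^bsub>H\<^esub> iA (C.sw A (\<lambda>c q. c \<otimes>\<^bsub>A\<^esub> S q) r)"
        by (rule C.sw_lin[OF mod_A mod_H Sa.bil_S(2) br(2) l, symmetric])
      finally show "C.sw H (\<lambda>c q. ?u b c q) r = \<epsilon> r \<odot>\<^bsub>H\<^esub> iV (act b v)"
        using br k by (simp add: Sa.antipode_right lin_smult[OF lin_iA] iA_one Ha.smult_mult_right)
    qed
    also have "\<dots> = iV (act y v)" by (rule Sa.sw_counit_right[OF mod_H _ y]) (intro lh, simp_all add: v)
    finally show ?thesis .
  qed
  have lv: "lin A H (\<lambda>y. iV v \<otimes>\<^bsub>H\<^esub> iA (S y))" by (intro lh) (simp_all add: v)
  have "iV v \<otimes>\<^bsub>H\<^esub> iA (S a) = C.sw H (\<lambda>x y. \<epsilon> x \<odot>\<^bsub>H\<^esub> (iV v \<otimes>\<^bsub>H\<^esub> iA (S y))) a"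
    by (rule Sa.sw_counit_left[OF mod_H lv a, symmetric])
  also have "\<dots> = C.sw H (\<lambda>x y. C.sw H (\<lambda>p q. ?t p q y) x) a"
  proof (rule C.sw_cong[OF mod_H ts(1) a, symmetric])
    fix x y assume xy: "x \<in> carrier A" "y \<in> carrier A"
    have k: "iV v \<otimes>\<^bsub>H\<^esub> iA (S y) \<in> carrier H" using xy v by simp
    have l: "lin A H (\<lambda>z. iA z \<otimes>\<^bsub>H\<^esub> (iV v \<otimes>\<^bsub>H\<^esub> iA (S y)))" by (intro lh) (simp_all add: k)
    have "C.sw H (\<lambda>p q. ?t p q y) x = C.sw H (\<lambda>p q. iA (S p \<otimes>\<^bsub>A\<^esub> q) \<otimes>\<^bsub>H\<^esub> (iV v \<otimes>\<^bsub>H\<^esub> iA (S y))) x"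
      by (rule C.sw_cong[OF mod_H C.tril_bil(3)[OF t xy(2)] xy(1)]) (simp add: v xy iA_mult Ha.m_assoc)
    also have "\<dots> = iA (C.sw A (\<lambda>p q. S p \<otimes>\<^bsub>A\<^esub> q) x) \<otimes>\<^bsub>H\<^esub> (iV v \<otimes>\<^bsub>H\<^esub> iA (S y))"
      by (rule C.sw_lin[OF mod_A mod_H Sa.bil_S(1) xy(1) l, symmetric])
    finally show "C.sw H (\<lambda>p q. ?t p q y) x = \<epsilon> x \<odot>\<^bsub>H\<^esub> (iV v \<otimes>\<^bsub>H\<^esub> iA (S y))"
      using xy k by (simp add: Sa.antipode_left lin_smult[OF lin_iA] iA_one Ha.smult_mult_left)
  qed
  also have "\<dots> = C.sw H (\<lambda>x y. C.sw H (\<lambda>p q. ?t x p q) y) a" by (rule C.sw_coassoc[OF mod_H t a])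
  also have "\<dots> = C.sw H (\<lambda>x y. iA (S x) \<otimes>\<^bsub>H\<^esub> iV (act y v) \<oplus>\<^bsub>H\<^esub> iA (S x \<otimes>\<^bsub>A\<^esub> ?n y)) a"
  proof (rule C.sw_cong[OF mod_H ts(2) a])
    fix x y assume xy: "x \<in> carrier A" "y \<in> carrier A"
    have k: "iA (S x) \<in> carrier H" using xy by simp
    have "C.sw H (\<lambda>p q. ?t x p q) y = C.sw H (\<lambda>p q. iA (S x) \<otimes>\<^bsub>H\<^esub> ((iA p \<otimes>\<^bsub>H\<^esub> iV v) \<otimes>\<^bsub>H\<^esub> iA (S q))) y"
      by (rule C.sw_cong[OF mod_H C.tril_bil(1)[OF t xy(1)] xy(2)]) (simp add: v xy Ha.m_assoc)
    also have "\<dots> = iA (S x) \<otimes>\<^bsub>H\<^esub> (iV (act y v) \<oplus>\<^bsub>H\<^esub> iA (?n y))"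
      using C.sw_lin[OF mod_H mod_H b4 xy(2) lin_mult_left[OF alg_H k]] by (simp add: K xy)
    finally show "C.sw H (\<lambda>p q. ?t x p q) y = iA (S x) \<otimes>\<^bsub>H\<^esub> iV (act y v) \<oplus>\<^bsub>H\<^esub> iA (S x \<otimes>\<^bsub>A\<^esub> ?n y)"
      using xy v by (simp add: Ha.r_distr iA_mult)
  qed
  also have "\<dots> = C.sw H (\<lambda>x y. iA (S x) \<otimes>\<^bsub>H\<^esub> iV (act y v)) a \<oplus>\<^bsub>H\<^esub> C.sw H (\<lambda>x y. iA (S x \<otimes>\<^bsub>A\<^esub> ?n y)) a"
    by (rule C.sw_plus[OF mod_H b6 bil_lin_comp[OF b7 lin_iA] a])
  finally show ?thesis by (simp add: C.sw_lin[OF mod_A mod_H b7 a lin_iA] C.sw_cocomm[OF mod_H b6 a])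
qed

text \<open>
  The universal property with values in the opposite algebra. The relation between \<open>a\<close> and \<open>v\<close> is
  \<open>antipode_av\<close> combined with \<open>S_lm\<close>.
\<close>

lemma antipode_exists:
  assumes st: "star_condition R A \<Delta> V lam kap" and el: "\<forall>x\<in>carrier (tensor R A V). \<epsilon> (lam x) = \<zero>\<^bsub>R\<^esub>"
  obtains s where "s \<in> alg_hom R H (op_alg H)" "\<And>v. v \<in> carrier V \<Longrightarrow> s (iV v) = \<ominus>\<^bsub>H\<^esub> iV v" "\<And>a. a \<in> carrier A \<Longrightarrow> s (iA a) = iA (S a)"
proof -
  show thesis
  proof (rule H_lift[OF assoc_algebra_op[OF alg_H], of "\<lambda>v. \<ominus>\<^bsub>H\<^esub> iV v" "\<lambda>a. iA (S a)"])
    show "lin V (op_alg H) (\<lambda>v. \<ominus>\<^bsub>H\<^esub> iV v)" using lin_neg[OF mod_H lin_iV] by simp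
    show "lin A (op_alg H) (\<lambda>a. iA (S a))" using lin_comp[OF Sa.antipode_linear lin_iA] by simp
    show "iA (S (a \<otimes>\<^bsub>A\<^esub> b)) = iA (S a) \<otimes>\<^bsub>op_alg H\<^esub> iA (S b)" if "a \<in> carrier A" "b \<in> carrier A" for a b
      using that by (simp add: Sa.S_antihom iA_mult)
    show "iA (S \<one>\<^bsub>A\<^esub>) = \<one>\<^bsub>op_alg H\<^esub>" by (simp add: Sa.S_one iA_one)
  next
    fix a v assume a: "a \<in> carrier A" and v: "v \<in> carrier V"
    let ?N = "C.sw A (\<lambda>x y. S x \<otimes>\<^bsub>A\<^esub> C.sw A (\<lambda>p q. lm p v \<otimes>\<^bsub>A\<^esub> S q) y) a"
    let ?X = "C.sw H (\<lambda>b c. iA (S c) \<otimes>\<^bsub>H\<^esub> iV (act b v)) a"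
    have b3: "bil R A A A (\<lambda>p q. lm p v \<otimes>\<^bsub>A\<^esub> S q)" using v by (intro bilI lh) simp_all
    have b7: "bil R A A A (\<lambda>x y. S x \<otimes>\<^bsub>A\<^esub> C.sw A (\<lambda>p q. lm p v \<otimes>\<^bsub>A\<^esub> S q) y)"
      by (intro bilI lin_mult1 lin_mult2 C.lin_sw[OF mod_A b3] lh) (simp_all add: C.sw_closed[OF mod_A b3])
    have Nc: "?N \<in> carrier A" by (rule C.sw_closed[OF mod_A b7 a])
    have b6: "bil R A A H (\<lambda>b c. iA (S c) \<otimes>\<^bsub>H\<^esub> iV (act b v))" using v by (intro bilI lh) simp_all
    have Xc: "?X \<in> carrier H" by (rule C.sw_closed[OF mod_H b6 a])
    have SN: "S (lm a v) = \<ominus>\<^bsub>A\<^esub> ?N" using S_lm[OF st el a v] Nc a v by (metis C.minus_equality Sa.S_closed lm_closed)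
    have "C.sw H (\<lambda>b c. iA (S c) \<otimes>\<^bsub>H\<^esub> (\<ominus>\<^bsub>H\<^esub> iV (act b v))) a = C.sw H (\<lambda>b c. \<ominus>\<^bsub>H\<^esub> (iA (S c) \<otimes>\<^bsub>H\<^esub> iV (act b v))) a"
      by (rule C.sw_cong[OF mod_H bil_lin_comp[OF b6 lin_neg[OF mod_H lin_id]] a, symmetric]) (simp add: v Ha.r_minus)
    also have "\<dots> = \<ominus>\<^bsub>H\<^esub> ?X" by (rule C.sw_lin[OF mod_H mod_H b6 a lin_neg[OF mod_H lin_id], symmetric])
    finally have e: "C.sw H (\<lambda>b c. iA (S c) \<otimes>\<^bsub>H\<^esub> (\<ominus>\<^bsub>H\<^esub> iV (act b v))) a = \<ominus>\<^bsub>H\<^esub> ?X" .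
    have "(\<ominus>\<^bsub>H\<^esub> iV v) \<otimes>\<^bsub>H\<^esub> iA (S a) = \<ominus>\<^bsub>H\<^esub> (?X \<oplus>\<^bsub>H\<^esub> iA ?N)"
      using antipode_av[OF a v] a v by (simp add: Ha.l_minus)
    also have "\<dots> = \<ominus>\<^bsub>H\<^esub> ?X \<oplus>\<^bsub>H\<^esub> iA (S (lm a v))"
      using Xc Nc by (simp add: SN lin_uminus[OF mod_A mod_H lin_iA] Ha.minus_add)
    finally show "iA (S a) \<otimes>\<^bsub>op_alg H\<^esub> (\<ominus>\<^bsub>H\<^esub> iV v) = C.sw (op_alg H) (\<lambda>b c. (\<ominus>\<^bsub>H\<^esub> iV (act b v)) \<otimes>\<^bsub>op_alg H\<^esub> iA (S c)) a \<oplus>\<^bsub>op_alg H\<^esub> iA (S (lm a v))"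
      unfolding tlift_op_alg op_alg_simps e .
  next
    fix v w assume vw: "v \<in> carrier V" "w \<in> carrier V"
    have Sk: "S (kA v w) = \<ominus>\<^bsub>A\<^esub> kA v w" by (rule Sa.S_primitive) (use st vw in \<open>simp_all add: star_condition_iff\<close>)
    have "iV w \<otimes>\<^bsub>H\<^esub> iV v \<ominus>\<^bsub>H\<^esub> iV v \<otimes>\<^bsub>H\<^esub> iV w = \<ominus>\<^bsub>H\<^esub> (iV v \<otimes>\<^bsub>H\<^esub> iV w \<ominus>\<^bsub>H\<^esub> iV w \<otimes>\<^bsub>H\<^esub> iV v)"
      using vw by (simp add: a_minus_def Ha.minus_add Ha.a_comm)
    then show "(\<ominus>\<^bsub>H\<^esub> iV v) \<otimes>\<^bsub>op_alg H\<^esub> (\<ominus>\<^bsub>H\<^esub> iV w) \<ominus>\<^bsub>op_alg H\<^esub> (\<ominus>\<^bsub>H\<^esub> iV w) \<otimes>\<^bsub>op_alg H\<^esub> (\<ominus>\<^bsub>H\<^esub> iV v) =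
      iA (S (kA v w)) \<oplus>\<^bsub>op_alg H\<^esub> (\<ominus>\<^bsub>H\<^esub> iV (kV v w))"
      using vw by (simp add: rel_vv Sk lin_uminus[OF mod_A mod_H lin_iA] Ha.minus_add Ha.l_minus Ha.r_minus)
  qed (rule that)
qed

text \<open>
  The antipode laws are not equalities of algebra maps. They pass from \<open>x\<close> to \<open>g x\<close> for a generator \<open>g\<close> because
  \<open>S(g\<^sub>(\<^sub>1\<^sub>) x\<^sub>(\<^sub>1\<^sub>)) g\<^sub>(\<^sub>2\<^sub>) x\<^sub>(\<^sub>2\<^sub>) = S(x\<^sub>(\<^sub>1\<^sub>)) S(g\<^sub>(\<^sub>1\<^sub>)) g\<^sub>(\<^sub>2\<^sub>) x\<^sub>(\<^sub>2\<^sub>)\<close>, where the inner product is a scalar, and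
  similarly on the other side.
\<close>

lemma H_hopf_algebra:
  assumes bi: "cocomm_bialgebra R H D e"
    and DV: "\<And>v. v \<in> carrier V \<Longrightarrow> D (iV v) = prim H (iV v)" and DA: "\<And>a. a \<in> carrier A \<Longrightarrow> D (iA a) = J (\<Delta> a)"
    and eA: "\<And>a. a \<in> carrier A \<Longrightarrow> e (iA a) = \<epsilon> a"
    and s: "s \<in> alg_hom R H (op_alg H)" "\<And>v. v \<in> carrier V \<Longrightarrow> s (iV v) = \<ominus>\<^bsub>H\<^esub> iV v" "\<And>a. a \<in> carrier A \<Longrightarrow> s (iA a) = iA (S a)"
  shows "cocomm_hopf_algebra R H D e s"
proof -
  interpret E: cocomm_bialgebra R H D e by fact
  have sl: "lin H H s" using alg_hom_lin[OF s(1)] by simp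
  have sc [simp]: "s x \<in> carrier H" if "x \<in> carrier H" for x by (rule lin_closed[OF sl that])
  have sm: "s (x \<otimes>\<^bsub>H\<^esub> y) = s y \<otimes>\<^bsub>H\<^esub> s x" if "x \<in> carrier H" "y \<in> carrier H" for x y using alg_hom_mult[OF s(1) that] by simp
  have s1: "s \<one>\<^bsub>H\<^esub> = \<one>\<^bsub>H\<^esub>" using alg_hom_one[OF s(1)] by simp
  have bl: "bil R H H H (\<lambda>x y. s x \<otimes>\<^bsub>H\<^esub> y)" and br: "bil R H H H (\<lambda>x y. x \<otimes>\<^bsub>H\<^esub> s y)"
    by (intro bilI lin_mult1 lin_mult2 sl lin_id; simp)+
  let ?P = "tensor R H H"
  let ?m = "tlift R H (\<lambda>x y. s x \<otimes>\<^bsub>H\<^esub> y)" and ?m' = "tlift R H (\<lambda>x y. x \<otimes>\<^bsub>H\<^esub> s y)"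
  note ml = lin_tlift[OF mod_H mod_H mod_H bl] and ml' = lin_tlift[OF mod_H mod_H mod_H br]
  note mt = tlift_tens[OF mod_H mod_H mod_H bl] and mt' = tlift_tens[OF mod_H mod_H mod_H br]
  note eq = tensor_lin_eq[OF mod_H mod_H mod_H]
  have m1: "?m (U \<otimes>\<^bsub>?P\<^esub> tens R H H u v) = (s u \<otimes>\<^bsub>H\<^esub> ?m U) \<otimes>\<^bsub>H\<^esub> v" if "U \<in> carrier ?P" "u \<in> carrier H" "v \<in> carrier H" for U u v
  proof (rule eq[OF lin_comp[OF lin_mult_right[OF alg_HH] ml] _ _ that(1)])
    show "lin ?P H (\<lambda>U. (s u \<otimes>\<^bsub>H\<^esub> ?m U) \<otimes>\<^bsub>H\<^esub> v)" by (intro lin_mult1 lin_mult2 ml) (simp_all add: that)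
  qed (simp_all add: that tensor_H(3) mt sm Ha.m_assoc)
  have m2: "?m' (tens R H H u v \<otimes>\<^bsub>?P\<^esub> W) = (u \<otimes>\<^bsub>H\<^esub> ?m' W) \<otimes>\<^bsub>H\<^esub> s v" if "W \<in> carrier ?P" "u \<in> carrier H" "v \<in> carrier H" for W u v
  proof (rule eq[OF lin_comp[OF lin_mult_left[OF alg_HH] ml'] _ _ that(1)])
    show "lin ?P H (\<lambda>U. (u \<otimes>\<^bsub>H\<^esub> ?m' U) \<otimes>\<^bsub>H\<^esub> s v)" by (intro lin_mult1 lin_mult2 ml') (simp_all add: that)
  qed (simp_all add: that tensor_H(3) mt' sm Ha.m_assoc)
  have M: "?m (U \<otimes>\<^bsub>?P\<^esub> W) = r \<odot>\<^bsub>H\<^esub> ?m W" if "U \<in> carrier ?P" "W \<in> carrier ?P" "?m U = r \<odot>\<^bsub>H\<^esub> \<one>\<^bsub>H\<^esub>" "r \<in> carrier R" for U W r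
    by (rule eq[OF lin_comp[OF lin_mult_left[OF alg_HH that(1)] ml] lin_scale[OF mod_H ml that(4)] _ that(2)])
      (simp add: m1 that mt Ha.smult_mult_right Ha.smult_mult_left)
  have M': "?m' (U \<otimes>\<^bsub>?P\<^esub> W) = r \<odot>\<^bsub>H\<^esub> ?m' U" if "U \<in> carrier ?P" "W \<in> carrier ?P" "?m' W = r \<odot>\<^bsub>H\<^esub> \<one>\<^bsub>H\<^esub>" "r \<in> carrier R" for U W r
    by (rule eq[OF lin_comp[OF lin_mult_right[OF alg_HH that(2)] ml'] lin_scale[OF mod_H ml' that(4)] _ that(1)])
      (simp add: m2 that mt' Ha.smult_mult_right Ha.smult_mult_left)
  note D = E.comult_hom
  note Dl = alg_hom_lin[OF D] and Dc = alg_hom_closed[OF D]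
  have gen: "?m (D g) = e g \<odot>\<^bsub>H\<^esub> \<one>\<^bsub>H\<^esub> \<and> ?m' (D g) = e g \<odot>\<^bsub>H\<^esub> \<one>\<^bsub>H\<^esub>" if "g \<in> iV ` carrier V \<union> iA ` carrier A" for g
    using that
  proof (elim UnE imageE)
    fix v assume v: "v \<in> carrier V" and g: "g = iV v"
    have "e (iV v) = \<zero>\<^bsub>R\<^esub>" by (rule E.eps_primitive) (simp_all add: v DV)
    then show ?thesis using v by (simp add: g DV) (simp add: prim_def lin_add[OF ml] lin_add[OF ml'] mt mt' s1 s(2) Ha.r_neg Ha.l_neg)
  next
    fix a assume a: "a \<in> carrier A" and g: "g = iA a"
    have "?m (D g) = C.sw H (\<lambda>b c. ?m (tens R H H (iA b) (iA c))) a"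
      using C.sw_lin[OF mod_HH mod_H bil_J a ml] by (simp add: g DA a)
    also have "\<dots> = C.sw H (\<lambda>b c. iA (S b \<otimes>\<^bsub>A\<^esub> c)) a"
      by (rule C.sw_cong[OF mod_H bil_lin_comp[OF bil_J ml] a]) (simp add: mt s iA_mult)
    also have "\<dots> = iA (C.sw A (\<lambda>b c. S b \<otimes>\<^bsub>A\<^esub> c) a)" by (rule C.sw_lin[OF mod_A mod_H Sa.bil_S(1) a lin_iA, symmetric])
    finally have 1: "?m (D g) = e g \<odot>\<^bsub>H\<^esub> \<one>\<^bsub>H\<^esub>" using a by (simp add: Sa.antipode_left lin_smult[OF lin_iA] iA_one g eA)
    have "?m' (D g) = C.sw H (\<lambda>b c. ?m' (tens R H H (iA b) (iA c))) a"
      using C.sw_lin[OF mod_HH mod_H bil_J a ml'] by (simp add: g DA a)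
    also have "\<dots> = C.sw H (\<lambda>b c. iA (b \<otimes>\<^bsub>A\<^esub> S c)) a"
      by (rule C.sw_cong[OF mod_H bil_lin_comp[OF bil_J ml'] a]) (simp add: mt' s iA_mult)
    also have "\<dots> = iA (C.sw A (\<lambda>b c. b \<otimes>\<^bsub>A\<^esub> S c) a)" by (rule C.sw_lin[OF mod_A mod_H Sa.bil_S(2) a lin_iA, symmetric])
    finally have 2: "?m' (D g) = e g \<odot>\<^bsub>H\<^esub> \<one>\<^bsub>H\<^esub>" using a by (simp add: Sa.antipode_right lin_smult[OF lin_iA] iA_one g eA)
    from 1 2 show ?thesis ..
  qed
  have all: "?m (D h) = e h \<odot>\<^bsub>H\<^esub> \<one>\<^bsub>H\<^esub> \<and> ?m' (D h) = e h \<odot>\<^bsub>H\<^esub> \<one>\<^bsub>H\<^esub>" if "h \<in> carrier H" for h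
    using generates_H alg_H that
  proof (induction rule: generates_induct)
    case one
    then show ?case by (simp add: alg_hom_one[OF D] tensor_H(2) mt mt' s1 E.eps_one)
  next
    case (add x y)
    then show ?case using lin_add[OF E.lin_eps, of x y]
      by (simp add: lin_add[OF Dl] lin_add[OF ml] lin_add[OF ml'] Dc Ha.smult_l_distr)
  next
    case (smult r x)
    then show ?case by (simp add: lin_smult[OF Dl] lin_smult[OF ml] lin_smult[OF ml'] Dc E.counit_smult Ha.smult_assoc1)
  next
    case (mult g x)
    then have g: "g \<in> carrier H" by auto
    have "?m (D g \<otimes>\<^bsub>?P\<^esub> D x) = e g \<odot>\<^bsub>H\<^esub> ?m (D x)" using gen[OF mult(1)] by (intro M) (simp_all add: g mult Dc)
    moreover have "?m' (D g \<otimes>\<^bsub>?P\<^esub> D x) = e x \<odot>\<^bsub>H\<^esub> ?m' (D g)" using mult by (intro M') (simp_all add: g Dc)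
    ultimately show ?case using g mult gen[OF mult(1)]
      by (simp add: alg_hom_mult[OF D] E.eps_mult Ha.smult_assoc1[symmetric] m_comm)
  qed
  show ?thesis
    by (intro cocomm_hopf_algebra.intro cocomm_hopf_algebra_axioms.intro bi sl) (simp_all add: all)
qed

theorem star_imp_hopf:
  assumes "star_condition R A \<Delta> V lam kap" "\<forall>x\<in>carrier (tensor R A V). \<epsilon> (lam x) = \<zero>\<^bsub>R\<^esub>"
  shows "H_cocomm_hopf_algebra R A \<Delta> \<epsilon> S V act lam kap"
proof -
  obtain D where D: "D \<in> alg_hom R H (tensor R H H)" "\<And>v. v \<in> carrier V \<Longrightarrow> D (iV v) = prim H (iV v)"
    "\<And>a. a \<in> carrier A \<Longrightarrow> D (iA a) = J (\<Delta> a)" by (rule comult_exists[OF assms(1)]) blast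
  obtain e where e: "e \<in> alg_hom R H (reg_alg R)" "\<And>v. v \<in> carrier V \<Longrightarrow> e (iV v) = \<zero>\<^bsub>R\<^esub>" "\<And>a. a \<in> carrier A \<Longrightarrow> e (iA a) = \<epsilon> a"
    by (rule counit_exists[OF Sa.cocomm_bialgebra_axioms assms]) blast
  obtain s where s: "s \<in> alg_hom R H (op_alg H)" "\<And>v. v \<in> carrier V \<Longrightarrow> s (iV v) = \<ominus>\<^bsub>H\<^esub> iV v" "\<And>a. a \<in> carrier A \<Longrightarrow> s (iA a) = iA (S a)"
    by (rule antipode_exists[OF assms]) blast
  show ?thesis
    unfolding H_cocomm_hopf_algebra_def Let_def extends_comult_iff
    by (intro exI[of _ D] exI[of _ e] exI[of _ s] conjI ballI
        H_hopf_algebra[OF H_bialgebra[OF Sa.cocomm_bialgebra_axioms D e] D(2,3) e(3) s] D e s)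
qed

end

subsection \<open>Necessity of the conditions\<close>

context H_data
begin

text \<open>
  Applying \<open>D\<close> to the defining relations and subtracting \<open>comult_av\<close>, respectively \<open>prim_bracket\<close>, leaves the two
  equations of the condition under \<open>J\<close>.
\<close>

lemma cocomm_imp_star:
  assumes inj: "inj_on J (carrier (tensor R A A))"
    and D: "D \<in> alg_hom R H (tensor R H H)" and DV: "\<And>v. v \<in> carrier V \<Longrightarrow> D (iV v) = prim H (iV v)"
    and DA: "\<And>a. a \<in> carrier A \<Longrightarrow> D (iA a) = J (\<Delta> a)"
  shows "star_condition R A \<Delta> V lam kap"
  unfolding star_condition_iff
proof (intro conjI ballI)
  let ?P = "tensor R H H"
  note Dl = alg_hom_lin[OF D]
  have Jc [simp]: "J U \<in> carrier ?P" if "U \<in> carrier (tensor R A A)" for U by (rule lin_closed[OF lin_J that])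
  fix a v assume a: "a \<in> carrier A" and v: "v \<in> carrier V"
  let ?Y = "C.sw ?P (\<lambda>b c. prim H (iV (act b v)) \<otimes>\<^bsub>?P\<^esub> J (\<Delta> c)) a"
  have bY: "bil R A A ?P (\<lambda>b c. prim H (iV (act b v)) \<otimes>\<^bsub>?P\<^esub> J (\<Delta> c))"
    by (intro bilI lin_mult1 lin_mult2 lin_JDelta li) (simp_all add: v)
  have Y: "D (C.sw H (\<lambda>b c. iV (act b v) \<otimes>\<^bsub>H\<^esub> iA c) a) = ?Y"
    unfolding C.sw_lin[OF mod_H mod_HH bil_H[OF v] a Dl]
    by (rule C.sw_cong[OF mod_HH bY a, symmetric]) (simp add: alg_hom_mult[OF D] v DV DA)
  have "J (\<Delta> a) \<otimes>\<^bsub>?P\<^esub> prim H (iV v) = D (iA a \<otimes>\<^bsub>H\<^esub> iV v)" using a v by (simp add: alg_hom_mult[OF D] DV DA)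
  also have "\<dots> = ?Y \<oplus>\<^bsub>?P\<^esub> J (\<Delta> (lm a v))"
    using a v C.sw_closed[OF mod_H bil_H[OF v] a] by (simp add: rel_av lin_add[OF Dl] Y DA)
  finally have "?Y \<oplus>\<^bsub>?P\<^esub> J (star_rhs a v) = ?Y \<oplus>\<^bsub>?P\<^esub> J (\<Delta> (lm a v))" by (simp only: comult_av[OF a v])
  then have "J (star_rhs a v) = J (\<Delta> (lm a v))" using C.sw_closed[OF mod_HH bY a] a v by simp
  then show "\<Delta> (lm a v) = star_rhs a v" using inj a v by (simp add: inj_on_def)
next
  let ?P = "tensor R H H"
  note Dl = alg_hom_lin[OF D]
  fix v w assume vw: "v \<in> carrier V" "w \<in> carrier V"
  have pc: "prim A (kA v w) \<in> carrier (tensor R A A)" using lin_closed[OF lin_prim[OF alg_A]] vw by simp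
  have Jc [simp]: "J U \<in> carrier ?P" if "U \<in> carrier (tensor R A A)" for U by (rule lin_closed[OF lin_J that])
  have "D (iV v \<otimes>\<^bsub>H\<^esub> iV w \<ominus>\<^bsub>H\<^esub> iV w \<otimes>\<^bsub>H\<^esub> iV v) = prim H (iV v \<otimes>\<^bsub>H\<^esub> iV w \<ominus>\<^bsub>H\<^esub> iV w \<otimes>\<^bsub>H\<^esub> iV v)"
    using vw by (simp add: lin_minus[OF mod_H mod_HH Dl] alg_hom_mult[OF D] DV prim_bracket[OF alg_H, symmetric])
  then have "J (\<Delta> (kA v w)) \<oplus>\<^bsub>?P\<^esub> prim H (iV (kV v w)) = J (prim A (kA v w)) \<oplus>\<^bsub>?P\<^esub> prim H (iV (kV v w))"
    using vw by (simp add: rel_vv lin_add[OF Dl] lin_add[OF lin_prim[OF alg_H]] DA DV J_prim)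
  then have "J (\<Delta> (kA v w)) = J (prim A (kA v w))" using vw pc by simp
  then show "\<Delta> (kA v w) = prim A (kA v w)" using inj vw pc by (simp add: inj_on_def)
qed

text \<open>
  The counit of \<open>H\<close> vanishes on the primitive elements of \<open>V\<close>, hence on every term of the relation between \<open>a\<close> and
  \<open>v\<close> except \<open>\<lambda>(a, v)\<close>.
\<close>

lemma bialgebra_imp_eps_lam:
  assumes EA: "cocomm_bialgebra R A \<Delta> \<epsilon>" and EH: "cocomm_bialgebra R H D e"
    and DV: "\<And>v. v \<in> carrier V \<Longrightarrow> D (iV v) = prim H (iV v)" and eA: "\<And>a. a \<in> carrier A \<Longrightarrow> e (iA a) = \<epsilon> a"
    and x: "x \<in> carrier (tensor R A V)"
  shows "\<epsilon> (lam x) = \<zero>\<^bsub>R\<^esub>"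
proof -
  interpret EA: cocomm_bialgebra R A \<Delta> \<epsilon> by fact
  interpret EH: cocomm_bialgebra R H D e by fact
  have mR: "module R (reg_alg R)" by (rule assoc_algebra_module[OF assoc_algebra_reg])
  have eV: "e (iV v) = \<zero>\<^bsub>R\<^esub>" if "v \<in> carrier V" for v by (rule EH.eps_primitive) (simp_all add: that DV)
  have "\<epsilon> (lam x) = \<zero>\<^bsub>reg_alg R\<^esub>"
  proof (rule tensor_lin_eq[OF mod_A mod_V mR lin_comp[OF lam_linear EA.lin_eps] lin_const_zero[OF mR] _ x])
    fix a v assume a: "a \<in> carrier A" and v: "v \<in> carrier V"
    have "e (C.sw H (\<lambda>b c. iV (act b v) \<otimes>\<^bsub>H\<^esub> iA c) a) = C.sw (reg_alg R) (\<lambda>b c. e (iV (act b v) \<otimes>\<^bsub>H\<^esub> iA c)) a"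
      by (rule C.sw_lin[OF mod_H mR bil_H[OF v] a EH.lin_eps])
    also have "\<dots> = C.sw (reg_alg R) (\<lambda>b c. \<zero>\<^bsub>reg_alg R\<^esub>) a"
      by (rule C.sw_cong[OF mR bil_lin_comp[OF bil_H[OF v] EH.lin_eps] a]) (simp add: v EH.eps_mult eV)
    finally have 1: "e (C.sw H (\<lambda>b c. iV (act b v) \<otimes>\<^bsub>H\<^esub> iA c) a) = \<zero>\<^bsub>R\<^esub>"
      using tlift_zero[OF mod_A mod_A mR C.Delta_closed[OF a]] by simp
    have "e (iA a \<otimes>\<^bsub>H\<^esub> iV v) = \<zero>\<^bsub>R\<^esub>" using a v by (simp add: EH.eps_mult eV)
    then show "\<epsilon> (lm a v) = \<zero>\<^bsub>reg_alg R\<^esub>"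
      using a v C.sw_closed[OF mod_H bil_H[OF v] a] lin_add[OF EH.lin_eps, of "C.sw H (\<lambda>b c. iV (act b v) \<otimes>\<^bsub>H\<^esub> iA c) a" "iA (lm a v)"]
      by (simp add: rel_av 1 eA)
  qed
  then show ?thesis by simp
qed

end

context H_hopf
begin

text \<open>
  The antipode of \<open>H\<close> turns the relation between \<open>a\<close> and \<open>v\<close> into
  \<open>v S(a) = S(a\<^sub>(\<^sub>2\<^sub>)) a\<^sub>(\<^sub>1\<^sub>)(v) - S(\<lambda>(a, v))\<close>. The first term on the right is rewritten by the defining relations for
  \<open>S(a\<^sub>(\<^sub>1\<^sub>))\<close> and \<open>a\<^sub>(\<^sub>2\<^sub>)(v)\<close>: with the formula for \<open>\<Delta> \<circ> S\<close> and \<open>S(a\<^sub>(\<^sub>1\<^sub>)) a\<^sub>(\<^sub>2\<^sub>) = \<epsilon>(a) 1\<close> this gives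
  \<open>v S(a) + \<lambda>(S(a\<^sub>(\<^sub>1\<^sub>)), a\<^sub>(\<^sub>2\<^sub>)(v))\<close>.
\<close>

lemma hopf_imp_S_lam:
  assumes inj: "inj_on iA (carrier A)" and EH: "cocomm_hopf_algebra R H D e s"
    and DV: "\<And>v. v \<in> carrier V \<Longrightarrow> D (iV v) = prim H (iV v)" and sA: "\<And>a. a \<in> carrier A \<Longrightarrow> s (iA a) = iA (S a)"
    and a: "a \<in> carrier A" and v: "v \<in> carrier V"
  shows "S (lm a v) = C.sw A (\<lambda>b c. lm (S b) (act c v)) a"
proof -
  interpret E: cocomm_hopf_algebra R H D e s by fact
  have sV: "s (iV w) = \<ominus>\<^bsub>H\<^esub> iV w" if "w \<in> carrier V" for w by (rule E.S_primitive) (simp_all add: that DV)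
  let ?X = "C.sw H (\<lambda>b c. iA (S c) \<otimes>\<^bsub>H\<^esub> iV (act b v)) a"
  let ?n = "C.sw A (\<lambda>b c. lm (S b) (act c v)) a"
  have lm2: "lin X A (\<lambda>x. lm b (f x))" if "b \<in> carrier A" "lin X V f" for X :: "('k, 'x1, 'x2) module_scheme" and f b
    by (rule lin_comp[OF that(2) bil_right[OF bil_lm that(1)]])
  have act2: "lin X V (\<lambda>x. act b (f x))" if "b \<in> carrier A" "lin X V f" for X :: "('k, 'x1, 'x2) module_scheme" and f b
    by (rule lin_comp[OF that(2) bil_right[OF bil_act that(1)]])
  have b6: "bil R A A H (\<lambda>b c. iA (S c) \<otimes>\<^bsub>H\<^esub> iV (act b v))" using v by (intro bilI lh) simp_all
  have b8: "bil R A A A (\<lambda>b c. lm (S b) (act c v))" by (rule bilI; intro lm2 lin_lm lh) (simp_all add: v)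
  let ?t = "\<lambda>x y c. iV (act (S y) (act c v)) \<otimes>\<^bsub>H\<^esub> iA (S x)"
  have t: "tril R A H ?t" by (rule trilI; intro lin_mult1 lin_mult2 lin_iV_comp lin_iA_comp act2 lin_act Sa.lin_S_comp lin_id) (simp_all add: v)
  note ts = C.tril_sw_bil[OF mod_H t]
  have Xc: "?X \<in> carrier H" by (rule C.sw_closed[OF mod_H b6 a])
  have nc: "?n \<in> carrier A" by (rule C.sw_closed[OF mod_A b8 a])
  \<comment> \<open>Cocommutativity puts the components in the order needed for \<open>S(a\<^sub>(\<^sub>1\<^sub>)) a\<^sub>(\<^sub>2\<^sub>)\<close> to appear.\<close>
  have "?X = C.sw H (\<lambda>b c. iA (S b) \<otimes>\<^bsub>H\<^esub> iV (act c v)) a" by (rule C.sw_cocomm[OF mod_H b6 a])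
  also have "\<dots> = C.sw H (\<lambda>b c. C.sw H (\<lambda>x y. ?t x y c) b \<oplus>\<^bsub>H\<^esub> iA (lm (S b) (act c v))) a"
  proof (rule C.sw_cong[OF mod_H bil_plus[OF mod_H ts(1) bil_lin_comp[OF b8 lin_iA]] a, symmetric])
    fix b c assume bc: "b \<in> carrier A" "c \<in> carrier A"
    let ?w = "act c v"
    have w: "?w \<in> carrier V" using bc v by simp
    have bss: "bil R A A (tensor R A A) (\<lambda>x y. tens R A A (S y) (S x))" by (intro bilI lh) simp_all
    note lb = lin_tlift[OF mod_A mod_A mod_H bil_H[OF w]] and tb = tlift_tens[OF mod_A mod_A mod_H bil_H[OF w]]
    have "C.sw H (\<lambda>b c. iV (act b ?w) \<otimes>\<^bsub>H\<^esub> iA c) (S b) = C.sw H (\<lambda>x y. tlift R H (\<lambda>b c. iV (act b ?w) \<otimes>\<^bsub>H\<^esub> iA c) (tens R A A (S y) (S x))) b"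
      unfolding Sa.S_comult[OF bc(1)] by (rule C.sw_lin[OF mod_AA mod_H bss bc(1) lb])
    also have "\<dots> = C.sw H (\<lambda>x y. ?t x y c) b"
      by (rule C.sw_cong[OF mod_H bil_lin_comp[OF bss lb] bc(1)]) (simp add: tb)
    finally show "C.sw H (\<lambda>x y. ?t x y c) b \<oplus>\<^bsub>H\<^esub> iA (lm (S b) ?w) = iA (S b) \<otimes>\<^bsub>H\<^esub> iV ?w"
      using bc w by (simp add: rel_av)
  qed
  also have "\<dots> = C.sw H (\<lambda>b c. C.sw H (\<lambda>x y. ?t x y c) b) a \<oplus>\<^bsub>H\<^esub> C.sw H (\<lambda>b c. iA (lm (S b) (act c v))) a"
    by (rule C.sw_plus[OF mod_H ts(1) bil_lin_comp[OF b8 lin_iA] a])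
  also have "C.sw H (\<lambda>b c. iA (lm (S b) (act c v))) a = iA ?n" by (rule C.sw_lin[OF mod_A mod_H b8 a lin_iA, symmetric])
  also have "C.sw H (\<lambda>b c. C.sw H (\<lambda>x y. ?t x y c) b) a = C.sw H (\<lambda>x r. C.sw H (\<lambda>y c. ?t x y c) r) a"
    by (rule C.sw_coassoc[OF mod_H t a])
  also have "\<dots> = C.sw H (\<lambda>x r. \<epsilon> r \<odot>\<^bsub>H\<^esub> (iV v \<otimes>\<^bsub>H\<^esub> iA (S x))) a"
  proof (rule C.sw_cong[OF mod_H ts(2) a])
    fix x r assume xr: "x \<in> carrier A" "r \<in> carrier A"
    have l: "lin A H (\<lambda>z. iV (act z v) \<otimes>\<^bsub>H\<^esub> iA (S x))" by (intro lh) (simp_all add: v xr)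
    have "C.sw H (\<lambda>y c. ?t x y c) r = C.sw H (\<lambda>y c. iV (act (S y \<otimes>\<^bsub>A\<^esub> c) v) \<otimes>\<^bsub>H\<^esub> iA (S x)) r"
      by (rule C.sw_cong[OF mod_H C.tril_bil(1)[OF t xr(1)] xr(2)]) (simp add: v VM.act_mult)
    also have "\<dots> = iV (act (C.sw A (\<lambda>y c. S y \<otimes>\<^bsub>A\<^esub> c) r) v) \<otimes>\<^bsub>H\<^esub> iA (S x)"
      by (rule C.sw_lin[OF mod_A mod_H Sa.bil_S(1) xr(2) l, symmetric])
    finally show "C.sw H (\<lambda>y c. ?t x y c) r = \<epsilon> r \<odot>\<^bsub>H\<^esub> (iV v \<otimes>\<^bsub>H\<^esub> iA (S x))"
      using xr v by (simp add: Sa.antipode_left VM.act_smult_left VM.act_one lin_smult[OF lin_iV] Ha.smult_mult_left)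
  qed
  also have "\<dots> = iV v \<otimes>\<^bsub>H\<^esub> iA (S a)" by (rule Sa.sw_counit_right[OF mod_H _ a]) (intro lh, simp_all add: v)
  finally have X: "?X = iV v \<otimes>\<^bsub>H\<^esub> iA (S a) \<oplus>\<^bsub>H\<^esub> iA ?n" .
  have "\<ominus>\<^bsub>H\<^esub> (iV v \<otimes>\<^bsub>H\<^esub> iA (S a)) = s (iA a \<otimes>\<^bsub>H\<^esub> iV v)" using a v by (simp add: E.S_antihom sV sA Ha.l_minus)
  also have "\<dots> = s (C.sw H (\<lambda>b c. iV (act b v) \<otimes>\<^bsub>H\<^esub> iA c) a) \<oplus>\<^bsub>H\<^esub> iA (S (lm a v))"
    using a v C.sw_closed[OF mod_H bil_H[OF v] a] by (simp add: rel_av lin_add[OF E.antipode_linear] sA)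
  also have "s (C.sw H (\<lambda>b c. iV (act b v) \<otimes>\<^bsub>H\<^esub> iA c) a) = C.sw H (\<lambda>b c. \<ominus>\<^bsub>H\<^esub> (iA (S c) \<otimes>\<^bsub>H\<^esub> iV (act b v))) a"
    unfolding C.sw_lin[OF mod_H mod_H bil_H[OF v] a E.antipode_linear]
    by (rule C.sw_cong[OF mod_H bil_lin_comp[OF bil_H[OF v] E.antipode_linear] a]) (simp add: v E.S_antihom sV sA Ha.r_minus)
  also have "\<dots> = \<ominus>\<^bsub>H\<^esub> ?X" by (rule C.sw_lin[OF mod_H mod_H b6 a lin_neg[OF mod_H lin_id], symmetric])
  finally have e: "\<ominus>\<^bsub>H\<^esub> (iV v \<otimes>\<^bsub>H\<^esub> iA (S a)) = \<ominus>\<^bsub>H\<^esub> (iV v \<otimes>\<^bsub>H\<^esub> iA (S a) \<oplus>\<^bsub>H\<^esub> iA ?n) \<oplus>\<^bsub>H\<^esub> iA (S (lm a v))"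
    by (simp only: X)
  have cancel: "q = r" if "\<ominus>\<^bsub>H\<^esub> p = \<ominus>\<^bsub>H\<^esub> (p \<oplus>\<^bsub>H\<^esub> r) \<oplus>\<^bsub>H\<^esub> q" "p \<in> carrier H" "q \<in> carrier H" "r \<in> carrier H" for p q r
  proof -
    have "(p \<oplus>\<^bsub>H\<^esub> r) \<oplus>\<^bsub>H\<^esub> \<ominus>\<^bsub>H\<^esub> p = q" using that by (simp add: Ha.r_neg2)
    then show ?thesis using that(2-4) by (simp add: Ha.a_comm[of p r] Ha.a_assoc Ha.r_neg)
  qed
  have "iA (S (lm a v)) = iA ?n" by (rule cancel[OF e]) (use a v nc in simp_all)
  then show ?thesis using inj a v nc by (simp add: inj_on_def)
qed

end

section \<open>The smash product\<close>

text \<open>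
  Linear endomorphisms, made extensional so that equality of elements is equality on \<open>P\<close>.
\<close>

definition end_alg :: "('k, 'r) ring_scheme \<Rightarrow> ('k, 'p, 'x) module_scheme \<Rightarrow> ('k, 'p \<Rightarrow> 'p) module"
  where "end_alg R P = \<lparr>
    carrier = linear_maps R P P \<inter> extensional (carrier P),
    mult = (\<lambda>f g. \<lambda>x\<in>carrier P. f (g x)),
    one = (\<lambda>x\<in>carrier P. x),
    zero = (\<lambda>x\<in>carrier P. \<zero>\<^bsub>P\<^esub>),
    add = (\<lambda>f g. \<lambda>x\<in>carrier P. f x \<oplus>\<^bsub>P\<^esub> g x),
    smult = (\<lambda>r f. \<lambda>x\<in>carrier P. r \<odot>\<^bsub>P\<^esub> f x)\<rparr>"

context cring
begin

lemma end_alg_apply: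
  "x \<in> carrier P \<Longrightarrow> (f \<otimes>\<^bsub>end_alg R P\<^esub> g) x = f (g x)"
  "x \<in> carrier P \<Longrightarrow> \<one>\<^bsub>end_alg R P\<^esub> x = x"
  "x \<in> carrier P \<Longrightarrow> \<zero>\<^bsub>end_alg R P\<^esub> x = \<zero>\<^bsub>P\<^esub>"
  "x \<in> carrier P \<Longrightarrow> (f \<oplus>\<^bsub>end_alg R P\<^esub> g) x = f x \<oplus>\<^bsub>P\<^esub> g x"
  "x \<in> carrier P \<Longrightarrow> (r \<odot>\<^bsub>end_alg R P\<^esub> f) x = r \<odot>\<^bsub>P\<^esub> f x"
  by (simp_all add: end_alg_def)

lemma end_alg_lin: "f \<in> carrier (end_alg R P) \<Longrightarrow> lin P P f" by (simp add: end_alg_def)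
lemma end_alg_closed: "\<lbrakk>f \<in> carrier (end_alg R P); x \<in> carrier P\<rbrakk> \<Longrightarrow> f x \<in> carrier P"
  by (rule lin_closed[OF end_alg_lin])

lemma lin_restrict:
  assumes "module R P" "lin P P f" shows "lin P P (restrict f (carrier P))"
  by (rule lin_cong[OF assms(2,1)]) simp

lemma restrict_end_alg:
  assumes "module R P" "lin P P f" shows "restrict f (carrier P) \<in> carrier (end_alg R P)"
  using lin_restrict[OF assms] by (simp add: end_alg_def)

lemma end_alg_eqI:
  assumes "f \<in> carrier (end_alg R P)" "g \<in> carrier (end_alg R P)" "\<And>x. x \<in> carrier P \<Longrightarrow> f x = g x"
  shows "f = g"
  by (rule extensionalityI[of _ "carrier P"]) (use assms in \<open>auto simp: end_alg_def\<close>)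

lemma end_alg_ops_closed:
  assumes P: "module R P"
  shows "\<one>\<^bsub>end_alg R P\<^esub> \<in> carrier (end_alg R P)" "\<zero>\<^bsub>end_alg R P\<^esub> \<in> carrier (end_alg R P)"
    and "\<lbrakk>f \<in> carrier (end_alg R P); g \<in> carrier (end_alg R P)\<rbrakk> \<Longrightarrow> f \<otimes>\<^bsub>end_alg R P\<^esub> g \<in> carrier (end_alg R P)"
    and "\<lbrakk>f \<in> carrier (end_alg R P); g \<in> carrier (end_alg R P)\<rbrakk> \<Longrightarrow> f \<oplus>\<^bsub>end_alg R P\<^esub> g \<in> carrier (end_alg R P)"
    and "\<lbrakk>r \<in> carrier R; f \<in> carrier (end_alg R P)\<rbrakk> \<Longrightarrow> r \<odot>\<^bsub>end_alg R P\<^esub> f \<in> carrier (end_alg R P)"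
  using restrict_end_alg[OF P lin_id] restrict_end_alg[OF P lin_const_zero[OF P]]
    restrict_end_alg[OF P lin_comp[OF end_alg_lin end_alg_lin]]
    restrict_end_alg[OF P lin_plus[OF P end_alg_lin end_alg_lin]]
    restrict_end_alg[OF P lin_scale[OF P end_alg_lin]]
  by (simp_all add: end_alg_def[of R P])

lemma assoc_algebra_end: assumes P: "module R P" shows "assoc_algebra R (end_alg R P)"
proof -
  interpret P: module R P by fact
  let ?E = "end_alg R P"
  note c = end_alg_ops_closed[OF P] and a = end_alg_apply and ec = end_alg_closed
  note eq = end_alg_eqI[where P=P]
  have neg: "(\<ominus> \<one>) \<odot>\<^bsub>?E\<^esub> f \<oplus>\<^bsub>?E\<^esub> f = \<zero>\<^bsub>?E\<^esub>" if "f \<in> carrier ?E" for f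
    by (rule eq) (simp_all add: c a that ec P.smult_l_minus P.M.l_neg)
  have m: "module R ?E"
  proof (rule moduleI)
    show "abelian_group ?E"
    proof (rule abelian_groupI)
      show "\<exists>g\<in>carrier ?E. g \<oplus>\<^bsub>?E\<^esub> f = \<zero>\<^bsub>?E\<^esub>" if "f \<in> carrier ?E" for f
        using neg[OF that] c(5)[of "\<ominus> \<one>" f] that by auto
    qed (auto intro!: eq simp: c a ec P.M.a_ac)
  qed (auto intro!: eq simp: is_cring c a ec P.smult_l_distr P.smult_r_distr P.smult_assoc1)
  show ?thesis
  proof (rule assoc_algebraI[OF m])
    fix f assume f: "f \<in> carrier ?E"
    show "lin ?E ?E (\<lambda>g. f \<otimes>\<^bsub>?E\<^esub> g)"
      by (rule linI) (auto intro!: eq simp: c a ec f lin_add[OF end_alg_lin[OF f]] lin_smult[OF end_alg_lin[OF f]])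
    show "lin ?E ?E (\<lambda>g. g \<otimes>\<^bsub>?E\<^esub> f)"
      by (rule linI) (auto intro!: eq simp: c a ec f)
  qed (auto intro!: eq simp: c a ec)
qed

lemma lin_eval: "x \<in> carrier P \<Longrightarrow> lin (end_alg R P) P (\<lambda>f. f x)"
  by (rule linI) (auto simp: end_alg_apply end_alg_closed)

end

locale smash_data = cring R + C: cocomm_algebra R A \<Delta> + VM: algebra_module R A V act
  for R :: "('k, 'r) ring_scheme" and A :: "('k, 'a, 'x) module_scheme" and \<Delta>
    and V :: "('k, 'v, 'y) module_scheme" and act
begin

lemma zero_data: "H_data R A \<Delta> V act (zero_lam A) (zero_kap A V)"
proof (intro H_data.intro H_data_axioms.intro cring_axioms C.cocomm_algebra_axioms VM.algebra_module_axioms)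
  interpret A: module R A by (rule C.mod_A)
  have mV: "module R V" ..
  show "lin (tensor R A V) A (zero_lam A)"
    using lin_const_zero[OF C.mod_A, of "tensor R A V"] by (simp add: zero_lam_def)
  show "lin (wedge R V) (dsum A V) (zero_kap A V)"
    using lin_const_zero[OF module_dsum[OF C.mod_A mV], of "wedge R V"] by (simp add: zero_kap_def dsum_simps)
qed

sublocale Z: H_data R A \<Delta> V act "zero_lam A" "zero_kap A V" by (rule zero_data)

abbreviation Sy where "Sy \<equiv> sym_alg R V"
abbreviation P where "P \<equiv> tensor R (sym_alg R V) A"
abbreviation t where "t \<equiv> tens R (sym_alg R V) A"
abbreviation g where "g \<equiv> sgen R V"

lemma alg_Sy [simp]: "assoc_algebra R Sy" by (simp add: assoc_algebra_sym_alg)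
lemma alg_P [simp]: "assoc_algebra R P" by (simp add: tensor_algebra)
sublocale Sa: assoc_algebra R Sy by (rule alg_Sy)
sublocale Pa: assoc_algebra R P by (rule alg_P)
lemma mod_Sy [simp]: "module R Sy" by (rule assoc_algebra_module[OF alg_Sy])
lemma mod_P [simp]: "module R P" by (rule assoc_algebra_module[OF alg_P])
lemma g_closed [simp]: "v \<in> carrier V \<Longrightarrow> g v \<in> carrier Sy" by (rule lin_closed[OF lin_sgen[OF Z.mod_V]])
lemma t_closed [simp]: "\<lbrakk>f \<in> carrier Sy; a \<in> carrier A\<rbrakk> \<Longrightarrow> t f a \<in> carrier P" by (simp add: tens_closed)
lemma lin_g: "lin X V f \<Longrightarrow> lin X Sy (\<lambda>x. g (f x))" by (rule lin_comp[OF _ lin_sgen[OF Z.mod_V]])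

lemmas P_simps = tensor_algebra(2,3)[OF alg_Sy Z.alg_A]
lemmas lp = lin_tens1 lin_tens2 lin_mult1 lin_mult2 lin_plus Z.lin_act lin_g lin_id
lemmas P_eq = tensor_lin_eq[OF mod_Sy Z.mod_A]

lemma act2: "\<lbrakk>b \<in> carrier A; lin X V f\<rbrakk> \<Longrightarrow> lin X V (\<lambda>x. act b (f x))"
  by (rule lin_comp[OF _ bil_right[OF Z.bil_act]])

abbreviation E where "E \<equiv> end_alg R P"
lemma alg_E [simp]: "assoc_algebra R E" by (simp add: assoc_algebra_end)
lemma mod_E [simp]: "module R E" by (rule assoc_algebra_module[OF alg_E])

subsection \<open>Operators on the tensor product\<close>

text \<open>
  Right multiplication by \<open>v\<close> in the smash product, written down before that product is known to be associative.
\<close>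

definition rmul_V where "rmul_V v = tlift R P (\<lambda>f a. C.sw P (\<lambda>b c. t (g (act b v) \<otimes>\<^bsub>Sy\<^esub> f) c) a)"

lemma rmul_V_bil1: "\<lbrakk>v \<in> carrier V; f \<in> carrier Sy\<rbrakk> \<Longrightarrow> bil R A A P (\<lambda>b c. t (g (act b v) \<otimes>\<^bsub>Sy\<^esub> f) c)"
  by (intro bilI lp) simp_all

lemma rmul_V_bil: "v \<in> carrier V \<Longrightarrow> bil R Sy A P (\<lambda>f a. C.sw P (\<lambda>b c. t (g (act b v) \<otimes>\<^bsub>Sy\<^esub> f) c) a)"
proof (rule bilI)
  assume v: "v \<in> carrier V"
  show "lin A P (\<lambda>a. C.sw P (\<lambda>b c. t (g (act b v) \<otimes>\<^bsub>Sy\<^esub> f) c) a)" if "f \<in> carrier Sy" for f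
    by (rule C.lin_sw[OF mod_P rmul_V_bil1[OF v that] lin_id])
  show "lin Sy P (\<lambda>f. C.sw P (\<lambda>b c. t (g (act b v) \<otimes>\<^bsub>Sy\<^esub> f) c) a)" if "a \<in> carrier A" for a
    by (rule C.lin_sw_fun[OF mod_Sy mod_P rmul_V_bil1[OF v] _ that], assumption) (intro lp, simp_all add: v)
qed

lemma lin_rmul_V: "v \<in> carrier V \<Longrightarrow> lin P P (rmul_V v)"
  unfolding rmul_V_def by (rule lin_tlift[OF mod_Sy Z.mod_A mod_P rmul_V_bil])
lemma rmul_V_t: "\<lbrakk>v \<in> carrier V; f \<in> carrier Sy; a \<in> carrier A\<rbrakk> \<Longrightarrow> rmul_V v (t f a) = C.sw P (\<lambda>b c. t (g (act b v) \<otimes>\<^bsub>Sy\<^esub> f) c) a"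
  unfolding rmul_V_def by (rule tlift_tens[OF mod_Sy Z.mod_A mod_P rmul_V_bil])

lemma g_left_comm:
  "\<lbrakk>v \<in> carrier V; w \<in> carrier V; f \<in> carrier Sy\<rbrakk> \<Longrightarrow> g v \<otimes>\<^bsub>Sy\<^esub> (g w \<otimes>\<^bsub>Sy\<^esub> f) = g w \<otimes>\<^bsub>Sy\<^esub> (g v \<otimes>\<^bsub>Sy\<^esub> f)"
  by (simp add: Sa.m_assoc[symmetric] sgen_commute[OF Z.mod_V, of v w])

lemma rmul_V_rmul_V_t:
  assumes v: "v \<in> carrier V" and w: "w \<in> carrier V" and f: "f \<in> carrier Sy" and a: "a \<in> carrier A"
  shows "rmul_V v (rmul_V w (t f a)) = C.sw P (\<lambda>b c. C.sw P (\<lambda>b' c'. t (g (act b' v) \<otimes>\<^bsub>Sy\<^esub> (g (act b w) \<otimes>\<^bsub>Sy\<^esub> f)) c') c) a"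
    and "tril R A P (\<lambda>b b' c'. t (g (act b' v) \<otimes>\<^bsub>Sy\<^esub> (g (act b w) \<otimes>\<^bsub>Sy\<^esub> f)) c')"
proof -
  show "rmul_V v (rmul_V w (t f a)) = C.sw P (\<lambda>b c. C.sw P (\<lambda>b' c'. t (g (act b' v) \<otimes>\<^bsub>Sy\<^esub> (g (act b w) \<otimes>\<^bsub>Sy\<^esub> f)) c') c) a"
    unfolding rmul_V_t[OF w f a] C.sw_lin[OF mod_P mod_P rmul_V_bil1[OF w f] a lin_rmul_V[OF v]]
    by (rule C.sw_cong[OF mod_P bil_lin_comp[OF rmul_V_bil1[OF w f] lin_rmul_V[OF v]] a]) (simp add: rmul_V_t v w f)
  show "tril R A P (\<lambda>b b' c'. t (g (act b' v) \<otimes>\<^bsub>Sy\<^esub> (g (act b w) \<otimes>\<^bsub>Sy\<^esub> f)) c')"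
    by (intro trilI lp) (simp_all add: v w f)
qed

text \<open>
  Applied to \<open>f \<otimes> a\<close>, both sides are \<open>\<Sum> a\<^sub>(\<^sub>1\<^sub>)(v) a\<^sub>(\<^sub>2\<^sub>)(w) f \<otimes> a\<^sub>(\<^sub>3\<^sub>)\<close> up to the order of the first two
  components, so cocommutativity of \<open>A\<close> gives the claim.
\<close>

lemma rmul_V_commute:
  assumes v: "v \<in> carrier V" and w: "w \<in> carrier V" and x: "x \<in> carrier P"
  shows "rmul_V v (rmul_V w x) = rmul_V w (rmul_V v x)"
proof (rule P_eq[OF mod_P lin_comp[OF lin_rmul_V[OF w] lin_rmul_V[OF v]] lin_comp[OF lin_rmul_V[OF v] lin_rmul_V[OF w]] _ x])
  fix f a assume f: "f \<in> carrier Sy" and a: "a \<in> carrier A"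
  have "rmul_V v (rmul_V w (t f a)) = C.sw P (\<lambda>b c. C.sw P (\<lambda>b' c'. t (g (act b v) \<otimes>\<^bsub>Sy\<^esub> (g (act b' w) \<otimes>\<^bsub>Sy\<^esub> f)) c') c) a"
    unfolding rmul_V_rmul_V_t(1)[OF v w f a] by (rule C.sw_left_comm[OF mod_P rmul_V_rmul_V_t(2)[OF v w f a] a])
  also have "\<dots> = rmul_V w (rmul_V v (t f a))"
    unfolding rmul_V_rmul_V_t(1)[OF w v f a]
  proof (rule C.sw_cong[OF mod_P _ a, symmetric])
    show "bil R A A P (\<lambda>x y. C.sw P (\<lambda>b' c'. t (g (act b' w) \<otimes>\<^bsub>Sy\<^esub> (g (act x v) \<otimes>\<^bsub>Sy\<^esub> f)) c') y)"
      by (rule C.tril_sw_bil(2)[OF mod_P rmul_V_rmul_V_t(2)[OF w v f a]])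
    fix x y assume xy: "x \<in> carrier A" "y \<in> carrier A"
    show "C.sw P (\<lambda>b' c'. t (g (act b' w) \<otimes>\<^bsub>Sy\<^esub> (g (act x v) \<otimes>\<^bsub>Sy\<^esub> f)) c') y = C.sw P (\<lambda>b' c'. t (g (act x v) \<otimes>\<^bsub>Sy\<^esub> (g (act b' w) \<otimes>\<^bsub>Sy\<^esub> f)) c') y"
      by (rule C.sw_cong[OF mod_P C.tril_bil(1)[OF rmul_V_rmul_V_t(2)[OF w v f a] xy(1)] xy(2)]) (simp add: xy v w f g_left_comm)
  qed
  finally show "rmul_V v (rmul_V w (t f a)) = rmul_V w (rmul_V v (t f a))" .
qed

lemma lin_rmul_V_arg: assumes x: "x \<in> carrier P" shows "lin V P (\<lambda>v. rmul_V v x)"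
  unfolding rmul_V_def
proof (rule lin_tlift_fun[OF Z.mod_V mod_Sy Z.mod_A mod_P x rmul_V_bil], assumption)
  show "lin V P (\<lambda>v. C.sw P (\<lambda>b c. t (g (act b v) \<otimes>\<^bsub>Sy\<^esub> f) c) a)" if "f \<in> carrier Sy" "a \<in> carrier A" for f a
    by (rule C.lin_sw_fun[OF Z.mod_V mod_P rmul_V_bil1[OF _ that(1)] _ that(2)], assumption)
      (intro lin_tens1 lin_mult1 lin_g act2 lin_id, simp_all add: that)
qed

lemma rmul_Sym_hom_exists: "\<exists>M. M \<in> alg_hom R Sy E \<and> (\<forall>v\<in>carrier V. M (g v) = restrict (rmul_V v) (carrier P))"
proof -
  note c = restrict_end_alg[OF mod_P lin_rmul_V] and Mc = lin_closed[OF lin_rmul_V]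
  note oc = end_alg_ops_closed[OF mod_P]
  interpret V: module R V by simp
  have l: "lin V E (\<lambda>v. restrict (rmul_V v) (carrier P))"
    by (rule linI) (auto intro!: end_alg_eqI[where P=P] c oc simp: end_alg_apply lin_add[OF lin_rmul_V_arg] lin_smult[OF lin_rmul_V_arg])
  have comm: "restrict (rmul_V v) (carrier P) \<otimes>\<^bsub>E\<^esub> restrict (rmul_V w) (carrier P) = restrict (rmul_V w) (carrier P) \<otimes>\<^bsub>E\<^esub> restrict (rmul_V v) (carrier P)"
    if "v \<in> carrier V" "w \<in> carrier V" for v w
    by (rule end_alg_eqI[where P=P]) (use that in \<open>auto simp: c oc end_alg_apply Mc rmul_V_commute\<close>)
  show ?thesis by (rule sym_alg_lift[OF Z.mod_V alg_E l comm]) auto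
qed

text \<open>
  The commuting operators \<open>rmul_V v\<close> extend to the symmetric algebra, giving right multiplication by \<open>f\<close>.
\<close>

definition rmul_Sym where "rmul_Sym = (SOME M. M \<in> alg_hom R Sy E \<and> (\<forall>v\<in>carrier V. M (g v) = restrict (rmul_V v) (carrier P)))"

lemma rmul_Sym_hom: "rmul_Sym \<in> alg_hom R Sy E" and rmul_Sym_g: "v \<in> carrier V \<Longrightarrow> rmul_Sym (g v) = restrict (rmul_V v) (carrier P)"
  using someI_ex[OF rmul_Sym_hom_exists] by (auto simp: rmul_Sym_def)

lemma rmul_Sym_E: "f \<in> carrier Sy \<Longrightarrow> rmul_Sym f \<in> carrier E" by (rule alg_hom_closed[OF rmul_Sym_hom])
lemma lin_rmul_Sym: "f \<in> carrier Sy \<Longrightarrow> lin P P (rmul_Sym f)" by (rule end_alg_lin[OF rmul_Sym_E])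
lemma lin_rmul_Sym_arg: "x \<in> carrier P \<Longrightarrow> lin Sy P (\<lambda>f. rmul_Sym f x)" by (rule lin_comp[OF alg_hom_lin[OF rmul_Sym_hom] lin_eval])
lemma rmul_Sym_closed [simp]: "\<lbrakk>f \<in> carrier Sy; x \<in> carrier P\<rbrakk> \<Longrightarrow> rmul_Sym f x \<in> carrier P" by (rule lin_closed[OF lin_rmul_Sym])
lemma rmul_Sym_one: "x \<in> carrier P \<Longrightarrow> rmul_Sym \<one>\<^bsub>Sy\<^esub> x = x" by (simp add: alg_hom_one[OF rmul_Sym_hom] end_alg_apply)
lemma rmul_Sym_mult: "\<lbrakk>v \<in> carrier V; f \<in> carrier Sy; x \<in> carrier P\<rbrakk> \<Longrightarrow> rmul_Sym (g v \<otimes>\<^bsub>Sy\<^esub> f) x = rmul_V v (rmul_Sym f x)"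
  by (simp add: alg_hom_mult[OF rmul_Sym_hom] end_alg_apply rmul_Sym_g)

lemmas Sy_induct = generates_induct[OF generates_sym_alg[OF Z.mod_V] alg_Sy, consumes 1, case_names one add smult mult]

lemma rmul_Sym_rmul_V: assumes "f \<in> carrier Sy" "v \<in> carrier V" "x \<in> carrier P" shows "rmul_Sym f (rmul_V v x) = rmul_V v (rmul_Sym f x)"
  using assms(1)
proof (induction rule: Sy_induct)
  case one then show ?case using assms by (simp add: rmul_Sym_one lin_closed[OF lin_rmul_V])
next
  case (add f1 f2) then show ?case using assms by (simp add: lin_add[OF lin_rmul_Sym_arg] lin_add[OF lin_rmul_V] lin_closed[OF lin_rmul_V])
next
  case (smult r f1) then show ?case using assms by (simp add: lin_smult[OF lin_rmul_Sym_arg] lin_smult[OF lin_rmul_V] lin_closed[OF lin_rmul_V])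
next
  case (mult h f1) then show ?case using assms by (auto simp: rmul_Sym_mult lin_closed[OF lin_rmul_V] rmul_V_commute)
qed

lemma rmul_V_Sy_lin:
  assumes v: "v \<in> carrier V" and w: "w \<in> carrier V" and x: "x \<in> carrier P"
  shows "rmul_V v (t (g w) \<one>\<^bsub>A\<^esub> \<otimes>\<^bsub>P\<^esub> x) = t (g w) \<one>\<^bsub>A\<^esub> \<otimes>\<^bsub>P\<^esub> rmul_V v x"
proof (rule P_eq[OF mod_P lin_comp[OF lin_mult_left[OF alg_P] lin_rmul_V[OF v]] lin_comp[OF lin_rmul_V[OF v] lin_mult_left[OF alg_P]] _ x])
  fix f a assume f: "f \<in> carrier Sy" and a: "a \<in> carrier A"
  have l: "lin P P (\<lambda>y. t (g w) \<one>\<^bsub>A\<^esub> \<otimes>\<^bsub>P\<^esub> y)" by (rule lin_mult_left) (simp_all add: w)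
  have "t (g w) \<one>\<^bsub>A\<^esub> \<otimes>\<^bsub>P\<^esub> rmul_V v (t f a) = C.sw P (\<lambda>b c. t (g w) \<one>\<^bsub>A\<^esub> \<otimes>\<^bsub>P\<^esub> t (g (act b v) \<otimes>\<^bsub>Sy\<^esub> f) c) a"
    unfolding rmul_V_t[OF v f a] by (rule C.sw_lin[OF mod_P mod_P rmul_V_bil1[OF v f] a l])
  also have "\<dots> = C.sw P (\<lambda>b c. t (g (act b v) \<otimes>\<^bsub>Sy\<^esub> (g w \<otimes>\<^bsub>Sy\<^esub> f)) c) a"
    by (rule C.sw_cong[OF mod_P bil_lin_comp[OF rmul_V_bil1[OF v f] l] a]) (simp add: v w f P_simps g_left_comm)
  finally show "rmul_V v (t (g w) \<one>\<^bsub>A\<^esub> \<otimes>\<^bsub>P\<^esub> t f a) = t (g w) \<one>\<^bsub>A\<^esub> \<otimes>\<^bsub>P\<^esub> rmul_V v (t f a)"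
    using v w f a by (simp add: P_simps rmul_V_t)
qed (simp_all add: w)

lemma rmul_Sym_Sy_lin:
  assumes "f \<in> carrier Sy" "w \<in> carrier V" "x \<in> carrier P"
  shows "rmul_Sym f (t (g w) \<one>\<^bsub>A\<^esub> \<otimes>\<^bsub>P\<^esub> x) = t (g w) \<one>\<^bsub>A\<^esub> \<otimes>\<^bsub>P\<^esub> rmul_Sym f x"
  using assms(1)
proof (induction rule: Sy_induct)
  case one then show ?case using assms by (simp add: rmul_Sym_one)
next
  case (add f1 f2) then show ?case using assms by (simp add: lin_add[OF lin_rmul_Sym_arg] Pa.r_distr)
next
  case (smult r f1) then show ?case using assms by (simp add: lin_smult[OF lin_rmul_Sym_arg] Pa.smult_mult_right)
next
  case (mult h f1) then show ?case using assms by (auto simp: rmul_Sym_mult rmul_V_Sy_lin)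
qed

text \<open>
  The product of \<open>1 \<otimes> b\<close> and \<open>f \<otimes> 1\<close> in the smash product, obtained as right multiplication by \<open>f\<close>. This makes it
  linear in \<open>f\<close> without reference to representatives in the tensor algebra.
\<close>

definition cross where "cross b f = rmul_Sym f (t \<one>\<^bsub>Sy\<^esub> b)"

lemma cross_closed [simp]: "\<lbrakk>b \<in> carrier A; f \<in> carrier Sy\<rbrakk> \<Longrightarrow> cross b f \<in> carrier P" by (simp add: cross_def)
lemma lin_cross1: "\<lbrakk>lin X A h; f \<in> carrier Sy\<rbrakk> \<Longrightarrow> lin X P (\<lambda>x. cross (h x) f)"
  unfolding cross_def by (rule lin_comp[OF _ lin_rmul_Sym]) (intro lin_tens2, simp_all)
lemma lin_cross2: "b \<in> carrier A \<Longrightarrow> lin Sy P (\<lambda>f. cross b f)"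
  unfolding cross_def by (rule lin_rmul_Sym_arg) simp
lemma cross_one: "b \<in> carrier A \<Longrightarrow> cross b \<one>\<^bsub>Sy\<^esub> = t \<one>\<^bsub>Sy\<^esub> b" by (simp add: cross_def rmul_Sym_one)

lemma cross_bil: "\<lbrakk>v \<in> carrier V; f \<in> carrier Sy\<rbrakk> \<Longrightarrow> bil R A A P (\<lambda>b1 b2. t (g (act b1 v)) \<one>\<^bsub>A\<^esub> \<otimes>\<^bsub>P\<^esub> cross b2 f)"
  by (intro bilI lp lin_cross1) simp_all

text \<open>
  The recursion that determines \<open>cross\<close>: moving \<open>b\<close> past a product \<open>v f\<close> one factor at a time.
\<close>

lemma cross_mult:
  assumes b: "b \<in> carrier A" and v: "v \<in> carrier V" and f: "f \<in> carrier Sy"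
  shows "cross b (g v \<otimes>\<^bsub>Sy\<^esub> f) = C.sw P (\<lambda>b1 b2. t (g (act b1 v)) \<one>\<^bsub>A\<^esub> \<otimes>\<^bsub>P\<^esub> cross b2 f) b"
proof -
  have "cross b (g v \<otimes>\<^bsub>Sy\<^esub> f) = rmul_Sym f (rmul_V v (t \<one>\<^bsub>Sy\<^esub> b))"
    using b v f by (simp add: cross_def rmul_Sym_mult rmul_Sym_rmul_V)
  also have "\<dots> = C.sw P (\<lambda>b1 b2. rmul_Sym f (t (g (act b1 v) \<otimes>\<^bsub>Sy\<^esub> \<one>\<^bsub>Sy\<^esub>) b2)) b"
    unfolding rmul_V_t[OF v Sa.one_closed b] by (rule C.sw_lin[OF mod_P mod_P rmul_V_bil1[OF v Sa.one_closed] b lin_rmul_Sym[OF f]])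
  also have "\<dots> = C.sw P (\<lambda>b1 b2. t (g (act b1 v)) \<one>\<^bsub>A\<^esub> \<otimes>\<^bsub>P\<^esub> cross b2 f) b"
  proof (rule C.sw_cong[OF mod_P bil_lin_comp[OF rmul_V_bil1[OF v Sa.one_closed] lin_rmul_Sym[OF f]] b])
    fix x y assume xy: "x \<in> carrier A" "y \<in> carrier A"
    have "t (g (act x v)) y = t (g (act x v)) \<one>\<^bsub>A\<^esub> \<otimes>\<^bsub>P\<^esub> t \<one>\<^bsub>Sy\<^esub> y" using xy v by (simp add: P_simps)
    then show "rmul_Sym f (t (g (act x v) \<otimes>\<^bsub>Sy\<^esub> \<one>\<^bsub>Sy\<^esub>) y) = t (g (act x v)) \<one>\<^bsub>A\<^esub> \<otimes>\<^bsub>P\<^esub> cross y f"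
      using xy v f by (simp add: cross_def rmul_Sym_Sy_lin)
  qed
  finally show ?thesis .
qed

text \<open>Left multiplication by \<open>1 \<otimes> b\<close> in the smash product.\<close>

definition lmul_A where "lmul_A b = tlift R P (\<lambda>f a. cross b f \<otimes>\<^bsub>P\<^esub> t \<one>\<^bsub>Sy\<^esub> a)"

lemma lmul_A_bil: "b \<in> carrier A \<Longrightarrow> bil R Sy A P (\<lambda>f a. cross b f \<otimes>\<^bsub>P\<^esub> t \<one>\<^bsub>Sy\<^esub> a)"
  by (intro bilI lp lin_cross2) simp_all
lemma lin_lmul_A: "b \<in> carrier A \<Longrightarrow> lin P P (lmul_A b)"
  unfolding lmul_A_def by (rule lin_tlift[OF mod_Sy Z.mod_A mod_P lmul_A_bil])
lemma lmul_A_t: "\<lbrakk>b \<in> carrier A; f \<in> carrier Sy; a \<in> carrier A\<rbrakk> \<Longrightarrow> lmul_A b (t f a) = cross b f \<otimes>\<^bsub>P\<^esub> t \<one>\<^bsub>Sy\<^esub> a"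
  unfolding lmul_A_def by (rule tlift_tens[OF mod_Sy Z.mod_A mod_P lmul_A_bil])
lemma lmul_A_closed [simp]: "\<lbrakk>b \<in> carrier A; x \<in> carrier P\<rbrakk> \<Longrightarrow> lmul_A b x \<in> carrier P" by (rule lin_closed[OF lin_lmul_A])
lemma lin_lmul_A_arg: assumes x: "x \<in> carrier P" and h: "lin X A h" shows "lin X P (\<lambda>z. lmul_A (h z) x)"
proof (rule lin_comp[OF h])
  show "lin A P (\<lambda>b. lmul_A b x)" unfolding lmul_A_def
    by (rule lin_tlift_fun[OF Z.mod_A mod_Sy Z.mod_A mod_P x lmul_A_bil], assumption) (intro lp lin_cross1, simp_all)
qed

lemma lmul_A_right:
  assumes "b \<in> carrier A" "a \<in> carrier A" "x \<in> carrier P"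
  shows "lmul_A b (x \<otimes>\<^bsub>P\<^esub> t \<one>\<^bsub>Sy\<^esub> a) = lmul_A b x \<otimes>\<^bsub>P\<^esub> t \<one>\<^bsub>Sy\<^esub> a"
  by (rule P_eq[OF mod_P lin_comp[OF lin_mult_right[OF alg_P] lin_lmul_A] lin_comp[OF lin_lmul_A lin_mult_right[OF alg_P]] _ assms(3)])
    (use assms in \<open>simp_all add: P_simps lmul_A_t Pa.m_assoc\<close>)

lemma lmul_A_bil2: "\<lbrakk>v \<in> carrier V; x \<in> carrier P\<rbrakk> \<Longrightarrow> bil R A A P (\<lambda>b1 b2. t (g (act b1 v)) \<one>\<^bsub>A\<^esub> \<otimes>\<^bsub>P\<^esub> lmul_A b2 x)"
  by (intro bilI lp lin_lmul_A_arg) simp_all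

lemma lmul_A_g:
  assumes b: "b \<in> carrier A" and v: "v \<in> carrier V" and x: "x \<in> carrier P"
  shows "lmul_A b (t (g v) \<one>\<^bsub>A\<^esub> \<otimes>\<^bsub>P\<^esub> x) = C.sw P (\<lambda>b1 b2. t (g (act b1 v)) \<one>\<^bsub>A\<^esub> \<otimes>\<^bsub>P\<^esub> lmul_A b2 x) b"
proof (rule P_eq[OF mod_P lin_comp[OF lin_mult_left[OF alg_P] lin_lmul_A[OF b]] _ _ x])
  show "lin P P (\<lambda>x. C.sw P (\<lambda>b1 b2. t (g (act b1 v)) \<one>\<^bsub>A\<^esub> \<otimes>\<^bsub>P\<^esub> lmul_A b2 x) b)"
    by (rule C.lin_sw_fun[OF mod_P mod_P lmul_A_bil2[OF v] _ b], assumption) (intro lin_mult2 lin_lmul_A, simp_all add: v)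
  fix f a assume f: "f \<in> carrier Sy" and a: "a \<in> carrier A"
  have l: "lin P P (\<lambda>y. y \<otimes>\<^bsub>P\<^esub> t \<one>\<^bsub>Sy\<^esub> a)" by (rule lin_mult_right) (simp_all add: a)
  have "lmul_A b (t (g v) \<one>\<^bsub>A\<^esub> \<otimes>\<^bsub>P\<^esub> t f a) = C.sw P (\<lambda>b1 b2. (t (g (act b1 v)) \<one>\<^bsub>A\<^esub> \<otimes>\<^bsub>P\<^esub> cross b2 f) \<otimes>\<^bsub>P\<^esub> t \<one>\<^bsub>Sy\<^esub> a) b"
    using C.sw_lin[OF mod_P mod_P cross_bil[OF v f] b l] b v f a by (simp add: P_simps lmul_A_t cross_mult)
  also have "\<dots> = C.sw P (\<lambda>b1 b2. t (g (act b1 v)) \<one>\<^bsub>A\<^esub> \<otimes>\<^bsub>P\<^esub> lmul_A b2 (t f a)) b"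
    by (rule C.sw_cong[OF mod_P bil_lin_comp[OF cross_bil[OF v f] l] b]) (simp add: v f a lmul_A_t Pa.m_assoc)
  finally show "lmul_A b (t (g v) \<one>\<^bsub>A\<^esub> \<otimes>\<^bsub>P\<^esub> t f a) = C.sw P (\<lambda>b1 b2. t (g (act b1 v)) \<one>\<^bsub>A\<^esub> \<otimes>\<^bsub>P\<^esub> lmul_A b2 (t f a)) b" .
qed (simp add: v)

text \<open>
  Associativity \<open>b (b' f) = (b b') f\<close>, by induction on \<open>f\<close> from the recursion for \<open>cross\<close> and the multiplicativity
  of \<open>\<Delta>\<close>.
\<close>

lemma lmul_A_cross:
  assumes "f \<in> carrier Sy" shows "\<forall>b\<in>carrier A. \<forall>b'\<in>carrier A. lmul_A b (cross b' f) = cross (b \<otimes>\<^bsub>A\<^esub> b') f"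
  using assms
proof (induction rule: Sy_induct)
  case one then show ?case by (simp add: cross_one lmul_A_t P_simps)
next
  case (add f1 f2) then show ?case by (simp add: lin_add[OF lin_cross2] lin_add[OF lin_lmul_A])
next
  case (smult r f1) then show ?case by (simp add: lin_smult[OF lin_cross2] lin_smult[OF lin_lmul_A])
next
  case (mult h f)
  then obtain v where v: "v \<in> carrier V" and h: "h = g v" by auto
  note f = mult(2) and IH = mult(3)
  show ?case
  proof (intro ballI)
    fix b b' assume b: "b \<in> carrier A" and b': "b' \<in> carrier A"
    let ?B = "\<lambda>x y. t (g (act x v)) \<one>\<^bsub>A\<^esub> \<otimes>\<^bsub>P\<^esub> cross y f"
    have B: "bil R A A P ?B" by (rule cross_bil[OF v f])
    have q1: "bil R A A P (\<lambda>c1 c2. ?B (c1 \<otimes>\<^bsub>A\<^esub> b1) (c2 \<otimes>\<^bsub>A\<^esub> b2))" if "b1 \<in> carrier A" "b2 \<in> carrier A" for b1 b2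
      by (intro bilI lp lin_cross1) (simp_all add: v f that)
    have q2: "bil R A A P (\<lambda>b1 b2. ?B (c1 \<otimes>\<^bsub>A\<^esub> b1) (c2 \<otimes>\<^bsub>A\<^esub> b2))" if "c1 \<in> carrier A" "c2 \<in> carrier A" for c1 c2
      by (intro bilI lp lin_cross1) (simp_all add: v f that)
    have "lmul_A b (cross b' (g v \<otimes>\<^bsub>Sy\<^esub> f)) = C.sw P (\<lambda>b1 b2. lmul_A b (?B b1 b2)) b'"
      unfolding cross_mult[OF b' v f] by (rule C.sw_lin[OF mod_P mod_P B b' lin_lmul_A[OF b]])
    also have "\<dots> = C.sw P (\<lambda>b1 b2. C.sw P (\<lambda>c1 c2. ?B (c1 \<otimes>\<^bsub>A\<^esub> b1) (c2 \<otimes>\<^bsub>A\<^esub> b2)) b) b'"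
    proof (rule C.sw_cong[OF mod_P bil_lin_comp[OF B lin_lmul_A[OF b]] b'])
      fix b1 b2 assume bb: "b1 \<in> carrier A" "b2 \<in> carrier A"
      show "lmul_A b (?B b1 b2) = C.sw P (\<lambda>c1 c2. ?B (c1 \<otimes>\<^bsub>A\<^esub> b1) (c2 \<otimes>\<^bsub>A\<^esub> b2)) b"
        unfolding lmul_A_g[OF b Z.act_closed[OF bb(1) v] cross_closed[OF bb(2) f]]
        by (rule C.sw_cong[OF mod_P lmul_A_bil2[OF Z.act_closed[OF bb(1) v] cross_closed[OF bb(2) f]] b])
          (simp add: bb v IH VM.act_mult)
    qed
    also have "\<dots> = C.sw P (\<lambda>c1 c2. C.sw P (\<lambda>b1 b2. ?B (c1 \<otimes>\<^bsub>A\<^esub> b1) (c2 \<otimes>\<^bsub>A\<^esub> b2)) b') b"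
      by (rule tlift_swap[OF Z.mod_A Z.mod_A Z.mod_A Z.mod_A mod_P q1 q2 C.Delta_closed[OF b'] C.Delta_closed[OF b]])
    also have "\<dots> = C.sw P ?B (b \<otimes>\<^bsub>A\<^esub> b')" by (rule C.sw_mult[OF mod_P B b b', symmetric])
    also have "\<dots> = cross (b \<otimes>\<^bsub>A\<^esub> b') (g v \<otimes>\<^bsub>Sy\<^esub> f)" by (rule cross_mult[OF _ v f, symmetric]) (simp add: b b')
    finally show "lmul_A b (cross b' (h \<otimes>\<^bsub>Sy\<^esub> f)) = cross (b \<otimes>\<^bsub>A\<^esub> b') (h \<otimes>\<^bsub>Sy\<^esub> f)" by (simp add: h)
  qed
qed

lemma lmul_A_mult:
  assumes "b \<in> carrier A" "b' \<in> carrier A" "x \<in> carrier P"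
  shows "lmul_A (b \<otimes>\<^bsub>A\<^esub> b') x = lmul_A b (lmul_A b' x)"
  by (rule P_eq[OF mod_P lin_lmul_A lin_comp[OF lin_lmul_A lin_lmul_A] _ assms(3)])
    (use assms lmul_A_cross in \<open>simp_all add: lmul_A_t lmul_A_right\<close>)

lemma cross_unit: assumes "f \<in> carrier Sy" shows "cross \<one>\<^bsub>A\<^esub> f = t f \<one>\<^bsub>A\<^esub>"
  using assms
proof (induction rule: Sy_induct)
  case one then show ?case by (simp add: cross_one)
next
  case (add f1 f2) then show ?case by (simp add: lin_add[OF lin_cross2] lin_add[OF lin_tens1[OF mod_Sy Z.mod_A lin_id]])
next
  case (smult r f1) then show ?case by (simp add: lin_smult[OF lin_cross2] lin_smult[OF lin_tens1[OF mod_Sy Z.mod_A lin_id]])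
next
  case (mult h f) then show ?case by (auto simp: cross_mult C.sw_one[OF mod_P cross_bil] VM.act_one P_simps)
qed

lemma lmul_A_one: "x \<in> carrier P \<Longrightarrow> lmul_A \<one>\<^bsub>A\<^esub> x = x"
  by (rule P_eq[OF mod_P lin_lmul_A lin_id]) (simp_all add: lmul_A_t cross_unit P_simps)

subsection \<open>The isomorphism\<close>

lemma zero_simps: "zero_lam A U = \<zero>\<^bsub>A\<^esub>" "fst (zero_kap A V W) = \<zero>\<^bsub>A\<^esub>" "snd (zero_kap A V W) = \<zero>\<^bsub>V\<^esub>"
  by (simp_all add: zero_lam_def zero_kap_def)

lemma lrep_exists: "\<exists>F. F \<in> alg_hom R Z.H E \<and>
   (\<forall>v\<in>carrier V. F (Z.iV v) = (\<lambda>x\<in>carrier P. t (g v) \<one>\<^bsub>A\<^esub> \<otimes>\<^bsub>P\<^esub> x)) \<and>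
   (\<forall>a\<in>carrier A. F (Z.iA a) = (\<lambda>x\<in>carrier P. lmul_A a x))"
proof -
  let ?L = "\<lambda>v. \<lambda>x\<in>carrier P. t (g v) \<one>\<^bsub>A\<^esub> \<otimes>\<^bsub>P\<^esub> x" and ?W = "\<lambda>a. \<lambda>x\<in>carrier P. lmul_A a x"
  interpret E: assoc_algebra R E by simp
  have Lc: "?L v \<in> carrier E" if "v \<in> carrier V" for v
    by (rule restrict_end_alg[OF mod_P lin_mult_left[OF alg_P]]) (simp add: that)
  have Wc: "?W a \<in> carrier E" if "a \<in> carrier A" for a
    by (rule restrict_end_alg[OF mod_P lin_lmul_A[OF that]])
  have lL: "lin V E ?L"
  proof (rule linI)
    have l: "lin V P (\<lambda>v. t (g v) \<one>\<^bsub>A\<^esub> \<otimes>\<^bsub>P\<^esub> x)" if "x \<in> carrier P" for x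
      by (intro lp) (simp_all add: that)
    interpret V: module R V by simp
    show "?L (v \<oplus>\<^bsub>V\<^esub> w) = ?L v \<oplus>\<^bsub>E\<^esub> ?L w" if "v \<in> carrier V" "w \<in> carrier V" for v w
      by (rule end_alg_eqI[where P=P]) (use that lin_add[OF l] in \<open>auto simp: end_alg_apply intro!: Lc E.a_closed\<close>)
    show "?L (r \<odot>\<^bsub>V\<^esub> v) = r \<odot>\<^bsub>E\<^esub> ?L v" if "r \<in> carrier R" "v \<in> carrier V" for r v
      by (rule end_alg_eqI[where P=P]) (use that lin_smult[OF l] in \<open>auto simp: end_alg_apply intro!: Lc E.smult_closed\<close>)
  qed (rule Lc)
  have lW: "lin A E ?W"
  proof (rule linI)
    interpret A: module R A by simp
    show "?W (v \<oplus>\<^bsub>A\<^esub> w) = ?W v \<oplus>\<^bsub>E\<^esub> ?W w" if "v \<in> carrier A" "w \<in> carrier A" for v w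
      by (rule end_alg_eqI[where P=P]) (use that lin_add[OF lin_lmul_A_arg[OF _ lin_id]] in \<open>auto simp: end_alg_apply intro!: Wc E.a_closed\<close>)
    show "?W (r \<odot>\<^bsub>A\<^esub> v) = r \<odot>\<^bsub>E\<^esub> ?W v" if "r \<in> carrier R" "v \<in> carrier A" for r v
      by (rule end_alg_eqI[where P=P]) (use that lin_smult[OF lin_lmul_A_arg[OF _ lin_id]] in \<open>auto simp: end_alg_apply intro!: Wc E.smult_closed\<close>)
  qed (rule Wc)
  have z: "?W \<zero>\<^bsub>A\<^esub> = \<zero>\<^bsub>E\<^esub>" "?L \<zero>\<^bsub>V\<^esub> = \<zero>\<^bsub>E\<^esub>"
    using lin_zero[OF Z.mod_A mod_E lW] lin_zero[OF Z.mod_V mod_E lL] .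
  show ?thesis
  proof (rule Z.H_lift[OF alg_E lL lW])
    show "?W (a \<otimes>\<^bsub>A\<^esub> b) = ?W a \<otimes>\<^bsub>E\<^esub> ?W b" if "a \<in> carrier A" "b \<in> carrier A" for a b
      by (rule end_alg_eqI[where P=P]) (use that in \<open>auto simp: end_alg_apply lmul_A_mult intro!: Wc E.m_closed\<close>)
    show "?W \<one>\<^bsub>A\<^esub> = \<one>\<^bsub>E\<^esub>"
      by (rule end_alg_eqI[where P=P]) (auto simp: end_alg_apply lmul_A_one intro!: Wc)
  next
    fix a v assume a: "a \<in> carrier A" and v: "v \<in> carrier V"
    have bE: "bil R A A E (\<lambda>b c. ?L (act b v) \<otimes>\<^bsub>E\<^esub> ?W c)"
      by (intro bilI lin_mult1 lin_mult2 lW lin_comp[OF _ lL] Z.lin_act lin_id) (simp_all add: v Wc Lc)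
    have "?W a \<otimes>\<^bsub>E\<^esub> ?L v = C.sw E (\<lambda>b c. ?L (act b v) \<otimes>\<^bsub>E\<^esub> ?W c) a"
    proof (rule end_alg_eqI[where P=P])
      show "?W a \<otimes>\<^bsub>E\<^esub> ?L v \<in> carrier E" by (intro E.m_closed Wc Lc a v)
      show "C.sw E (\<lambda>b c. ?L (act b v) \<otimes>\<^bsub>E\<^esub> ?W c) a \<in> carrier E" by (rule C.sw_closed[OF mod_E bE a])
      fix x assume x: "x \<in> carrier P"
      have "C.sw E (\<lambda>b c. ?L (act b v) \<otimes>\<^bsub>E\<^esub> ?W c) a x = C.sw P (\<lambda>b c. (?L (act b v) \<otimes>\<^bsub>E\<^esub> ?W c) x) a"
        by (rule C.sw_lin[OF mod_E mod_P bE a lin_eval[OF x]])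
      also have "\<dots> = C.sw P (\<lambda>b c. t (g (act b v)) \<one>\<^bsub>A\<^esub> \<otimes>\<^bsub>P\<^esub> lmul_A c x) a"
        by (rule C.sw_cong[OF mod_P bil_lin_comp[OF bE lin_eval[OF x]] a]) (simp add: end_alg_apply x)
      finally show "(?W a \<otimes>\<^bsub>E\<^esub> ?L v) x = C.sw E (\<lambda>b c. ?L (act b v) \<otimes>\<^bsub>E\<^esub> ?W c) a x"
        using a v x by (simp add: end_alg_apply lmul_A_g)
    qed
    then show "?W a \<otimes>\<^bsub>E\<^esub> ?L v = C.sw E (\<lambda>b c. ?L (act b v) \<otimes>\<^bsub>E\<^esub> ?W c) a \<oplus>\<^bsub>E\<^esub> ?W (zero_lam A (tens R A V a v))"
      using C.sw_closed[OF mod_E bE a] by (simp only: zero_simps z E.r_zero)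
  next
    fix v w assume v: "v \<in> carrier V" and w: "w \<in> carrier V"
    have "?L v \<otimes>\<^bsub>E\<^esub> ?L w = ?L w \<otimes>\<^bsub>E\<^esub> ?L v"
      by (rule end_alg_eqI[where P=P]) (use v w in \<open>auto simp: end_alg_apply P_simps Pa.m_assoc[symmetric] sgen_commute[OF Z.mod_V, of v w] intro!: Lc E.m_closed\<close>)
    then show "?L v \<otimes>\<^bsub>E\<^esub> ?L w \<ominus>\<^bsub>E\<^esub> ?L w \<otimes>\<^bsub>E\<^esub> ?L v = ?W (fst (zero_kap A V (wdg R V v w))) \<oplus>\<^bsub>E\<^esub> ?L (snd (zero_kap A V (wdg R V v w)))"
      using E.diff_eq_zero_iff[OF E.m_closed[OF Lc[OF v] Lc[OF w]] E.m_closed[OF Lc[OF w] Lc[OF v]]]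
      by (simp only: zero_simps z E.r_zero E.zero_closed)
  qed blast
qed

text \<open>
  The left regular representation of the smash product, as a representation of \<open>\<H>\<^sub>0\<^sub>,\<^sub>0\<close>. Its existence shows that
  \<open>\<H>\<^sub>0\<^sub>,\<^sub>0\<close> is no smaller than \<open>Sym(V) \<otimes> A\<close>.
\<close>

definition lrep where "lrep = (SOME F. F \<in> alg_hom R Z.H E \<and>
   (\<forall>v\<in>carrier V. F (Z.iV v) = (\<lambda>x\<in>carrier P. t (g v) \<one>\<^bsub>A\<^esub> \<otimes>\<^bsub>P\<^esub> x)) \<and>
   (\<forall>a\<in>carrier A. F (Z.iA a) = (\<lambda>x\<in>carrier P. lmul_A a x)))"

lemma lrep_hom: "lrep \<in> alg_hom R Z.H E"
  and lrep_iV: "\<lbrakk>v \<in> carrier V; x \<in> carrier P\<rbrakk> \<Longrightarrow> lrep (Z.iV v) x = t (g v) \<one>\<^bsub>A\<^esub> \<otimes>\<^bsub>P\<^esub> x"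
  and lrep_iA: "\<lbrakk>a \<in> carrier A; x \<in> carrier P\<rbrakk> \<Longrightarrow> lrep (Z.iA a) x = lmul_A a x"
  using someI_ex[OF lrep_exists] by (auto simp: lrep_def)

lemma lin_lrep: "x \<in> carrier P \<Longrightarrow> lin Z.H P (\<lambda>h. lrep h x)" by (rule lin_comp[OF alg_hom_lin[OF lrep_hom] lin_eval])
lemma lrep_mult: "\<lbrakk>h \<in> carrier Z.H; k \<in> carrier Z.H; x \<in> carrier P\<rbrakk> \<Longrightarrow> lrep (h \<otimes>\<^bsub>Z.H\<^esub> k) x = lrep h (lrep k x)"
  by (simp add: alg_hom_mult[OF lrep_hom] end_alg_apply)
lemma lrep_one: "x \<in> carrier P \<Longrightarrow> lrep \<one>\<^bsub>Z.H\<^esub> x = x" by (simp add: alg_hom_one[OF lrep_hom] end_alg_apply)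
lemma lrep_closed [simp]: "\<lbrakk>h \<in> carrier Z.H; x \<in> carrier P\<rbrakk> \<Longrightarrow> lrep h x \<in> carrier P" by (rule lin_closed[OF lin_lrep])

lemma iSym_exists: "\<exists>i. i \<in> alg_hom R Sy Z.H \<and> (\<forall>v\<in>carrier V. i (g v) = Z.iV v)"
proof (rule sym_alg_lift[OF Z.mod_V Z.alg_H Z.lin_iV])
  fix v w assume vw: "v \<in> carrier V" "w \<in> carrier V"
  have "Z.iV v \<otimes>\<^bsub>Z.H\<^esub> Z.iV w \<ominus>\<^bsub>Z.H\<^esub> Z.iV w \<otimes>\<^bsub>Z.H\<^esub> Z.iV v = \<zero>\<^bsub>Z.H\<^esub>"
    using Z.rel_vv[OF vw] lin_zero[OF Z.mod_A Z.mod_H Z.lin_iA] lin_zero[OF Z.mod_V Z.mod_H Z.lin_iV] by (simp add: zero_simps)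
  then show "Z.iV v \<otimes>\<^bsub>Z.H\<^esub> Z.iV w = Z.iV w \<otimes>\<^bsub>Z.H\<^esub> Z.iV v" using vw by (simp add: Z.Ha.diff_eq_zero_iff)
qed blast

definition iSym where "iSym = (SOME i. i \<in> alg_hom R Sy Z.H \<and> (\<forall>v\<in>carrier V. i (g v) = Z.iV v))"

lemma iSym_hom: "iSym \<in> alg_hom R Sy Z.H" and iSym_g: "v \<in> carrier V \<Longrightarrow> iSym (g v) = Z.iV v"
  using someI_ex[OF iSym_exists] by (auto simp: iSym_def)
lemma iSym_closed [simp]: "f \<in> carrier Sy \<Longrightarrow> iSym f \<in> carrier Z.H" by (rule alg_hom_closed[OF iSym_hom])

lemma lrep_iSym: assumes "f \<in> carrier Sy" "x \<in> carrier P" shows "lrep (iSym f) x = t f \<one>\<^bsub>A\<^esub> \<otimes>\<^bsub>P\<^esub> x"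
  using assms(1)
proof (induction rule: Sy_induct)
  case one then show ?case using assms(2) by (simp add: alg_hom_one[OF iSym_hom] lrep_one P_simps(1)[symmetric])
next
  case (add f1 f2) then show ?case using assms(2)
    by (simp add: lin_add[OF alg_hom_lin[OF iSym_hom]] lin_add[OF lin_lrep] lin_add[OF lin_tens1[OF mod_Sy Z.mod_A lin_id]] Pa.l_distr)
next
  case (smult r f1) then show ?case using assms(2)
    by (simp add: lin_smult[OF alg_hom_lin[OF iSym_hom]] lin_smult[OF lin_lrep] lin_smult[OF lin_tens1[OF mod_Sy Z.mod_A lin_id]] Pa.smult_mult_left)
next
  case (mult h f1)
  then obtain v where v: "v \<in> carrier V" "h = g v" by auto
  have "t (g v \<otimes>\<^bsub>Sy\<^esub> f1) \<one>\<^bsub>A\<^esub> = t (g v) \<one>\<^bsub>A\<^esub> \<otimes>\<^bsub>P\<^esub> t f1 \<one>\<^bsub>A\<^esub>" using v mult by (simp add: P_simps)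
  then show ?case using assms(2) mult v by (simp add: alg_hom_mult[OF iSym_hom] iSym_g lrep_mult lrep_iV Pa.m_assoc)
qed

definition psi where "psi = tlift R Z.H (\<lambda>f a. iSym f \<otimes>\<^bsub>Z.H\<^esub> Z.iA a)"

lemma psi_bil: "bil R Sy A Z.H (\<lambda>f a. iSym f \<otimes>\<^bsub>Z.H\<^esub> Z.iA a)"
  by (intro bilI lin_mult1 lin_mult2 alg_hom_lin[OF iSym_hom] Z.lin_iA) simp_all
lemma lin_psi: "lin P Z.H psi" unfolding psi_def by (rule lin_tlift[OF mod_Sy Z.mod_A Z.mod_H psi_bil])
lemma psi_t: "\<lbrakk>f \<in> carrier Sy; a \<in> carrier A\<rbrakk> \<Longrightarrow> psi (t f a) = iSym f \<otimes>\<^bsub>Z.H\<^esub> Z.iA a"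
  unfolding psi_def by (rule tlift_tens[OF mod_Sy Z.mod_A Z.mod_H psi_bil])
lemma psi_closed [simp]: "x \<in> carrier P \<Longrightarrow> psi x \<in> carrier Z.H" by (rule lin_closed[OF lin_psi])

lemma lrep_psi_t: "\<lbrakk>f \<in> carrier Sy; a \<in> carrier A; y \<in> carrier P\<rbrakk> \<Longrightarrow> lrep (psi (t f a)) y = t f \<one>\<^bsub>A\<^esub> \<otimes>\<^bsub>P\<^esub> lmul_A a y"
  by (simp add: psi_t lrep_mult lrep_iSym lrep_iA)

definition phi where "phi h = lrep h (t \<one>\<^bsub>Sy\<^esub> \<one>\<^bsub>A\<^esub>)"

lemma lin_phi: "lin Z.H P phi" using lin_lrep[of "t \<one>\<^bsub>Sy\<^esub> \<one>\<^bsub>A\<^esub>"] by (simp add: phi_def[abs_def])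

lemma phi_psi: "z \<in> carrier P \<Longrightarrow> phi (psi z) = z"
  by (rule P_eq[OF mod_P lin_comp[OF lin_psi lin_phi] lin_id]) (simp_all add: phi_def lrep_psi_t lmul_A_t cross_one P_simps)

lemma psi_g: "\<lbrakk>v \<in> carrier V; z \<in> carrier P\<rbrakk> \<Longrightarrow> psi (t (g v) \<one>\<^bsub>A\<^esub> \<otimes>\<^bsub>P\<^esub> z) = Z.iV v \<otimes>\<^bsub>Z.H\<^esub> psi z"
  by (rule P_eq[OF Z.mod_H lin_comp[OF lin_mult_left[OF alg_P] lin_psi] lin_mult2[OF Z.alg_H lin_psi]])
    (simp_all add: P_simps psi_t alg_hom_mult[OF iSym_hom] iSym_g Z.Ha.m_assoc)

lemma psi_a: "\<lbrakk>a \<in> carrier A; z \<in> carrier P\<rbrakk> \<Longrightarrow> psi (z \<otimes>\<^bsub>P\<^esub> t \<one>\<^bsub>Sy\<^esub> a) = psi z \<otimes>\<^bsub>Z.H\<^esub> Z.iA a"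
  by (rule P_eq[OF Z.mod_H lin_comp[OF lin_mult_right[OF alg_P] lin_psi] lin_mult1[OF Z.alg_H lin_psi]])
    (simp_all add: P_simps psi_t Z.iA_mult Z.Ha.m_assoc)

lemma psi_cross: assumes "f \<in> carrier Sy" shows "\<forall>b\<in>carrier A. psi (cross b f) = Z.iA b \<otimes>\<^bsub>Z.H\<^esub> iSym f"
  using assms
proof (induction rule: Sy_induct)
  case one then show ?case by (simp add: cross_one psi_t alg_hom_one[OF iSym_hom])
next
  case (add f1 f2) then show ?case
    by (simp add: lin_add[OF lin_cross2] lin_add[OF lin_psi] lin_add[OF alg_hom_lin[OF iSym_hom]] Z.Ha.r_distr)
next
  case (smult r f1) then show ?case
    by (simp add: lin_smult[OF lin_cross2] lin_smult[OF lin_psi] lin_smult[OF alg_hom_lin[OF iSym_hom]] Z.Ha.smult_mult_right)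
next
  case (mult h f)
  then obtain v where v: "v \<in> carrier V" and h: "h = g v" by auto
  note f = mult(2) and IH = mult(3)
  show ?case
  proof
    fix b assume b: "b \<in> carrier A"
    have l: "lin Z.H Z.H (\<lambda>y. y \<otimes>\<^bsub>Z.H\<^esub> iSym f)" by (rule lin_mult_right) (simp_all add: f)
    have "psi (cross b (g v \<otimes>\<^bsub>Sy\<^esub> f)) = C.sw Z.H (\<lambda>b1 b2. psi (t (g (act b1 v)) \<one>\<^bsub>A\<^esub> \<otimes>\<^bsub>P\<^esub> cross b2 f)) b"
      unfolding cross_mult[OF b v f] by (rule C.sw_lin[OF mod_P Z.mod_H cross_bil[OF v f] b lin_psi])
    also have "\<dots> = C.sw Z.H (\<lambda>b1 b2. (Z.iV (act b1 v) \<otimes>\<^bsub>Z.H\<^esub> Z.iA b2) \<otimes>\<^bsub>Z.H\<^esub> iSym f) b"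
      by (rule C.sw_cong[OF Z.mod_H bil_lin_comp[OF cross_bil[OF v f] lin_psi] b]) (simp add: v f psi_g IH Z.Ha.m_assoc)
    also have "\<dots> = (Z.iA b \<otimes>\<^bsub>Z.H\<^esub> Z.iV v) \<otimes>\<^bsub>Z.H\<^esub> iSym f"
      using C.sw_lin[OF Z.mod_H Z.mod_H Z.bil_H[OF v] b l] C.sw_closed[OF Z.mod_H Z.bil_H[OF v] b] lin_zero[OF Z.mod_A Z.mod_H Z.lin_iA]
      by (simp add: Z.rel_av[OF b v] zero_simps)
    finally show "psi (cross b (h \<otimes>\<^bsub>Sy\<^esub> f)) = Z.iA b \<otimes>\<^bsub>Z.H\<^esub> iSym (h \<otimes>\<^bsub>Sy\<^esub> f)"
      using b v f by (simp add: h alg_hom_mult[OF iSym_hom] iSym_g Z.Ha.m_assoc)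
  qed
qed

lemma psi_lmul_A: "\<lbrakk>b \<in> carrier A; z \<in> carrier P\<rbrakk> \<Longrightarrow> psi (lmul_A b z) = Z.iA b \<otimes>\<^bsub>Z.H\<^esub> psi z"
  by (rule P_eq[OF Z.mod_H lin_comp[OF lin_lmul_A lin_psi] lin_mult2[OF Z.alg_H lin_psi]])
    (use psi_cross in \<open>simp_all add: lmul_A_t psi_a psi_t Z.Ha.m_assoc\<close>)

text \<open>
  The image of \<open>psi\<close> contains the unit and is closed under left multiplication by \<open>V\<close> and, by \<open>psi_lmul_A\<close>, by \<open>A\<close>.
\<close>

lemma psi_surj: assumes "h \<in> carrier Z.H" shows "\<exists>z\<in>carrier P. psi z = h"
  using Z.generates_H Z.alg_H assms
proof (induction rule: generates_induct)
  case one show ?case by (rule bexI[of _ "t \<one>\<^bsub>Sy\<^esub> \<one>\<^bsub>A\<^esub>"]) (simp_all add: psi_t alg_hom_one[OF iSym_hom] Z.iA_one)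
next
  case (add x y) then show ?case using lin_add[OF lin_psi] by (metis Pa.a_closed)
next
  case (smult r x) then show ?case using lin_smult[OF lin_psi] by (metis Pa.smult_closed)
next
  case (mult h x)
  then obtain z where z: "z \<in> carrier P" "psi z = x" by auto
  from mult(1) show ?case
  proof (elim UnE imageE)
    fix v assume "v \<in> carrier V" "h = Z.iV v"
    then show ?thesis using z psi_g[of v z] by (intro bexI[of _ "t (g v) \<one>\<^bsub>A\<^esub> \<otimes>\<^bsub>P\<^esub> z"]) simp_all
  next
    fix a assume "a \<in> carrier A" "h = Z.iA a"
    then show ?thesis using z psi_lmul_A[of a z] by (intro bexI[of _ "lmul_A a z"]) simp_all
  qed
qed

lemma psi_phi: "h \<in> carrier Z.H \<Longrightarrow> psi (phi h) = h" using psi_surj phi_psi by metis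

lemma bij_phi: "bij_betw phi (carrier Z.H) (carrier P)"
  by (rule bij_betwI[where g=psi]) (auto simp: psi_phi phi_psi lin_closed[OF lin_phi])

subsection \<open>The multiplication of the smash product\<close>

lemma sym_act_lin: "\<lbrakk>w \<in> lists (carrier V); w \<noteq> []\<rbrakk> \<Longrightarrow> lin A Sy (sym_act R \<Delta> V act w)"
proof (induction w)
  case (Cons v w)
  then have v: "v \<in> carrier V" by simp
  show ?case
  proof (cases "w = []")
    case True
    have "lin A Sy (\<lambda>a. g (act a v))" by (intro lp) (rule v)
    then show ?thesis using True by simp
  next
    case False
    then have IH: "lin A Sy (sym_act R \<Delta> V act w)" using Cons by simp
    have "bil R A A Sy (\<lambda>b c. g (act b v) \<otimes>\<^bsub>Sy\<^esub> sym_act R \<Delta> V act w c)"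
      by (intro bilI lin_mult1 lin_mult2 lin_g Z.lin_act IH lin_id) (simp_all add: v lin_closed[OF IH])
    from C.lin_sw[OF mod_Sy this lin_id] show ?thesis using False by simp
  qed
qed simp

text \<open>
  On words \<open>cross\<close> is the action of \<open>A\<close> by iterated coproducts. The empty word is excluded because
  without a counit \<open>A\<close> does not act on \<open>Sym\<^sup>0\<close>.
\<close>

lemma cross_word:
  assumes "w \<in> lists (carrier V)" "w \<noteq> []"
  shows "\<forall>b\<in>carrier A. cross b (word_val Sy g w) = C.sw P (\<lambda>b1 b2. t (sym_act R \<Delta> V act w b1) b2) b"
  using assms
proof (induction w)
  case (Cons v w)
  then have v: "v \<in> carrier V" and w: "w \<in> lists (carrier V)" by auto
  have gV: "g \<in> carrier V \<rightarrow> carrier Sy" by simp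
  have wc: "word_val Sy g w \<in> carrier Sy" by (rule word_val_closed[OF alg_Sy gV w])
  show ?case
  proof (cases "w = []")
    case True
    show ?thesis
    proof
      fix b assume b: "b \<in> carrier A"
      have "cross b (word_val Sy g (v # w)) = C.sw P (\<lambda>b1 b2. t (g (act b1 v)) \<one>\<^bsub>A\<^esub> \<otimes>\<^bsub>P\<^esub> cross b2 \<one>\<^bsub>Sy\<^esub>) b"
        using cross_mult[OF b v Sa.one_closed] True by simp
      also have "\<dots> = C.sw P (\<lambda>b1 b2. t (g (act b1 v)) b2) b"
        by (rule C.sw_cong[OF mod_P cross_bil[OF v Sa.one_closed] b]) (simp add: v cross_one P_simps)
      finally show "cross b (word_val Sy g (v # w)) = C.sw P (\<lambda>b1 b2. t (sym_act R \<Delta> V act (v # w) b1) b2) b" using True by simp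
    qed
  next
    case False
    let ?s = "sym_act R \<Delta> V act w"
    note sl = sym_act_lin[OF w False] and sc = lin_closed[OF sym_act_lin[OF w False]]
    have bS: "bil R A A Sy (\<lambda>u r. g (act u v) \<otimes>\<^bsub>Sy\<^esub> ?s r)"
      by (intro bilI lin_mult1 lin_mult2 lin_g Z.lin_act sl lin_id) (simp_all add: v sc)
    have bP: "bil R A A P (\<lambda>c1 c2. t (?s c1) c2)" by (intro bilI lin_tens1 lin_tens2 sl lin_id) (simp_all add: sc)
    let ?t = "\<lambda>u r y. t (g (act u v) \<otimes>\<^bsub>Sy\<^esub> ?s r) y"
    have tt: "tril R A P ?t" by (intro trilI lin_tens1 lin_tens2 lin_mult1 lin_mult2 lin_g Z.lin_act sl lin_id) (simp_all add: v sc)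
    show ?thesis
    proof
      fix b assume b: "b \<in> carrier A"
      have "cross b (word_val Sy g (v # w)) = C.sw P (\<lambda>b1 b2. t (g (act b1 v)) \<one>\<^bsub>A\<^esub> \<otimes>\<^bsub>P\<^esub> cross b2 (word_val Sy g w)) b"
        using cross_mult[OF b v wc] by simp
      also have "\<dots> = C.sw P (\<lambda>b1 b2. C.sw P (\<lambda>c1 c2. ?t b1 c1 c2) b2) b"
      proof (rule C.sw_cong[OF mod_P cross_bil[OF v wc] b])
        fix b1 b2 assume bb: "b1 \<in> carrier A" "b2 \<in> carrier A"
        have l: "lin P P (\<lambda>y. t (g (act b1 v)) \<one>\<^bsub>A\<^esub> \<otimes>\<^bsub>P\<^esub> y)" by (rule lin_mult_left) (simp_all add: bb v)
        have "t (g (act b1 v)) \<one>\<^bsub>A\<^esub> \<otimes>\<^bsub>P\<^esub> cross b2 (word_val Sy g w) = C.sw P (\<lambda>c1 c2. t (g (act b1 v)) \<one>\<^bsub>A\<^esub> \<otimes>\<^bsub>P\<^esub> t (?s c1) c2) b2"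
          using Cons.IH False w C.sw_lin[OF mod_P mod_P bP bb(2) l] bb by simp
        also have "\<dots> = C.sw P (\<lambda>c1 c2. ?t b1 c1 c2) b2"
          by (rule C.sw_cong[OF mod_P bil_lin_comp[OF bP l] bb(2)]) (simp add: P_simps bb v sc)
        finally show "t (g (act b1 v)) \<one>\<^bsub>A\<^esub> \<otimes>\<^bsub>P\<^esub> cross b2 (word_val Sy g w) = C.sw P (\<lambda>c1 c2. ?t b1 c1 c2) b2" .
      qed
      also have "\<dots> = C.sw P (\<lambda>x y. C.sw P (\<lambda>u r. ?t u r y) x) b" by (rule C.sw_coassoc[OF mod_P tt b, symmetric])
      also have "\<dots> = C.sw P (\<lambda>x y. t (C.sw Sy (\<lambda>u r. g (act u v) \<otimes>\<^bsub>Sy\<^esub> ?s r) x) y) b"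
      proof (rule C.sw_cong[OF mod_P C.tril_sw_bil(1)[OF mod_P tt] b])
        fix x y assume xy: "x \<in> carrier A" "y \<in> carrier A"
        show "C.sw P (\<lambda>u r. ?t u r y) x = t (C.sw Sy (\<lambda>u r. g (act u v) \<otimes>\<^bsub>Sy\<^esub> ?s r) x) y"
          by (rule C.sw_lin[OF mod_Sy mod_P bS xy(1) lin_tens1[OF mod_Sy Z.mod_A lin_id xy(2)], symmetric])
      qed
      finally show "cross b (word_val Sy g (v # w)) = C.sw P (\<lambda>b1 b2. t (sym_act R \<Delta> V act (v # w) b1) b2) b" using False by simp
    qed
  qed
qed simp

abbreviation Sm where "Sm \<equiv> smash R A \<Delta> V act"

text \<open>
  This identifies the inner operation in the definition of the product of \<open>smash\<close>: the case distinction on the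
  empty word is the restriction to words of one linear map.
\<close>

lemma smash_slift:
  assumes f': "f' \<in> carrier Sy" and a': "a' \<in> carrier A" and f: "f \<in> carrier Sy" and a: "a \<in> carrier A"
  shows "slift R P (\<lambda>w. if w = [] then t f' (a' \<otimes>\<^bsub>A\<^esub> a)
          else tlift R P (\<lambda>b c. t (f' \<otimes>\<^bsub>Sy\<^esub> sym_act R \<Delta> V act w b) (c \<otimes>\<^bsub>A\<^esub> a)) (\<Delta> a')) f
      = t f' \<one>\<^bsub>A\<^esub> \<otimes>\<^bsub>P\<^esub> (cross a' f \<otimes>\<^bsub>P\<^esub> t \<one>\<^bsub>Sy\<^esub> a)"
proof (rule slift_eq[OF Z.mod_V mod_P _ _ f])
  show "lin Sy P (\<lambda>f. t f' \<one>\<^bsub>A\<^esub> \<otimes>\<^bsub>P\<^esub> (cross a' f \<otimes>\<^bsub>P\<^esub> t \<one>\<^bsub>Sy\<^esub> a))"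
    by (intro lin_mult1 lin_mult2 lin_cross2) (simp_all add: f' a' a)
  fix w assume w: "w \<in> lists (carrier V)"
  show "t f' \<one>\<^bsub>A\<^esub> \<otimes>\<^bsub>P\<^esub> (cross a' (word_val Sy g w) \<otimes>\<^bsub>P\<^esub> t \<one>\<^bsub>Sy\<^esub> a) = (if w = [] then t f' (a' \<otimes>\<^bsub>A\<^esub> a)
          else tlift R P (\<lambda>b c. t (f' \<otimes>\<^bsub>Sy\<^esub> sym_act R \<Delta> V act w b) (c \<otimes>\<^bsub>A\<^esub> a)) (\<Delta> a'))"
  proof (cases "w = []")
    case True then show ?thesis using f' a' a by (simp add: cross_one P_simps)
  next
    case False
    note sl = sym_act_lin[OF w False] and sc = lin_closed[OF sym_act_lin[OF w False]]
    have bP: "bil R A A P (\<lambda>c1 c2. t (sym_act R \<Delta> V act w c1) c2)" by (intro bilI lin_tens1 lin_tens2 sl lin_id) (simp_all add: sc)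
    have l: "lin P P (\<lambda>y. t f' \<one>\<^bsub>A\<^esub> \<otimes>\<^bsub>P\<^esub> (y \<otimes>\<^bsub>P\<^esub> t \<one>\<^bsub>Sy\<^esub> a))" by (intro lin_mult1 lin_mult2 lin_id) (simp_all add: f' a)
    have "t f' \<one>\<^bsub>A\<^esub> \<otimes>\<^bsub>P\<^esub> (cross a' (word_val Sy g w) \<otimes>\<^bsub>P\<^esub> t \<one>\<^bsub>Sy\<^esub> a) =
        C.sw P (\<lambda>b c. t f' \<one>\<^bsub>A\<^esub> \<otimes>\<^bsub>P\<^esub> (t (sym_act R \<Delta> V act w b) c \<otimes>\<^bsub>P\<^esub> t \<one>\<^bsub>Sy\<^esub> a)) a'"
      using cross_word[OF w False] a' C.sw_lin[OF mod_P mod_P bP a' l] by simp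
    also have "\<dots> = C.sw P (\<lambda>b c. t (f' \<otimes>\<^bsub>Sy\<^esub> sym_act R \<Delta> V act w b) (c \<otimes>\<^bsub>A\<^esub> a)) a'"
      by (rule C.sw_cong[OF mod_P bil_lin_comp[OF bP l] a']) (simp add: f' a sc P_simps)
    finally show ?thesis using False by simp
  qed
qed

text \<open>
  The product of the smash product is the action of \<open>\<H>\<^sub>0\<^sub>,\<^sub>0\<close>, whence \<open>phi\<close> is multiplicative.
\<close>

lemma smash_mult:
  assumes U: "U \<in> carrier P" and W: "W \<in> carrier P"
  shows "U \<otimes>\<^bsub>Sm\<^esub> W = lrep (psi U) W"
proof -
  let ?sl = "\<lambda>f' a' f a. slift R P (\<lambda>w. if w = [] then t f' (a' \<otimes>\<^bsub>A\<^esub> a)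
          else tlift R P (\<lambda>b c. t (f' \<otimes>\<^bsub>Sy\<^esub> sym_act R \<Delta> V act w b) (c \<otimes>\<^bsub>A\<^esub> a)) (\<Delta> a')) f"
  have b1: "bil R Sy A P (\<lambda>f' a'. t f' \<one>\<^bsub>A\<^esub> \<otimes>\<^bsub>P\<^esub> lmul_A a' W)"
    by (intro bilI lp lin_lmul_A_arg) (simp_all add: W)
  have "U \<otimes>\<^bsub>Sm\<^esub> W = tlift R P (\<lambda>f' a'. tlift R P (\<lambda>f a. ?sl f' a' f a) W) U"
    by (simp add: smash_def Let_def)
  also have "\<dots> = tlift R P (\<lambda>f' a'. t f' \<one>\<^bsub>A\<^esub> \<otimes>\<^bsub>P\<^esub> lmul_A a' W) U"
  proof (rule tlift_cong[OF mod_Sy Z.mod_A mod_P b1 U, symmetric])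
    fix f' a' assume f': "f' \<in> carrier Sy" and a': "a' \<in> carrier A"
    have l: "lin P P (\<lambda>y. t f' \<one>\<^bsub>A\<^esub> \<otimes>\<^bsub>P\<^esub> y)" by (rule lin_mult_left) (simp_all add: f')
    have "t f' \<one>\<^bsub>A\<^esub> \<otimes>\<^bsub>P\<^esub> lmul_A a' W = tlift R P (\<lambda>f a. t f' \<one>\<^bsub>A\<^esub> \<otimes>\<^bsub>P\<^esub> (cross a' f \<otimes>\<^bsub>P\<^esub> t \<one>\<^bsub>Sy\<^esub> a)) W"
      unfolding lmul_A_def by (rule lin_of_tlift[OF mod_Sy Z.mod_A mod_P mod_P lmul_A_bil[OF a'] W l])
    also have "\<dots> = tlift R P (\<lambda>f a. ?sl f' a' f a) W"
      by (rule tlift_cong[OF mod_Sy Z.mod_A mod_P bil_lin_comp[OF lmul_A_bil[OF a'] l] W]) (rule smash_slift[OF f' a', symmetric])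
    finally show "t f' \<one>\<^bsub>A\<^esub> \<otimes>\<^bsub>P\<^esub> lmul_A a' W = tlift R P (\<lambda>f a. ?sl f' a' f a) W" .
  qed
  also have "\<dots> = lrep (psi U) W"
    by (rule P_eq[OF mod_P lin_tlift[OF mod_Sy Z.mod_A mod_P b1] lin_comp[OF lin_psi lin_lrep[OF W]] _ U])
      (simp add: tlift_tens[OF mod_Sy Z.mod_A mod_P b1] lrep_psi_t W)
  finally show ?thesis .
qed

lemma smash_simps: "carrier Sm = carrier P" "\<one>\<^bsub>Sm\<^esub> = \<one>\<^bsub>P\<^esub>" "x \<oplus>\<^bsub>Sm\<^esub> y = x \<oplus>\<^bsub>P\<^esub> y" "r \<odot>\<^bsub>Sm\<^esub> x = r \<odot>\<^bsub>P\<^esub> x"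
  by (simp_all add: smash_def Let_def)

theorem smash_iso_phi: "smash_iso R A \<Delta> V act phi"
  unfolding smash_iso_def Let_def
proof (intro conjI ballI)
  note pc = lin_closed[OF lin_phi]
  show "phi \<in> alg_hom R Z.H Sm"
  proof (rule alg_homI)
    show "lin Z.H Sm phi" using lin_phi by (simp add: linear_maps_def smash_simps)
    show "phi \<one>\<^bsub>Z.H\<^esub> = \<one>\<^bsub>Sm\<^esub>" by (simp add: phi_def lrep_one smash_simps P_simps)
    show "phi (x \<otimes>\<^bsub>Z.H\<^esub> y) = phi x \<otimes>\<^bsub>Sm\<^esub> phi y" if "x \<in> carrier Z.H" "y \<in> carrier Z.H" for x y
      using that by (simp add: smash_mult pc psi_phi) (simp add: phi_def lrep_mult)
  qed
  show "bij_betw phi (carrier Z.H) (carrier Sm)" using bij_phi by (simp add: smash_simps)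
  show "phi (Z.iV v) = t (g v) \<one>\<^bsub>A\<^esub>" if "v \<in> carrier V" for v using that by (simp add: phi_def lrep_iV P_simps)
  show "phi (Z.iA a) = t \<one>\<^bsub>Sy\<^esub> a" if "a \<in> carrier A" for a using that by (simp add: phi_def lrep_iA lmul_A_t cross_one P_simps)
qed

end

section \<open>Consequences of the PBW property\<close>

text \<open>
  Over a basis \<open>B\<close> of \<open>V\<close>, the monoid algebra of this monoid is a polynomial ring with variables \<open>B\<close>.
\<close>

definition msets :: "'v set \<Rightarrow> 'v multiset monoid"
  where "msets B = \<lparr>carrier = {M. set_mset M \<subseteq> B}, mult = (+), one = {#}\<rparr>"

lemma msets_simps [simp]: "carrier (msets B) = {M. set_mset M \<subseteq> B}" "\<one>\<^bsub>msets B\<^esub> = {#}" "M \<otimes>\<^bsub>msets B\<^esub> N = M + N"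
  by (simp_all add: msets_def)

lemma monoid_msets: "monoid (msets B)" by (rule monoidI) (auto simp: msets_def)

text \<open>
  An arbitrary choice of order replaces the ordered monomials of the usual PBW basis, so that no linear order
  on the basis is needed.
\<close>

definition word_of :: "'v multiset \<Rightarrow> 'v list" where "word_of M = (SOME w. mset w = M)"

lemma mset_word_of [simp]: "mset (word_of M) = M"
  unfolding word_of_def by (rule someI_ex) (rule ex_mset)

lemma word_of_empty [simp]: "word_of {#} = []"
  using mset_word_of[of "{#}"] by (metis mset_zero_iff)

lemma length_word_of [simp]: "length (word_of M) = size M" by (metis mset_word_of size_mset)

lemma word_of_lists: "set_mset M \<subseteq> B \<Longrightarrow> word_of M \<in> lists B"
  by (metis in_listsI mset_word_of set_mset_mset subsetD)

context cring
begin

lemma lin_inverse: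
  assumes "module R M" "lin M N f" "bij_betw f (carrier M) (carrier N)"
  shows "lin N M (inv_into (carrier M) f)"
proof -
  interpret M: module R M by fact
  let ?i = "inv_into (carrier M) f"
  have c: "?i y \<in> carrier M" "f (?i y) = y" if "y \<in> carrier N" for y
    using bij_betw_imp_surj_on[OF assms(3)] that by (auto intro: inv_into_into f_inv_into_f)
  have i: "?i (f x) = x" if "x \<in> carrier M" for x
    using that bij_betw_imp_inj_on[OF assms(3)] by (rule inv_into_f_f[rotated])
  show ?thesis
  proof (rule linI)
    show "?i (x \<oplus>\<^bsub>N\<^esub> y) = ?i x \<oplus>\<^bsub>M\<^esub> ?i y" if "x \<in> carrier N" "y \<in> carrier N" for x y
      using i[of "?i x \<oplus>\<^bsub>M\<^esub> ?i y"] c that by (simp add: lin_add[OF assms(2)])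
    show "?i (r \<odot>\<^bsub>N\<^esub> x) = r \<odot>\<^bsub>M\<^esub> ?i x" if "r \<in> carrier R" "x \<in> carrier N" for r x
      using i[of "r \<odot>\<^bsub>M\<^esub> ?i x"] c that by (simp add: lin_smult[OF assms(2)])
  qed (rule c)
qed

lemma spanned_tensor_left:
  assumes "module R M" "module R N" "spanned R M S"
  shows "spanned R (tensor R M N) {tens R M N s n | s n. s \<in> S \<and> n \<in> carrier N}"
  unfolding spanned_def
proof (intro conjI allI impI)
  have SM: "S \<subseteq> carrier M" using assms(3) by (simp add: spanned_def)
  show "{tens R M N s n | s n. s \<in> S \<and> n \<in> carrier N} \<subseteq> carrier (tensor R M N)"
    using SM by (auto intro!: tens_closed assms)
  fix K assume K: "submodule K R (tensor R M N)" "{tens R M N s n | s n. s \<in> S \<and> n \<in> carrier N} \<subseteq> K"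
  interpret T: module R "tensor R M N" by (rule module_tensor[OF assms(1,2)])
  have z: "\<zero>\<^bsub>tensor R M N\<^esub> \<in> K" using subgroup.one_closed[OF submodule.axioms(1)[OF K(1)]] by simp
  have "tens R M N m n \<in> K" if n: "n \<in> carrier N" and m: "m \<in> carrier M" for m n
  proof -
    note l = lin_tens1[OF assms(1,2) lin_id n]
    show ?thesis using assms(3,1) m
    proof (induction rule: span_induct)
      case (gen x) then show ?case using K(2) n by blast
    next
      case zero then show ?case using lin_zero[OF assms(1) T.module_axioms l] z by simp
    next
      case (add x y) then show ?case using T.submoduleE(5)[OF K(1)] by (simp add: lin_add[OF l])
    next
      case (smult r x) then show ?case using T.submoduleE(4)[OF K(1)] by (simp add: lin_smult[OF l])
    qed
  qed
  then have "{tens R M N m n | m n. m \<in> carrier M \<and> n \<in> carrier N} \<subseteq> K" by blast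
  then show "carrier (tensor R M N) \<subseteq> K" using spanned_tensor[OF assms(1,2)] K(1) by (simp add: spanned_def)
qed

end

subsection \<open>The filtration and its associated graded algebra\<close>

context H_data
begin

abbreviation F where "F \<equiv> H_filt R A \<Delta> V act lam kap"
abbreviation Pf where "Pf \<equiv> prev_filt H F"
abbreviation GR where "GR \<equiv> assoc_graded H F"

text \<open>
  The words that span the \<open>n\<close>-th filtration step: at most \<open>n\<close> letters from \<open>V\<close>.
\<close>

definition Fgens where "Fgens n = {word_val H (case_sum iV iA) ls | ls. ls \<in> lists (carrier V <+> carrier A) \<and> length (filter isl ls) \<le> n}"

lemma F_def: "F n = mod_span R H (Fgens n)"
  by (simp add: H_filt_def Fgens_def word_val_def Let_def)

lemma case_closed: "case_sum iV iA \<in> (carrier V <+> carrier A) \<rightarrow> carrier H" by auto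

lemma Fgens_closed: "Fgens n \<subseteq> carrier H"
  unfolding Fgens_def using word_val_closed[OF alg_H case_closed] by blast

lemma submodule_F: "submodule (F n) R H" unfolding F_def by (rule submodule_mod_span[OF mod_H Fgens_closed])
lemma F_closed: "x \<in> F n \<Longrightarrow> x \<in> carrier H" using Ha.submoduleE(1)[OF submodule_F] by blast
lemma F_mono: "n \<le> m \<Longrightarrow> F n \<subseteq> F m"
  unfolding F_def by (rule mod_span_mono) (auto simp: Fgens_def)
lemmas F_add = Ha.submoduleE(5)[OF submodule_F] and F_smult = Ha.submoduleE(4)[OF submodule_F]
lemma submodule_zero: "submodule N R H \<Longrightarrow> \<zero>\<^bsub>H\<^esub> \<in> N" by (drule submodule.axioms(1), drule subgroup.one_closed) simp
lemmas F_zero = submodule_zero[OF submodule_F]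
lemma Fgens_F: "x \<in> Fgens n \<Longrightarrow> x \<in> F n" unfolding F_def by (rule subsetD[OF mod_span_superset])

lemma F_mult:
  assumes x: "x \<in> F n" and y: "y \<in> F m" shows "x \<otimes>\<^bsub>H\<^esub> y \<in> F (n + m)"
proof -
  have gg: "x \<otimes>\<^bsub>H\<^esub> y \<in> F (n + m)" if xg: "x \<in> Fgens n" and yg: "y \<in> Fgens m" for x y
  proof -
    from xg obtain u where u: "x = word_val H (case_sum iV iA) u" "u \<in> lists (carrier V <+> carrier A)" "length (filter isl u) \<le> n"
      unfolding Fgens_def by blast
    from yg obtain w where w: "y = word_val H (case_sum iV iA) w" "w \<in> lists (carrier V <+> carrier A)" "length (filter isl w) \<le> m"
      unfolding Fgens_def by blast
    have "x \<otimes>\<^bsub>H\<^esub> y = word_val H (case_sum iV iA) (u @ w)" unfolding u w by (rule word_val_append[OF alg_H case_closed u(2) w(2), symmetric])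
    then have "x \<otimes>\<^bsub>H\<^esub> y \<in> Fgens (n + m)" unfolding Fgens_def using u w by (intro CollectI exI[of _ "u @ w"]) auto
    then show ?thesis by (rule Fgens_F)
  qed
  have gy: "x \<otimes>\<^bsub>H\<^esub> y \<in> F (n + m)" if xg: "x \<in> Fgens n" for x
  proof -
    have xc: "x \<in> carrier H" using xg Fgens_closed by auto
    show ?thesis using mod_H Fgens_closed y[unfolded F_def]
    proof (induction rule: mod_span_induct)
      case (gen y) then show ?case by (rule gg[OF xg])
    next
      case zero show ?case using F_zero xc by simp
    next
      case (add y z) then show ?case using xc F_add by (simp add: Ha.r_distr)
    next
      case (smult r y) then show ?case using xc F_smult by (simp add: Ha.smult_mult_right)
    qed
  qed
  have yc: "y \<in> carrier H" by (rule F_closed[OF y])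
  show ?thesis using mod_H Fgens_closed x[unfolded F_def]
  proof (induction rule: mod_span_induct)
    case (gen x) then show ?case by (rule gy)
  next
    case zero show ?case using F_zero yc by simp
  next
    case (add x z) then show ?case using yc F_add by (simp add: Ha.l_distr)
  next
    case (smult r x) then show ?case using yc F_smult by (simp add: Ha.smult_mult_left)
  qed
qed

lemma F_one: "\<one>\<^bsub>H\<^esub> \<in> F n"
  by (rule Fgens_F) (auto simp: Fgens_def intro!: exI[of _ "[]"])
lemma F_iV: "v \<in> carrier V \<Longrightarrow> iV v \<in> F (Suc 0)"
  by (rule Fgens_F) (auto simp: Fgens_def intro!: exI[of _ "[Inl v]"])
lemma F_iA: "a \<in> carrier A \<Longrightarrow> iA a \<in> F 0"
  by (rule Fgens_F) (auto simp: Fgens_def intro!: exI[of _ "[Inr a]"])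

lemma F_word: "w \<in> lists (carrier V) \<Longrightarrow> word_val H iV w \<in> F (length w)"
proof (induction w)
  case (Cons v w) then show ?case using F_mult[OF F_iV, of v "word_val H iV w" "length w"] by simp
qed (simp add: F_one)

lemma F_exhaustive: assumes "h \<in> carrier H" shows "\<exists>n. h \<in> F n"
  using generates_H alg_H assms
proof (induction rule: generates_induct)
  case one then show ?case using F_one by blast
next
  case (add x y)
  then obtain n m where "x \<in> F n" "y \<in> F m" by blast
  then have "x \<in> F (max n m)" "y \<in> F (max n m)" using F_mono by (meson max.cobounded1 max.cobounded2 subsetD)+
  then show ?case using F_add by blast
next
  case (smult r x) then show ?case using F_smult by blast
next
  case (mult g x)
  then obtain n where "x \<in> F n" by blast
  moreover have "g \<in> F (Suc 0)" using mult(1) F_iV F_iA F_mono[of 0 "Suc 0"] by auto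
  ultimately show ?case using F_mult by blast
qed

lemma submodule_Pf: "submodule (Pf n) R H"
proof (cases n)
  case 0
  have "submodule {\<zero>\<^bsub>H\<^esub>} R H" by (rule Ha.submoduleI) auto
  then show ?thesis using 0 by (simp add: prev_filt_def)
qed (simp add: prev_filt_def submodule_F)

lemma Pf_Suc: "Pf (Suc n) = F n" by (simp add: prev_filt_def)

lemma quotient_Pf: "quotient_module R H (Pf n)"
  by (intro quotient_module.intro quotient_module_axioms.intro mod_H submodule_Pf)

lemma Pf_subset_F: "Pf n \<subseteq> F n"
  using F_mono[of "n - 1" n] F_zero by (auto simp: prev_filt_def)

lemma Pf_mult: "x \<in> Pf n \<Longrightarrow> y \<in> F m \<Longrightarrow> x \<otimes>\<^bsub>H\<^esub> y \<in> Pf (n + m)" "x \<in> F m \<Longrightarrow> y \<in> Pf n \<Longrightarrow> x \<otimes>\<^bsub>H\<^esub> y \<in> Pf (m + n)"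
proof -
  have z: "\<zero>\<^bsub>H\<^esub> \<in> Pf k" for k by (rule submodule_zero[OF submodule_Pf])
  show "x \<in> Pf n \<Longrightarrow> y \<in> F m \<Longrightarrow> x \<otimes>\<^bsub>H\<^esub> y \<in> Pf (n + m)"
    by (cases n) (use z F_mult[of x "n - 1" y m] F_closed in \<open>auto simp: prev_filt_def\<close>)
  show "x \<in> F m \<Longrightarrow> y \<in> Pf n \<Longrightarrow> x \<otimes>\<^bsub>H\<^esub> y \<in> Pf (m + n)"
    by (cases n) (use z F_mult[of x m y "n - 1"] F_closed in \<open>auto simp: prev_filt_def\<close>)
qed

lemma coset_F: "h \<in> F n \<Longrightarrow> y \<in> Pf n +>\<^bsub>H\<^esub> h \<Longrightarrow> y \<in> F n"
  unfolding a_r_coset_def' by (auto intro: F_add[OF subsetD[OF Pf_subset_F]])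

lemma gr_mult_apply:
  "(x \<otimes>\<^bsub>GR\<^esub> y) k = (\<Oplus>\<^bsub>quot_alg H (Pf k)\<^esub>i\<in>{..k}. \<Union>g\<in>x i. \<Union>h\<in>y (k - i). Pf k +>\<^bsub>H\<^esub> (g \<otimes>\<^bsub>H\<^esub> h))"
  by (simp add: assoc_graded_def Let_def)

text \<open>
  Only the summand with degrees \<open>n\<close> and \<open>m\<close> contributes to the product in the associated graded algebra. Elsewhere
  one of the factors is a zero coset, and all products then lie in the previous filtration step.
\<close>

lemma symbol_mult:
  assumes x: "x \<in> F n" and y: "y \<in> F m"
  shows "symbol H F n x \<otimes>\<^bsub>GR\<^esub> symbol H F m y = symbol H F (n + m) (x \<otimes>\<^bsub>H\<^esub> y)"
proof
  fix k
  interpret Q: quotient_module R H "Pf k" by (rule quotient_Pf)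
  interpret N: module R "quot_alg H (Pf k)" by (rule Q.module_quot)
  have xc: "x \<in> carrier H" and yc: "y \<in> carrier H" using x y F_closed by auto
  let ?T = "\<lambda>i. \<Union>g\<in>symbol H F n x i. \<Union>h\<in>symbol H F m y (k - i). Pf k +>\<^bsub>H\<^esub> (g \<otimes>\<^bsub>H\<^esub> h)"
  have self: "z \<in> Pf j +>\<^bsub>H\<^esub> z" if "z \<in> carrier H" for z j
  proof -
    interpret Qj: quotient_module R H "Pf j" by (rule quotient_Pf)
    show ?thesis by (rule Qj.I.a_rcos_self[OF that])
  qed
  have z: "\<zero>\<^bsub>H\<^esub> \<in> Pf j" for j by (rule submodule_zero[OF submodule_Pf])
  have ne: "symbol H F j w i \<noteq> {}" if "w \<in> carrier H" for j w i using self[OF that] z by (auto simp: symbol_def)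
  have sF: "g \<in> F i" if "g \<in> symbol H F j w i" "w \<in> F j" for g j w i
    using that coset_F subsetD[OF Pf_subset_F] by (auto simp: symbol_def split: if_splits)
  have triv: "?T i = Pf k" if i: "i \<le> k" and ne2: "\<not> (i = n \<and> k - i = m)" for i
  proof -
    have "Pf k +>\<^bsub>H\<^esub> (g \<otimes>\<^bsub>H\<^esub> h) = Pf k" if g: "g \<in> symbol H F n x i" and h: "h \<in> symbol H F m y (k - i)" for g h
    proof (rule Q.coset_zero)
      consider "i \<noteq> n" | "k - i \<noteq> m" using ne2 by auto
      then show "g \<otimes>\<^bsub>H\<^esub> h \<in> Pf k"
      proof cases
        case 1 then have "g \<in> Pf i" using g by (simp add: symbol_def)
        then show ?thesis using Pf_mult(1)[OF _ sF[OF h y], of g i] i by simp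
      next
        case 2 then have "h \<in> Pf (k - i)" using h by (simp add: symbol_def)
        then show ?thesis using Pf_mult(2)[OF sF[OF g x], of h "k - i"] i by simp
      qed
    qed
    then show ?thesis using ne[OF xc, of n i] ne[OF yc, of m "k - i"] by auto
  qed
  show "(symbol H F n x \<otimes>\<^bsub>GR\<^esub> symbol H F m y) k = symbol H F (n + m) (x \<otimes>\<^bsub>H\<^esub> y) k"
  proof (cases "k = n + m")
    case False
    have "(\<Oplus>\<^bsub>quot_alg H (Pf k)\<^esub>i\<in>{..k}. ?T i) = (\<Oplus>\<^bsub>quot_alg H (Pf k)\<^esub>i\<in>{..k}. \<zero>\<^bsub>quot_alg H (Pf k)\<^esub>)"
    proof (rule N.M.finsum_cong')
      fix i assume i: "i \<in> {..k}"
      have "\<not> (i = n \<and> k - i = m)" using i False by auto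
      then show "?T i = \<zero>\<^bsub>quot_alg H (Pf k)\<^esub>" unfolding quot_alg_simps(3) using triv[of i] i by (simp only: atMost_iff simp_thms)
    qed simp_all
    also have "\<dots> = \<zero>\<^bsub>quot_alg H (Pf k)\<^esub>" by (rule N.M.finsum_zero)
    also have "\<dots> = symbol H F (n + m) (x \<otimes>\<^bsub>H\<^esub> y) k" using False by (simp add: symbol_def quot_alg_simps(3))
    finally show ?thesis by (simp only: gr_mult_apply)
  next
    case True
    have main: "?T n = Pf k +>\<^bsub>H\<^esub> (x \<otimes>\<^bsub>H\<^esub> y)"
    proof -
      have "Pf k +>\<^bsub>H\<^esub> (g \<otimes>\<^bsub>H\<^esub> h) = Pf k +>\<^bsub>H\<^esub> (x \<otimes>\<^bsub>H\<^esub> y)" if g: "g \<in> Pf n +>\<^bsub>H\<^esub> x" and h: "h \<in> Pf m +>\<^bsub>H\<^esub> y" for g h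
      proof -
        interpret Qn: quotient_module R H "Pf n" by (rule quotient_Pf)
        interpret Qm: quotient_module R H "Pf m" by (rule quotient_Pf)
        have gc: "g \<in> carrier H" "g \<ominus>\<^bsub>H\<^esub> x \<in> Pf n" using Qn.coset_mem[OF xc g] Qn.coset_eq_iff[of g x] xc by auto
        have hc: "h \<in> carrier H" "h \<ominus>\<^bsub>H\<^esub> y \<in> Pf m" using Qm.coset_mem[OF yc h] Qm.coset_eq_iff[of h y] yc by auto
        have hF: "h \<in> F m" by (rule coset_F[OF y h])
        have "g \<otimes>\<^bsub>H\<^esub> h \<ominus>\<^bsub>H\<^esub> x \<otimes>\<^bsub>H\<^esub> y = (g \<ominus>\<^bsub>H\<^esub> x) \<otimes>\<^bsub>H\<^esub> h \<oplus>\<^bsub>H\<^esub> x \<otimes>\<^bsub>H\<^esub> (h \<ominus>\<^bsub>H\<^esub> y)"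
          using gc(1) hc(1) xc yc
          by (simp add: a_minus_def Ha.l_distr Ha.r_distr Ha.l_minus Ha.r_minus Ha.a_assoc Ha.r_neg1)
        also have "\<dots> \<in> Pf k"
          using Ha.submoduleE(5)[OF submodule_Pf] Pf_mult(1)[OF gc(2) hF] Pf_mult(2)[OF x hc(2)] True by simp
        finally show ?thesis using Q.coset_eq_iff gc(1) hc(1) xc yc by simp
      qed
      then show ?thesis using True ne[OF xc, of n n] ne[OF yc, of m m] by (auto simp: symbol_def)
    qed
    have cc: "Pf k +>\<^bsub>H\<^esub> (x \<otimes>\<^bsub>H\<^esub> y) \<in> carrier (quot_alg H (Pf k))" using xc yc by (intro Q.coset_closed Ha.m_closed)
    have "(\<Oplus>\<^bsub>quot_alg H (Pf k)\<^esub>i\<in>{..k}. ?T i) = (\<Oplus>\<^bsub>quot_alg H (Pf k)\<^esub>i\<in>{..k}. if n = i then (Pf k +>\<^bsub>H\<^esub> (x \<otimes>\<^bsub>H\<^esub> y)) else \<zero>\<^bsub>quot_alg H (Pf k)\<^esub>)"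
    proof (rule N.M.finsum_cong')
      fix i assume "i \<in> {..k}"
      then show "?T i = (if n = i then (Pf k +>\<^bsub>H\<^esub> (x \<otimes>\<^bsub>H\<^esub> y)) else \<zero>\<^bsub>quot_alg H (Pf k)\<^esub>)"
        by (cases "n = i") (use main triv True in \<open>auto simp: quot_alg_simps(3)\<close>)
    qed (use cc in simp_all)
    also have "\<dots> = Pf k +>\<^bsub>H\<^esub> (x \<otimes>\<^bsub>H\<^esub> y)"
      by (rule N.M.finsum_singleton) (use True cc in simp_all)
    finally show ?thesis using True by (simp add: gr_mult_apply symbol_def)
  qed
qed

lemma symbol_carrier: assumes "h \<in> F n" shows "symbol H F n h \<in> carrier GR"
proof -
  have "\<exists>h'\<in>F k. symbol H F n h k = Pf k +>\<^bsub>H\<^esub> h'" for k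
  proof (cases "k = n")
    case False
    interpret Q: quotient_module R H "Pf k" by (rule quotient_Pf)
    have "Pf k +>\<^bsub>H\<^esub> \<zero>\<^bsub>H\<^esub> = Pf k" by (rule Q.coset_zero[OF submodule_zero[OF submodule_Pf]])
    then show ?thesis using False F_zero[of k] by (intro bexI[of _ "\<zero>\<^bsub>H\<^esub>"]) (auto simp: symbol_def)
  qed (use assms in \<open>auto simp: symbol_def\<close>)
  moreover have "finite {k. symbol H F n h k \<noteq> Pf k}" by (rule finite_subset[of _ "{n}"]) (auto simp: symbol_def)
  ultimately show ?thesis by (simp add: assoc_graded_def Let_def)
qed

lemma gr_add_apply: "(x \<oplus>\<^bsub>GR\<^esub> y) n = x n \<oplus>\<^bsub>quot_alg H (Pf n)\<^esub> y n"
  and gr_smult_apply: "(r \<odot>\<^bsub>GR\<^esub> x) n = r \<odot>\<^bsub>quot_alg H (Pf n)\<^esub> x n"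
  by (simp_all add: assoc_graded_def Let_def quot_alg_simps)

end

subsection \<open>A linear retraction onto \<open>A\<close>\<close>

locale pbw_data = H_data R A \<Delta> V act lam kap + Sd: smash_data R A \<Delta> V act
  for R :: "('k, 'r) ring_scheme" and A :: "('k, 'a, 'x) module_scheme" and \<Delta>
    and V :: "('k, 'v, 'y) module_scheme" and act lam kap +
  fixes B :: "'v set" and gr_map
  assumes B: "B \<subseteq> carrier V"
    and basis: "\<And>x. x \<in> carrier V \<Longrightarrow> \<exists>!f. f \<in> fin_supp R B \<and> lin_ext R V (\<lambda>b. b) f = x"
    and gr_map: "natural_gr_map R A \<Delta> V act lam kap gr_map"
    and gr_map_bij: "bij_betw gr_map (carrier Sd.Z.H) (carrier GR)"
begin

abbreviation Q where "Q \<equiv> monoid_algebra R (msets B)"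
abbreviation QA where "QA \<equiv> tensor R Q A"
abbreviation tq where "tq \<equiv> tens R Q A"
abbreviation Sy where "Sy \<equiv> sym_alg R V"
abbreviation g where "g \<equiv> sgen R V"
text \<open>
  The free module on \<open>B\<close>, as the underlying module of a monoid algebra with arbitrary operations on \<open>B\<close>.
\<close>

abbreviation FB where "FB \<equiv> monoid_algebra R \<lparr>carrier = B, mult = undefined, one = undefined\<rparr>"

lemma alg_Q [simp]: "assoc_algebra R Q" by (rule assoc_algebra_monoid_algebra(1)[OF monoid_msets])
lemma mod_Q [simp]: "module R Q" by (rule module_monoid_algebra)
lemma mod_QA [simp]: "module R QA" by (simp add: module_tensor)
sublocale Qa: assoc_algebra R Q by (rule alg_Q)
sublocale QAm: module R QA by (rule mod_QA)

lemma del_closed [simp]: "set_mset M \<subseteq> B \<Longrightarrow> delta R M \<in> carrier Q" by (rule delta_closed) simp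
lemma del_mult: "\<lbrakk>set_mset M \<subseteq> B; set_mset N \<subseteq> B\<rbrakk> \<Longrightarrow> delta R M \<otimes>\<^bsub>Q\<^esub> delta R N = delta R (M + N)"
  using assoc_algebra_monoid_algebra(2)[OF monoid_msets, of M B N] by simp
lemma Q_one: "\<one>\<^bsub>Q\<^esub> = delta R {#}" by (simp add: monoid_algebra_simps)
lemma tq_closed [simp]: "\<lbrakk>q \<in> carrier Q; a \<in> carrier A\<rbrakk> \<Longrightarrow> tq q a \<in> carrier QA" by (simp add: tens_closed)

lemma spanned_Q: "spanned R Q (delta R ` {M. set_mset M \<subseteq> B})" using spanned_monoid_algebra[of "msets B"] by simp

lemma Q_eq:
  assumes "module R N" "lin Q N f" "lin Q N h" "\<And>M. set_mset M \<subseteq> B \<Longrightarrow> f (delta R M) = h (delta R M)" "q \<in> carrier Q"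
  shows "f q = h q"
  by (rule lin_eq_on_span[OF spanned_Q mod_Q assms(1-3) _ assms(5)]) (use assms(4) in auto)

lemma id_V: "(\<lambda>b. b) \<in> carrier \<lparr>carrier = B, mult = undefined, one = undefined\<rparr> \<rightarrow> carrier V" using B by auto
lemma lin_cf: "lin FB V (lin_ext R V (\<lambda>b. b))" by (rule lin_lin_ext[OF mod_V id_V])

lemma bij_cf: "bij_betw (lin_ext R V (\<lambda>b. b)) (carrier FB) (carrier V)"
proof -
  have c: "carrier FB = fin_supp R B" by (simp add: monoid_algebra_simps)
  show ?thesis unfolding bij_betw_def
  proof
    show "inj_on (lin_ext R V (\<lambda>b. b)) (carrier FB)"
      using basis lin_closed[OF lin_cf] unfolding c inj_on_def by blast
    show "lin_ext R V (\<lambda>b. b) ` carrier FB = carrier V"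
      using basis lin_closed[OF lin_cf] unfolding c by blast
  qed
qed

lemma spanned_B: "spanned R V B"
proof -
  have "spanned R V (lin_ext R V (\<lambda>b. b) ` delta R ` B)"
    using spanned_image[OF spanned_monoid_algebra module_monoid_algebra mod_V lin_cf] bij_betw_imp_surj_on[OF bij_cf] by simp
  moreover have "lin_ext R V (\<lambda>b. b) ` delta R ` B = B"
    using lin_ext_delta[OF mod_V id_V] by force
  ultimately show ?thesis by simp
qed

text \<open>A vector as a linear polynomial in the basis.\<close>

definition V_to_Q where "V_to_Q v = lin_ext R Q (\<lambda>b. delta R {#b#}) (inv_into (carrier FB) (lin_ext R V (\<lambda>b. b)) v)"

lemma qb: "(\<lambda>b. delta R {#b#}) \<in> carrier \<lparr>carrier = B, mult = undefined, one = undefined\<rparr> \<rightarrow> carrier Q" by auto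
lemma lin_V_to_Q: "lin V Q V_to_Q"
  unfolding V_to_Q_def[abs_def] by (rule lin_comp[OF lin_inverse[OF module_monoid_algebra lin_cf bij_cf] lin_lin_ext[OF mod_Q qb]])
lemma V_to_Q_B: assumes "b \<in> B" shows "V_to_Q b = delta R {#b#}"
proof -
  have d: "delta R b \<in> carrier FB" by (rule delta_closed) (simp add: assms)
  have "lin_ext R V (\<lambda>b. b) (delta R b) = b" by (rule lin_ext_delta[OF mod_V id_V]) (simp add: assms)
  then have "inv_into (carrier FB) (lin_ext R V (\<lambda>b. b)) b = delta R b"
    using inv_into_f_f[OF bij_betw_imp_inj_on[OF bij_cf] d] by simp
  then show ?thesis using lin_ext_delta[OF mod_Q qb, of b] assms by (simp add: V_to_Q_def)
qed

lemma V_to_Q_commute: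
  assumes "v \<in> carrier V" "w \<in> carrier V" shows "V_to_Q v \<otimes>\<^bsub>Q\<^esub> V_to_Q w = V_to_Q w \<otimes>\<^bsub>Q\<^esub> V_to_Q v"
proof -
  note qc = lin_closed[OF lin_V_to_Q]
  have BV: "b \<in> B \<Longrightarrow> b \<in> carrier V" for b using B by auto
  have 1: "V_to_Q b \<otimes>\<^bsub>Q\<^esub> V_to_Q w = V_to_Q w \<otimes>\<^bsub>Q\<^esub> V_to_Q b" if "b \<in> B" for b
    by (rule lin_eq_on_span[OF spanned_B mod_V mod_Q lin_mult2[OF alg_Q lin_V_to_Q] lin_mult1[OF alg_Q lin_V_to_Q] _ assms(2)])
      (use that BV in \<open>auto simp: V_to_Q_B del_mult add.commute qc\<close>)
  show ?thesis
    by (rule lin_eq_on_span[OF spanned_B mod_V mod_Q lin_mult1[OF alg_Q lin_V_to_Q] lin_mult2[OF alg_Q lin_V_to_Q] _ assms(1)])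
      (use 1 assms qc in auto)
qed

lemma Sym_to_Q_exists: "\<exists>c. c \<in> alg_hom R Sy Q \<and> (\<forall>v\<in>carrier V. c (g v) = V_to_Q v)"
  by (rule sym_alg_lift[OF mod_V alg_Q lin_V_to_Q V_to_Q_commute]) auto

definition Sym_to_Q where "Sym_to_Q = (SOME c. c \<in> alg_hom R Sy Q \<and> (\<forall>v\<in>carrier V. c (g v) = V_to_Q v))"
lemma Sym_to_Q_hom: "Sym_to_Q \<in> alg_hom R Sy Q" and Sym_to_Q_g: "v \<in> carrier V \<Longrightarrow> Sym_to_Q (g v) = V_to_Q v"
  using someI_ex[OF Sym_to_Q_exists] by (auto simp: Sym_to_Q_def)

text \<open>
  Inverse to \<open>Sym_to_Q\<close>; hence the symmetric algebra of a free module is a polynomial ring.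
\<close>

definition Q_to_Sym where "Q_to_Sym = lin_ext R Sy (\<lambda>M. word_val Sy g (word_of M))"

lemma g_Pi: "g \<in> carrier V \<rightarrow> carrier Sy" by simp
lemma lists_B: "w \<in> lists B \<Longrightarrow> w \<in> lists (carrier V)" using B by auto
lemma wv_closed: "w \<in> lists (carrier V) \<Longrightarrow> word_val Sy g w \<in> carrier Sy" by (rule word_val_closed[OF Sd.alg_Sy g_Pi])
lemma Q_to_Sym_Pi: "(\<lambda>M. word_val Sy g (word_of M)) \<in> carrier (msets B) \<rightarrow> carrier Sy"
  using wv_closed lists_B word_of_lists[of _ B] by auto
lemma lin_Q_to_Sym: "lin Q Sy Q_to_Sym" unfolding Q_to_Sym_def by (rule lin_lin_ext[OF Sd.mod_Sy Q_to_Sym_Pi])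
lemma Q_to_Sym_delta: "set_mset M \<subseteq> B \<Longrightarrow> Q_to_Sym (delta R M) = word_val Sy g (word_of M)"
  unfolding Q_to_Sym_def by (rule lin_ext_delta[OF Sd.mod_Sy Q_to_Sym_Pi]) simp

lemma word_val_move:
  assumes "v \<in> carrier V" "u \<in> lists (carrier V)" "w \<in> lists (carrier V)"
  shows "word_val Sy g (u @ v # w) = g v \<otimes>\<^bsub>Sy\<^esub> word_val Sy g (u @ w)"
  using assms(2)
proof (induction u)
  case (Cons x u)
  then have "u @ w \<in> lists (carrier V)" using assms by auto
  then show ?case using Cons assms wv_closed[of "u @ w"] by (simp add: Sd.g_left_comm)
qed simp

text \<open>
  Letters commute in the symmetric algebra, so a word depends only on its multiset of letters.
\<close>

lemma word_val_mset:
  assumes "u \<in> lists (carrier V)" "mset u = mset w" shows "word_val Sy g u = word_val Sy g w"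
  using assms
proof (induction u arbitrary: w)
  case (Cons v u)
  then have "v \<in> set w" by (metis list.set_intros(1) mset_eq_setD)
  then obtain w1 w2 where w: "w = w1 @ v # w2" by (meson split_list)
  have sw: "w \<in> lists (carrier V)" using Cons(1,2) mset_eq_setD[OF Cons(4)] by (auto simp: in_lists_conv_set)
  have "mset u = mset (w1 @ w2)" using Cons(4) unfolding w by simp
  then have e: "word_val Sy g u = word_val Sy g (w1 @ w2)" using Cons(3) by simp
  have "word_val Sy g w = g v \<otimes>\<^bsub>Sy\<^esub> word_val Sy g (w1 @ w2)" using sw unfolding w by (intro word_val_move) auto
  then show ?case by (simp only: word_val_simps e)
qed simp

lemma Q_to_Sym_V_to_Q: assumes "v \<in> carrier V" "y \<in> carrier Q" shows "Q_to_Sym (V_to_Q v \<otimes>\<^bsub>Q\<^esub> y) = g v \<otimes>\<^bsub>Sy\<^esub> Q_to_Sym y"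
proof -
  note qc = lin_closed[OF lin_V_to_Q] and xc = lin_closed[OF lin_Q_to_Sym]
  have BV: "b \<in> B \<Longrightarrow> b \<in> carrier V" for b using B by auto
  have 1: "Q_to_Sym (V_to_Q b \<otimes>\<^bsub>Q\<^esub> y) = g b \<otimes>\<^bsub>Sy\<^esub> Q_to_Sym y" if b: "b \<in> B" for b
  proof (rule Q_eq[OF Sd.mod_Sy lin_comp[OF lin_mult_left[OF alg_Q qc[OF BV[OF b]]] lin_Q_to_Sym] lin_mult2[OF Sd.alg_Sy lin_Q_to_Sym] _ assms(2)])
    fix M assume M: "set_mset M \<subseteq> B"
    have "word_val Sy g (word_of (add_mset b M)) = word_val Sy g (b # word_of M)"
      by (rule word_val_mset) (use b M word_of_lists[of "add_mset b M" B] lists_B in auto)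
    then show "Q_to_Sym (V_to_Q b \<otimes>\<^bsub>Q\<^esub> delta R M) = g b \<otimes>\<^bsub>Sy\<^esub> Q_to_Sym (delta R M)"
      using b M by (simp add: V_to_Q_B del_mult Q_to_Sym_delta)
  qed (simp add: BV b)
  show ?thesis
    by (rule lin_eq_on_span[OF spanned_B mod_V Sd.mod_Sy lin_comp[OF lin_mult1[OF alg_Q lin_V_to_Q] lin_Q_to_Sym]
        lin_mult1[OF Sd.alg_Sy lin_sgen[OF mod_V]] _ assms(1)]) (use 1 assms xc in auto)
qed

lemma Q_to_Sym_Sym_to_Q: assumes "f \<in> carrier Sy" shows "Q_to_Sym (Sym_to_Q f) = f"
  using assms
proof (induction rule: Sd.Sy_induct)
  case one then show ?case by (simp add: alg_hom_one[OF Sym_to_Q_hom] Q_one Q_to_Sym_delta)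
next
  case (add x y) then show ?case by (simp add: lin_add[OF alg_hom_lin[OF Sym_to_Q_hom]] lin_add[OF lin_Q_to_Sym] alg_hom_closed[OF Sym_to_Q_hom])
next
  case (smult r x) then show ?case by (simp add: lin_smult[OF alg_hom_lin[OF Sym_to_Q_hom]] lin_smult[OF lin_Q_to_Sym] alg_hom_closed[OF Sym_to_Q_hom])
next
  case (mult h x) then show ?case by (auto simp: alg_hom_mult[OF Sym_to_Q_hom] Sym_to_Q_g Q_to_Sym_V_to_Q alg_hom_closed[OF Sym_to_Q_hom])
qed

lemma word_val_V_to_Q: "w \<in> lists B \<Longrightarrow> word_val Q V_to_Q w = delta R (mset w)"
proof (induction w)
  case (Cons b w)
  then have "set_mset (mset w) \<subseteq> B" "b \<in> B" by auto
  then show ?case using Cons by (simp add: V_to_Q_B del_mult)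
qed (simp add: Q_one)

lemma Sym_to_Q_Q_to_Sym: "q \<in> carrier Q \<Longrightarrow> Sym_to_Q (Q_to_Sym q) = q"
proof (rule Q_eq[OF mod_Q lin_comp[OF lin_Q_to_Sym alg_hom_lin[OF Sym_to_Q_hom]] lin_id])
  fix M assume M: "set_mset M \<subseteq> B"
  have w: "word_of M \<in> lists B" by (rule word_of_lists[OF M])
  have "Sym_to_Q (Q_to_Sym (delta R M)) = word_val Q (\<lambda>v. Sym_to_Q (g v)) (word_of M)"
    unfolding Q_to_Sym_delta[OF M] by (rule word_val_hom[OF Sd.alg_Sy Sym_to_Q_hom g_Pi lists_B[OF w]])
  also have "\<dots> = word_val Q V_to_Q (word_of M)"
    unfolding word_val_def by (rule foldr_cong) (use lists_B[OF w] in \<open>auto simp: Sym_to_Q_g\<close>)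
  finally show "Sym_to_Q (Q_to_Sym (delta R M)) = delta R M" using w by (simp add: word_val_V_to_Q)
qed

text \<open>
  \<open>\<H>\<^sub>0\<^sub>,\<^sub>0\<close> in coordinates: polynomials with coefficients in \<open>A\<close>.
\<close>

definition QA_to_H0 where "QA_to_H0 = tlift R Sd.Z.H (\<lambda>q a. Sd.iSym (Q_to_Sym q) \<otimes>\<^bsub>Sd.Z.H\<^esub> Sd.Z.iA a)"

lemma QA_to_H0_bil: "bil R Q A Sd.Z.H (\<lambda>q a. Sd.iSym (Q_to_Sym q) \<otimes>\<^bsub>Sd.Z.H\<^esub> Sd.Z.iA a)"
  by (intro bilI lin_mult1 lin_mult2 lin_comp[OF lin_Q_to_Sym alg_hom_lin[OF Sd.iSym_hom]] Sd.Z.lin_iA) (simp_all add: lin_closed[OF lin_Q_to_Sym])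
lemma lin_QA_to_H0: "lin QA Sd.Z.H QA_to_H0" unfolding QA_to_H0_def by (rule lin_tlift[OF mod_Q mod_A Sd.Z.mod_H QA_to_H0_bil])
lemma QA_to_H0_tq: "\<lbrakk>q \<in> carrier Q; a \<in> carrier A\<rbrakk> \<Longrightarrow> QA_to_H0 (tq q a) = Sd.iSym (Q_to_Sym q) \<otimes>\<^bsub>Sd.Z.H\<^esub> Sd.Z.iA a"
  unfolding QA_to_H0_def by (rule tlift_tens[OF mod_Q mod_A Sd.Z.mod_H QA_to_H0_bil])

definition P_to_QA where "P_to_QA = tlift R QA (\<lambda>f a. tq (Sym_to_Q f) a)"

lemma P_to_QA_bil: "bil R Sy A QA (\<lambda>f a. tq (Sym_to_Q f) a)"
  by (intro bilI lin_tens1 lin_tens2 alg_hom_lin[OF Sym_to_Q_hom] lin_id) (simp_all add: alg_hom_closed[OF Sym_to_Q_hom])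
lemma lin_P_to_QA: "lin Sd.P QA P_to_QA" unfolding P_to_QA_def by (rule lin_tlift[OF Sd.mod_Sy mod_A mod_QA P_to_QA_bil])
lemma P_to_QA_t: "\<lbrakk>f \<in> carrier Sy; a \<in> carrier A\<rbrakk> \<Longrightarrow> P_to_QA (Sd.t f a) = tq (Sym_to_Q f) a"
  unfolding P_to_QA_def by (rule tlift_tens[OF Sd.mod_Sy mod_A mod_QA P_to_QA_bil])

lemma QA_to_H0_P_to_QA: "z \<in> carrier Sd.P \<Longrightarrow> QA_to_H0 (P_to_QA z) = Sd.psi z"
  by (rule Sd.P_eq[OF Sd.Z.mod_H lin_comp[OF lin_P_to_QA lin_QA_to_H0] Sd.lin_psi])
    (simp_all add: P_to_QA_t QA_to_H0_tq alg_hom_closed[OF Sym_to_Q_hom] Q_to_Sym_Sym_to_Q Sd.psi_t)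

lemma P_to_QA_phi_QA_to_H0: "x \<in> carrier QA \<Longrightarrow> P_to_QA (Sd.phi (QA_to_H0 x)) = x"
proof (rule tensor_lin_eq[OF mod_Q mod_A mod_QA lin_comp[OF lin_QA_to_H0 lin_comp[OF Sd.lin_phi lin_P_to_QA]] lin_id])
  fix q a assume "q \<in> carrier Q" "a \<in> carrier A"
  then show "P_to_QA (Sd.phi (QA_to_H0 (tq q a))) = tq q a"
    by (simp add: QA_to_H0_tq Sd.psi_t[symmetric] Sd.phi_psi P_to_QA_t Sym_to_Q_Q_to_Sym lin_closed[OF lin_Q_to_Sym])
qed

lemma QA_to_H0_surj: assumes "h \<in> carrier Sd.Z.H" shows "\<exists>x\<in>carrier QA. QA_to_H0 x = h"
  by (rule bexI[of _ "P_to_QA (Sd.phi h)"])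
    (use assms in \<open>simp_all add: QA_to_H0_P_to_QA Sd.psi_phi lin_closed[OF Sd.lin_phi] lin_closed[OF lin_P_to_QA]\<close>)

lemma gr_map_facts:
  "gr_map \<in> alg_hom R Sd.Z.H GR"
  "v \<in> carrier V \<Longrightarrow> gr_map (Sd.Z.iV v) = symbol H F 1 (iV v)"
  "a \<in> carrier A \<Longrightarrow> gr_map (Sd.Z.iA a) = symbol H F 0 (iA a)"
  using gr_map by (auto simp: natural_gr_map_def Let_def)

lemma iV_Pi: "iV \<in> carrier V \<rightarrow> carrier H" and iV0_Pi: "Sd.Z.iV \<in> carrier V \<rightarrow> carrier Sd.Z.H" by auto
lemma wvH_closed: "w \<in> lists (carrier V) \<Longrightarrow> word_val H iV w \<in> carrier H" by (rule word_val_closed[OF alg_H iV_Pi])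
lemma wvH0_closed: "w \<in> lists (carrier V) \<Longrightarrow> word_val Sd.Z.H Sd.Z.iV w \<in> carrier Sd.Z.H" by (rule word_val_closed[OF Sd.Z.alg_H iV0_Pi])

lemma iSym_word: "w \<in> lists (carrier V) \<Longrightarrow> Sd.iSym (word_val Sy g w) = word_val Sd.Z.H Sd.Z.iV w"
proof (induction w)
  case (Cons v w) then show ?case by (simp add: alg_hom_mult[OF Sd.iSym_hom] wv_closed Sd.iSym_g)
qed (simp add: alg_hom_one[OF Sd.iSym_hom])

text \<open>
  The map to the associated graded algebra is multiplicative and sends generators to their symbols, and symbols
  multiply.
\<close>

lemma gr_map_word:
  assumes "w \<in> lists (carrier V)" "a \<in> carrier A"
  shows "gr_map (word_val Sd.Z.H Sd.Z.iV w \<otimes>\<^bsub>Sd.Z.H\<^esub> Sd.Z.iA a) = symbol H F (length w) (word_val H iV w \<otimes>\<^bsub>H\<^esub> iA a)"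
  using assms(1)
proof (induction w)
  case Nil then show ?case using assms(2) by (simp add: gr_map_facts)
next
  case (Cons v w)
  then have v: "v \<in> carrier V" and w: "w \<in> lists (carrier V)" by auto
  have f: "word_val H iV w \<otimes>\<^bsub>H\<^esub> iA a \<in> F (length w)" using F_mult[OF F_word[OF w] F_iA[OF assms(2)]] by simp
  have "gr_map (Sd.Z.iV v \<otimes>\<^bsub>Sd.Z.H\<^esub> (word_val Sd.Z.H Sd.Z.iV w \<otimes>\<^bsub>Sd.Z.H\<^esub> Sd.Z.iA a)) =
    symbol H F 1 (iV v) \<otimes>\<^bsub>GR\<^esub> symbol H F (length w) (word_val H iV w \<otimes>\<^bsub>H\<^esub> iA a)"
    using Cons v w assms(2) wvH0_closed[OF w] by (simp add: alg_hom_mult[OF gr_map_facts(1)] gr_map_facts(2))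
  also have "\<dots> = symbol H F (1 + length w) (iV v \<otimes>\<^bsub>H\<^esub> (word_val H iV w \<otimes>\<^bsub>H\<^esub> iA a))"
    by (rule symbol_mult) (use F_iV[OF v] f in simp_all)
  finally show ?case using v assms(2) wvH0_closed[OF w] wvH_closed[OF w] by (simp add: Ha.m_assoc Sd.Z.Ha.m_assoc)
qed

definition Q_to_H where "Q_to_H = lin_ext R H (\<lambda>M. word_val H iV (word_of M))"
lemma Q_to_H_Pi: "(\<lambda>M. word_val H iV (word_of M)) \<in> carrier (msets B) \<rightarrow> carrier H"
  using wvH_closed lists_B word_of_lists[of _ B] by auto
lemma lin_Q_to_H: "lin Q H Q_to_H" unfolding Q_to_H_def by (rule lin_lin_ext[OF mod_H Q_to_H_Pi])
lemma Q_to_H_delta: "set_mset M \<subseteq> B \<Longrightarrow> Q_to_H (delta R M) = word_val H iV (word_of M)"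
  unfolding Q_to_H_def by (rule lin_ext_delta[OF mod_H Q_to_H_Pi]) simp

text \<open>
  The chosen PBW monomials in \<open>H\<close>: each multiset is replaced by its chosen word.
\<close>

definition QA_to_H where "QA_to_H = tlift R H (\<lambda>q a. Q_to_H q \<otimes>\<^bsub>H\<^esub> iA a)"
lemma QA_to_H_bil: "bil R Q A H (\<lambda>q a. Q_to_H q \<otimes>\<^bsub>H\<^esub> iA a)"
  by (intro bilI lin_mult1 lin_mult2 lin_Q_to_H lin_iA) (simp_all add: lin_closed[OF lin_Q_to_H])
lemma lin_QA_to_H: "lin QA H QA_to_H" unfolding QA_to_H_def by (rule lin_tlift[OF mod_Q mod_A mod_H QA_to_H_bil])
lemma QA_to_H_tq: "\<lbrakk>set_mset M \<subseteq> B; a \<in> carrier A\<rbrakk> \<Longrightarrow> QA_to_H (tq (delta R M) a) = word_val H iV (word_of M) \<otimes>\<^bsub>H\<^esub> iA a"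
  unfolding QA_to_H_def using tlift_tens[OF mod_Q mod_A mod_H QA_to_H_bil, of "delta R M" a] by (simp add: Q_to_H_delta)

definition Q_component where "Q_component n q = (\<lambda>M. if size M = n then q M else \<zero>\<^bsub>R\<^esub>)" for q :: "'v multiset \<Rightarrow> 'k"
lemma lin_Q_component: "lin Q Q (Q_component n)"
proof (rule linI)
  show "Q_component n q \<in> carrier Q" if "q \<in> carrier Q" for q
    unfolding monoid_algebra_simps Q_component_def
    by (rule fin_suppI[where T="{M. q M \<noteq> \<zero>\<^bsub>R\<^esub>}"]) (use that in \<open>auto simp: monoid_algebra_simps fin_supp_def\<close>)
qed (auto simp: Q_component_def monoid_algebra_simps)
lemma Q_component_delta: "Q_component n (delta R M) = (if size M = n then delta R M else \<zero>\<^bsub>Q\<^esub>)"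
  by (auto simp: Q_component_def delta_def monoid_algebra_simps fun_eq_iff)

definition QA_component where "QA_component n = tlift R QA (\<lambda>q a. tq (Q_component n q) a)"
lemma QA_component_bil: "bil R Q A QA (\<lambda>q a. tq (Q_component n q) a)"
  by (intro bilI lin_tens1 lin_tens2 lin_Q_component lin_id) (simp_all add: lin_closed[OF lin_Q_component])
lemma lin_QA_component: "lin QA QA (QA_component n)" unfolding QA_component_def by (rule lin_tlift[OF mod_Q mod_A mod_QA QA_component_bil])
lemma QA_component_tq: "\<lbrakk>set_mset M \<subseteq> B; a \<in> carrier A\<rbrakk> \<Longrightarrow> QA_component n (tq (delta R M) a) = (if size M = n then tq (delta R M) a else \<zero>\<^bsub>QA\<^esub>)"
  unfolding QA_component_def using tlift_tens[OF mod_Q mod_A mod_QA QA_component_bil, of "delta R M" a n]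
    lin_zero[OF mod_Q mod_QA lin_tens1[OF mod_Q mod_A lin_id]] by (simp add: Q_component_delta)

lemma spanned_QA: "spanned R QA {tq (delta R M) a | M a. set_mset M \<subseteq> B \<and> a \<in> carrier A}"
proof -
  have e: "{tq s n | s n. s \<in> delta R ` {M. set_mset M \<subseteq> B} \<and> n \<in> carrier A} = {tq (delta R M) a | M a. set_mset M \<subseteq> B \<and> a \<in> carrier A}"
    by blast
  show ?thesis using spanned_tensor_left[OF mod_Q mod_A spanned_Q] unfolding e .
qed

lemma QA_eq:
  assumes "module R N" "lin QA N f" "lin QA N h" "\<And>M a. \<lbrakk>set_mset M \<subseteq> B; a \<in> carrier A\<rbrakk> \<Longrightarrow> f (tq (delta R M) a) = h (tq (delta R M) a)" "x \<in> carrier QA"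
  shows "f x = h x"
  by (rule lin_eq_on_span[OF spanned_QA mod_QA assms(1-3) _ assms(5)]) (use assms(4) in auto)

lemma QA_component_QA_component: "x \<in> carrier QA \<Longrightarrow> QA_component n (QA_component m x) = (if n = m then QA_component m x else \<zero>\<^bsub>QA\<^esub>)"
proof -
  assume x: "x \<in> carrier QA"
  note z = lin_zero[OF mod_QA mod_QA lin_QA_component]
  show ?thesis
  proof (cases "n = m")
    case True
    have "QA_component n (QA_component m x) = QA_component m x"
      by (rule QA_eq[OF mod_QA lin_comp[OF lin_QA_component lin_QA_component] lin_QA_component _ x]) (simp add: QA_component_tq z True)
    then show ?thesis using True by simp
  next
    case False
    have "QA_component n (QA_component m x) = \<zero>\<^bsub>QA\<^esub>"
      by (rule QA_eq[OF mod_QA lin_comp[OF lin_QA_component lin_QA_component] lin_const_zero[OF mod_QA] _ x]) (use False in \<open>auto simp: QA_component_tq z\<close>)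
    then show ?thesis using False by simp
  qed
qed

text \<open>
  The given isomorphism, in coordinates, sends a homogeneous element to the symbol of its PBW monomials.
\<close>

lemma gr_map_QA_to_H0:
  assumes "x \<in> carrier QA" shows "gr_map (QA_to_H0 x) n = Pf n +>\<^bsub>H\<^esub> QA_to_H (QA_component n x)"
proof -
  interpret Qn: quotient_module R H "Pf n" by (rule quotient_Pf)
  note Tc = lin_closed[OF lin_QA_to_H lin_closed[OF lin_QA_component]] and pc = lin_closed[OF lin_QA_to_H0]
  have z: "Pf n +>\<^bsub>H\<^esub> QA_to_H \<zero>\<^bsub>QA\<^esub> = Pf n"
    using lin_zero[OF mod_QA mod_H lin_QA_to_H] Qn.coset_zero[OF submodule_zero[OF submodule_Pf]] by simp
  have pure: "gr_map (QA_to_H0 (tq (delta R M) a)) n = Pf n +>\<^bsub>H\<^esub> QA_to_H (QA_component n (tq (delta R M) a))" if M: "set_mset M \<subseteq> B" and a: "a \<in> carrier A" for M a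
  proof -
    have w: "word_of M \<in> lists (carrier V)" by (rule lists_B[OF word_of_lists[OF M]])
    show ?thesis using M a z by (simp add: QA_to_H0_tq Q_to_Sym_delta iSym_word[OF w] gr_map_word[OF w a] QA_component_tq QA_to_H_tq symbol_def)
  qed
  have sm: "gr_map (QA_to_H0 (r \<odot>\<^bsub>QA\<^esub> x)) n = Pf n +>\<^bsub>H\<^esub> QA_to_H (QA_component n (r \<odot>\<^bsub>QA\<^esub> x))"
    if "r \<in> carrier R" "x \<in> carrier QA" "gr_map (QA_to_H0 x) n = Pf n +>\<^bsub>H\<^esub> QA_to_H (QA_component n x)" for r x
    using that by (simp add: lin_smult[OF lin_QA_to_H0] lin_smult[OF alg_hom_lin[OF gr_map_facts(1)]] pc gr_smult_apply
        Qn.coset_smult Tc lin_smult[OF lin_QA_component] lin_smult[OF lin_QA_to_H] lin_closed[OF lin_QA_component])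
  have one: "tq (delta R {#}) \<one>\<^bsub>A\<^esub> \<in> carrier QA" by simp
  have 0: "gr_map (QA_to_H0 \<zero>\<^bsub>QA\<^esub>) n = Pf n +>\<^bsub>H\<^esub> QA_to_H (QA_component n \<zero>\<^bsub>QA\<^esub>)"
    using sm[OF _ one pure, of "\<zero>\<^bsub>R\<^esub>"] QAm.smult_l_null[OF one] by simp
  show ?thesis using spanned_QA mod_QA assms
  proof (induction rule: span_induct)
    case (gen x) then show ?case using pure by blast
  next
    case zero show ?case by (rule 0)
  next
    case (add x y)
    then show ?case by (simp add: lin_add[OF lin_QA_to_H0] lin_add[OF alg_hom_lin[OF gr_map_facts(1)]] pc gr_add_apply
        Qn.coset_add Tc lin_add[OF lin_QA_component] lin_add[OF lin_QA_to_H] lin_closed[OF lin_QA_component])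
  next
    case (smult r x) then show ?case by (rule sm)
  qed
qed

text \<open>
  The polynomials of degree less than \<open>N\<close>, matching the index shift of \<open>prev_filt\<close>.
\<close>

definition QA_below where "QA_below N = mod_span R QA {tq (delta R M) a | M a. set_mset M \<subseteq> B \<and> a \<in> carrier A \<and> size M < N}"

lemma QA_below_gens: "{tq (delta R M) a | M a. set_mset M \<subseteq> B \<and> a \<in> carrier A \<and> size M < N} \<subseteq> carrier QA" by auto
lemma submodule_QA_below: "submodule (QA_below N) R QA" unfolding QA_below_def by (rule submodule_mod_span[OF mod_QA QA_below_gens])
lemma QA_below_closed: "x \<in> QA_below N \<Longrightarrow> x \<in> carrier QA" using QAm.submoduleE(1)[OF submodule_QA_below] by blast
lemma QA_below_zero: "\<zero>\<^bsub>QA\<^esub> \<in> QA_below N" using subgroup.one_closed[OF submodule.axioms(1)[OF submodule_QA_below]] by simp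
lemma QA_below_mono: "n \<le> m \<Longrightarrow> QA_below n \<subseteq> QA_below m" unfolding QA_below_def by (rule mod_span_mono) (use order_less_le_trans in blast)

lemma QA_below_exhaustive: assumes "x \<in> carrier QA" shows "\<exists>N. x \<in> QA_below N"
  using spanned_QA mod_QA assms
proof (induction rule: span_induct)
  case (gen x)
  then obtain M a where "x = tq (delta R M) a" "set_mset M \<subseteq> B" "a \<in> carrier A" by blast
  then have "x \<in> {tq (delta R M') a | M' a. set_mset M' \<subseteq> B \<and> a \<in> carrier A \<and> size M' < Suc (size M)}" by blast
  then have "x \<in> QA_below (Suc (size M))" unfolding QA_below_def by (rule subsetD[OF mod_span_superset])
  then show ?case ..
next
  case zero show ?case using QA_below_zero by blast
next
  case (add x y)
  then obtain n m where "x \<in> QA_below n" "y \<in> QA_below m" by blast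
  then have "x \<in> QA_below (max n m)" "y \<in> QA_below (max n m)" using QA_below_mono by (meson max.cobounded1 max.cobounded2 subsetD)+
  then show ?case using QAm.submoduleE(5)[OF submodule_QA_below] by blast
next
  case (smult r x) then show ?case using QAm.submoduleE(4)[OF submodule_QA_below] by blast
qed

lemma QA_minus_zero: "\<ominus>\<^bsub>QA\<^esub> \<zero>\<^bsub>QA\<^esub> = \<zero>\<^bsub>QA\<^esub>" by (rule QAm.M.minus_equality) simp_all

lemma QA_below_step:
  assumes "x \<in> QA_below (Suc N)" shows "x \<ominus>\<^bsub>QA\<^esub> QA_component N x \<in> QA_below N"
  using mod_QA QA_below_gens assms[unfolded QA_below_def]
proof (induction rule: mod_span_induct)
  case (gen x)
  then obtain M a where x: "x = tq (delta R M) a" "set_mset M \<subseteq> B" "a \<in> carrier A" "size M < Suc N" by blast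
  have xc: "tq (delta R M) a \<in> carrier QA" using x by simp
  show ?case
  proof (cases "size M = N")
    case True then show ?thesis using x xc QA_below_zero by (simp add: QA_component_tq a_minus_def QAm.M.r_neg)
  next
    case False
    then have "size M < N" using x(4) by simp
    then have "x \<in> {tq (delta R M') a | M' a. set_mset M' \<subseteq> B \<and> a \<in> carrier A \<and> size M' < N}" using x(1-3) by blast
    then have "x \<in> QA_below N" unfolding QA_below_def by (rule subsetD[OF mod_span_superset])
    then show ?thesis using x xc False by (simp add: QA_component_tq a_minus_def QA_minus_zero)
  qed
next
  case zero show ?case using QA_below_zero lin_zero[OF mod_QA mod_QA lin_diff[OF mod_QA lin_id lin_QA_component]] by simp
next
  case (add x y) then show ?case
    using lin_add[OF lin_diff[OF mod_QA lin_id lin_QA_component]] QAm.submoduleE(5)[OF submodule_QA_below] by simp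
next
  case (smult r x) then show ?case
    using lin_smult[OF lin_diff[OF mod_QA lin_id lin_QA_component]] QAm.submoduleE(4)[OF submodule_QA_below] by simp
qed

lemma QA_to_H_QA_below: assumes "x \<in> QA_below N" shows "QA_to_H x \<in> Pf N"
  using mod_QA QA_below_gens assms[unfolded QA_below_def]
proof (induction rule: mod_span_induct)
  case (gen x)
  then obtain M a where x: "x = tq (delta R M) a" "set_mset M \<subseteq> B" "a \<in> carrier A" "size M < N" by blast
  have w: "word_of M \<in> lists (carrier V)" by (rule lists_B[OF word_of_lists[OF x(2)]])
  have "QA_to_H x \<in> F (size M)" using x F_mult[OF F_word[OF w] F_iA[OF x(3)]] by (simp add: QA_to_H_tq)
  moreover have "F (size M) \<subseteq> F (N - 1)" using x(4) by (intro F_mono) simp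
  ultimately show ?case using x(4) by (auto simp: prev_filt_def)
next
  case zero show ?case using submodule_zero[OF submodule_Pf] lin_zero[OF mod_QA mod_H lin_QA_to_H] by simp
next
  case (add x y) then show ?case using Ha.submoduleE(5)[OF submodule_Pf] by (simp add: lin_add[OF lin_QA_to_H])
next
  case (smult r x) then show ?case using Ha.submoduleE(4)[OF submodule_Pf] by (simp add: lin_smult[OF lin_QA_to_H])
qed

lemma gr_map_QA_to_H0_inj: assumes "x \<in> carrier QA" "\<And>n. QA_to_H (QA_component n x) \<in> Pf n" shows "x = \<zero>\<^bsub>QA\<^esub>"
proof -
  have "gr_map (QA_to_H0 x) n = gr_map (QA_to_H0 \<zero>\<^bsub>QA\<^esub>) n" for n
  proof -
    interpret Qn: quotient_module R H "Pf n" by (rule quotient_Pf)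
    show ?thesis using Qn.coset_zero[OF assms(2)] Qn.coset_zero[OF submodule_zero[OF submodule_Pf]] assms(1)
      by (simp add: gr_map_QA_to_H0 lin_zero[OF mod_QA mod_QA lin_QA_component] lin_zero[OF mod_QA mod_H lin_QA_to_H])
  qed
  then have "gr_map (QA_to_H0 x) = gr_map (QA_to_H0 \<zero>\<^bsub>QA\<^esub>)" by (rule ext)
  then have e: "QA_to_H0 x = QA_to_H0 \<zero>\<^bsub>QA\<^esub>"
    by (rule inj_onD[OF bij_betw_imp_inj_on[OF gr_map_bij] _ lin_closed[OF lin_QA_to_H0 assms(1)] lin_closed[OF lin_QA_to_H0 QAm.M.zero_closed]])
  show ?thesis using P_to_QA_phi_QA_to_H0[OF assms(1)] P_to_QA_phi_QA_to_H0[OF QAm.M.zero_closed] unfolding e by simp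
qed

text \<open>
  By descent on the degree: if \<open>x\<close> maps to zero, then its top part has vanishing symbol, hence vanishes because
  the map to the associated graded algebra is injective, and the degree of \<open>x\<close> drops.
\<close>

lemma QA_to_H_inj_QA_below: "x \<in> QA_below N \<Longrightarrow> QA_to_H x = \<zero>\<^bsub>H\<^esub> \<Longrightarrow> x = \<zero>\<^bsub>QA\<^esub>"
proof (induction N arbitrary: x)
  case 0
  have "submodule {\<zero>\<^bsub>QA\<^esub>} R QA" by (rule QAm.submoduleI) auto
  then have "QA_below 0 \<subseteq> {\<zero>\<^bsub>QA\<^esub>}" unfolding QA_below_def by (rule mod_span_minimal) simp
  then show ?case using 0(1) by blast
next
  case (Suc N)
  have xc: "x \<in> carrier QA" by (rule QA_below_closed[OF Suc(2)])
  have px: "QA_component N x \<in> carrier QA" by (rule lin_closed[OF lin_QA_component xc])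
  have "QA_to_H (x \<ominus>\<^bsub>QA\<^esub> QA_component N x) \<in> Pf N" by (rule QA_to_H_QA_below[OF QA_below_step[OF Suc(2)]])
  then have "\<ominus>\<^bsub>H\<^esub> QA_to_H (QA_component N x) \<in> Pf N"
    unfolding lin_minus[OF mod_QA mod_H lin_QA_to_H xc px] Suc(3) using lin_closed[OF lin_QA_to_H px] by (simp add: a_minus_def)
  then have "\<ominus>\<^bsub>H\<^esub> (\<ominus>\<^bsub>H\<^esub> QA_to_H (QA_component N x)) \<in> Pf N" by (rule Ha.submoduleE(3)[OF submodule_Pf])
  then have TN: "QA_to_H (QA_component N x) \<in> Pf N" using lin_closed[OF lin_QA_to_H px] by simp
  have "QA_component N x = \<zero>\<^bsub>QA\<^esub>"
  proof (rule gr_map_QA_to_H0_inj[OF px])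
    show "QA_to_H (QA_component n (QA_component N x)) \<in> Pf n" for n
      using TN submodule_zero[OF submodule_Pf] lin_zero[OF mod_QA mod_H lin_QA_to_H] by (simp add: QA_component_QA_component[OF xc])
  qed
  then have "x \<in> QA_below N" using QA_below_step[OF Suc(2)] xc by (simp add: a_minus_def QA_minus_zero)
  then show ?case using Suc.IH Suc(3) by blast
qed

text \<open>
  The symbol of an element of degree \<open>n\<close> is the symbol of some PBW polynomial; the difference has lower degree.
\<close>

lemma QA_to_H_surj: "Pf n \<subseteq> QA_to_H ` carrier QA"
proof (induction n)
  case 0
  have "\<zero>\<^bsub>H\<^esub> \<in> QA_to_H ` carrier QA" by (rule image_eqI) (rule lin_zero[OF mod_QA mod_H lin_QA_to_H, symmetric], simp)
  then show ?case by (simp add: prev_filt_def)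
next
  case (Suc n)
  show ?case
  proof
    fix h assume "h \<in> Pf (Suc n)"
    then have h: "h \<in> F n" by (simp add: Pf_Suc)
    have hc: "h \<in> carrier H" by (rule F_closed[OF h])
    have "symbol H F n h \<in> gr_map ` carrier Sd.Z.H" unfolding bij_betw_imp_surj_on[OF gr_map_bij] by (rule symbol_carrier[OF h])
    then obtain k where k: "symbol H F n h = gr_map k" "k \<in> carrier Sd.Z.H" by (rule imageE)
    obtain x where x: "x \<in> carrier QA" "QA_to_H0 x = k" using QA_to_H0_surj[OF k(2)] by blast
    interpret Qn: quotient_module R H "Pf n" by (rule quotient_Pf)
    have px: "QA_component n x \<in> carrier QA" by (rule lin_closed[OF lin_QA_component x(1)])
    have Tc: "QA_to_H (QA_component n x) \<in> carrier H" by (rule lin_closed[OF lin_QA_to_H px])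
    have "Pf n +>\<^bsub>H\<^esub> h = Pf n +>\<^bsub>H\<^esub> QA_to_H (QA_component n x)" using gr_map_QA_to_H0[OF x(1), of n] unfolding x(2) k(1)[symmetric] by (simp add: symbol_def)
    then have "h \<ominus>\<^bsub>H\<^esub> QA_to_H (QA_component n x) \<in> Pf n" using Qn.coset_eq_iff[OF hc Tc] by simp
    then have "h \<ominus>\<^bsub>H\<^esub> QA_to_H (QA_component n x) \<in> QA_to_H ` carrier QA" by (rule subsetD[OF Suc])
    then obtain y where y: "h \<ominus>\<^bsub>H\<^esub> QA_to_H (QA_component n x) = QA_to_H y" "y \<in> carrier QA" by (rule imageE)
    have "QA_to_H (y \<oplus>\<^bsub>QA\<^esub> QA_component n x) = h"
      unfolding lin_add[OF lin_QA_to_H y(2) px] y(1)[symmetric] using hc Tc by (simp add: a_minus_def Ha.a_assoc Ha.l_neg)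
    then show "h \<in> QA_to_H ` carrier QA" by (rule image_eqI[OF sym]) (rule QAm.M.a_closed[OF y(2) px])
  qed
qed

lemma bij_QA_to_H: "bij_betw QA_to_H (carrier QA) (carrier H)"
  unfolding bij_betw_def
proof
  show "inj_on QA_to_H (carrier QA)"
  proof (rule inj_onI)
    fix x y assume xy: "x \<in> carrier QA" "y \<in> carrier QA" "QA_to_H x = QA_to_H y"
    have "QA_to_H (x \<ominus>\<^bsub>QA\<^esub> y) = \<zero>\<^bsub>H\<^esub>"
      using xy lin_closed[OF lin_QA_to_H] by (simp add: lin_minus[OF mod_QA mod_H lin_QA_to_H] Ha.diff_eq_zero_iff)
    moreover obtain N where "x \<ominus>\<^bsub>QA\<^esub> y \<in> QA_below N" using QA_below_exhaustive[OF QAm.M.minus_closed[OF xy(1,2)]] by blast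
    ultimately have "x \<ominus>\<^bsub>QA\<^esub> y = \<zero>\<^bsub>QA\<^esub>" using QA_to_H_inj_QA_below by blast
    then show "x = y" using xy by (simp add: QAm.M.diff_eq_zero_iff)
  qed
  show "QA_to_H ` carrier QA = carrier H"
  proof (intro equalityI subsetI)
    fix h assume "h \<in> QA_to_H ` carrier QA" then show "h \<in> carrier H" by (elim imageE) (simp add: lin_closed[OF lin_QA_to_H])
  next
    fix h assume "h \<in> carrier H"
    then obtain n where "h \<in> F n" using F_exhaustive by blast
    then have "h \<in> Pf (Suc n)" by (simp add: Pf_Suc)
    then show "h \<in> QA_to_H ` carrier QA" by (rule subsetD[OF QA_to_H_surj])
  qed
qed

text \<open>
  Transport the coefficient of the empty multiset along the bijection \<open>QA_to_H\<close>, under which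
  \<open>a\<close> corresponds to \<open>1 \<otimes> a\<close>. This uses that the word chosen for the empty multiset is empty.
\<close>

theorem retraction_exists: "\<exists>r. lin H A r \<and> (\<forall>a\<in>carrier A. r (iA a) = a)"
proof -
  interpret A: assoc_algebra R A by simp
  have b: "bil R Q A A (\<lambda>q a. q {#} \<odot>\<^bsub>A\<^esub> a)"
  proof (rule bilI)
    show "lin A A (\<lambda>a. q {#} \<odot>\<^bsub>A\<^esub> a)" if "q \<in> carrier Q" for q
      by (rule lin_scale[OF mod_A lin_id]) (use that in \<open>simp add: monoid_algebra_simps fin_supp_closed\<close>)
    show "lin Q A (\<lambda>q. q {#} \<odot>\<^bsub>A\<^esub> a)" if "a \<in> carrier A" for a
      by (rule linI) (use that in \<open>auto simp: monoid_algebra_simps fin_supp_closed C.smult_l_distr C.smult_assoc1\<close>)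
  qed
  let ?e = "tlift R A (\<lambda>q a. q {#} \<odot>\<^bsub>A\<^esub> a)"
  have l: "lin H A (\<lambda>h. ?e (inv_into (carrier QA) QA_to_H h))"
    by (rule lin_comp[OF lin_inverse[OF mod_QA lin_QA_to_H bij_QA_to_H] lin_tlift[OF mod_Q mod_A mod_A b]])
  have "?e (inv_into (carrier QA) QA_to_H (iA a)) = a" if a: "a \<in> carrier A" for a
  proof -
    have "QA_to_H (tq (delta R {#}) a) = iA a" using a by (simp add: QA_to_H_tq)
    then have "inv_into (carrier QA) QA_to_H (iA a) = tq (delta R {#}) a"
      using inv_into_f_f[OF bij_betw_imp_inj_on[OF bij_QA_to_H], of "tq (delta R {#}) a"] a by simp
    then show ?thesis using a by (simp add: tlift_tens[OF mod_Q mod_A mod_A b]) (simp add: delta_def)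
  qed
  then show ?thesis using l by (intro exI[of _ "\<lambda>h. ?e (inv_into (carrier QA) QA_to_H h)"] conjI ballI)
qed

end

context H_data
begin

lemma PBW_retraction:
  assumes "PBW_property R A \<Delta> V act lam kap" "free_module R V"
  obtains r where "lin H A r" "\<And>a. a \<in> carrier A \<Longrightarrow> r (iA a) = a"
proof -
  have Sd: "smash_data R A \<Delta> V act"
    by (rule smash_data.intro[OF cring_axioms C.cocomm_algebra_axioms VM.algebra_module_axioms])
  obtain B where B: "B \<subseteq> carrier V" "\<forall>x\<in>carrier V. \<exists>!f. f \<in> fin_supp R B \<and> lin_ext R V (\<lambda>b. b) f = x"
    using assms(2) unfolding free_module_def by (elim exE conjE)
  obtain gr_map where gr_map: "natural_gr_map R A \<Delta> V act lam kap gr_map"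
    "bij_betw gr_map (carrier (H_alg R A \<Delta> V act (zero_lam A) (zero_kap A V))) (carrier GR)"
    using assms(1) unfolding PBW_property_def by (elim exE conjE)
  have "pbw_data R A \<Delta> V act lam kap B gr_map"
    by (rule pbw_data.intro[OF H_data_axioms Sd pbw_data_axioms.intro[OF B(1) bspec[OF B(2)] gr_map]])
  from pbw_data.retraction_exists[OF this] obtain r where "lin H A r \<and> (\<forall>a\<in>carrier A. r (iA a) = a)" ..
  then show thesis by (intro that[of r]) auto
qed

text \<open>
  A retraction \<open>r\<close> of \<open>A \<rightarrow> H\<close> gives the retraction \<open>r \<otimes> r\<close> of \<open>J\<close>.
\<close>

lemma PBW_inj:
  assumes "PBW_property R A \<Delta> V act lam kap" "free_module R V"
  shows "inj_on iA (carrier A)" "inj_on J (carrier (tensor R A A))"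
proof -
  obtain r where r: "lin H A r" "\<And>a. a \<in> carrier A \<Longrightarrow> r (iA a) = a" by (rule PBW_retraction[OF assms]) blast
  show "inj_on iA (carrier A)" by (rule inj_on_inverseI[of _ r]) (rule r(2))
  have b: "bil R H H (tensor R A A) (\<lambda>x y. tens R A A (r x) (r y))"
    by (intro bilI lin_tens1 lin_tens2 r(1)) (simp_all add: lin_closed[OF r(1)])
  let ?rr = "tlift R (tensor R A A) (\<lambda>x y. tens R A A (r x) (r y))"
  have "?rr (J U) = U" if "U \<in> carrier (tensor R A A)" for U
    by (rule tensor_lin_eq[OF mod_A mod_A mod_AA lin_comp[OF lin_J lin_tlift[OF mod_H mod_H mod_AA b]] lin_id _ that])
      (simp add: J_tens tlift_tens[OF mod_H mod_H mod_AA b] r)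
  then show "inj_on J (carrier (tensor R A A))" by (rule inj_on_inverseI)
qed

end

section \<open>The equivalences\<close>

context H_data
begin

lemma PBW_cocomm_imp_star:
  assumes "PBW_property R A \<Delta> V act lam kap" "free_module R V" "cocomm_algebra R H D" "extends_comult R A \<Delta> V H iA iV D"
  shows "star_condition R A \<Delta> V lam kap"
  using assms(4) unfolding extends_comult_iff
  by (intro cocomm_imp_star[OF PBW_inj(2)[OF assms(1,2)] cocomm_algebra.comult_hom[OF assms(3)]]) simp_all

theorem cocomm_algebra_converse:
  assumes "PBW_property R A \<Delta> V act lam kap" "free_module R V" "H_cocomm_algebra R A \<Delta> V act lam kap"
  shows "star_condition R A \<Delta> V lam kap"
proof -
  obtain D where "cocomm_algebra R H D" "extends_comult R A \<Delta> V H iA iV D"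
    using assms(3) unfolding H_cocomm_algebra_def Let_def by (elim exE conjE)
  then show ?thesis by (rule PBW_cocomm_imp_star[OF assms(1,2)])
qed

theorem cocomm_bialgebra_converse:
  assumes "PBW_property R A \<Delta> V act lam kap" "free_module R V" "cocomm_bialgebra R A \<Delta> \<epsilon>"
    and "H_cocomm_bialgebra R A \<Delta> \<epsilon> V act lam kap"
  shows "star_condition R A \<Delta> V lam kap \<and> (\<forall>x\<in>carrier (tensor R A V). \<epsilon> (lam x) = \<zero>\<^bsub>R\<^esub>)"
proof -
  obtain D e where D: "cocomm_bialgebra R H D e" and x: "extends_comult R A \<Delta> V H iA iV D"
    and e: "\<forall>a\<in>carrier A. e (iA a) = \<epsilon> a"
    using assms(4) unfolding H_cocomm_bialgebra_def Let_def by (elim exE conjE)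
  have "star_condition R A \<Delta> V lam kap"
    by (rule PBW_cocomm_imp_star[OF assms(1,2) cocomm_bialgebra.axioms(1)[OF D] x])
  moreover have "\<epsilon> (lam y) = \<zero>\<^bsub>R\<^esub>" if "y \<in> carrier (tensor R A V)" for y
    by (rule bialgebra_imp_eps_lam[OF assms(3) D _ _ that]) (use x e in \<open>simp_all add: extends_comult_iff\<close>)
  ultimately show ?thesis by simp
qed

theorem cocomm_hopf_converse:
  assumes "PBW_property R A \<Delta> V act lam kap" "free_module R V" "cocomm_hopf_algebra R A \<Delta> \<epsilon> S"
    and "H_cocomm_hopf_algebra R A \<Delta> \<epsilon> S V act lam kap"
  shows "star_condition R A \<Delta> V lam kap \<and> (\<forall>x\<in>carrier (tensor R A V). \<epsilon> (lam x) = \<zero>\<^bsub>R\<^esub>) \<and>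
    (\<forall>a\<in>carrier A. \<forall>v\<in>carrier V. S (lm a v) = tlift R A (\<lambda>b c. lm (S b) (act c v)) (\<Delta> a))"
proof -
  obtain D e s where D: "cocomm_hopf_algebra R H D e s" and x: "extends_comult R A \<Delta> V H iA iV D"
    and e: "\<forall>a\<in>carrier A. e (iA a) = \<epsilon> a" and s: "\<forall>a\<in>carrier A. s (iA a) = iA (S a)"
    using assms(4) unfolding H_cocomm_hopf_algebra_def Let_def by (elim exE conjE)
  have "H_cocomm_bialgebra R A \<Delta> \<epsilon> V act lam kap"
    unfolding H_cocomm_bialgebra_def Let_def
    by (intro exI[of _ D] exI[of _ e] conjI x e cocomm_hopf_algebra.axioms(1)[OF D])
  note 1 = cocomm_bialgebra_converse[OF assms(1,2) cocomm_hopf_algebra.axioms(1)[OF assms(3)] this]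
  have "S (lm a v) = tlift R A (\<lambda>b c. lm (S b) (act c v)) (\<Delta> a)" if "a \<in> carrier A" "v \<in> carrier V" for a v
    by (rule H_hopf.hopf_imp_S_lam[OF H_hopf.intro[OF H_data_axioms assms(3)] PBW_inj(1)[OF assms(1,2)] D _ _ that])
      (use x s in \<open>simp_all add: extends_comult_iff\<close>)
  then show ?thesis using 1 by blast
qed

lemma tens_zero:
  assumes "y \<in> carrier A"
  shows "tens R A A \<zero>\<^bsub>A\<^esub> y = \<zero>\<^bsub>tensor R A A\<^esub>" "tens R A A y \<zero>\<^bsub>A\<^esub> = \<zero>\<^bsub>tensor R A A\<^esub>"
  using lin_zero[OF mod_A mod_AA lin_tens1[OF mod_A mod_A lin_id assms]] lin_zero[OF mod_A mod_AA lin_tens2[OF mod_A mod_A lin_id assms]]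
  by simp_all

lemma comult_zero: "\<Delta> \<zero>\<^bsub>A\<^esub> = \<zero>\<^bsub>tensor R A A\<^esub>"
  by (rule lin_zero[OF mod_A mod_AA alg_hom_lin[OF C.comult_hom]])

lemma primitive_zero: "primitive R A \<Delta> \<zero>\<^bsub>A\<^esub>"
proof -
  interpret AA: module R "tensor R A A" by (rule mod_AA)
  show ?thesis by (simp add: primitive_def comult_zero tens_zero)
qed

text \<open>With \<open>\<lambda> = 0\<close> both sides of the first equation of the condition vanish.\<close>

lemma star_of_lam_zero:
  assumes "lam = zero_lam A"
    and prim: "\<forall>x\<in>carrier (wedge R V). primitive R A \<Delta> (fst (kap x))"
  shows "star_condition R A \<Delta> V lam kap"
proof -
  interpret AA: module R "tensor R A A" by (rule mod_AA)
  have lin: "lin A (tensor R A A) \<Delta>" by (rule alg_hom_lin[OF C.comult_hom])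
  have z: "tlift R (tensor R A A) b U = \<zero>\<^bsub>tensor R A A\<^esub>"
    if U: "U \<in> carrier (tensor R A A)" and b: "\<And>x y. \<lbrakk>x \<in> carrier A; y \<in> carrier A\<rbrakk> \<Longrightarrow> b x y = \<zero>\<^bsub>tensor R A A\<^esub>" for b U
  proof -
    have "tlift R (tensor R A A) (\<lambda>x y. \<zero>\<^bsub>tensor R A A\<^esub>) U = tlift R (tensor R A A) b U"
      by (rule tlift_cong[OF mod_A mod_A mod_AA _ U]) (simp_all add: b bilI lin_const_zero[OF mod_AA])
    then show ?thesis using tlift_zero[OF mod_A mod_A mod_AA U] by simp
  qed
  have "\<Delta> (lam (tens R A V a v)) =
      tlift R (tensor R A A) (\<lambda>b c. tens R A A (lam (tens R A V b v)) c) (\<Delta> a) \<oplus>\<^bsub>tensor R A A\<^esub>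
      tlift R (tensor R A A) (\<lambda>b c. tens R A A b (lam (tens R A V c v))) (\<Delta> a)"
    if "a \<in> carrier A" "v \<in> carrier V" for a v
    using z[OF lin_closed[OF lin that(1)]] that
    by (simp add: assms(1) zero_lam_def comult_zero tens_zero)
  then show ?thesis using prim by (simp add: star_condition_def wdg_closed)
qed

lemma extends_all_of_lam_zero:
  assumes "lam = zero_lam A"
    and prim: "\<forall>x\<in>carrier (wedge R V). primitive R A \<Delta> (fst (kap x))"
  shows "H_cocomm_algebra R A \<Delta> V act lam kap \<and>
    (\<forall>\<epsilon>. cocomm_bialgebra R A \<Delta> \<epsilon> \<longrightarrow> H_cocomm_bialgebra R A \<Delta> \<epsilon> V act lam kap) \<and>
    (\<forall>\<epsilon> S. cocomm_hopf_algebra R A \<Delta> \<epsilon> S \<longrightarrow> H_cocomm_hopf_algebra R A \<Delta> \<epsilon> S V act lam kap)"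
proof -
  note st = star_of_lam_zero[OF assms]
  have eps: "\<forall>x\<in>carrier (tensor R A V). \<epsilon> (lam x) = \<zero>\<^bsub>R\<^esub>" if "cocomm_bialgebra R A \<Delta> \<epsilon>" for \<epsilon>
  proof -
    interpret E: cocomm_bialgebra R A \<Delta> \<epsilon> by (rule that)
    have "\<epsilon> \<zero>\<^bsub>A\<^esub> = \<zero>\<^bsub>R\<^esub>" using E.counit_smult[of "\<zero>\<^bsub>R\<^esub>" "\<zero>\<^bsub>A\<^esub>"] ring_hom_closed[OF E.counit_hom, of "\<zero>\<^bsub>A\<^esub>"] by simp
    then show ?thesis by (simp add: assms(1) zero_lam_def)
  qed
  show ?thesis
  proof (intro conjI allI impI)
    show "H_cocomm_algebra R A \<Delta> V act lam kap" by (rule star_imp_cocomm[OF st])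
  next
    fix \<epsilon> assume e: "cocomm_bialgebra R A \<Delta> \<epsilon>"
    show "H_cocomm_bialgebra R A \<Delta> \<epsilon> V act lam kap" by (rule star_imp_bialgebra[OF e st eps[OF e]])
  next
    fix \<epsilon> S assume e: "cocomm_hopf_algebra R A \<Delta> \<epsilon> S"
    show "H_cocomm_hopf_algebra R A \<Delta> \<epsilon> S V act lam kap"
      by (rule H_hopf.star_imp_hopf[OF H_hopf.intro[OF H_data_axioms e] st eps[OF cocomm_hopf_algebra.axioms(1)[OF e]]])
  qed
qed

end

theorem proposition4p2:
  fixes R :: "('k, 'r) ring_scheme"
    and A :: "('k, 'a, 'x) module_scheme"
    and V :: "('k, 'v, 'y) module_scheme"
    and \<Delta> :: "'a \<Rightarrow> ('a \<times> 'a \<Rightarrow> 'k) set"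
    and act :: "'a \<Rightarrow> 'v \<Rightarrow> 'v"
    and lam :: "('a \<times> 'v \<Rightarrow> 'k) set \<Rightarrow> 'a"
    and kap :: "('v \<times> 'v \<Rightarrow> 'k) set \<Rightarrow> 'a \<times> 'v"
  assumes "cocomm_algebra R A \<Delta>" and "free_module R A"
    and "algebra_module R A V act" and "free_module R V"
    and "lam \<in> linear_maps R (tensor R A V) A"
    and "kap \<in> linear_maps R (wedge R V) (dsum A V)"
  shows
    "((star_condition R A \<Delta> V lam kap \<longrightarrow> H_cocomm_algebra R A \<Delta> V act lam kap) \<and>
      (PBW_property R A \<Delta> V act lam kap \<longrightarrow>
        H_cocomm_algebra R A \<Delta> V act lam kap \<longrightarrow> star_condition R A \<Delta> V lam kap))
     \<and>
     (\<forall>\<epsilon>. cocomm_bialgebra R A \<Delta> \<epsilon> \<longrightarrow>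
      (star_condition R A \<Delta> V lam kap \<and> (\<forall>x\<in>carrier (tensor R A V). \<epsilon> (lam x) = \<zero>\<^bsub>R\<^esub>) \<longrightarrow>
        H_cocomm_bialgebra R A \<Delta> \<epsilon> V act lam kap) \<and>
      (PBW_property R A \<Delta> V act lam kap \<longrightarrow> H_cocomm_bialgebra R A \<Delta> \<epsilon> V act lam kap \<longrightarrow>
        star_condition R A \<Delta> V lam kap \<and> (\<forall>x\<in>carrier (tensor R A V). \<epsilon> (lam x) = \<zero>\<^bsub>R\<^esub>)))
     \<and>
     (\<forall>\<epsilon> S. cocomm_hopf_algebra R A \<Delta> \<epsilon> S \<longrightarrow>
      (star_condition R A \<Delta> V lam kap \<and> (\<forall>x\<in>carrier (tensor R A V). \<epsilon> (lam x) = \<zero>\<^bsub>R\<^esub>) \<and>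
        (\<forall>a\<in>carrier A. \<forall>v\<in>carrier V. S (lam (tens R A V a v)) =
          tlift R A (\<lambda>b c. lam (tens R A V (S b) (act c v))) (\<Delta> a)) \<longrightarrow>
        H_cocomm_hopf_algebra R A \<Delta> \<epsilon> S V act lam kap) \<and>
      (PBW_property R A \<Delta> V act lam kap \<longrightarrow> H_cocomm_hopf_algebra R A \<Delta> \<epsilon> S V act lam kap \<longrightarrow>
        star_condition R A \<Delta> V lam kap \<and> (\<forall>x\<in>carrier (tensor R A V). \<epsilon> (lam x) = \<zero>\<^bsub>R\<^esub>) \<and>
        (\<forall>a\<in>carrier A. \<forall>v\<in>carrier V. S (lam (tens R A V a v)) =
          tlift R A (\<lambda>b c. lam (tens R A V (S b) (act c v))) (\<Delta> a))))
     \<and>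
     ((\<exists>\<phi>. smash_iso R A \<Delta> V act \<phi>) \<and>
      H_cocomm_algebra R A \<Delta> V act (zero_lam A) (zero_kap A V) \<and>
      (\<forall>\<epsilon>. cocomm_bialgebra R A \<Delta> \<epsilon> \<longrightarrow>
        H_cocomm_bialgebra R A \<Delta> \<epsilon> V act (zero_lam A) (zero_kap A V)) \<and>
      (\<forall>\<epsilon> S. cocomm_hopf_algebra R A \<Delta> \<epsilon> S \<longrightarrow>
        H_cocomm_hopf_algebra R A \<Delta> \<epsilon> S V act (zero_lam A) (zero_kap A V)))
     \<and>
     ((\<forall>x\<in>carrier (wedge R V). primitive R A \<Delta> (fst (kap x))) \<longrightarrow>
      H_cocomm_algebra R A \<Delta> V act (zero_lam A) kap \<and>
      (\<forall>\<epsilon>. cocomm_bialgebra R A \<Delta> \<epsilon> \<longrightarrow>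
        H_cocomm_bialgebra R A \<Delta> \<epsilon> V act (zero_lam A) kap) \<and>
      (\<forall>\<epsilon> S. cocomm_hopf_algebra R A \<Delta> \<epsilon> S \<longrightarrow>
        H_cocomm_hopf_algebra R A \<Delta> \<epsilon> S V act (zero_lam A) kap))"
proof -
  interpret C: cocomm_algebra R A \<Delta> by fact
  have sm: "smash_data R A \<Delta> V act" by (rule smash_data.intro[OF C.R.is_cring assms(1,3)])
  have H: "H_data R A \<Delta> V act lam kap"
    by (rule H_data.intro[OF C.R.is_cring assms(1,3) H_data_axioms.intro[OF assms(5,6)]])
  have z: "H_data R A \<Delta> V act (zero_lam A) (zero_kap A V)" by (rule smash_data.zero_data[OF sm])
  have zk: "H_data R A \<Delta> V act (zero_lam A) kap"
    by (rule H_data.intro[OF C.R.is_cring assms(1,3) H_data_axioms.intro[OF H_data.lam_linear[OF z] assms(6)]])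
  have p0: "\<forall>x\<in>carrier (wedge R V). primitive R A \<Delta> (fst (zero_kap A V x))"
    using H_data.primitive_zero[OF H] by (simp add: zero_kap_def)
  show ?thesis
  proof (intro conjI)
    show "star_condition R A \<Delta> V lam kap \<longrightarrow> H_cocomm_algebra R A \<Delta> V act lam kap"
      using H_data.star_imp_cocomm[OF H] by simp
    show "PBW_property R A \<Delta> V act lam kap \<longrightarrow> H_cocomm_algebra R A \<Delta> V act lam kap \<longrightarrow> star_condition R A \<Delta> V lam kap"
      using H_data.cocomm_algebra_converse[OF H _ assms(4)] by simp
    show "\<exists>\<phi>. smash_iso R A \<Delta> V act \<phi>" by (rule exI) (rule smash_data.smash_iso_phi[OF sm])
    show "H_cocomm_algebra R A \<Delta> V act (zero_lam A) (zero_kap A V)"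
      "\<forall>\<epsilon>. cocomm_bialgebra R A \<Delta> \<epsilon> \<longrightarrow> H_cocomm_bialgebra R A \<Delta> \<epsilon> V act (zero_lam A) (zero_kap A V)"
      "\<forall>\<epsilon> S. cocomm_hopf_algebra R A \<Delta> \<epsilon> S \<longrightarrow> H_cocomm_hopf_algebra R A \<Delta> \<epsilon> S V act (zero_lam A) (zero_kap A V)"
      using H_data.extends_all_of_lam_zero[OF z refl p0] by simp_all
    show "(\<forall>x\<in>carrier (wedge R V). primitive R A \<Delta> (fst (kap x))) \<longrightarrow>
      H_cocomm_algebra R A \<Delta> V act (zero_lam A) kap \<and>
      (\<forall>\<epsilon>. cocomm_bialgebra R A \<Delta> \<epsilon> \<longrightarrow>
        H_cocomm_bialgebra R A \<Delta> \<epsilon> V act (zero_lam A) kap) \<and>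
      (\<forall>\<epsilon> S. cocomm_hopf_algebra R A \<Delta> \<epsilon> S \<longrightarrow>
        H_cocomm_hopf_algebra R A \<Delta> \<epsilon> S V act (zero_lam A) kap)"
      using H_data.extends_all_of_lam_zero[OF zk refl] by (rule impI)
  next
    show "\<forall>\<epsilon>. cocomm_bialgebra R A \<Delta> \<epsilon> \<longrightarrow>
      (star_condition R A \<Delta> V lam kap \<and> (\<forall>x\<in>carrier (tensor R A V). \<epsilon> (lam x) = \<zero>\<^bsub>R\<^esub>) \<longrightarrow>
        H_cocomm_bialgebra R A \<Delta> \<epsilon> V act lam kap) \<and>
      (PBW_property R A \<Delta> V act lam kap \<longrightarrow> H_cocomm_bialgebra R A \<Delta> \<epsilon> V act lam kap \<longrightarrow>
        star_condition R A \<Delta> V lam kap \<and> (\<forall>x\<in>carrier (tensor R A V). \<epsilon> (lam x) = \<zero>\<^bsub>R\<^esub>))"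
      by (intro allI impI conjI[OF impI impI[OF impI]] H_data.cocomm_bialgebra_converse[OF H _ assms(4)])
        (assumption | (erule conjE)+, rule H_data.star_imp_bialgebra[OF H])+
  next
    show "\<forall>\<epsilon> S. cocomm_hopf_algebra R A \<Delta> \<epsilon> S \<longrightarrow>
      (star_condition R A \<Delta> V lam kap \<and> (\<forall>x\<in>carrier (tensor R A V). \<epsilon> (lam x) = \<zero>\<^bsub>R\<^esub>) \<and>
        (\<forall>a\<in>carrier A. \<forall>v\<in>carrier V. S (lam (tens R A V a v)) =
          tlift R A (\<lambda>b c. lam (tens R A V (S b) (act c v))) (\<Delta> a)) \<longrightarrow>
        H_cocomm_hopf_algebra R A \<Delta> \<epsilon> S V act lam kap) \<and>
      (PBW_property R A \<Delta> V act lam kap \<longrightarrow> H_cocomm_hopf_algebra R A \<Delta> \<epsilon> S V act lam kap \<longrightarrow>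
        star_condition R A \<Delta> V lam kap \<and> (\<forall>x\<in>carrier (tensor R A V). \<epsilon> (lam x) = \<zero>\<^bsub>R\<^esub>) \<and>
        (\<forall>a\<in>carrier A. \<forall>v\<in>carrier V. S (lam (tens R A V a v)) =
          tlift R A (\<lambda>b c. lam (tens R A V (S b) (act c v))) (\<Delta> a)))"
      by (intro allI impI conjI[OF impI impI[OF impI]] H_data.cocomm_hopf_converse[OF H _ assms(4)])
        (assumption | (erule conjE)+, rule H_hopf.star_imp_hopf[OF H_hopf.intro[OF H]])+
  qed
qed

end
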